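(* Let $N>4$ be an integer with $N\neq 6$, and let $\Pi\subset\mathbb{R}^2$ be a regular $N$-gon. Then the outer billiard map $f_\Pi$ on $\Pi$ has aperiodic points, i.e. there is a point $z\in\mathbb{R}^2$ such that all iterates $f_\Pi^n(z)$, $n\in\mathbb{Z}$ (positive and negative), are defined and are pairwise distinct.
   Context: Fix an orientation of the plane $\mathbb{R}^2$. For distinct points $a,b$, the line $ab$ is the line through $a$ and $b$ oriented from $a$ to $b$, so that its left and right half-planes are well defined. For an open convex polygon $\Pi\subset\mathbb{R}^2$, the (right) outer billiard map $f_\Pi$ is the partially defined map of $\mathbb{R}^2\setminus\overline\Pi$ defined at those points $z$ for which there is a vertex $a$ of $\Pi$ such that all other vertices of $\Pi$ lie strictly on the left of the line $za$; for such $z$ one sets $f_\Pi(z)=2a-z$. The map $f_\Pi$ is defined on $\mathbb{R}^2\setminus\overline\Pi$ except on finitely many rays, and is injective on its domain; negative iterates are iterates of the partially defined inverse map $f_\Pi^{-1}$. *)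

theory Defs
  imports "HOL-Analysis.Analysis"
begin

definition det2 :: "real^2 \<Rightarrow> real^2 \<Rightarrow> real" where
  "det2 u v = u $ 1 * v $ 2 - u $ 2 * v $ 1"

text \<open>The plane carries its standard (counterclockwise) orientation.\<close>

definition strictly_left_of_line :: "real^2 \<Rightarrow> real^2 \<Rightarrow> real^2 \<Rightarrow> bool" where
  "strictly_left_of_line a b p \<longleftrightarrow> det2 (b - a) (p - a) > 0"

text \<open>A polygon is an open set; its vertices are the extreme points of its closure.\<close>

definition polygon_vertices :: "(real^2) set \<Rightarrow> (real^2) set" where
  "polygon_vertices P = {a. a extreme_point_of closure P}"

text \<open>Centre, circumradius and rotation are arbitrary.\<close>

definition regular_polygon :: "nat \<Rightarrow> (real^2) set \<Rightarrow> bool" where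
  "regular_polygon N P \<longleftrightarrow> N \<ge> 3 \<and>
     (\<exists>(c::real^2) (r::real) (\<theta>::real). r > 0 \<and>
        P = interior (convex hull
              ((\<lambda>k::nat. c + r *\<^sub>R vector [cos (\<theta> + 2 * pi * real k / real N),
                                      sin (\<theta> + 2 * pi * real k / real N)]) ` {..<N})))"

definition tangent_vertex :: "(real^2) set \<Rightarrow> real^2 \<Rightarrow> real^2 \<Rightarrow> bool" where
  "tangent_vertex P z a \<longleftrightarrow> a \<in> polygon_vertices P \<and>
     (\<forall>b \<in> polygon_vertices P - {a}. strictly_left_of_line z a b)"

definition outer_billiard :: "(real^2) set \<Rightarrow> real^2 \<rightharpoonup> real^2" where
  "outer_billiard P z =
     (if z \<notin> closure P \<and> (\<exists>a. tangent_vertex P z a)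
      then Some (2 *\<^sub>R (THE a. tangent_vertex P z a) - z) else None)"

text \<open>The inverse below is meaningful for partial maps that are injective on their domain.\<close>

definition partial_inverse :: "('a \<rightharpoonup> 'a) \<Rightarrow> 'a \<rightharpoonup> 'a" where
  "partial_inverse f w = (if \<exists>z. f z = Some w then Some (THE z. f z = Some w) else None)"

primrec partial_iterate :: "('a \<rightharpoonup> 'a) \<Rightarrow> nat \<Rightarrow> 'a \<rightharpoonup> 'a" where
  "partial_iterate f 0 z = Some z"
| "partial_iterate f (Suc n) z = Option.bind (partial_iterate f n z) f"

definition int_iterate :: "('a \<rightharpoonup> 'a) \<Rightarrow> int \<Rightarrow> 'a \<rightharpoonup> 'a" where
  "int_iterate f n = (if n \<ge> 0 then partial_iterate f (nat n)
                      else partial_iterate (partial_inverse f) (nat (- n)))"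

definition aperiodic_point :: "('a \<rightharpoonup> 'a) \<Rightarrow> 'a \<Rightarrow> bool" where
  "aperiodic_point f z \<longleftrightarrow>
     (\<forall>n. int_iterate f n z \<noteq> None) \<and>
     (\<forall>m n. m \<noteq> n \<longrightarrow> int_iterate f m z \<noteq> int_iterate f n z)"

text \<open>The definite descriptions above are well defined: the tangent vertex is unique,
  and the outer billiard map is injective on its domain.\<close>

lemma tangent_vertex_unique:
  assumes "tangent_vertex P z a" and "tangent_vertex P z b"
  shows "a = b"
proof (rule ccontr)
  assume "a \<noteq> b"
  then have "det2 (a - z) (b - z) > 0" "det2 (b - z) (a - z) > 0"
    using assms by (auto simp: tangent_vertex_def strictly_left_of_line_def)
  then show False by (simp add: det2_def mult.commute)
qed

lemma outer_billiard_eq_Some_iff: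
  "outer_billiard P z = Some w \<longleftrightarrow>
     z \<notin> closure P \<and> (\<exists>a. tangent_vertex P z a \<and> w = 2 *\<^sub>R a - z)"
proof -
  have "(THE a. tangent_vertex P z a) = a" if "tangent_vertex P z a" for a
    using that tangent_vertex_unique by blast
  then show ?thesis by (auto simp: outer_billiard_def)
qed

lemma outer_billiard_inj:
  assumes "outer_billiard P z = Some w" and "outer_billiard P z' = Some w"
  shows "z = z'"
proof -
  obtain a a' where a: "tangent_vertex P z a" "w = 2 *\<^sub>R a - z"
    and a': "tangent_vertex P z' a'" "w = 2 *\<^sub>R a' - z'"
    using assms by (auto simp: outer_billiard_eq_Some_iff)
  have z: "z = 2 *\<^sub>R a - w" "z' = 2 *\<^sub>R a' - w"
    using a(2) a'(2) by (simp, metis add_diff_cancel_left' diff_add_cancel)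
  have "a = a'"
  proof (rule ccontr)
    assume "a \<noteq> a'"
    then have "det2 (a - z) (a' - z) > 0" "det2 (a' - z') (a - z') > 0"
      using a(1) a'(1) by (auto simp: tangent_vertex_def strictly_left_of_line_def)
    then show False unfolding z by (simp add: det2_def algebra_simps)
  qed
  then show ?thesis using z by simp
qed

end

theory Submission
  imports Defs "HOL-Analysis.Analysis"
begin

text \<open>Measured along the edge normals, far from the polygon the billiard becomes the recurrence
  \<open>x (n + 1) - lam x n + x (n - 1) \<in> \<int>\<close> with \<open>\<bar>x n\<bar> < 1/2\<close> and \<open>lam = 2 cos (\<pi> / h)\<close>, where \<open>h\<close> is
  \<open>N / 2\<close> or \<open>N\<close> according to the parity of \<open>N\<close>; the nonzero integers driving such an orbit
  alternate in sign, so every orbit of the recurrence is realised by the billiard.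

  Suppose that all these orbits are periodic. Fix \<open>x 0 = 1/2 - y\<close> and let \<open>t = x 1\<close> vary: the first
  return to this line is a bijective piecewise translation of an interval, and by periodicity any
  additive function of the displacement has mean zero. Take one that vanishes at 1 and is 1 at
  \<open>lam\<close>. As \<open>y\<close> tends to 0, the displacements at \<open>t\<close> and \<open>-t\<close> add up to \<open>lam\<close> modulo 1, since the
  two sides of the line \<open>x 0 = 1/2\<close> have the same future until they return and are then \<open>lam\<close> apart;
  so the mean tends to 1/2, a contradiction, provided that dominated convergence applies.

  The required bound comes from an analysis of nonperiodic limits of orbits. By cyclotomic
  arithmetic an orbit cannot hit the boundary of the torus at three times pairwise incongruent
  modulo \<open>h\<close>. A minimal set of limits hits it regularly at one phase, hence lies on finitely many
  parallel segments, and by the arithmetic again a periodic orbit that comes close to the interior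
  of one of them can never leave their neighbourhood.\<close>

section \<open>Integral combinations of powers of a root of unity\<close>

text \<open>The obstacle is the passage to the limit. On the lines \<open>x 0 = 1/2 - y\<close> the
  first return times may grow without bound as y tends to 0, and so may the additive function of the
  displacement, which is far from continuous. If values blow up along a sequence, its limit orbit
  cannot be periodic, because periodicity is an open condition; so only nonperiodic limits have to
  be understood. Their structure rests on a computation modulo 2. Boundary values are halves of odd
  integers, all other contributions lie in Z[zeta], and a concurrence of three boundary lines
  becomes (1 - u)(1 - w)(1 - uw) = 2((1 - u^2)X + (1 - w^2)Y) for two roots of unity u, w. Excluding
  this means that at a point of a limiting segment all boundary lines other than the one along the
  segment have a single direction. One linear functional, the foot, then decides once and for all on
  which side of them a nearby orbit passes. The final contradiction needs an additive function that
  separates \<open>lam\<close> from 1, hence \<open>lam\<close> irrational; this is guaranteed by h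
  >= 4.\<close>

lemma ex_rat_functional:
  fixes B :: "complex set" and g :: "complex \<Rightarrow> rat"
  assumes "\<not> module.dependent (\<lambda>(q::rat) (x::complex). of_rat q * x) B"
  shows "\<exists>\<phi> :: complex \<Rightarrow> rat. (\<forall>x y. \<phi> (x + y) = \<phi> x + \<phi> y) \<and>
           (\<forall>q x. \<phi> (of_rat q * x) = q * \<phi> x) \<and> (\<forall>x\<in>B. \<phi> x = g x)"
proof -
  interpret V: vector_space "\<lambda>(q::rat) (x::complex). of_rat q * x"
    by unfold_locales (simp_all add: algebra_simps of_rat_add of_rat_mult)
  interpret W: vector_space "\<lambda>(q::rat) (x::rat). q * x"
    by unfold_locales (simp_all add: algebra_simps)
  interpret VW: vector_space_pair "\<lambda>(q::rat) (x::complex). of_rat q * x" "\<lambda>(q::rat) (x::rat). q * x"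
    by unfold_locales
  obtain \<phi> where "Vector_Spaces.linear (\<lambda>(q::rat) (x::complex). of_rat q * x) (\<lambda>(q::rat) (x::rat). q * x) \<phi>"
    "\<forall>x\<in>B. \<phi> x = g x"
    using VW.linear_independent_extend[OF assms] by blast
  then show ?thesis
    by (intro exI[of _ \<phi>]) (auto simp: VW.linear_add VW.linear_scale)
qed

text \<open>The coordinate of 1 in a rational basis of the complex numbers. It is the identity on
  the rationals, which makes denominators visible.\<close>

lemma ex_rat_functional_1:
  "\<exists>\<phi> :: complex \<Rightarrow> rat. (\<forall>x y. \<phi> (x + y) = \<phi> x + \<phi> y) \<and>
     (\<forall>q x. \<phi> (of_rat q * x) = q * \<phi> x) \<and> \<phi> 1 = 1"
proof -
  interpret V: vector_space "\<lambda>(q::rat) (x::complex). of_rat q * x"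
    by unfold_locales (simp_all add: algebra_simps of_rat_add of_rat_mult)
  have "\<not> module.dependent (\<lambda>(q::rat) (x::complex). of_rat q * x) {1}"
    by (simp add: V.dependent_single)
  from ex_rat_functional[OF this, of "\<lambda>_. 1"] show ?thesis by auto
qed

section \<open>The ring Z[z] and its rational elements\<close>

inductive_set ZP :: "complex \<Rightarrow> complex set" for z where
  ZP_0: "0 \<in> ZP z"
| ZP_add_power: "x \<in> ZP z \<Longrightarrow> x + z ^ n \<in> ZP z"
| ZP_diff_power: "x \<in> ZP z \<Longrightarrow> x - z ^ n \<in> ZP z"

lemma ZP_power: "z ^ n \<in> ZP z"
  using ZP_add_power[OF ZP_0] by simp

lemma ZP_1: "1 \<in> ZP z"
  using ZP_power[of z 0] by simp

lemma ZP_add: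
  assumes "x \<in> ZP z" "y \<in> ZP z"
  shows "x + y \<in> ZP z"
  using assms(2)
proof (induction rule: ZP.induct)
  case (ZP_add_power y n)
  then show ?case using ZP.ZP_add_power[of "x + y" z n] by (simp add: algebra_simps)
next
  case (ZP_diff_power y n)
  then show ?case using ZP.ZP_diff_power[of "x + y" z n] by (simp add: algebra_simps)
qed (use assms in auto)

lemma ZP_minus: "x \<in> ZP z \<Longrightarrow> - x \<in> ZP z"
proof (induction rule: ZP.induct)
  case (ZP_add_power x n)
  then show ?case using ZP_diff_power[of "- x" z n] by simp
next
  case (ZP_diff_power x n)
  then show ?case using ZP.ZP_add_power[of "- x" z n] by (simp add: algebra_simps)
qed (auto intro: ZP.intros)

lemma ZP_diff: "x \<in> ZP z \<Longrightarrow> y \<in> ZP z \<Longrightarrow> x - y \<in> ZP z"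
  using ZP_add[of x z "- y"] ZP_minus by simp

lemma ZP_mult_power: "x \<in> ZP z \<Longrightarrow> x * z ^ m \<in> ZP z"
proof (induction rule: ZP.induct)
  case (ZP_add_power x n)
  then show ?case
    using ZP.ZP_add_power[of "x * z ^ m" z "n + m"] by (simp add: algebra_simps power_add)
next
  case (ZP_diff_power x n)
  then show ?case
    using ZP.ZP_diff_power[of "x * z ^ m" z "n + m"] by (simp add: algebra_simps power_add)
qed (auto intro: ZP.intros)

lemma ZP_mult:
  assumes "x \<in> ZP z" "y \<in> ZP z"
  shows "x * y \<in> ZP z"
  using assms(2)
proof (induction rule: ZP.induct)
  case (ZP_add_power y n)
  then show ?case using ZP_add[OF _ ZP_mult_power[OF assms(1), of n]] by (simp add: algebra_simps)
next
  case (ZP_diff_power y n)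
  then show ?case using ZP_diff[OF _ ZP_mult_power[OF assms(1), of n]] by (simp add: algebra_simps)
qed (auto intro: ZP_0)

lemma ZP_pow: "x \<in> ZP z \<Longrightarrow> x ^ n \<in> ZP z"
  by (induction n) (auto intro: ZP_1 ZP_mult)

lemma ZP_sum: "(\<And>i. i \<in> A \<Longrightarrow> f i \<in> ZP z) \<Longrightarrow> sum f A \<in> ZP z"
  by (induction A rule: infinite_finite_induct) (auto intro: ZP_0 ZP_add)

lemma ZP_of_nat: "of_nat n \<in> ZP z"
  by (induction n) (auto intro: ZP_0 ZP_1 ZP_add)

lemma ZP_of_int: "of_int n \<in> ZP z"
  by (cases n) (auto intro: ZP_of_nat ZP_minus ZP_1 ZP_diff simp del: of_nat_Suc)

lemma ZP_numeral: "numeral k \<in> ZP z"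
  using ZP_of_nat[of "numeral k"] by simp

text \<open>A rational functional normalised at 1 has bounded denominators on the ring, whereas
  the powers of a non-integral rational do not.\<close>

lemma ZP_rat_imp_int:
  assumes zM: "z ^ M = 1" "M > 0" and r: "of_rat r \<in> ZP z"
  shows "r \<in> \<int>"
proof -
  obtain \<phi> :: "complex \<Rightarrow> rat" where add: "\<And>x y. \<phi> (x + y) = \<phi> x + \<phi> y"
    and scale: "\<And>q x. \<phi> (of_rat q * x) = q * \<phi> x" and one: "\<phi> 1 = 1"
    using ex_rat_functional_1 by blast
  \<comment> \<open>A common denominator for the values of \<phi> at finitely many powers of
    \<open>z\<close>, built by multiplying the denominators one at a time. For \<open>k = M\<close>
    it serves all powers, since these repeat, and hence the whole ring.\<close>
  have "\<exists>Q::int. Q > 0 \<and> (\<forall>n<k. of_int Q * \<phi> (z ^ n) \<in> \<int>)" for k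
  proof (induction k)
    case (Suc k)
    then obtain Q :: int where Q: "Q > 0" "\<And>n. n < k \<Longrightarrow> of_int Q * \<phi> (z ^ n) \<in> \<int>" by blast
    obtain a b where ab: "quotient_of (\<phi> (z ^ k)) = (a, b)" by fastforce
    have b: "b > 0" "\<phi> (z ^ k) = of_int a / of_int b"
      using ab quotient_of_denom_pos quotient_of_div by blast+
    have "of_int (b * Q) * \<phi> (z ^ n) \<in> \<int>" if "n < Suc k" for n
    proof (cases "n = k")
      case True
      then have "of_int (b * Q) * \<phi> (z ^ n) = of_int (a * Q)" using b by simp
      then show ?thesis by (metis Ints_of_int)
    next
      case False
      then have "of_int (b * Q) * \<phi> (z ^ n) = of_int b * (of_int Q * \<phi> (z ^ n))" by simp
      then show ?thesis using Q(2)[of n] False that by (metis Ints_mult Ints_of_int less_SucE)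
    qed
    then show ?case using Q b by (intro exI[of _ "b * Q"]) auto
  qed (auto intro: exI[of _ 1])
  then obtain Q :: int where Q: "Q > 0" "\<And>n. n < M \<Longrightarrow> of_int Q * \<phi> (z ^ n) \<in> \<int>" by blast
  have Qp: "of_int Q * \<phi> (z ^ n) \<in> \<int>" for n
  proof -
    have "z ^ n = z ^ (n mod M) * (z ^ M) ^ (n div M)"
      by (metis mod_mult_div_eq power_add power_mult)
    then show ?thesis using zM Q(2)[of "n mod M"] by simp
  qed
  have \<phi>0: "\<phi> 0 = 0" using add[of 0 0] by simp
  have \<phi>m: "\<phi> (x - y) = \<phi> x - \<phi> y" for x y using add[of "x - y" y] by simp
  have Qx: "of_int Q * \<phi> x \<in> \<int>" if "x \<in> ZP z" for x
    using that
    by (induction rule: ZP.induct) (auto simp: \<phi>0 add \<phi>m ring_distribs intro: Qp)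
  have Qr: "of_int Q * r ^ n \<in> \<int>" for n
  proof -
    have "of_int Q * \<phi> (of_rat r ^ n) \<in> \<int>" using Qx ZP_pow[OF r] by blast
    moreover have "\<phi> (of_rat r ^ n) = r ^ n" using scale[of "r ^ n" 1] one by (simp add: of_rat_power)
    ultimately show ?thesis by simp
  qed
  obtain p q where pq: "quotient_of r = (p, q)" by fastforce
  have q: "q > 0" "coprime p q" "r = of_int p / of_int q"
    using pq quotient_of_denom_pos quotient_of_coprime quotient_of_div by blast+
  \<comment> \<open>In lowest terms the numerator cannot absorb any part of \<open>q ^ n\<close>, so
    the fixed number \<open>Q\<close> is divisible by every power of the denominator.\<close>
  have "q ^ n dvd Q" for n
  proof -
    obtain t :: int where t: "of_int Q * r ^ n = of_int t" using Qr[of n] by (auto elim: Ints_cases)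
    have "(of_int (Q * p ^ n) :: rat) = of_int (t * q ^ n)"
      using t q(1,3) by (simp add: power_divide field_simps)
    then have "Q * p ^ n = t * q ^ n" by (simp only: of_int_eq_iff)
    then have "q ^ n dvd Q * p ^ n" by simp
    moreover have "coprime (q ^ n) (p ^ n)" using q(2) by (simp add: coprime_commute)
    ultimately show ?thesis using coprime_dvd_mult_left_iff by blast
  qed
  then have le: "q ^ n \<le> Q" for n using Q(1) zdvd_imp_le by blast
  have "q = 1"
  proof (rule ccontr)
    assume "q \<noteq> 1"
    then have "q \<ge> 2" using q(1) by simp
    then have "2 ^ n \<le> q ^ n" for n by (simp add: power_mono)
    then have "(2::int) ^ nat Q \<le> Q" using le order_trans by blast
    moreover have "int (nat Q) < 2 ^ nat Q" by (metis of_nat_less_two_power)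
    ultimately show False using Q(1) by simp
  qed
  then show ?thesis using q(3) by simp
qed

text \<open>Parity of ordinary integers survives in the ring: half an odd integer is a rational
  non-integer, hence outside. All contradictions modulo 2 end here.\<close>

lemma odd_not_double_in_ZP:
  assumes "z ^ M = 1" "M > 0" "odd (q::int)" "y \<in> ZP z"
  shows "of_int q \<noteq> 2 * y"
proof
  assume "of_int q = 2 * y"
  then have "y = of_rat (of_int q / 2)" by (simp add: of_rat_divide)
  then have "(of_int q / 2 :: rat) \<in> \<int>" using ZP_rat_imp_int assms by blast
  then obtain t where "(of_int q :: rat) = of_int (2 * t)" by (auto elim!: Ints_cases simp: field_simps)
  then have "q = 2 * t" by (simp only: of_int_eq_iff)
  then show False using assms(3) by simp
qed

lemma ZP_one_minus_power: "x \<in> ZP z \<Longrightarrow> \<exists>c\<in>ZP z. 1 - x ^ k = (1 - x) * c"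
  using one_diff_power_eq[of x k] by (auto intro!: bexI[of _ "\<Sum>i<k. x ^ i"] ZP_sum ZP_pow)

text \<open>A root of unity congruent to 1 modulo 2 is $\pm 1$; its square is congruent to 1 modulo 4, and
  then the vanishing geometric sum forces 4 to divide its order.\<close>

lemma root_of_unity_cong_1_mod_2:
  assumes zM: "z ^ M = 1" "M > 0" and x: "x \<in> ZP z" "x ^ m = 1" "m > 0"
    and q: "odd (q::int)" and y: "y \<in> ZP z" "of_int q * (1 - x) = 2 * y"
  shows "x ^ 2 = 1"
proof (rule ccontr)
  assume ne: "x ^ 2 \<noteq> 1"
  define v where "v = x ^ 2"
  have vZ: "v \<in> ZP z" unfolding v_def using x by (rule_tac ZP_pow)
  \<comment> \<open>Writing 1 + x as 2 - (1 - x) shows that both factors of 1 - x^2 are divisible by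
    2 up to the odd factor \<open>q\<close>; \<open>y4\<close> is the resulting quotient by
    4.\<close>
  define y4 where "y4 = of_int q * y - y ^ 2"
  have y4Z: "y4 \<in> ZP z" unfolding y4_def
    using y by (intro ZP_diff ZP_mult ZP_of_int ZP_pow)
  have v4: "of_int (q ^ 2) * (1 - v) = 4 * y4"
  proof -
    have "of_int (q ^ 2) * (1 - v) = (of_int q * (1 - x)) * (of_int q * 2 - of_int q * (1 - x))"
      by (simp add: v_def power2_eq_square algebra_simps)
    also have "\<dots> = 4 * y4" unfolding y(2) y4_def by (simp add: power2_eq_square algebra_simps)
    finally show ?thesis .
  qed
  have vk4: "\<exists>c\<in>ZP z. of_int (q ^ 2) * (1 - v ^ k) = 4 * c" for k
  proof -
    obtain c where "c \<in> ZP z" "1 - v ^ k = (1 - v) * c" using ZP_one_minus_power[OF vZ] by blast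
    then show ?thesis using v4 y4Z by (intro bexI[of _ "y4 * c"] ZP_mult) auto
  qed
  have vm: "v ^ m = 1" using x(2) by (simp add: v_def power_mult[symmetric] mult.commute[of 2])
       (simp add: power_mult)
  define n where "n = (LEAST n. n > 0 \<and> v ^ n = 1)"
  have n: "n > 0" "v ^ n = 1" using LeastI[of "\<lambda>n. n > 0 \<and> v ^ n = 1" m] vm x(3) by (auto simp: n_def)
  have nmin: "n \<le> k" if "k > 0" "v ^ k = 1" for k
    unfolding n_def by (rule Least_le) (use that in auto)
  have "(1 - v) * (\<Sum>k<n. v ^ k) = 0" using one_diff_power_eq[of v n] n by simp
  then have s0: "(\<Sum>k<n. v ^ k) = 0" using ne by (simp add: v_def)
  have "\<exists>f. \<forall>k. f k \<in> ZP z \<and> of_int (q ^ 2) * (1 - v ^ k) = 4 * f k"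
    using vk4 by metis
  then obtain f where f: "\<And>k. f k \<in> ZP z" "\<And>k. of_int (q ^ 2) * (1 - v ^ k) = 4 * f k" by blast
  have "of_int (q ^ 2) * of_nat n = (\<Sum>k<n. of_int (q ^ 2) * (1 - v ^ k))"
    using s0 by (simp add: sum_distrib_left[symmetric] sum_subtractf)
  also have "\<dots> = 4 * (\<Sum>k<n. f k)" unfolding f by (simp add: sum_distrib_left)
  finally have e: "of_int (q ^ 2 * int n) = 4 * (\<Sum>k<n. f k)" by simp
  have ev: "even n"
  proof (rule ccontr)
    assume "odd n"
    then have "odd (q ^ 2 * int n)" using q by simp
    from odd_not_double_in_ZP[OF zM this, of "2 * (\<Sum>k<n. f k)"] e f(1)
    show False by (auto intro!: ZP_mult ZP_sum ZP_numeral)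
  qed
  then obtain l where l: "n = 2 * l" by blast
  then have "(v ^ l) ^ 2 = 1" using n by (simp add: power_mult[symmetric] mult.commute)
  moreover have "v ^ l \<noteq> 1" using nmin[of l] l n by auto
  ultimately have "v ^ l = -1" by (simp add: power2_eq_1_iff)
  \<comment> \<open>Now -1 is a power of \<open>v\<close>, so 1 - (-1) would be divisible by 4 up to
    an odd factor.\<close>
  then have "of_int (q ^ 2) * 2 = 4 * f l" using f(2)[of l] by simp
  then have "of_int (q ^ 2) = 2 * f l" by simp
  with odd_not_double_in_ZP[OF zM, of "q ^ 2" "f l"] q f(1) show False by simp
qed

text \<open>The power \<open>w\<close> of \<open>x\<close> is a nontrivial root of unity of odd
  order dividing \<open>r\<close>, so the differences 1 - w^k with k < r add up to \<open>r\<close>.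
  They are multiples of 1 - w and hence of 1 - x: thus 1 - x divides an odd integer and behaves like
  a unit modulo 2.\<close>

lemma ex_odd_multiple:
  assumes zM: "z ^ M = 1" and M: "M = 2 ^ e * r" "odd r" and x: "x \<in> ZP z" "x ^ M = 1" "x ^ (2 ^ e) \<noteq> 1"
  shows "\<exists>c\<in>ZP z. \<exists>q::int. odd q \<and> (1 - x) * c = of_int q"
proof -
  define w where "w = x ^ (2 ^ e)"
  have w: "w ^ r = 1" "w \<noteq> 1" "w \<in> ZP z"
    using x M by (auto simp: w_def power_mult[symmetric] intro: ZP_pow)
  obtain f where f: "\<And>k. f k \<in> ZP z" "\<And>k. 1 - w ^ k = (1 - w) * f k"
    using ZP_one_minus_power[OF w(3)] by metis
  obtain c where c: "c \<in> ZP z" "1 - w = (1 - x) * c"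
    using ZP_one_minus_power[OF x(1)] unfolding w_def by metis
  have "(\<Sum>k<r. w ^ k) = 0" using one_diff_power_eq[of w r] w by simp
  then have "of_nat r = (\<Sum>k<r. 1 - w ^ k)" by (simp add: sum_subtractf)
  also have "\<dots> = (1 - w) * (\<Sum>k<r. f k)" unfolding f by (simp add: sum_distrib_left)
  finally have "(1 - x) * (c * (\<Sum>k<r. f k)) = of_int (int r)" using c by (simp add: mult.assoc)
  moreover have "c * (\<Sum>k<r. f k) \<in> ZP z" using c f by (intro ZP_mult ZP_sum)
  ultimately show ?thesis using M(2) by (intro bexI[of _ "c * (\<Sum>k<r. f k)"] exI[of _ "int r"]) auto
qed

text \<open>The hypothesis makes 2^(n+1) the exact order of \<open>v\<close>, so its powers exhaust
  the roots of that order by counting.\<close>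

lemma primitive_root_generates:
  assumes v: "(v::complex) ^ (2 ^ n) = -1" and x: "x ^ (2 ^ Suc n) = 1"
  shows "\<exists>k. x = v ^ k"
proof -
  let ?N = "2 ^ Suc n :: nat"
  have "v ^ ?N = (v ^ (2 ^ n))\<^sup>2" by (simp add: power_mult[symmetric] mult.commute)
  then have vN: "v ^ ?N = 1" using v by simp
  have v0: "v \<noteq> 0" using v by (auto simp: power_0_left split: if_splits)
  have inj: "inj_on (\<lambda>k. v ^ k) {..<?N}"
  proof (rule linorder_inj_onI)
    fix i j assume ij: "i < j" "i \<in> {..<?N}" "j \<in> {..<?N}"
    show "v ^ i \<noteq> v ^ j"
    proof
      assume "v ^ i = v ^ j"
      then have "v ^ i * 1 = v ^ i * v ^ (j - i)" using \<open>v ^ i = v ^ j\<close> ij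
        by (metis le_add_diff_inverse less_imp_le mult.right_neutral power_add)
      then have d: "v ^ (j - i) = 1" using v0 by (metis mult_left_cancel power_not_zero)
      \<comment> \<open>If two powers of \<open>v\<close> coincide, Bezout replaces the exponent by
        its gcd with 2^(n+1). This is a power of two dividing 2^n, which contradicts v^(2^n) =
        -1.\<close>
      define g where "g = gcd (j - i) ?N"
      have "g dvd ?N" by (simp add: g_def)
      then obtain s where s: "s \<le> Suc n" "g = 2 ^ s" using divides_primepow_nat[of 2 g "Suc n"] two_is_prime_nat by auto
      have "g \<le> j - i" using ij by (auto simp: g_def intro: gcd_le1_nat)
      then have "g < ?N" using ij by auto
      then have "s \<le> n" using s by (metis less_Suc_eq_le nat_power_less_imp_less pos2)
      obtain a b where "(j - i) * a = ?N * b + g"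
        using bezout_nat[of "j - i" ?N] ij unfolding g_def by auto
      then have "v ^ ((j - i) * a) = v ^ (?N * b) * v ^ g" by (simp add: power_add)
      then have "v ^ g = 1" using d vN by (simp add: power_mult)
      then have "v ^ (2 ^ n) = 1" using s \<open>s \<le> n\<close>
        by (metis le_add_diff_inverse power_add power_mult power_one)
      then show False using v by simp
    qed
  qed (auto)
  have "card ((\<lambda>k. v ^ k) ` {..<?N}) = ?N" using card_image[OF inj] by simp
  moreover have "(\<lambda>k. v ^ k) ` {..<?N} \<subseteq> {x. x ^ ?N = 1}"
  proof safe
    fix k show "(v ^ k) ^ ?N = 1" using vN by (metis mult.commute power_mult power_one)
  qed
  moreover have "card {x::complex. x ^ ?N = 1} = ?N" "finite {x::complex. x ^ ?N = 1}"
    using card_roots_unity_eq[of ?N] finite_roots_unity[of ?N] by auto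
  ultimately have "(\<lambda>k. v ^ k) ` {..<?N} = {x. x ^ ?N = 1}"
    by (intro card_subset_eq) auto
  then show ?thesis using x by blast
qed

text \<open>The first two factors divide odd integers. Multiplying by their cofactors leaves an odd
  multiple of 1 - p3 that is divisible by 2.\<close>

lemma double_triple_product_nonprimary:
  assumes zM: "z ^ M = 1" "M > 0" and M: "M = 2 ^ e * r" "odd r"
    and p: "p1 \<in> ZP z" "p1 ^ M = 1" "p2 \<in> ZP z" "p2 ^ M = 1" "p3 \<in> ZP z" "p3 ^ M = 1"
    and ne: "p1 ^ (2 ^ e) \<noteq> 1" "p2 ^ (2 ^ e) \<noteq> 1"
    and eq: "(1 - p1) * (1 - p2) * (1 - p3) = 2 * y" "y \<in> ZP z"
  shows "p3 ^ 2 = 1"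
proof -
  obtain c1 q1 where c1: "c1 \<in> ZP z" "odd (q1::int)" "(1 - p1) * c1 = of_int q1"
    using ex_odd_multiple[OF zM(1) M p(1,2) ne(1)] by blast
  obtain c2 q2 where c2: "c2 \<in> ZP z" "odd (q2::int)" "(1 - p2) * c2 = of_int q2"
    using ex_odd_multiple[OF zM(1) M p(3,4) ne(2)] by blast
  have "of_int (q1 * q2) * (1 - p3) = ((1 - p1) * c1) * ((1 - p2) * c2) * (1 - p3)"
    using c1 c2 by simp
  also have "\<dots> = ((1 - p1) * (1 - p2) * (1 - p3)) * (c1 * c2)" by (simp add: ac_simps)
  also have "\<dots> = 2 * (y * (c1 * c2))" unfolding eq by simp
  finally have e: "of_int (q1 * q2) * (1 - p3) = 2 * (y * (c1 * c2))" .
  show ?thesis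
    by (rule root_of_unity_cong_1_mod_2[OF zM p(5,6) zM(2) _ _ e]) (use c1 c2 eq in \<open>auto intro!: ZP_mult\<close>)
qed

text \<open>For orders that are powers of two, 1 - \<alpha> is no unit modulo 2 and has to be
  cancelled. Since \<alpha> and \<beta> generate the same group of roots, 1 - \<alpha> is a multiple
  of 1 - \<beta>, and 1 + \<alpha> is a multiple of 1 - \<alpha>. The factors 1 - u^2 and 1 - w^2 on
  the right are multiples of 1 - \<alpha>^2, hence of (1 - \<alpha>)^2, so cancelling this square
  leaves 1 - \<gamma> divisible by 2. Without these factors the cancellation would destroy the
  divisibility.\<close>

lemma double_triple_product_primary:
  assumes zM: "z ^ M = 1" "M > 0"
    and in_ZP: "\<alpha> \<in> ZP z" "\<beta> \<in> ZP z" "\<gamma> \<in> ZP z" "\<gamma> ^ M = 1"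
    and n: "\<alpha> ^ (2 ^ n) = -1" "\<beta> ^ (2 ^ n) = -1" "n > 0"
    and u: "u ^ (2 ^ Suc n) = 1" and w: "w ^ (2 ^ Suc n) = 1"
    and eq: "(1 - \<alpha>) * (1 - \<beta>) * (1 - \<gamma>) = 2 * ((1 - u\<^sup>2) * X + (1 - w\<^sup>2) * Y)"
      "X \<in> ZP z" "Y \<in> ZP z"
  shows "\<gamma> ^ 2 = 1"
proof -
  obtain i j where i: "u = \<alpha> ^ i" and j: "w = \<alpha> ^ j"
    using primitive_root_generates[OF n(1)] u w by metis
  have "\<alpha> ^ (2 ^ Suc n) = (\<alpha> ^ (2 ^ n))\<^sup>2" by (simp add: power_mult[symmetric] mult.commute)
  then have aN: "\<alpha> ^ (2 ^ Suc n) = 1" using n(1) by simp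
  obtain k where k: "\<alpha> = \<beta> ^ k" using primitive_root_generates[OF n(2) aN] by blast
  have "(- \<alpha>) ^ (2 ^ Suc n) = 1" using aN by simp
  then obtain l where l: "- \<alpha> = \<alpha> ^ l" using primitive_root_generates[OF n(1)] by blast
  have a1: "\<alpha> \<noteq> 1" using n(1) by auto
  have a2: "\<alpha>\<^sup>2 \<in> ZP z" using in_ZP by (intro ZP_pow)
  obtain ci where ci: "ci \<in> ZP z" "1 - u\<^sup>2 = (1 - \<alpha>\<^sup>2) * ci"
    using ZP_one_minus_power[OF a2, of i] unfolding i by (metis mult.commute power_mult)
  obtain cj where cj: "cj \<in> ZP z" "1 - w\<^sup>2 = (1 - \<alpha>\<^sup>2) * cj"
    using ZP_one_minus_power[OF a2, of j] unfolding j by (metis mult.commute power_mult)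
  obtain ck where ck: "ck \<in> ZP z" "1 - \<alpha> = (1 - \<beta>) * ck"
    using ZP_one_minus_power[OF in_ZP(2), of k] unfolding k by blast
  obtain cl where cl: "cl \<in> ZP z" "1 + \<alpha> = (1 - \<alpha>) * cl"
    using ZP_one_minus_power[OF in_ZP(1), of l] unfolding l[symmetric] by auto
  have "(1 - \<alpha>) * (1 - \<alpha>) * (1 - \<gamma>) = ((1 - \<alpha>) * (1 - \<beta>) * (1 - \<gamma>)) * ck"
    by (subst (2) ck(2)) (simp add: ac_simps)
  also have "\<dots> = 2 * ((1 - \<alpha>\<^sup>2) * (ci * X + cj * Y)) * ck"
    unfolding eq ci cj by (simp add: algebra_simps)
  also have "\<dots> = (1 - \<alpha>) * (1 - \<alpha>) * (2 * (cl * (ci * X + cj * Y) * ck))"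
  proof -
    have "1 - \<alpha>\<^sup>2 = (1 - \<alpha>) * (1 + \<alpha>)" by (simp add: power2_eq_square algebra_simps)
    then show ?thesis unfolding cl(2) by (simp add: ac_simps)
  qed
  finally have "1 - \<gamma> = 2 * (cl * (ci * X + cj * Y) * ck)" using a1 by simp
  then have e: "of_int 1 * (1 - \<gamma>) = 2 * (cl * (ci * X + cj * Y) * ck)" by simp
  show ?thesis
    by (rule root_of_unity_cong_1_mod_2[OF zM in_ZP(3,4) zM(2) _ _ e])
      (use ci cj ck cl eq in \<open>auto intro!: ZP_mult ZP_add\<close>)
qed

text \<open>If two of u, w, uw have orders that are not powers of two, the nonprimary case applies
  to them. Otherwise all three orders are powers of two. With 2^g the least common exponent and g =
  n + 1, the 2^n-th powers of u, w, uw are signs, not all 1, the third being the product of the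
  others; so exactly two of them are -1, and the primary case applies to these two.\<close>

lemma double_triple_product:
  assumes zM: "z ^ M = 1" "M > 0"
    and u: "u \<in> ZP z" "u ^ M = 1" and w: "w \<in> ZP z" "w ^ M = 1"
    and eq: "(1 - u) * (1 - w) * (1 - u * w) = 2 * ((1 - u\<^sup>2) * X + (1 - w\<^sup>2) * Y)"
      "X \<in> ZP z" "Y \<in> ZP z"
  shows "u\<^sup>2 = 1 \<or> w\<^sup>2 = 1 \<or> (u * w)\<^sup>2 = 1"
proof (rule ccontr)
  assume neg: "\<not> ?thesis"
  obtain e r where M: "M = 2 ^ e * r" "odd r"
  proof -
    have "\<exists>e r. M = 2 ^ e * r \<and> odd r"
      using zM(2)
    proof (induction M rule: less_induct)
      case (less M)
      show ?case
      proof (cases "even M")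
        case True
        then obtain k where k: "M = 2 * k" by blast
        then obtain e r where "k = 2 ^ e * r" "odd r" using less.IH[of k] less.prems by auto
        then show ?thesis using k by (intro exI[of _ "Suc e"] exI[of _ r]) simp
      qed (auto intro: exI[of _ 0])
    qed
    then show ?thesis using that by blast
  qed
  have uw: "u * w \<in> ZP z" "(u * w) ^ M = 1" using u w by (auto simp: power_mult_distrib intro: ZP_mult)
  define y where "y = (1 - u\<^sup>2) * X + (1 - w\<^sup>2) * Y"
  have y: "y \<in> ZP z" unfolding y_def using eq u w by (intro ZP_add ZP_mult ZP_diff ZP_1 ZP_pow)
  have eq': "(1 - u) * (1 - w) * (1 - u * w) = 2 * y" "(1 - u) * (1 - u * w) * (1 - w) = 2 * y"
    "(1 - w) * (1 - u * w) * (1 - u) = 2 * y"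
    using eq(1) by (simp_all add: y_def ac_simps)
  note np = double_triple_product_nonprimary[OF zM M]
  have "\<not> (u ^ (2 ^ e) \<noteq> 1 \<and> w ^ (2 ^ e) \<noteq> 1)" using np[OF u w uw _ _ eq'(1) y] neg by blast
  moreover have "\<not> (u ^ (2 ^ e) \<noteq> 1 \<and> (u * w) ^ (2 ^ e) \<noteq> 1)" using np[OF u uw w _ _ eq'(2) y] neg by blast
  moreover have "\<not> (w ^ (2 ^ e) \<noteq> 1 \<and> (u * w) ^ (2 ^ e) \<noteq> 1)" using np[OF w uw u _ _ eq'(3) y] neg by blast
  ultimately have e1: "u ^ (2 ^ e) = 1 \<and> w ^ (2 ^ e) = 1" by (auto simp: power_mult_distrib)
  define g where "g = (LEAST g. u ^ (2 ^ g) = 1 \<and> w ^ (2 ^ g) = 1)"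
  have g: "u ^ (2 ^ g) = 1" "w ^ (2 ^ g) = 1"
    using LeastI[of "\<lambda>g. u ^ (2 ^ g) = 1 \<and> w ^ (2 ^ g) = 1", OF e1] by (auto simp: g_def)
  have gmin: "\<not> (u ^ (2 ^ k) = 1 \<and> w ^ (2 ^ k) = 1)" if "k < g" for k
    using not_less_Least that unfolding g_def by blast
  have "g \<noteq> 0"
  proof
    assume "g = 0"
    then show False using g neg by simp
  qed
  moreover have "g \<noteq> 1"
  proof
    assume "g = 1"
    then show False using g neg by simp
  qed
  ultimately obtain n where n: "g = Suc n" "n > 0" by (metis One_nat_def gr0I not0_implies_Suc)
  have sq: "(u ^ (2 ^ n))\<^sup>2 = 1" "(w ^ (2 ^ n))\<^sup>2 = 1"
    using g unfolding n by (simp_all add: power_mult[symmetric] mult.commute)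
  note pr = double_triple_product_primary[OF zM]
  consider (1) "u ^ (2 ^ n) = -1" "w ^ (2 ^ n) = -1" | (2) "u ^ (2 ^ n) = -1" "w ^ (2 ^ n) = 1"
    | (3) "u ^ (2 ^ n) = 1" "w ^ (2 ^ n) = -1"
    using sq gmin[of n] n by (auto simp: power2_eq_1_iff)
  then show False
  proof cases
    case 1
    show False
      using pr[OF u(1) w(1) uw 1 n(2) g(1)[unfolded n] g(2)[unfolded n] eq] neg by blast
  next
    case 2
    then have "(u * w) ^ (2 ^ n) = -1" by (simp add: power_mult_distrib)
    from pr[OF u(1) uw(1) w 2(1) this n(2) g(1)[unfolded n] g(2)[unfolded n] _ eq(2,3)] eq(1) neg
    show False by (simp add: ac_simps)
  next
    case 3
    then have "(u * w) ^ (2 ^ n) = -1" by (simp add: power_mult_distrib)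
    from pr[OF w(1) uw(1) u 3(2) this n(2) g(1)[unfolded n] g(2)[unfolded n] _ eq(2,3)] eq(1) neg
    show False by (simp add: ac_simps)
  qed
qed

section \<open>Rotations by $\pi/h$\<close>

text \<open>The bound on \<open>h\<close> is what N > 4 and N \<noteq> 6 leave when \<open>h\<close>
  is N/2 for even N and N for odd N. It places \<open>lam\<close> strictly between 1 and 2; h = 3
  would give \<open>lam = 1\<close>.\<close>

locale rotation =
  fixes h :: nat
  assumes h4: "h \<ge> 4"
begin

definition th :: real where "th = pi / real h"

text \<open>The Chebyshev polynomial of the second kind of degree n - 1 at \<open>cos th\<close>:
  the solution of the homogeneous recurrence with values 0 and 1 at times 0 and 1. All other
  solutions are expressed through its translates.\<close>

definition U :: "int \<Rightarrow> real" where "U n = sin (of_int n * th) / sin th"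

definition lam :: real where "lam = 2 * cos th"

definition zeta :: complex where "zeta = cis th"

lemma h_pos: "h > 0" using h4 by simp

lemma th_bounds: "0 < th" "th \<le> pi / 4"
  using h4 by (auto simp: th_def field_simps)

lemma sin_th_pos: "sin th > 0"
  using th_bounds pi_gt_zero by (intro sin_gt_zero) (auto simp: field_simps)

lemma h_th: "real h * th = pi" using h4 by (simp add: th_def)

lemma U_0 [simp]: "U 0 = 0" and U_1 [simp]: "U 1 = 1"
  using sin_th_pos by (auto simp: U_def)

lemma U_minus: "U (- n) = - U n" by (simp add: U_def)

lemma U_minus_1 [simp]: "U (-1) = -1" using U_minus[of 1] by simp

lemma U_add_h: "U (n + int h) = - U n"
proof -
  have "of_int (n + int h) * th = of_int n * th + pi" using h_th by (simp add: ring_distribs)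
  then show ?thesis by (simp add: U_def)
qed

lemma U_rec: "U (n + 1) = lam * U n - U (n - 1)"
proof -
  have "sin (of_int (n + 1) * th) + sin (of_int (n - 1) * th) = lam * sin (of_int n * th)"
    by (simp add: ring_distribs sin_add sin_diff lam_def)
  then show ?thesis using sin_th_pos by (simp add: U_def field_simps)
qed

lemma U_add_mult_h: "\<bar>U (n + int h * j)\<bar> = \<bar>U n\<bar>"
proof -
  have s: "\<bar>U (n + int h * int k)\<bar> = \<bar>U n\<bar>" for k n
  proof (induction k)
    case (Suc k)
    have e: "n + int h * int (Suc k) = (n + int h * int k) + int h" by (simp add: algebra_simps)
    show ?case unfolding e U_add_h using Suc by simp
  qed simp
  show ?thesis
  proof (cases "j \<ge> 0")
    case True
    then show ?thesis using s[of n "nat j"] by simp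
  next
    case False
    then show ?thesis using s[of "n + int h * j" "nat (- j)"] by (simp add: algebra_simps)
  qed
qed

lemma cis_eq_1_iff: "cis (2 * (of_int n * th)) = 1 \<longleftrightarrow> int h dvd n"
proof -
  have "cis x = 1 \<longleftrightarrow> cos x = 1" for x
    using sin_cos_squared_add[of x] by (fastforce simp: complex_eq_iff)
  then have "cis (2 * (of_int n * th)) = 1 \<longleftrightarrow> (\<exists>k::int. 2 * (of_int n * th) = of_int k * (2 * pi))"
    by (simp add: cos_one_2pi_int mult.assoc)
  also have "\<dots> \<longleftrightarrow> (\<exists>k::int. n = int h * k)"
  proof -
    have "2 * (of_int n * th) = of_int k * (2 * pi) \<longleftrightarrow> real_of_int n = real_of_int (int h * k)" for k :: int
      using h4 pi_gt_zero by (auto simp: th_def field_simps)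
    then show ?thesis by (simp only: of_int_eq_iff)
  qed
  finally show ?thesis by (auto simp: dvd_def)
qed

lemma U_eq_0_iff: "U n = 0 \<longleftrightarrow> int h dvd n"
proof -
  have "U n = 0 \<longleftrightarrow> sin (of_int n * th) = 0" using sin_th_pos by (simp add: U_def)
  also have "\<dots> \<longleftrightarrow> (\<exists>k::int. of_int n * th = of_int k * pi)" by (simp add: sin_zero_iff_int2)
  also have "\<dots> \<longleftrightarrow> (\<exists>k::int. n = int h * k)"
  proof -
    have "of_int n * th = of_int k * pi \<longleftrightarrow> real_of_int n = real_of_int (int h * k)" for k :: int
      using h4 pi_gt_zero by (auto simp: th_def field_simps)
    then show ?thesis by (simp only: of_int_eq_iff)
  qed
  finally show ?thesis by (auto simp: dvd_def)
qed

lemma zeta_pow: "zeta ^ (2 * h) = 1"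
proof -
  have "real (2 * h) * th = 2 * pi" using h_th by simp
  then show ?thesis unfolding zeta_def Complex.DeMoivre by (metis cis_2pi)
qed

lemma cis_in_ZP: "cis (of_int n * th) \<in> ZP zeta"
proof -
  define m where "m = nat (n mod (2 * int h))"
  have m: "int m = n mod (2 * int h)" using h4 by (simp add: m_def)
  obtain k where k: "n = int m + 2 * int h * k" using m by (metis mod_mult_div_eq)
  have "of_int n * th = of_nat m * th + of_int k * (2 * pi)"
    unfolding k h_th[symmetric] by (simp add: algebra_simps)
  then have "cis (of_int n * th) = cis (of_nat m * th) * cis (of_int k * (2 * pi))" by (simp add: cis_mult)
  also have "cis (of_int k * (2 * pi)) = 1"
    using cos_int_2pin[of k] sin_int_2pin[of k] by (simp add: complex_eq_iff mult_ac)
  finally have "cis (of_int n * th) = zeta ^ m" by (simp add: zeta_def Complex.DeMoivre)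
  then show ?thesis by (simp add: ZP_power)
qed

lemma of_real_U: "of_real (U n) * (zeta - cnj zeta) = cis (of_int n * th) - cis (- (of_int n * th))"
  using sin_th_pos by (simp add: U_def zeta_def complex_eq_iff)

lemma U_in_ZP: "of_real (U n) \<in> ZP zeta"
proof -
  have l: "of_real lam \<in> ZP zeta"
  proof -
    have "of_real lam = cis (of_int 1 * th) + cis (of_int (-1) * th)"
      by (simp add: lam_def complex_eq_iff)
    then show ?thesis using ZP_add[OF cis_in_ZP cis_in_ZP] by metis
  qed
  have n: "of_real (U (int n)) \<in> ZP zeta \<and> of_real (U (int n + 1)) \<in> ZP zeta" for n
  proof (induction n)
    case (Suc n)
    have "U (int (Suc n) + 1) = lam * U (int n + 1) - U (int n)"
      using U_rec[of "int n + 1"] by (simp add: algebra_simps)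
    then have "complex_of_real (U (int (Suc n) + 1)) = of_real lam * of_real (U (int n + 1)) - of_real (U (int n))" by simp
    moreover have "\<dots> \<in> ZP zeta" using Suc l by (intro ZP_diff ZP_mult) auto
    moreover have "int (Suc n) = int n + 1" by simp
    ultimately show ?case using Suc by metis
  qed (auto simp: ZP_0 ZP_1)
  show ?thesis
    using n[of "nat n"] n[of "nat (- n)"] U_minus[of n]
    by (cases "n \<ge> 0") (auto dest: ZP_minus)
qed

lemma lam_in_ZP: "of_real lam \<in> ZP zeta"
  using U_in_ZP[of 2] U_rec[of 1] by simp

lemma lam_bounds: "lam > 1" "lam < 2"
proof -
  have "cos th \<ge> cos (pi / 4)" using th_bounds pi_gt_zero by (intro cos_monotone_0_pi_le) auto
  moreover have "sqrt 2 > 1" by simp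
  ultimately show "lam > 1" unfolding lam_def cos_45 by linarith
  have "cos th < cos 0" using th_bounds pi_gt_zero by (intro cos_monotone_0_pi) auto
  then show "lam < 2" by (simp add: lam_def)
qed

text \<open>As an element of Z[zeta], a rational \<open>lam\<close> would be an integer, and none
  lies strictly between 1 and 2.\<close>

lemma lam_irrational: "lam \<notin> \<rat>"
proof
  assume "lam \<in> \<rat>"
  then obtain r where r: "lam = of_rat r" by (auto elim: Rats_cases)
  have "(of_rat r :: complex) = of_real (of_rat r)" by (cases r) (simp add: of_rat_rat)
  then have "(of_rat r :: complex) = of_real lam" unfolding r .
  then have "r \<in> \<int>" using ZP_rat_imp_int[OF zeta_pow] h_pos lam_in_ZP by simp
  then obtain n :: int where "lam = of_int n" using r by (auto elim!: Ints_cases)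
  then show False using lam_bounds by simp
qed

text \<open>Multiplication by \<open>zeta - cnj zeta\<close> turns each \<open>U n\<close> into a
  difference of two inverse roots of unity, and multiplication by uw clears the inverses. With A = B
  = 0 and all signs 1, the difference of the two sides factors as (1 - u)(1 - w)(1 - uw); A and B
  contribute only twice a combination of 1 - u^2 and 1 - w^2.\<close>

lemma no_triple_relation:
  assumes A: "of_real A \<in> ZP zeta" "of_real B \<in> ZP zeta"
    and eta: "\<bar>\<eta>0\<bar> = (1::int)" "\<bar>\<eta>1\<bar> = (1::int)" "\<bar>\<eta>2\<bar> = (1::int)"
    and eq: "U b * (of_int \<eta>0 + 2 * A) + U a * (of_int \<eta>2 + 2 * B) = U (a + b) * of_int \<eta>1"
  shows "int h dvd a \<or> int h dvd b \<or> int h dvd (a + b)"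
proof -
  define u w where "u = cis (of_int a * th)" and "w = cis (of_int b * th)"
  have uw: "u * w = cis (of_int (a + b) * th)" by (simp add: u_def w_def cis_mult algebra_simps)
  have inv: "cis (- (of_int a * th)) = inverse u" "cis (- (of_int b * th)) = inverse w"
    "cis (- (of_int (a + b) * th)) = inverse (u * w)" unfolding uw by (simp_all add: u_def w_def)
  have nz: "u \<noteq> 0" "w \<noteq> 0" by (simp_all add: u_def w_def)
  \<comment> \<open>Signs are 1 modulo 2. Multiplying the relation by \<eta>1 makes the sign on the
    right equal to 1, and the even remainders of the other two are absorbed into A and B.\<close>
  have odd1: "\<exists>s::int. \<eta> * \<eta>1 = 1 + 2 * s" if "\<bar>\<eta>\<bar> = 1" for \<eta> :: int
  proof -
    have "\<eta> * \<eta>1 = 1 \<or> \<eta> * \<eta>1 = -1" using that eta(2) by (auto simp: abs_if split: if_splits)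
    then show ?thesis
    proof
      assume "\<eta> * \<eta>1 = 1" then show ?thesis by (intro exI[of _ 0]) simp
    next
      assume "\<eta> * \<eta>1 = -1" then show ?thesis by (intro exI[of _ "-1"]) simp
    qed
  qed
  obtain s0 s2 :: int where s: "\<eta>0 * \<eta>1 = 1 + 2 * s0" "\<eta>2 * \<eta>1 = 1 + 2 * s2"
    using odd1 eta by metis
  have e11: "\<eta>1 * \<eta>1 = 1" using eta(2) by (auto simp: abs_if split: if_splits)
  define A' B' where "A' = of_int s0 + of_int \<eta>1 * A" and "B' = of_int s2 + of_int \<eta>1 * B"
  have AB: "of_real A' \<in> ZP zeta" "of_real B' \<in> ZP zeta"
    using A by (auto simp: A'_def B'_def intro!: ZP_add ZP_mult ZP_of_int)
  have eqr: "U b * (1 + 2 * A') + U a * (1 + 2 * B') = U (a + b)"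
  proof -
    have "(U b * (of_int \<eta>0 + 2 * A) + U a * (of_int \<eta>2 + 2 * B)) * of_int \<eta>1 = U (a + b) * of_int (\<eta>1 * \<eta>1)"
      unfolding eq by simp
    moreover have "(U b * (of_int \<eta>0 + 2 * A) + U a * (of_int \<eta>2 + 2 * B)) * of_int \<eta>1
       = U b * (of_int (\<eta>0 * \<eta>1) + 2 * (of_int \<eta>1 * A)) + U a * (of_int (\<eta>2 * \<eta>1) + 2 * (of_int \<eta>1 * B))"
      by (simp add: algebra_simps)
    ultimately show ?thesis unfolding s e11 A'_def B'_def by (simp add: algebra_simps)
  qed
  have "(w - inverse w) * (1 + 2 * of_real A') + (u - inverse u) * (1 + 2 * of_real B') = u * w - inverse (u * w)"
  proof -
    have "of_real (U b * (1 + 2 * A') + U a * (1 + 2 * B')) * (zeta - cnj zeta) = of_real (U (a + b)) * (zeta - cnj zeta)"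
      unfolding eqr ..
    then have "(of_real (U b) * (zeta - cnj zeta)) * (1 + 2 * of_real A') + (of_real (U a) * (zeta - cnj zeta)) * (1 + 2 * of_real B')
       = of_real (U (a + b)) * (zeta - cnj zeta)"
      by (simp add: algebra_simps)
    then show ?thesis unfolding of_real_U inv u_def[symmetric] w_def[symmetric] uw[symmetric] .
  qed
  then have "(w\<^sup>2 - 1) * u * (1 + 2 * of_real A') + (u\<^sup>2 - 1) * w * (1 + 2 * of_real B') = (u * w)\<^sup>2 - 1"
    using nz by (simp add: field_simps power2_eq_square)
  then have "(1 - u) * (1 - w) * (1 - u * w) = 2 * ((1 - u\<^sup>2) * (w * of_real B') + (1 - w\<^sup>2) * (u * of_real A'))"
    by (simp add: algebra_simps power2_eq_square)
  moreover have Z: "u \<in> ZP zeta" "w \<in> ZP zeta" unfolding u_def w_def by (rule cis_in_ZP)+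
  moreover have "u ^ (2 * h) = 1" "w ^ (2 * h) = 1"
  proof -
    have "cis (of_int n * th) ^ (2 * h) = 1" for n
    proof -
      have "cis (of_int n * th) ^ (2 * h) = cis (2 * (of_int (int h * n) * th))" by (simp add: Complex.DeMoivre algebra_simps)
      then show ?thesis using cis_eq_1_iff[of "int h * n"] by simp
    qed
    then show "u ^ (2 * h) = 1" "w ^ (2 * h) = 1" by (simp_all add: u_def w_def)
  qed
  ultimately have "u\<^sup>2 = 1 \<or> w\<^sup>2 = 1 \<or> (u * w)\<^sup>2 = 1"
    using double_triple_product[OF zeta_pow] h_pos ZP_mult[OF Z(2) AB(2)] ZP_mult[OF Z(1) AB(1)]
    by simp
  moreover have "cis (of_int n * th) ^ 2 = 1 \<longleftrightarrow> int h dvd n" for n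
    using cis_eq_1_iff[of n] by (simp add: Complex.DeMoivre)
  ultimately show ?thesis unfolding uw unfolding u_def w_def by blast
qed

end

context rotation begin

section \<open>Orbits of the rotation on the square torus\<close>

text \<open>The integer correction of one step of the torus map (x (n-1), x n) to (x n, lam x n - x
  (n-1) mod 1). The linear part has trace \<open>lam = 2 cos th\<close> and determinant 1, so it is
  conjugate to a rotation by \<open>th\<close>, of order 2h.\<close>

definition code :: "(int \<Rightarrow> real) \<Rightarrow> int \<Rightarrow> real" where
  "code x n = x (n + 1) - lam * x n + x (n - 1)"

text \<open>In the closed square a boundary value may be taken as 1/2 or as -1/2, so two
  neighbouring values need not determine the orbit; for a \<open>strict\<close> orbit they
  do.\<close>

definition orbit :: "(int \<Rightarrow> real) \<Rightarrow> bool" where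
  "orbit x \<longleftrightarrow> (\<forall>n. \<bar>x n\<bar> \<le> 1/2 \<and> code x n \<in> \<int>)"

definition strict :: "(int \<Rightarrow> real) \<Rightarrow> bool" where
  "strict x \<longleftrightarrow> orbit x \<and> (\<forall>n. \<bar>x n\<bar> < 1/2)"

definition periodic :: "(int \<Rightarrow> real) \<Rightarrow> bool" where
  "periodic x \<longleftrightarrow> (\<exists>p>0::int. \<forall>n. x (n + p) = x n)"

text \<open>The value at time \<open>i\<close> of the solution of the homogeneous recurrence through
  the state of \<open>x\<close> at times \<open>m - 1\<close> and \<open>m\<close>.\<close>

definition ext :: "(int \<Rightarrow> real) \<Rightarrow> int \<Rightarrow> int \<Rightarrow> real" where
  "ext x m i = U (i - m + 1) * x m - U (i - m) * x (m - 1)"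

lemma orbit_abs: "orbit x \<Longrightarrow> \<bar>x n\<bar> \<le> 1/2"
  and orbit_code: "orbit x \<Longrightarrow> code x n \<in> \<int>"
  by (auto simp: orbit_def)

lemma strict_orbit: "strict x \<Longrightarrow> orbit x"
  and strict_abs: "strict x \<Longrightarrow> \<bar>x n\<bar> < 1/2"
  by (auto simp: strict_def)

lemma code_shift: "code (\<lambda>n. x (n + k)) m = code x (m + k)"
proof -
  have "m + 1 + k = m + k + 1" "m - 1 + k = m + k - 1" by auto
  then show ?thesis by (simp only: code_def)
qed

lemma orbit_shift: "orbit x \<Longrightarrow> orbit (\<lambda>n. x (n + k))"
  by (simp add: orbit_def code_shift)

lemma strict_shift: "strict x \<Longrightarrow> strict (\<lambda>n. x (n + k))"
  by (simp add: strict_def orbit_shift)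

lemma orbit_uminus: "orbit x \<Longrightarrow> orbit (\<lambda>n. - x n)"
proof -
  assume x: "orbit x"
  have "code (\<lambda>n. - x n) m = - code x m" for m by (simp add: code_def)
  then show ?thesis using x by (simp add: orbit_def)
qed

lemma strict_uminus: "strict x \<Longrightarrow> strict (\<lambda>n. - x n)"
  by (simp add: strict_def orbit_uminus)

lemma periodic_shift_iff: "periodic (\<lambda>n. x (n + k)) \<longleftrightarrow> periodic x"
proof
  assume "periodic (\<lambda>n. x (n + k))"
  then obtain p where p: "p > 0" "\<And>n. x (n + p + k) = x (n + k)" by (auto simp: periodic_def)
  have "x (n + p) = x n" for n using p(2)[of "n - k"] by (simp add: algebra_simps)
  then show "periodic x" using p(1) by (auto simp: periodic_def)
next
  assume "periodic x"
  then obtain p where p: "p > 0" "\<And>n. x (n + p) = x n" by (auto simp: periodic_def)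
  have "x (n + p + k) = x (n + k)" for n using p(2)[of "n + k"] by (simp add: algebra_simps)
  then show "periodic (\<lambda>n. x (n + k))" using p(1) by (auto simp: periodic_def)
qed

lemma periodic_mult: "(\<And>n. x (n + p) = x n) \<Longrightarrow> x (n + int k * p) = (x n :: real)"
proof (induction k)
  case (Suc k)
  have "x (n + int (Suc k) * p) = x (n + int k * p + p)" by (simp add: algebra_simps)
  then show ?case using Suc by simp
qed simp

lemma homogeneous_unique:
  assumes v: "\<And>i::int. v (i + 1) = lam * v i - v (i - 1)" and w: "\<And>i::int. w (i + 1) = lam * w i - w (i - 1)"
    and eq: "v a = w a" "v (a + 1) = w (a + 1)"
  shows "v i = (w i :: real)"
proof -
  have up: "v (a + int k) = w (a + int k) \<and> v (a + int k + 1) = w (a + int k + 1)" for k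
  proof (induction k)
    case (Suc k)
    have e: "a + int (Suc k) = a + int k + 1" by simp
    have "v (a + int k + 1 + 1) = w (a + int k + 1 + 1)"
      unfolding v[of "a + int k + 1"] w[of "a + int k + 1"] using Suc by simp
    then show ?case unfolding e using Suc by simp
  qed (use eq in simp)
  have down: "v (a - int k) = w (a - int k) \<and> v (a - int k + 1) = w (a - int k + 1)" for k
  proof (induction k)
    case (Suc k)
    have e: "a - int (Suc k) = a - int k - 1" "a - int (Suc k) + 1 = a - int k" by auto
    have "v (a - int k - 1) = lam * v (a - int k) - v (a - int k + 1)"
      "w (a - int k - 1) = lam * w (a - int k) - w (a - int k + 1)"
      using v[of "a - int k"] w[of "a - int k"] by linarith+
    then show ?case unfolding e using Suc by simp
  qed (use eq in simp)
  show ?thesis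
  proof (cases "i \<ge> a")
    case True
    then show ?thesis using up[of "nat (i - a)"] by simp
  next
    case False
    then show ?thesis using down[of "nat (a - i)"] by simp
  qed
qed

lemma homogeneous_U: "U (i + 1 + c) = lam * U (i + c) - U (i - 1 + c)"
proof -
  have "i + 1 + c = (i + c) + 1" "i - 1 + c = (i + c) - 1" by auto
  then show ?thesis using U_rec[of "i + c"] by (simp only:)
qed

lemma ext_homogeneous: "ext x m (i + 1) = lam * ext x m i - ext x m (i - 1)"
proof -
  have e: "i + 1 - m + 1 = (i - m + 1) + 1" "i - 1 - m + 1 = (i - m + 1) - 1"
    "i + 1 - m = (i - m) + 1" "i - 1 - m = (i - m) - 1" by auto
  have 1: "U (i + 1 - m + 1) = lam * U (i - m + 1) - U (i - 1 - m + 1)" unfolding e(1,2) by (rule U_rec)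
  have 2: "U (i + 1 - m) = lam * U (i - m) - U (i - 1 - m)" unfolding e(3,4) by (rule U_rec)
  show ?thesis unfolding ext_def 1 2 by (simp add: algebra_simps)
qed

lemma homogeneous_via_U:
  assumes v: "\<And>i::int. v (i + 1) = lam * v i - v (i - 1)"
  shows "v i = U (i - a) * v (a + 1) - U (i - a - 1) * (v a :: real)"
proof (rule homogeneous_unique[of v "\<lambda>i. U (i - a) * v (a + 1) - U (i - a - 1) * v a" a, OF v])
  fix i
  show "U (i + 1 - a) * v (a + 1) - U (i + 1 - a - 1) * v a =
    lam * (U (i - a) * v (a + 1) - U (i - a - 1) * v a) - (U (i - 1 - a) * v (a + 1) - U (i - 1 - a - 1) * v a)"
  proof -
    have e: "i + 1 - a - 1 = (i - a - 1) + 1" "i - 1 - a - 1 = (i - a - 1) - 1"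
      "i + 1 - a = (i - a) + 1" "i - 1 - a = (i - a) - 1" by auto
    have 1: "U (i + 1 - a - 1) = lam * U (i - a - 1) - U (i - 1 - a - 1)" unfolding e(1,2) by (rule U_rec)
    have 2: "U (i + 1 - a) = lam * U (i - a) - U (i - 1 - a)" unfolding e(3,4) by (rule U_rec)
    show ?thesis unfolding 1 2 by (simp add: algebra_simps)
  qed
qed auto

lemma ext_via_U: "ext x m i = U (i - a) * ext x m (a + 1) - U (i - a - 1) * ext x m a"
  by (rule homogeneous_via_U[of "ext x m", OF ext_homogeneous])

lemma ext_self [simp]: "ext x m m = x m"
  and ext_pred [simp]: "ext x m (m - 1) = x (m - 1)"
  by (simp_all add: ext_def)

text \<open>Extrapolation ignores all codes from time \<open>m\<close> on, so including one more
  code adds its impulse response \<open>U\<close>. In particular the extrapolations of two orbits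
  keep a constant difference as long as their codes agree.\<close>

lemma ext_step: "ext x (m + 1) i = ext x m i + code x m * U (i - m)"
proof -
  have e: "i - (m + 1) + 1 = i - m" "i - (m + 1) = i - m - 1" "m + 1 - 1 = m" by auto
  have 1: "U (i - m - 1) = lam * U (i - m) - U (i - m + 1)" using U_rec[of "i - m"] by simp
  show ?thesis unfolding ext_def code_def e 1 by (simp add: algebra_simps)
qed

lemma ext_add_h: "ext x m (i + int h) = - ext x m i"
proof -
  have e: "i + int h - m = (i - m) + int h" "i - m + int h + 1 = (i - m + 1) + int h" by auto
  show ?thesis unfolding ext_def e U_add_h by simp
qed

lemma ext_add_mult_2h: "ext x m (i + 2 * int h * j) = ext x m i"
proof -
  have e: "ext x m (i + 2 * int h * int k) = ext x m i" for i k
  proof (induction k)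
    case (Suc k)
    have e: "i + 2 * int h * int (Suc k) = ((i + 2 * int h * int k) + int h) + int h" by (simp add: algebra_simps)
    show ?case unfolding e ext_add_h using Suc by simp
  qed simp
  show ?thesis
  proof (cases "j \<ge> 0")
    case True
    then show ?thesis using e[of i "nat j"] by simp
  next
    case False
    then show ?thesis using e[of "i + 2 * int h * j" "nat (- j)"] by (simp add: algebra_simps)
  qed
qed

lemma U_add_mult_2h: "U (i + 2 * int h * j) = U i"
proof -
  have "U i = ext (\<lambda>n. of_bool (n = 0)) 0 (i - 1)" for i by (simp add: ext_def)
  then show ?thesis using ext_add_mult_2h[of "\<lambda>n. of_bool (n = 0)" 0 "i - 1" j]
    by (simp add: algebra_simps)
qed

lemma ext_abs_mult_h: "\<bar>ext x m (i + int h * j)\<bar> = \<bar>ext x m i\<bar>"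
proof -
  have s: "\<bar>ext x m (i + int h * int k)\<bar> = \<bar>ext x m i\<bar>" for k i
  proof (induction k)
    case (Suc k)
    have e: "i + int h * int (Suc k) = (i + int h * int k) + int h" by (simp add: algebra_simps)
    show ?case unfolding e ext_add_h using Suc by simp
  qed simp
  show ?thesis
  proof (cases "j \<ge> 0")
    case True
    then show ?thesis using s[of i "nat j"] by simp
  next
    case False
    then show ?thesis using s[of "i + int h * j" "nat (- j)"] by (simp add: algebra_simps)
  qed
qed

lemma ext_sum: "ext x (m + int k) i = ext x m i + (\<Sum>l<k. code x (m + int l) * U (i - m - int l))"
proof (induction k)
  case (Suc k)
  have "ext x (m + int (Suc k)) i = ext x (m + int k + 1) i" by (simp add: algebra_simps)
  then show ?case using ext_step[of x "m + int k" i] Suc by (simp add: algebra_simps)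
qed simp

lemma ext_diff_eq:
  assumes "m \<le> n" "\<And>l. m \<le> l \<Longrightarrow> l < n \<Longrightarrow> code x l = code y l"
  shows "ext x n i - ext x m i = ext y n i - ext y m i"
  using ext_sum[of x m "nat (n - m)" i] ext_sum[of y m "nat (n - m)" i] assms
    sum.cong[of "{..<nat (n - m)}" "{..<nat (n - m)}" "\<lambda>l. code x (m + int l) * U (i - m - int l)"
        "\<lambda>l. code y (m + int l) * U (i - m - int l)"]
  by auto

lemma next_eq:
  assumes "orbit x" "orbit y" "x n = y n" "x (n - 1) = y (n - 1)" "\<bar>x (n + 1)\<bar> < 1/2"
  shows "y (n + 1) = x (n + 1)"
proof -
  have "x (n + 1) - y (n + 1) = code x n - code y n" using assms by (simp add: code_def)
  then have "x (n + 1) - y (n + 1) \<in> \<int>" using assms by (simp add: orbit_code)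
  moreover have "\<bar>x (n + 1) - y (n + 1)\<bar> < 1" using assms(5) orbit_abs[OF assms(2), of "n + 1"] by linarith
  ultimately show ?thesis using Ints_nonzero_abs_less1 by force
qed

lemma prev_eq:
  assumes "orbit x" "orbit y" "x n = y n" "x (n + 1) = y (n + 1)" "\<bar>x (n - 1)\<bar> < 1/2"
  shows "y (n - 1) = x (n - 1)"
proof -
  have "x (n - 1) - y (n - 1) = code x n - code y n" using assms by (simp add: code_def)
  then have "x (n - 1) - y (n - 1) \<in> \<int>" using assms by (simp add: orbit_code)
  moreover have "\<bar>x (n - 1) - y (n - 1)\<bar> < 1" using assms(5) orbit_abs[OF assms(2), of "n - 1"] by linarith
  ultimately show ?thesis using Ints_nonzero_abs_less1 by force
qed

lemma forward_eq:
  assumes "orbit x" "orbit y" "x n = y n" "x (n - 1) = y (n - 1)" "\<And>i. n < i \<Longrightarrow> i \<le> m \<Longrightarrow> \<bar>x i\<bar> < 1/2"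
  shows "n \<le> i \<Longrightarrow> i \<le> m \<Longrightarrow> y i = x i"
proof -
  have "n + int k \<le> m \<Longrightarrow> y (n + int k) = x (n + int k) \<and> y (n + int k - 1) = x (n + int k - 1)" for k
  proof (induction k)
    case (Suc k)
    then have "y (n + int k + 1) = x (n + int k + 1)"
      using next_eq[of x y "n + int k"] assms(1,2,5) by simp
    then show ?case using Suc by (simp add: algebra_simps)
  qed (use assms in auto)
  from this[of "nat (i - n)"] show "n \<le> i \<Longrightarrow> i \<le> m \<Longrightarrow> y i = x i" by simp
qed

lemma strict_eqI:
  assumes x: "strict x" and y: "orbit y" and eq: "x n = y n" "x (n - 1) = y (n - 1)"
  shows "y = x"
proof -
  have ox: "orbit x" using x strict_orbit by blast
  have up: "y (n + int k) = x (n + int k) \<and> y (n + int k - 1) = x (n + int k - 1)" for k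
  proof (induction k)
    case (Suc k)
    have "y (n + int k + 1) = x (n + int k + 1)"
      by (rule next_eq[OF ox y]) (use Suc strict_abs[OF x] in auto)
    then show ?case using Suc by (simp add: algebra_simps)
  qed (use eq in auto)
  have down: "y (n - int k) = x (n - int k) \<and> y (n - int k - 1) = x (n - int k - 1)" for k
  proof (induction k)
    case (Suc k)
    have "y (n - int k - 1 - 1) = x (n - int k - 1 - 1)"
      by (rule prev_eq[OF ox y]) (use Suc strict_abs[OF x] in auto)
    then show ?case using Suc by (auto simp: algebra_simps)
  qed (use eq in auto)
  show ?thesis
  proof
    fix i show "y i = x i"
      using up[of "nat (i - n)"] down[of "nat (n - i)"] by (cases "i \<ge> n") auto
  qed
qed

lemma strict_return:
  assumes "strict x" "x n = x m" "x (n - 1) = x (m - 1)"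
  shows "x (i + (n - m)) = x i"
proof -
  have "(\<lambda>i. x (i + (n - m))) = x"
    by (rule strict_eqI[OF assms(1) orbit_shift[OF strict_orbit[OF assms(1)]], of m]) (use assms in auto)
  then show ?thesis by metis
qed

subsection \<open>Limits of orbits\<close>

lemma seq_tendsto_iff:
  fixes f :: "'a \<Rightarrow> int \<Rightarrow> real"
  shows "(f \<longlongrightarrow> l) F \<longleftrightarrow> (\<forall>i. ((\<lambda>c. f c i) \<longlongrightarrow> l i) F)"
  using limitin_componentwise[of "\<lambda>_. euclidean" UNIV f l F]
  by (simp add: euclidean_product_topology)

lemma orbit_limit:
  assumes "\<And>k. orbit (y k)" "y \<longlonglongrightarrow> x"
  shows "orbit x"
  unfolding orbit_def
proof safe
  fix n
  have t: "(\<lambda>k. y k i) \<longlonglongrightarrow> x i" for i using assms(2) by (simp add: seq_tendsto_iff)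
  show "\<bar>x n\<bar> \<le> 1/2"
    by (rule LIMSEQ_le_const2[OF tendsto_rabs[OF t]]) (use assms(1) orbit_abs in blast)
  have "(\<lambda>k. code (y k) n) \<longlonglongrightarrow> code x n" unfolding code_def by (intro tendsto_intros t)
  then show "code x n \<in> \<int>"
    using closed_sequentially[OF closed_Ints, of "\<lambda>k. code (y k) n"] orbit_code[OF assms(1)] by simp
qed

text \<open>Codes are integers that depend continuously on three coordinates, hence are eventually
  constant along a convergent sequence, even if the limit lies on the boundary: its codes record
  from which side it is approached.\<close>

lemma eventually_code_eq:
  assumes "\<And>k. orbit (y k)" "y \<longlonglongrightarrow> x"
  shows "eventually (\<lambda>k. \<forall>n\<in>{a..b}. code (y k) n = code x n) sequentially"
proof (rule eventually_ball_finite)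
  show "finite {a..b}" by simp
  show "\<forall>n\<in>{a..b}. \<forall>\<^sub>F k in sequentially. code (y k) n = code x n"
  proof
    fix n
    have t: "(\<lambda>k. y k i) \<longlonglongrightarrow> x i" for i using assms(2) by (simp add: seq_tendsto_iff)
    have "(\<lambda>k. code (y k) n) \<longlonglongrightarrow> code x n" unfolding code_def by (intro tendsto_intros t)
    then have "eventually (\<lambda>k. dist (code (y k) n) (code x n) < 1) sequentially"
      by (rule tendstoD) simp
    then show "\<forall>\<^sub>F k in sequentially. code (y k) n = code x n"
    proof eventually_elim
      case (elim k)
      have "code (y k) n - code x n \<in> \<int>"
        using assms(1)[of k] orbit_limit[OF assms] orbit_code by (intro Ints_diff) auto
      then show ?case using elim Ints_nonzero_abs_less1 by (force simp: dist_real_def)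
    qed
  qed
qed

text \<open>Only those boundary orbits are kept whose choices of sign arise from an approach by
  strict orbits; this is what transfers facts about strict orbits to them.\<close>

definition Xbar :: "(int \<Rightarrow> real) set" where "Xbar = closure {x. strict x}"

lemma XbarE:
  assumes "x \<in> Xbar"
  obtains y where "\<And>k. strict (y k)" "y \<longlonglongrightarrow> x"
proof -
  have "\<exists>y. (\<forall>k. y k \<in> {x. strict x}) \<and> y \<longlonglongrightarrow> x"
    using assms unfolding Xbar_def closure_sequential .
  then obtain y where y: "\<forall>k. y k \<in> {x. strict x}" "y \<longlonglongrightarrow> x" by (elim exE conjE)
  from y(1) have "strict (y k)" for k by simp
  then show ?thesis using y(2) by (rule that)
qed

lemma strict_in_Xbar: "strict x \<Longrightarrow> x \<in> Xbar"
  unfolding Xbar_def by (rule subsetD[OF closure_subset]) simp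

lemma Xbar_limit: "(\<And>k. y k \<in> Xbar) \<Longrightarrow> y \<longlonglongrightarrow> x \<Longrightarrow> x \<in> Xbar"
  unfolding Xbar_def using closed_sequentially[OF closed_closure, of y] by simp

lemma Xbar_orbit: "x \<in> Xbar \<Longrightarrow> orbit x"
  by (erule XbarE) (rule orbit_limit[OF strict_orbit])

lemma tendsto_shift: "y \<longlonglongrightarrow> x \<Longrightarrow> (\<lambda>k n. y k (n + j)) \<longlonglongrightarrow> (\<lambda>n. x (n + j :: int) :: real)"
  by (simp add: seq_tendsto_iff)

lemma Xbar_shift: "x \<in> Xbar \<Longrightarrow> (\<lambda>n. x (n + k)) \<in> Xbar"
  by (erule XbarE) (rule Xbar_limit[OF strict_in_Xbar[OF strict_shift] tendsto_shift])

lemma compact_Xbar: "compact Xbar"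
proof -
  have "compactin (product_topology (\<lambda>i::int. euclidean) UNIV) (PiE UNIV (\<lambda>_. {-1/2..1/2::real}))"
    unfolding compactin_PiE by simp
  then have c: "compact (PiE UNIV (\<lambda>_::int. {-1/2..1/2::real}))"
    by (simp add: euclidean_product_topology)
  have "Xbar \<subseteq> PiE UNIV (\<lambda>_::int. {-1/2..1/2::real})"
  proof
    fix x assume "x \<in> Xbar"
    then have "\<bar>x n\<bar> \<le> 1/2" for n using Xbar_orbit orbit_abs by blast
    then have "- (1/2) \<le> x n \<and> x n \<le> 1/2" for n by (metis abs_le_D1 abs_le_D2 minus_le_iff)
    then show "x \<in> PiE UNIV (\<lambda>_. {-1/2..1/2})" by (auto simp: PiE_UNIV_domain)
  qed
  moreover have "closed Xbar" by (simp add: Xbar_def)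
  ultimately show ?thesis using c compact_Int_closed by (metis Int_absorb1)
qed

text \<open>A return to the same state after a multiple of the rotation period forces the strict orbits
  nearby, which have the same codes, to return as well.\<close>

lemma periodic_of_return:
  assumes x: "x \<in> Xbar" and mn: "m < n" "2 * int h dvd n - m" and eq: "x n = x m" "x (n - 1) = x (m - 1)"
  shows "x (i + (n - m)) = x i"
proof -
  obtain y where y: "\<And>k. strict (y k)" "y \<longlonglongrightarrow> x" using XbarE[OF x] by blast
  have t: "(\<lambda>k. y k i) \<longlonglongrightarrow> x i" for i using y(2) by (simp add: seq_tendsto_iff)
  obtain q where q: "n - m = 2 * int h * q" using mn(2) by (auto simp: dvd_def)
  have exteq: "ext z n j = U (j - m + 1) * z n - U (j - m) * z (n - 1)" for z j
    using U_add_mult_2h[of "j - n + 1" q] U_add_mult_2h[of "j - n" q]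
    unfolding ext_def q[symmetric] by (simp add: algebra_simps)
  have "eventually (\<lambda>k. \<forall>l\<in>{m..n}. code (y k) l = code x l) sequentially"
    by (rule eventually_code_eq[OF strict_orbit[OF y(1)] y(2)])
  then have "eventually (\<lambda>k. y k (i + (n - m)) = y k i) sequentially"
  proof eventually_elim
    case (elim k)
    have e: "ext (y k) n j = ext (y k) m j" for j
    proof -
      have "ext (y k) n j - ext (y k) m j = ext x n j - ext x m j"
        by (rule ext_diff_eq) (use mn elim in auto)
      also have "\<dots> = 0" unfolding exteq eq by (simp add: ext_def)
      finally show ?thesis by simp
    qed
    have "ext (y k) n m = y k n" "ext (y k) n (m - 1) = y k (n - 1)"
      unfolding exteq by simp_all
    then have "y k n = y k m" "y k (n - 1) = y k (m - 1)" using e[of m] e[of "m - 1"] by simp_all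
    then show ?case by (rule strict_return[OF y(1)])
  qed
  moreover have "(\<lambda>k. y k (i + (n - m))) \<longlonglongrightarrow> x (i + (n - m))" by (rule t)
  ultimately have "(\<lambda>k. y k i) \<longlonglongrightarrow> x (i + (n - m))"
    by (rule Lim_transform_eventually[rotated])
  then show ?thesis using t LIMSEQ_unique by blast
qed

lemma periodic_of_return':
  assumes "x \<in> Xbar" "m < n" "2 * int h dvd n - m" "x n = x m" "x (n - 1) = x (m - 1)"
  shows "periodic x"
  using periodic_of_return[OF assms] assms(2) unfolding periodic_def by (intro exI[of _ "n - m"]) auto

lemma periodicE:
  assumes "periodic x"
  obtains p where "p > 0" "2 * int h dvd p" "\<And>n. x (n + p) = x n"
proof -
  obtain p where p: "p > 0" "\<And>n. x (n + p) = x n" using assms by (auto simp: periodic_def)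
  have "x (n + int (2 * h) * p) = x n" for n using p(2) by (rule periodic_mult)
  then show ?thesis using p(1) h_pos by (intro that[of "int (2 * h) * p"]) auto
qed

text \<open>Periodicity is open: over one period, taken as a multiple of 2h, the codes of
  \<open>x\<close> contribute nothing to \<open>ext\<close>. Nearby limits have the same codes on
  that stretch, so they return to their own state. This is why \<open>Ybar\<close> is
  closed.\<close>

lemma eventually_period_eq:
  assumes x: "\<And>n. x (n + p) = x n" "p > 0" "2 * int h dvd p"
    and y: "\<And>k. y k \<in> Xbar" "y \<longlonglongrightarrow> x"
  shows "eventually (\<lambda>k. \<forall>i. y k (i + p) = y k i) sequentially"
proof -
  obtain q where q: "p = 2 * int h * q" using x(3) by (auto simp: dvd_def)
  have exteq: "ext z p j = U (j + 1) * z p - U j * z (p - 1)" for z j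
    using U_add_mult_2h[of "j - p + 1" q] U_add_mult_2h[of "j - p" q]
    unfolding ext_def q[symmetric] by (simp add: algebra_simps)
  have "eventually (\<lambda>k. \<forall>l\<in>{0..p}. code (y k) l = code x l) sequentially"
    by (rule eventually_code_eq[OF Xbar_orbit[OF y(1)] y(2)])
  then show ?thesis
  proof eventually_elim
    case (elim k)
    have e: "ext (y k) p j = ext (y k) 0 j" for j
    proof -
      have "ext (y k) p j - ext (y k) 0 j = ext x p j - ext x 0 j"
        by (rule ext_diff_eq) (use x elim in auto)
      also have "\<dots> = 0" unfolding exteq using x(1)[of 0] x(1)[of "-1"] by (simp add: ext_def algebra_simps)
      finally show ?thesis by simp
    qed
    have "ext (y k) p 0 = y k p" "ext (y k) p (- 1) = y k (p - 1)" unfolding exteq by simp_all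
    then have "y k p = y k 0" "y k (p - 1) = y k (0 - 1)"
      using e[of 0] e[of "-1"] ext_pred[of "y k" 0] by simp_all
    then show ?case using periodic_of_return[OF y(1), of 0 p k] x by simp
  qed
qed

definition Ybar :: "(int \<Rightarrow> real) set" where "Ybar = {x \<in> Xbar. \<not> periodic x}"

lemma Ybar_limit:
  assumes "\<And>k. y k \<in> Ybar" "y \<longlonglongrightarrow> x"
  shows "x \<in> Ybar"
proof -
  have X: "\<And>k. y k \<in> Xbar" using assms by (simp add: Ybar_def)
  have "\<not> periodic x"
  proof
    assume "periodic x"
    then obtain p where p: "p > 0" "2 * int h dvd p" "\<And>n. x (n + p) = x n" using periodicE by blast
    have "eventually (\<lambda>k. \<forall>i. y k (i + p) = y k i) sequentially"
      by (rule eventually_period_eq[OF p(3,1,2) X assms(2)])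
    then obtain k where "\<forall>i. y k (i + p) = y k i" by (auto simp: eventually_sequentially)
    then have "periodic (y k)" using p(1) by (auto simp: periodic_def)
    then show False using assms(1) by (simp add: Ybar_def)
  qed
  then show ?thesis using Xbar_limit[OF X assms(2)] by (simp add: Ybar_def)
qed

lemma compact_Ybar: "compact Ybar"
proof -
  have "closed Ybar" using Ybar_limit by (auto simp: closed_sequential_limits)
  moreover have "Ybar \<subseteq> Xbar" by (auto simp: Ybar_def)
  ultimately show ?thesis using compact_Xbar compact_Int_closed by (metis Int_absorb1)
qed

lemma Ybar_shift: "x \<in> Ybar \<Longrightarrow> (\<lambda>n. x (n + k)) \<in> Ybar"
  by (simp add: Ybar_def Xbar_shift periodic_shift_iff)

subsection \<open>Concurrent boundary hits\<close>

text \<open>Three values of a homogeneous solution, at distances \<open>a\<close> and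
  \<open>b\<close>, satisfy a linear relation with coefficients \<open>U b\<close>,
  \<open>U a\<close> and \<open>U (a + b)\<close>. It is applied to the extrapolation from the
  middle hit, whose values at the outer hits differ from the actual boundary values by elements of
  Z[zeta]. After doubling it is the relation excluded by \<open>no_triple_relation\<close>.\<close>

lemma no_triple_hit:
  assumes x: "orbit x" and n: "n0 < n1" "n1 < n2" and hit: "\<bar>x n0\<bar> = 1/2" "\<bar>x n1\<bar> = 1/2" "\<bar>x n2\<bar> = 1/2"
  shows "int h dvd (n1 - n0) \<or> int h dvd (n2 - n1) \<or> int h dvd (n2 - n0)"
proof -
  define a b where "a = n1 - n0" and "b = n2 - n1"
  define c where "c = n1"
  have sumZ: "of_real (\<Sum>l<k. code x (m + int l) * U (f l)) \<in> ZP zeta" for k m f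
    unfolding of_real_sum
  proof (rule ZP_sum)
    fix l
    obtain j :: int where "code x (m + int l) = of_int j" using orbit_code[OF x] by (auto elim: Ints_cases)
    then show "complex_of_real (code x (m + int l) * U (f l)) \<in> ZP zeta"
      using U_in_ZP by (auto intro!: ZP_mult ZP_of_int)
  qed
  have "\<exists>A. of_real A \<in> ZP zeta \<and> ext x n1 n0 = x n0 + A"
    using ext_sum[of x n0 "nat (n1 - n0)" n0] n sumZ[where k = "nat (n1 - n0)" and m = n0 and f = "\<lambda>l. n0 - n0 - int l"]
    by auto
  then obtain A where A: "of_real A \<in> ZP zeta" "ext x n1 n0 = x n0 + A" by blast
  have "\<exists>B. of_real B \<in> ZP zeta \<and> ext x n2 n2 = ext x n1 n2 + B"
    using ext_sum[of x n1 "nat (n2 - n1)" n2] n sumZ[where k = "nat (n2 - n1)" and m = n1 and f = "\<lambda>l. n2 - n1 - int l"]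
    by auto
  then obtain B where B: "of_real B \<in> ZP zeta" "x n2 = ext x n1 n2 + B" by auto
  have hit_int: "\<exists>\<eta>::int. \<bar>\<eta>\<bar> = 1 \<and> 2 * x n = of_int \<eta>" if "\<bar>x n\<bar> = 1/2" for n
  proof (cases "x n \<ge> 0")
    case True then show ?thesis using that by (intro exI[of _ 1]) auto
  next
    case False then show ?thesis using that by (intro exI[of _ "-1"]) auto
  qed
  obtain \<eta>0 \<eta>1 \<eta>2 :: int where \<eta>: "\<bar>\<eta>0\<bar> = 1" "\<bar>\<eta>1\<bar> = 1" "\<bar>\<eta>2\<bar> = 1"
    "2 * x n0 = of_int \<eta>0" "2 * x n1 = of_int \<eta>1" "2 * x n2 = of_int \<eta>2"
    using hit_int hit by metis
  have "U b * ext x n1 n0 + U a * ext x n1 n2 = U (a + b) * x n1"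
  proof -
    have e: "ext x n1 i = U (i - n1 + 1) * x n1 - U (i - n1) * x (n1 - 1)" for i by (simp add: ext_def)
    define v where "v = (\<lambda>i. U b * U (i - a) + U a * U (i + b) - U (a + b) * U i)"
    have "v i = 0" for i
    proof (rule homogeneous_unique[of v "\<lambda>_. 0" 0 i])
      show "v (i + 1) = lam * v i - v (i - 1)" for i
      proof -
        have e: "i + 1 - a = i + 1 + (- a)" "U (i + 1) = U (i + 1 + 0)" "i - a = i + (- a)" "U i = U (i + 0)"
          "i - 1 - a = i - 1 + (- a)" "U (i - 1) = U (i - 1 + 0)" by auto
        show ?thesis unfolding v_def e homogeneous_U by algebra
      qed
      show "v 0 = 0" using U_minus[of a] by (simp add: v_def)
      show "v (0 + 1) = 0"
      proof -
        \<comment> \<open>The addition formula: i -> U (i + b) is a homogeneous solution, here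
          evaluated at \<open>a\<close> from its values at 0 and 1.\<close>
        have "U b * U (1 - a) + U a * U (1 + b) = U (a + b)"
          using homogeneous_via_U[of "\<lambda>i. U (i + b)" a 0] homogeneous_U[of _ b] U_minus[of "a - 1"]
          by (simp add: algebra_simps)
        then show ?thesis by (simp add: v_def)
      qed
    qed auto
    from this[of 0] this[of 1]
    have v0: "U b * U (- a) + U a * U b = 0" and v1: "U b * U (1 - a) + U a * U (1 + b) = U (a + b)"
      by (simp_all add: v_def)
    have e0: "ext x n1 n0 = U (1 - a) * x n1 - U (- a) * x (n1 - 1)"
      and e2: "ext x n1 n2 = U (1 + b) * x n1 - U b * x (n1 - 1)"
      unfolding e by (simp_all add: a_def b_def algebra_simps)
    have "U b * ext x n1 n0 + U a * ext x n1 n2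
        = (U b * U (1 - a) + U a * U (1 + b)) * x n1 - (U b * U (- a) + U a * U b) * x (n1 - 1)"
      unfolding e0 e2 by (simp add: algebra_simps)
    then show ?thesis unfolding v0 v1 by simp
  qed
  moreover have "ext x n1 n0 = of_int \<eta>0 / 2 + A" "ext x n1 n2 = of_int \<eta>2 / 2 - B" "x n1 = of_int \<eta>1 / 2"
    using A B \<eta> by auto
  ultimately have "U b * (of_int \<eta>0 / 2 + A) + U a * (of_int \<eta>2 / 2 - B) = U (a + b) * (of_int \<eta>1 / 2)"
    by (simp only:)
  then have "U b * (of_int \<eta>0 + 2 * A) + U a * (of_int \<eta>2 + 2 * (- B)) = U (a + b) * of_int \<eta>1"
    by (simp add: field_simps)
  then have "int h dvd a \<or> int h dvd b \<or> int h dvd (a + b)"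
    using no_triple_relation[of A "- B" \<eta>0 \<eta>1 \<eta>2 b a] A B \<eta> by (simp add: ZP_minus)
  then show ?thesis by (simp add: a_def b_def)
qed

end

section \<open>Minimal sets\<close>

text \<open>Zorn's lemma produces maximal elements and is therefore applied to the complements of
  the closed invariant sets. The recurrence clause is minimality tested on the closure of a tail of
  the orbit.\<close>

lemma ex_minimal_invariant_set:
  fixes K :: "'a::metric_space set"
  assumes K: "compact K" "K \<noteq> {}" and t: "continuous_on UNIV t" "t ` K \<subseteq> K"
  shows "\<exists>M\<subseteq>K. compact M \<and> M \<noteq> {} \<and> t ` M = M \<and>
    (\<forall>x\<in>M. \<forall>U. open U \<longrightarrow> U \<inter> M \<noteq> {} \<longrightarrow> (\<forall>N. \<exists>k\<ge>N. (t ^^ k) x \<in> U))"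
proof -
  define inv where "inv F \<longleftrightarrow> closed F \<and> F \<noteq> {} \<and> F \<subseteq> K \<and> t ` F \<subseteq> F" for F
  define \<A> where "\<A> = uminus ` {F. inv F}"
  have "\<exists>M\<in>\<A>. \<forall>X\<in>\<A>. M \<subseteq> X \<longrightarrow> X = M"
  proof (rule subset_Zorn_nonempty)
    have "inv K" using K t by (auto simp: inv_def compact_imp_closed)
    then show "\<A> \<noteq> {}" by (auto simp: \<A>_def)
  next
    fix \<C> assume ne: "\<C> \<noteq> {}" and ch: "subset.chain \<A> \<C>"
    define \<D> where "\<D> = uminus ` \<C>"
    have inv: "inv D" if D: "D \<in> \<D>" for D
    proof -
      obtain C where C: "C \<in> \<C>" "D = - C" using D unfolding \<D>_def by blast
      then have "C \<in> \<A>" using ch by (auto simp: subset.chain_def)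
      then show ?thesis using C by (auto simp: \<A>_def)
    qed
    have chD: "D \<subseteq> D' \<or> D' \<subseteq> D" if D: "D \<in> \<D>" "D' \<in> \<D>" for D D'
    proof -
      obtain C C' where "C \<in> \<C>" "D = - C" "C' \<in> \<C>" "D' = - C'" using D unfolding \<D>_def by blast
      moreover then have "C \<subseteq> C' \<or> C' \<subseteq> C" using ch by (auto simp: subset.chain_def)
      ultimately show ?thesis by blast
    qed
    have fin: "\<Inter>F' \<in> \<D>" if "finite F'" "F' \<noteq> {}" "F' \<subseteq> \<D>" for F'
      using that
    proof (induction F' rule: finite_ne_induct)
      case (insert D F')
      then have "D \<in> \<D>" "\<Inter>F' \<in> \<D>" by auto
      then have "D \<inter> \<Inter>F' = D \<or> D \<inter> \<Inter>F' = \<Inter>F'" using chD by blast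
      then show ?case using \<open>D \<in> \<D>\<close> \<open>\<Inter>F' \<in> \<D>\<close> by auto
    qed auto
    have "K \<inter> \<Inter>\<D> \<noteq> {}"
    proof (rule compact_imp_fip[OF K(1)])
      show "closed T" if "T \<in> \<D>" for T using inv[OF that] by (simp add: inv_def)
      show "K \<inter> \<Inter>F' \<noteq> {}" if F': "finite F'" "F' \<subseteq> \<D>" for F'
      proof (cases "F' = {}")
        case True
        then show ?thesis using K(2) by simp
      next
        case False
        have "inv (\<Inter>F')" by (rule inv[OF fin[OF F'(1) False F'(2)]])
        then show ?thesis unfolding inv_def by (metis inf.absorb_iff2)
      qed
    qed
    moreover obtain D where D: "D \<in> \<D>" using ne by (auto simp: \<D>_def)
    moreover have "\<Inter>\<D> \<subseteq> K" using D inv[OF D] by (auto simp: inv_def)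
    moreover have "closed (\<Inter>\<D>)" using inv by (auto simp: inv_def)
    moreover have "t ` \<Inter>\<D> \<subseteq> \<Inter>\<D>"
    proof
      fix y assume "y \<in> t ` \<Inter>\<D>"
      then obtain z where z: "y = t z" "\<And>D. D \<in> \<D> \<Longrightarrow> z \<in> D" by auto
      show "y \<in> \<Inter>\<D>"
      proof
        fix D assume "D \<in> \<D>"
        then show "y \<in> D" using inv[of D] z by (auto simp: inv_def)
      qed
    qed
    ultimately have "inv (\<Inter>\<D>)" by (auto simp: inv_def)
    moreover have "\<Union>\<C> = - \<Inter>\<D>" by (auto simp: \<D>_def)
    ultimately show "\<Union>\<C> \<in> \<A>" by (auto simp: \<A>_def)
  qed
  then obtain M where M: "inv M" and minM: "\<And>F. inv F \<Longrightarrow> F \<subseteq> M \<Longrightarrow> F = M"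
    unfolding \<A>_def by (metis (no_types, lifting) Compl_subset_Compl_iff double_complement imageE imageI mem_Collect_eq)
  have cM: "compact M" using M K(1) unfolding inv_def by (metis compact_Int_closed inf.absorb2 inf_commute)
  have tM: "t ` M = M"
  proof (rule minM)
    have "compact (t ` M)" using cM t(1) by (metis compact_continuous_image continuous_on_subset subset_UNIV)
    then show "inv (t ` M)" using M by (auto simp: inv_def compact_imp_closed)
    show "t ` M \<subseteq> M" using M by (simp add: inv_def)
  qed
  have "\<exists>k\<ge>N. (t ^^ k) x \<in> U" if x: "x \<in> M" and U: "open U" "U \<inter> M \<noteq> {}" for x U N
  proof (rule ccontr)
    assume neg: "\<not> (\<exists>k\<ge>N. (t ^^ k) x \<in> U)"
    define A where "A = {(t ^^ k) x |k. k \<ge> N}"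
    have tk: "(t ^^ k) x \<in> M" for k by (induction k) (use x tM in auto)
    have "inv (closure A)"
      unfolding inv_def
    proof (intro conjI)
      show "closure A \<noteq> {}" by (auto simp: A_def)
      have "closure A \<subseteq> M" using tk M by (intro closure_minimal) (auto simp: A_def inv_def)
      then show "closure A \<subseteq> K" using M by (auto simp: inv_def)
      have "t ` A \<subseteq> closure A"
      proof
        fix y assume "y \<in> t ` A"
        then obtain k where "k \<ge> N" "y = (t ^^ Suc k) x" by (auto simp: A_def)
        then have "y \<in> A" unfolding A_def by (intro CollectI exI[of _ "Suc k"]) auto
        then show "y \<in> closure A" using closure_subset by blast
      qed
      then show "t ` closure A \<subseteq> closure A"
        using t(1) by (intro image_closure_subset) (auto intro: continuous_on_subset)
    qed simp
    moreover have "closure A \<subseteq> M" using tk M by (intro closure_minimal) (auto simp: A_def inv_def)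
    ultimately have "closure A = M" by (rule minM)
    moreover have "A \<inter> U = {}" using neg by (auto simp: A_def)
    ultimately show False using U open_Int_closure_eq_empty[of U A] by blast
  qed
  then show ?thesis using M cM tM by (intro exI[of _ M]) (auto simp: inv_def)
qed

text \<open>The minimal set is sought inside the omega-limit set \<open>L\<close> of
  \<open>x\<close>, so that the orbit of \<open>x\<close> itself accumulates at every point of it.
  This link later carries information about the minimal set over to \<open>x\<close>.\<close>

lemma ex_minimal_set_in_omega_limit:
  fixes K :: "'a::metric_space set"
  assumes K: "compact K" "x \<in> K" and t: "continuous_on UNIV t" "t ` K \<subseteq> K"
  shows "\<exists>M\<subseteq>K. compact M \<and> M \<noteq> {} \<and> t ` M = M \<and>
    (\<forall>x\<in>M. \<forall>U. open U \<longrightarrow> U \<inter> M \<noteq> {} \<longrightarrow> (\<forall>N. \<exists>k\<ge>N. (t ^^ k) x \<in> U)) \<and>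
    (\<forall>z\<in>M. \<forall>U. open U \<longrightarrow> z \<in> U \<longrightarrow> (\<forall>N. \<exists>k\<ge>N. (t ^^ k) x \<in> U))"
proof -
  define A where "A N = {(t ^^ k) x |k. k \<ge> N}" for N
  define L where "L = (\<Inter>N. closure (A N))"
  have tk: "(t ^^ k) x \<in> K" for k by (induction k) (use K t in auto)
  have AK: "closure (A N) \<subseteq> K" for N
    using tk K by (intro closure_minimal) (auto simp: A_def compact_imp_closed)
  have anti: "A N \<subseteq> A N'" if "N' \<le> N" for N N' using that by (auto simp: A_def)
  have cL: "compact L"
  proof -
    have "closed L" by (auto simp: L_def)
    moreover have "L \<subseteq> K" using AK by (auto simp: L_def)
    ultimately show ?thesis using K(1) by (metis compact_Int_closed inf.absorb2 inf_commute)
  qed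
  have "K \<inter> (\<Inter>N\<in>UNIV. closure (A N)) \<noteq> {}"
  proof (rule compact_imp_fip_image[OF K(1)])
    fix I' :: "nat set" assume "finite I'"
    then obtain N where N: "\<And>i. i \<in> I' \<Longrightarrow> i \<le> N" by (meson finite_nat_set_iff_bounded_le)
    have "(t ^^ N) x \<in> A i" if "i \<in> I'" for i using N[OF that] by (auto simp: A_def)
    then have "(t ^^ N) x \<in> K \<inter> (\<Inter>i\<in>I'. closure (A i))" using tk closure_subset by blast
    then show "K \<inter> (\<Inter>i\<in>I'. closure (A i)) \<noteq> {}" by blast
  qed auto
  then have "L \<noteq> {}" by (auto simp: L_def)
  moreover have "t ` L \<subseteq> L"
  proof -
    have "t ` closure (A N) \<subseteq> closure (A N)" for N
    proof (rule image_closure_subset)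
      show "continuous_on (closure (A N)) t" using t(1) continuous_on_subset by blast
      show "t ` A N \<subseteq> closure (A N)"
      proof
        fix y assume "y \<in> t ` A N"
        then obtain k where "k \<ge> N" "y = (t ^^ Suc k) x" by (auto simp: A_def)
        then have "y \<in> A N" unfolding A_def by (intro CollectI exI[of _ "Suc k"]) auto
        then show "y \<in> closure (A N)" using closure_subset by blast
      qed
    qed simp
    then show ?thesis by (fastforce simp: L_def)
  qed
  ultimately obtain M where M: "M \<subseteq> L" "compact M" "M \<noteq> {}" "t ` M = M"
    "\<forall>x\<in>M. \<forall>U. open U \<longrightarrow> U \<inter> M \<noteq> {} \<longrightarrow> (\<forall>N. \<exists>k\<ge>N. (t ^^ k) x \<in> U)"
    using ex_minimal_invariant_set[OF cL _ t(1)] by blast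
  have "\<exists>k\<ge>N. (t ^^ k) x \<in> U" if "z \<in> M" "open U" "z \<in> U" for z U N
  proof -
    have "z \<in> closure (A N)" using that M(1) by (auto simp: L_def)
    then have "U \<inter> A N \<noteq> {}" using that open_Int_closure_eq_empty[of U "A N"] by blast
    then show ?thesis by (auto simp: A_def)
  qed
  moreover have "M \<subseteq> K" using M(1) AK by (auto simp: L_def)
  ultimately show ?thesis using M by blast
qed

lemma ex_open_subset_of_countable_cover:
  fixes M :: "'a::complete_space set"
  assumes M: "compact M" "M \<noteq> {}" and C: "M \<subseteq> (\<Union>n::'i::countable. C n)" "\<And>n. closed (C n)"
  shows "\<exists>n U. open U \<and> U \<inter> M \<noteq> {} \<and> U \<inter> M \<subseteq> C n"
proof (rule ccontr)
  assume neg: "\<not> ?thesis"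
  let ?X = "top_of_set M"
  have "?X interior_of \<Union>(range (\<lambda>n. C n \<inter> M)) = {}"
  proof (rule Baire_category_alt)
    have "completely_metrizable_space ?X"
      using completely_metrizable_space_closedin[OF completely_metrizable_space_euclidean, of M]
        compact_imp_closed[OF M(1)] by simp
    then show "completely_metrizable_space ?X \<or> locally_compact_space ?X \<and> regular_space ?X" ..
    show "countable (range (\<lambda>n. C n \<inter> M))" by simp
    fix T assume "T \<in> range (\<lambda>n. C n \<inter> M)"
    then obtain n where n: "T = C n \<inter> M" by blast
    show "closedin ?X T \<and> ?X interior_of T = {}"
    proof
      show "closedin ?X T" unfolding n using C(2) by (metis closedin_closed_Int inf_commute)
      show "?X interior_of T = {}"
      proof (rule ccontr)
        assume "?X interior_of T \<noteq> {}"
        moreover have "openin ?X (?X interior_of T)" by simp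
        then obtain U where "open U" "?X interior_of T = M \<inter> U" unfolding openin_open by blast
        moreover have "?X interior_of T \<subseteq> T" by (rule interior_of_subset)
        ultimately show False using neg n by blast
      qed
    qed
  qed
  moreover have "\<Union>(range (\<lambda>n. C n \<inter> M)) = topspace ?X" using C(1) by auto
  ultimately show False using M(2) by (metis interior_of_topspace topspace_euclidean_subtopology)
qed

section \<open>Minimal sets of nonperiodic limits, assuming all strict orbits periodic\<close>

locale all_periodic = rotation +
  assumes strict_periodic: "strict x \<Longrightarrow> periodic x"
begin

text \<open>Time is shifted by multiples of 2h only. This is the period of the homogeneous
  solutions, so \<open>sh\<close> acts on \<open>ext\<close> by a mere change of the reference
  time.\<close>

definition sh :: "int \<Rightarrow> (int \<Rightarrow> real) \<Rightarrow> int \<Rightarrow> real" where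
  "sh k x = (\<lambda>n. x (n + 2 * int h * k))"

lemma sh_apply: "sh k x n = x (n + 2 * int h * k)" by (simp add: sh_def)

lemma sh_sh: "sh k (sh l x) = sh (k + l) x" by (simp add: sh_def algebra_simps)

lemma sh_0 [simp]: "sh 0 x = x" by (simp add: sh_def)

lemma sh_funpow: "(sh 1 ^^ k) x = sh (int k) x"
  by (induction k) (simp_all add: sh_sh)

lemma continuous_sh: "continuous_on UNIV (sh k)"
  unfolding sh_def by (intro continuous_on_coordinatewise_then_product continuous_on_product_coordinates)

lemma Ybar_sh: "x \<in> Ybar \<Longrightarrow> sh k x \<in> Ybar"
  unfolding sh_def by (rule Ybar_shift)

lemma Ybar_hit: "x \<in> Ybar \<Longrightarrow> \<exists>n. \<bar>x n\<bar> = 1/2"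
proof -
  assume x: "x \<in> Ybar"
  then have o: "orbit x" and np: "\<not> periodic x" by (auto simp: Ybar_def Xbar_orbit)
  then have "\<not> strict x" using strict_periodic by blast
  then obtain n where "\<not> \<bar>x n\<bar> < 1/2" using o by (auto simp: strict_def)
  then show ?thesis using orbit_abs[OF o, of n] by (intro exI[of _ n]) simp
qed

text \<open>The recurrence clause is minimality under \<open>sh 1\<close>. The last clause
  normalises the phase: every orbit hits the boundary at multiples of 2h with bounded gaps, whatever
  other hits it may have.\<close>

definition hit_set :: "(int \<Rightarrow> real) set \<Rightarrow> bool" where
  "hit_set M \<longleftrightarrow> M \<noteq> {} \<and> compact M \<and> M \<subseteq> Ybar \<and> (\<forall>x\<in>M. \<forall>k. sh k x \<in> M) \<and>
     (\<forall>x\<in>M. \<forall>U. open U \<longrightarrow> U \<inter> M \<noteq> {} \<longrightarrow> (\<forall>N. \<exists>k\<ge>N. sh (int k) x \<in> U)) \<and>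
     (\<exists>J\<ge>0. \<forall>x\<in>M. \<forall>j. \<exists>k\<in>{j..j + J}. \<bar>x (2 * int h * k)\<bar> = 1/2)"

text \<open>Baire's theorem provides a fixed time at which all points of a relatively open set hit the boundary.\<close>

lemma ex_hit_set:
  assumes \<omega>: "\<omega> \<in> Ybar"
  shows "\<exists>a M. hit_set M \<and>
    (\<forall>z\<in>M. \<forall>U. open U \<longrightarrow> z \<in> U \<longrightarrow> (\<forall>N. \<exists>k\<ge>N. sh (int k) (\<lambda>n. \<omega> (n + a)) \<in> U))"
proof -
  have "sh 1 ` Ybar \<subseteq> Ybar" using Ybar_sh by blast
  from ex_minimal_set_in_omega_limit[OF compact_Ybar \<omega> continuous_sh this]
  obtain M where MM: "M \<subseteq> Ybar \<and> compact M \<and> M \<noteq> {} \<and> sh 1 ` M = M \<and>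
    (\<forall>x\<in>M. \<forall>U. open U \<longrightarrow> U \<inter> M \<noteq> {} \<longrightarrow> (\<forall>N. \<exists>k\<ge>N. (sh 1 ^^ k) x \<in> U)) \<and>
    (\<forall>z\<in>M. \<forall>U. open U \<longrightarrow> z \<in> U \<longrightarrow> (\<forall>N. \<exists>k\<ge>N. (sh 1 ^^ k) \<omega> \<in> U))"
    by (rule exE)
  then have M: "M \<subseteq> Ybar" "compact M" "M \<noteq> {}" "sh 1 ` M = M" by simp_all
  from MM have minM: "\<exists>k\<ge>N. sh (int k) x \<in> U" if "x \<in> M" "open U" "U \<inter> M \<noteq> {}" for x U N
    using that by (simp add: sh_funpow)
  from MM have lim: "\<exists>k\<ge>N. sh (int k) \<omega> \<in> U" if "z \<in> M" "open U" "z \<in> U" for z U N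
    using that by (simp add: sh_funpow)
  have up: "sh (int k) x \<in> M" if "x \<in> M" for k x
    using that
  proof (induction k)
    case (Suc k)
    have "sh (int (Suc k)) x = sh 1 (sh (int k) x)" by (simp add: sh_sh)
    then show ?case using Suc M(4) by blast
  qed simp
  have down: "sh (- int k) x \<in> M" if "x \<in> M" for k x
    using that
  proof (induction k)
    case (Suc k)
    then obtain z where z: "z \<in> M" "sh (- int k) x = sh 1 z" using M(4) by blast
    have "sh (- int (Suc k)) x = sh (-1) (sh (- int k) x)" by (simp add: sh_sh)
    also have "\<dots> = z" unfolding z(2) by (simp add: sh_sh)
    finally show ?case using z by simp
  qed simp
  have Msh: "sh k x \<in> M" if "x \<in> M" for k x
    using up[OF that, of "nat k"] down[OF that, of "nat (- k)"] by (cases "k \<ge> 0") auto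
  have cl: "closed {x. \<bar>x n\<bar> = (1/2::real)}" for n :: int
  proof -
    have "continuous_on UNIV (\<lambda>x::int \<Rightarrow> real. \<bar>x n\<bar>)"
      by (intro continuous_intros continuous_on_product_coordinates)
    then have "closed ((\<lambda>x::int \<Rightarrow> real. \<bar>x n\<bar>) -` {1/2})" by (intro closed_vimage) auto
    then show ?thesis by (simp add: vimage_def)
  qed
  have "M \<subseteq> (\<Union>n. {x. \<bar>x n\<bar> = 1/2})" using Ybar_hit M(1) by auto
  from ex_open_subset_of_countable_cover[OF M(2,3) this cl]
  obtain a U where U: "open U" "U \<inter> M \<noteq> {}" "U \<inter> M \<subseteq> {x. \<bar>x a\<bar> = 1/2}" by blast
  \<comment> \<open>Finitely many preimages of \<open>U\<close> cover the compact set
    \<open>M\<close>, so every orbit visits \<open>U\<close>, and thus hits the boundary at phase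
    \<open>a\<close>, with bounded gaps.\<close>
  have "\<exists>J. \<forall>x\<in>M. \<exists>k\<le>J. sh (int k) x \<in> U"
  proof -
    have "open (sh (int k) -` U)" for k :: nat
      using U(1) continuous_sh open_vimage by blast
    moreover have "M \<subseteq> (\<Union>k\<in>UNIV. sh (int k) -` U)" using minM[OF _ U(1,2), of _ 0] by auto
    ultimately obtain F where F: "finite F" "M \<subseteq> (\<Union>k\<in>F. sh (int k) -` U)"
      using compactE_image[OF M(2), of UNIV "\<lambda>k. sh (int k) -` U"] by metis
    then obtain J where J: "\<And>k. k \<in> F \<Longrightarrow> k \<le> J" by (meson finite_nat_set_iff_bounded_le)
    show ?thesis
    proof (rule exI[of _ J], rule ballI)
      fix x assume "x \<in> M"
      then obtain k where "k \<in> F" "sh (int k) x \<in> U" using F(2) by auto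
      then show "\<exists>k\<le>J. sh (int k) x \<in> U" using J by blast
    qed
  qed
  then obtain J where J: "\<And>x. x \<in> M \<Longrightarrow> \<exists>k\<le>J. sh (int k) x \<in> U" by blast
  have hit: "\<exists>k\<in>{j..j + int J}. \<bar>x (a + 2 * int h * k)\<bar> = 1/2" if x: "x \<in> M" for x j
  proof -
    obtain k where k: "k \<le> J" "sh (int k) (sh j x) \<in> U" using J[OF Msh[OF x]] by blast
    then have "sh (int k + j) x \<in> U \<inter> M" using Msh[OF x] by (simp add: sh_sh)
    then have "\<bar>sh (int k + j) x a\<bar> = 1/2" using U(3) by blast
    then show ?thesis using k by (intro bexI[of _ "int k + j"]) (auto simp: sh_apply)
  qed
  \<comment> \<open>A shift of time by \<open>a\<close>, which commutes with \<open>sh\<close>,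
    moves this hit to phase 0.\<close>
  define s where "s = (\<lambda>(x::int \<Rightarrow> real) n. x (n + a))"
  have sc: "continuous_on UNIV s"
    unfolding s_def by (intro continuous_on_coordinatewise_then_product continuous_on_product_coordinates)
  have ssh: "s (sh k x) = sh k (s x)" for k x by (simp add: s_def sh_def algebra_simps)
  have "hit_set (s ` M)"
    unfolding hit_set_def
  proof (intro conjI ballI allI impI)
    show "compact (s ` M)" using M(2) sc by (metis compact_continuous_image continuous_on_subset subset_UNIV)
    show "s ` M \<subseteq> Ybar" using M(1) Ybar_shift unfolding s_def by blast
    show "sh k x \<in> s ` M" if "x \<in> s ` M" for x k using that Msh by (auto simp: ssh[symmetric])
    show "\<exists>k\<ge>N. sh (int k) x \<in> V" if x: "x \<in> s ` M" and V: "open V" "V \<inter> s ` M \<noteq> {}" for x V N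
    proof -
      have "open (s -` V)" using V(1) sc open_vimage by blast
      moreover have "s -` V \<inter> M \<noteq> {}" using V(2) by blast
      moreover obtain z where "z \<in> M" "x = s z" using x by blast
      ultimately show ?thesis using minM[of z "s -` V" N] by (auto simp: ssh)
    qed
    show "\<exists>J\<ge>0. \<forall>x\<in>s ` M. \<forall>j. \<exists>k\<in>{j..j + J}. \<bar>x (2 * int h * k)\<bar> = 1/2"
    proof (intro exI[of _ "int J"] conjI ballI allI)
      fix x j assume "x \<in> s ` M"
      then obtain z where z: "z \<in> M" "x = s z" by blast
      show "\<exists>k\<in>{j..j + int J}. \<bar>x (2 * int h * k)\<bar> = 1/2"
        using hit[OF z(1), of j] by (simp add: z(2) s_def add.commute)
    qed simp
  qed (use M(3) in auto)
  moreover have "\<exists>k\<ge>N. sh (int k) (\<lambda>n. \<omega> (n + a)) \<in> V" if z: "z \<in> s ` M" and V: "open V" "z \<in> V" for z V N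
  proof -
    have "open (s -` V)" using V(1) sc open_vimage by blast
    moreover obtain w where "w \<in> M" "z = s w" using z by blast
    ultimately obtain k where "k \<ge> N" "sh (int k) \<omega> \<in> s -` V" using lim[of w "s -` V" N] V(2) by auto
    moreover have "s (sh (int k) \<omega>) = sh (int k) (\<lambda>n. \<omega> (n + a))"
      unfolding ssh by (simp add: s_def)
    ultimately show ?thesis by auto
  qed
  ultimately show ?thesis by blast
qed

end

subsection \<open>Finiteness of the levels\<close>

lemma finite_sums_lessThan:
  fixes V :: "real set"
  assumes "finite V"
  shows "finite {(\<Sum>l<k::nat. f l) |f. \<forall>l<k. f l \<in> V}"
proof (induction k)
  case (Suc k)
  have "{(\<Sum>l<Suc k. f l) |f. \<forall>l<Suc k. f l \<in> V}
      \<subseteq> (\<lambda>(a, b). a + b) ` ({(\<Sum>l<k. f l) |f. \<forall>l<k. f l \<in> V} \<times> V)"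
  proof
    fix x assume "x \<in> {(\<Sum>l<Suc k. f l) |f. \<forall>l<Suc k. f l \<in> V}"
    then obtain f where f: "x = (\<Sum>l<k. f l) + f k" "\<forall>l<Suc k. f l \<in> V" by auto
    then have "((\<Sum>l<k. f l), f k) \<in> {(\<Sum>l<k. f l) |f. \<forall>l<k. f l \<in> V} \<times> V" by auto
    then show "x \<in> (\<lambda>(a, b). a + b) ` ({(\<Sum>l<k. f l) |f. \<forall>l<k. f l \<in> V} \<times> V)" using f(1) by force
  qed
  then show ?case using Suc assms finite_subset by blast
qed simp

context rotation begin

lemma code_abs: "orbit x \<Longrightarrow> \<bar>code x n\<bar> < 2"
proof -
  assume x: "orbit x"
  have "\<bar>lam * x n\<bar> \<le> lam * (1/2)"
    using orbit_abs[OF x, of n] lam_bounds by (simp add: abs_mult)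
  then show ?thesis
    using orbit_abs[OF x, of "n + 1"] orbit_abs[OF x, of "n - 1"] lam_bounds unfolding code_def by linarith
qed

lemma code_cases: "orbit x \<Longrightarrow> code x n \<in> {-1, 0, 1}"
proof -
  assume x: "orbit x"
  obtain c :: int where c: "code x n = of_int c" using orbit_code[OF x] by (auto elim: Ints_cases)
  have "\<bar>c\<bar> < 2" using code_abs[OF x, of n] unfolding c by linarith
  then have "c = -1 \<or> c = 0 \<or> c = 1" by auto
  then show ?thesis using c by auto
qed

lemma U_mod: "U (i mod (2 * int h)) = U i"
  using U_add_mult_2h[of "i mod (2 * int h)" "i div (2 * int h)"] by simp

lemma finite_range_U: "finite (range U)"
proof -
  have "range U \<subseteq> U ` {0..<2 * int h}"
  proof
    fix x assume "x \<in> range U"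
    then obtain i where "x = U i" by blast
    then have "x = U (i mod (2 * int h))" by (simp add: U_mod)
    then show "x \<in> U ` {0..<2 * int h}" using h_pos by (intro image_eqI) auto
  qed
  then show ?thesis using finite_subset by blast
qed

text \<open>The change is a sum of at most \<open>L\<close> terms, each a code in {-1, 0, 1} times a
  value of the periodic function \<open>U\<close>.\<close>

lemma finite_ext_diff: "finite {ext x (m + int k) i - ext x m i |x m k. orbit x \<and> k \<le> L}"
proof -
  define V where "V = (\<lambda>(a, b). a * b) ` ({-1, 0, 1::real} \<times> range U)"
  have "finite V" using finite_range_U by (simp add: V_def)
  have "{ext x (m + int k) i - ext x m i |x m k. orbit x \<and> k \<le> L}
      \<subseteq> (\<Union>k\<le>L. {(\<Sum>l<k. f l) |f. \<forall>l<k. f l \<in> V})"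
  proof
    fix d assume "d \<in> {ext x (m + int k) i - ext x m i |x m k. orbit x \<and> k \<le> L}"
    then obtain x m k where d: "d = ext x (m + int k) i - ext x m i" "orbit x" "k \<le> L" by blast
    have "d = (\<Sum>l<k. code x (m + int l) * U (i - m - int l))" unfolding d ext_sum by simp
    moreover have "code x (m + int l) * U (i - m - int l) \<in> V" for l
    proof -
      have "(code x (m + int l), U (i - m - int l)) \<in> {-1, 0, 1} \<times> range U"
        using code_cases[OF d(2)] by blast
      then show ?thesis unfolding V_def by force
    qed
    ultimately show "d \<in> (\<Union>k\<le>L. {(\<Sum>l<k. f l) |f. \<forall>l<k. f l \<in> V})" using d(3) by blast
  qed
  then show ?thesis by (rule finite_subset) (simp add: finite_sums_lessThan[OF \<open>finite V\<close>])
qed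

lemma ext_abs_0: "int h dvd m \<Longrightarrow> \<bar>ext x m 0\<bar> = \<bar>x m\<bar>"
  using ext_abs_mult_h[of x m 0 "m div int h"] by simp

lemma continuous_ext: "continuous_on UNIV (\<lambda>x. ext x m i)"
  unfolding ext_def by (intro continuous_intros continuous_on_product_coordinates)

lemma tendsto_ext: "f \<longlonglongrightarrow> x \<Longrightarrow> (\<lambda>k. ext (f k) m i) \<longlonglongrightarrow> ext x m i"
  unfolding ext_def seq_tendsto_iff by (intro tendsto_intros) auto

text \<open>The coordinates used from here on: at time \<open>m\<close> an orbit has the level
  \<open>c = ext x m 0\<close> and the position \<open>p = ext x m 1\<close> along that level.
  \<open>phi\<close> is the homogeneous solution with these values at times 0 and 1.\<close>

definition phi :: "int \<Rightarrow> real \<Rightarrow> real \<Rightarrow> real" where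
  "phi i c p = U i * p - U (i - 1) * c"

lemma ext_phi: "ext x m i = phi i (ext x m 0) (ext x m 1)"
  using ext_via_U[of x m i 0] by (simp add: phi_def)

lemma ext_eqI: "ext x m 0 = ext y m 0 \<Longrightarrow> ext x m 1 = ext y m 1 \<Longrightarrow> x m = y m \<and> x (m - 1) = y (m - 1)"
  using ext_phi[of x m m] ext_phi[of y m m] ext_phi[of x m "m - 1"] ext_phi[of y m "m - 1"] by simp

lemma ext_bound: "\<exists>B>0. \<forall>x m i. orbit x \<longrightarrow> \<bar>ext x m i\<bar> \<le> B"
proof -
  obtain A where A: "\<And>i. \<bar>U i\<bar> \<le> A"
    using finite_imp_bounded[OF finite_range_U] by (auto simp: bounded_iff)
  have "\<bar>ext x m i\<bar> \<le> A" if "orbit x" for x m i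
  proof -
    have "\<bar>U (i - m + 1) * x m\<bar> \<le> A * (1/2)" "\<bar>U (i - m) * x (m - 1)\<bar> \<le> A * (1/2)"
      unfolding abs_mult using A[of "i - m + 1"] A[of "i - m"] orbit_abs[OF that] A[of 0] by (intro mult_mono; simp)+
    then show ?thesis unfolding ext_def by linarith
  qed
  moreover have "A \<ge> 1" using A[of 1] by simp
  ultimately show ?thesis by (intro exI[of _ A]) auto
qed

end

context all_periodic begin

lemma ext_sh: "ext (sh k x) m i = ext x (m + 2 * int h * k) i"
proof -
  have "ext (sh k x) m i = ext x (m + 2 * int h * k) (i + 2 * int h * k)"
    by (simp add: ext_def sh_def algebra_simps)
  then show ?thesis by (simp add: ext_add_mult_2h)
qed

end

section \<open>The levels of a minimal set and the side on which it touches the boundary\<close>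

locale hitting = all_periodic +
  fixes M :: "(int \<Rightarrow> real) set"
  assumes hit_set: "hit_set M"
begin

lemma M_ne: "M \<noteq> {}" and M_compact: "compact M" and M_Ybar: "x \<in> M \<Longrightarrow> x \<in> Ybar"
  and M_sh: "x \<in> M \<Longrightarrow> sh k x \<in> M"
  and M_dense: "x \<in> M \<Longrightarrow> open V \<Longrightarrow> V \<inter> M \<noteq> {} \<Longrightarrow> \<exists>k\<ge>N. sh (int k) x \<in> V"
  using hit_set unfolding hit_set_def by auto

lemma M_Xbar: "x \<in> M \<Longrightarrow> x \<in> Xbar" and M_not_periodic: "x \<in> M \<Longrightarrow> \<not> periodic x"
  using M_Ybar by (auto simp: Ybar_def)

lemma M_orbit: "x \<in> M \<Longrightarrow> orbit x"
  using M_Xbar Xbar_orbit by blast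

lemma M_hit: "\<exists>J\<ge>0. \<forall>x\<in>M. \<forall>j. \<exists>k\<in>{j..j + J}. \<bar>x (2 * int h * k)\<bar> = 1/2"
  using hit_set unfolding hit_set_def by blast

lemma M_return_distinct:
  assumes x: "x \<in> M" and mn: "m < n" "2 * int h dvd n - m"
  shows "ext x m 0 \<noteq> ext x n 0 \<or> ext x m 1 \<noteq> ext x n 1"
proof (rule ccontr)
  assume "\<not> ?thesis"
  then have e: "ext x n i = ext x m i" for i using ext_phi[of x n i] ext_phi[of x m i] by simp
  obtain q where q: "n - m = 2 * int h * q" using mn by (auto simp: dvd_def)
  have "x n = ext x m n" "x (n - 1) = ext x m (n - 1)" using e[of n] e[of "n - 1"] by simp_all
  moreover have "n = m + 2 * int h * q" "n - 1 = m - 1 + 2 * int h * q" using q by auto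
  ultimately have "x n = x m" "x (n - 1) = x (m - 1)" by (metis ext_add_mult_2h ext_self, metis ext_add_mult_2h ext_pred)
  from periodic_of_return'[OF M_Xbar[OF x] mn this] show False using M_not_periodic[OF x] by blast
qed

definition levels :: "real set" where
  "levels = {ext x m 0 |x m. x \<in> M}"

lemma level_mem: "x \<in> M \<Longrightarrow> ext x m 0 \<in> levels"
  by (auto simp: levels_def)

text \<open>At a hit of phase 0 the level is 1/2 or -1/2. Every time lies at most \<open>L\<close>
  steps after such a hit: up to \<open>J\<close> periods plus the period in progress. So the level
  differs from 1/2 or -1/2 by one of finitely many amounts.\<close>

lemma finite_levels: "finite levels"
proof -
  obtain J where J: "J \<ge> 0" "\<And>x j. x \<in> M \<Longrightarrow> \<exists>k\<in>{j..j + J}. \<bar>x (2 * int h * k)\<bar> = 1/2"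
    using M_hit by blast
  define L where "L = nat (2 * int h * (J + 1))"
  define D where "D = {ext x (m + int k) 0 - ext x m 0 |x m k. orbit x \<and> k \<le> L}"
  have "levels \<subseteq> (\<lambda>(a, b). a + b) ` ({1/2, -1/2} \<times> D)"
  proof
    fix c assume "c \<in> levels"
    then obtain x m where x: "x \<in> M" "c = ext x m 0" by (auto simp: levels_def)
    define j where "j = m div (2 * int h)"
    have j: "2 * int h * j \<le> m" "m < 2 * int h * (j + 1)"
    proof -
      have "2 * int h > 0" using h_pos by simp
      then have "0 \<le> m mod (2 * int h)" "m mod (2 * int h) < 2 * int h" by simp_all
      moreover have "m = 2 * int h * j + m mod (2 * int h)" unfolding j_def by simp
      ultimately show "2 * int h * j \<le> m" "m < 2 * int h * (j + 1)" by (simp_all add: distrib_left)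
    qed
    obtain k where k: "k \<in> {j - J..j - J + J}" "\<bar>x (2 * int h * k)\<bar> = 1/2" using J(2)[OF x(1)] by blast
    define n where "n = 2 * int h * k"
    have "n \<le> m" using j(1) k(1) mult_left_mono[of k j "2 * int h"] by (auto simp: n_def)
    have "m - n \<le> 2 * int h * (J + 1)"
    proof -
      have "j + 1 - k \<le> J + 1" using k(1) by auto
      then have "2 * int h * (j + 1 - k) \<le> 2 * int h * (J + 1)" by (rule mult_left_mono) simp
      then show ?thesis using j(2) by (simp add: n_def algebra_simps)
    qed
    then have "nat (m - n) \<le> L" by (simp add: L_def nat_mono)
    then have "ext x (n + int (nat (m - n))) 0 - ext x n 0 \<in> D"
      unfolding D_def using M_orbit[OF x(1)] by blast
    then have "c - ext x n 0 \<in> D" using \<open>n \<le> m\<close> x by simp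
    moreover have "ext x n 0 = x n" using ext_add_mult_2h[of x n 0 k] by (simp add: n_def)
    then have "ext x n 0 \<in> {1/2, -1/2}" using k(2) by (auto simp: n_def)
    ultimately have "(ext x n 0, c - ext x n 0) \<in> {1/2, -1/2} \<times> D" by blast
    then show "c \<in> (\<lambda>(a, b). a + b) ` ({1/2, -1/2} \<times> D)" by force
  qed
  moreover have "finite D" unfolding D_def by (rule finite_ext_diff)
  ultimately show ?thesis using finite_subset by blast
qed

text \<open>Points of \<open>M\<close> are limits of strict orbits, whose level differs from theirs by a constant as
  long as the codes agree; hence all boundary hits happen on the same side.\<close>

lemma side_unique_single:
  assumes x: "x \<in> M" and m: "int h dvd m" "ext x m 0 = 1/2" and n: "int h dvd n" "ext x n 0 = - 1/2"
  shows False
proof -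
  obtain y where y: "\<And>k. strict (y k)" "y \<longlonglongrightarrow> x" using XbarE[OF M_Xbar[OF x]] by blast
  define a b where "a = min m n" and "b = max m n"
  have "eventually (\<lambda>k. \<forall>l\<in>{a..b}. code (y k) l = code x l) sequentially"
    by (rule eventually_code_eq[OF strict_orbit[OF y(1)] y(2)])
  then obtain k where k: "\<And>l. l \<in> {a..b} \<Longrightarrow> code (y k) l = code x l"
    unfolding eventually_sequentially by blast
  have "ext (y k) b 0 - ext (y k) a 0 = ext x b 0 - ext x a 0"
    by (rule ext_diff_eq) (use k in \<open>auto simp: a_def b_def\<close>)
  then have "ext (y k) m 0 - ext x m 0 = ext (y k) n 0 - ext x n 0"
    by (auto simp: a_def b_def max_def min_def split: if_splits)
  moreover have "\<bar>ext (y k) m 0\<bar> < 1/2" "\<bar>ext (y k) n 0\<bar> < 1/2"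
    using ext_abs_0[OF m(1)] ext_abs_0[OF n(1)] strict_abs[OF y(1)] by simp_all
  ultimately show False using m n by linarith
qed

text \<open>Which of 1/2 and -1/2 occurs as a level of \<open>M\<close> at multiples of
  \<open>h\<close>. The other never does (\<open>side_hit\<close>), so strict orbits close to
  \<open>M\<close> pass on one side of it.\<close>

definition side :: real where
  "side = (if \<exists>x\<in>M. \<exists>m. int h dvd m \<and> ext x m 0 = 1/2 then 1 else -1)"

lemma side_cases: "side = 1 \<or> side = -1" by (simp add: side_def)

lemma near_level_eq: "\<exists>\<epsilon>>0. \<forall>c\<in>levels. \<forall>d\<in>levels. \<bar>c - d\<bar> < \<epsilon> \<longrightarrow> c = d"
proof -
  define S where "S = (\<lambda>(c, d). \<bar>c - d\<bar>) ` (levels \<times> levels) - {0}"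
  have "finite S" using finite_levels by (simp add: S_def)
  have pos: "s > 0" if "s \<in> S" for s using that by (auto simp: S_def)
  show ?thesis
  proof (cases "S = {}")
    case True
    then show ?thesis by (intro exI[of _ 1]) (auto simp: S_def)
  next
    case False
    have "Min S > 0" using False \<open>finite S\<close> pos by simp
    moreover have "c = d" if "c \<in> levels" "d \<in> levels" "\<bar>c - d\<bar> < Min S" for c d
    proof (rule ccontr)
      assume "c \<noteq> d"
      then have "\<bar>c - d\<bar> \<in> S" using that by (force simp: S_def)
      then show False using that(3) Min_le[OF \<open>finite S\<close>, of "\<bar>c - d\<bar>"] by linarith
    qed
    ultimately show ?thesis by blast
  qed
qed

text \<open>A hit of \<open>x\<close> on the wrong side would be copied onto the orbit of a point
  \<open>z\<close> that hits on the right one: the orbit of \<open>z\<close> comes close to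
  \<open>x\<close>, and nearby levels are equal because there are finitely many. A single orbit
  hitting both sides is already excluded.\<close>

lemma side_hit:
  assumes x: "x \<in> M" and m: "int h dvd m"
  shows "ext x m 0 \<noteq> - side / 2"
proof
  assume neg: "ext x m 0 = - side / 2"
  show False
  proof (cases "\<exists>x\<in>M. \<exists>m. int h dvd m \<and> ext x m 0 = 1/2")
    case True
    then obtain z n where z: "z \<in> M" "int h dvd n" "ext z n 0 = 1/2" by blast
    have xm: "ext x m 0 = - 1/2" using neg True by (simp add: side_def)
    obtain \<epsilon> where \<epsilon>: "\<epsilon> > 0" "\<And>c d. c \<in> levels \<Longrightarrow> d \<in> levels \<Longrightarrow> \<bar>c - d\<bar> < \<epsilon> \<Longrightarrow> c = d"
      using near_level_eq by blast
    define V where "V = (\<lambda>w. ext w m 0) -` ball (ext x m 0) \<epsilon>"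
    have "open V" unfolding V_def using continuous_ext by (intro open_vimage) auto
    moreover have "x \<in> V \<inter> M" using x \<epsilon>(1) by (simp add: V_def)
    then have "V \<inter> M \<noteq> {}" by blast
    ultimately obtain k where k: "sh (int k) z \<in> V" using M_dense[OF z(1), of V 0] by blast
    have "ext (sh (int k) z) m 0 = ext x m 0"
      using k \<epsilon>(2)[OF level_mem[OF M_sh[OF z(1)]] level_mem[OF x]]
      by (auto simp: V_def dist_real_def abs_minus_commute)
    then have "ext z (m + 2 * int h * int k) 0 = - 1/2" using xm by (simp add: ext_sh)
    moreover have "int h dvd m + 2 * int h * int k" using m by simp
    ultimately show False using side_unique_single[OF z(1,2,3)] by blast
  next
    case False
    then have "ext x m 0 = 1/2" using neg unfolding side_def if_not_P[OF False] by simp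
    then show False using False x m by blast
  qed
qed

text \<open>At multiples of \<open>h\<close> one end of [-1/2, 1/2] is never attained. The levels
  then lie in a half-open unit interval, where congruence modulo 1 is equality.\<close>

lemma level_eqI:
  assumes "x \<in> M" "y \<in> M" "int h dvd m" "int h dvd n" "ext x m 0 - ext y n 0 \<in> \<int>"
  shows "ext x m 0 = ext y n 0"
proof -
  have "\<bar>ext x m 0\<bar> \<le> 1/2" "\<bar>ext y n 0\<bar> \<le> 1/2"
    using assms ext_abs_0 orbit_abs[OF M_orbit] by metis+
  moreover have "ext x m 0 \<noteq> - side / 2" "ext y n 0 \<noteq> - side / 2" using assms side_hit by blast+
  ultimately have "\<bar>ext x m 0 - ext y n 0\<bar> < 1" using side_cases by (auto simp: abs_le_iff abs_less_iff)
  then show ?thesis using assms(5) Ints_nonzero_abs_less1 by force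
qed

end

subsection \<open>Gaps\<close>

lemma Ints_close_eq:
  fixes a b r :: real
  assumes "a \<in> \<int>" "b \<in> \<int>" "\<bar>r + a\<bar> < 1/2" "\<bar>r + b\<bar> \<le> 1/2"
  shows "a = b"
proof -
  have "a - b \<in> \<int>" using assms by simp
  moreover have "\<bar>a - b\<bar> < 1" using assms(3,4) by linarith
  ultimately show ?thesis using Ints_nonzero_abs_less1 by force
qed

lemma Ints_half_abs:
  fixes r :: real
  assumes "r + 1/2 \<in> \<int>" "\<bar>r\<bar> \<le> 1/2"
  shows "\<bar>r\<bar> = 1/2"
proof -
  obtain j :: int where j: "r + 1/2 = of_int j" using assms(1) by (auto elim: Ints_cases)
  then have "0 \<le> j" "j \<le> 1" using assms(2) by linarith+
  then have "j = 0 \<or> j = 1" by auto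
  then show ?thesis using j by auto
qed

lemma finite_of_separated:
  fixes S :: "real set"
  assumes sep: "\<And>s t. s \<in> S \<Longrightarrow> t \<in> S \<Longrightarrow> s < t \<Longrightarrow> t - s \<ge> l" and l: "l > 0" and B: "\<And>s. s \<in> S \<Longrightarrow> \<bar>s\<bar> \<le> B"
  shows "finite S"
proof (rule inj_on_finite[of "\<lambda>s. \<lfloor>s / l\<rfloor>" S "{\<lfloor>-B / l\<rfloor>..\<lfloor>B / l\<rfloor>}"])
  have "\<lfloor>s / l\<rfloor> < \<lfloor>t / l\<rfloor>" if "s \<in> S" "t \<in> S" "s < t" for s t
  proof -
    have "(s + l) / l \<le> t / l" using sep[OF that] l by (intro divide_right_mono) auto
    then have "s / l + 1 \<le> t / l" using l by (simp add: add_divide_distrib)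
    then have "\<lfloor>s / l + 1\<rfloor> \<le> \<lfloor>t / l\<rfloor>" by (rule floor_mono)
    then show ?thesis by simp
  qed
  then show "inj_on (\<lambda>s. \<lfloor>s / l\<rfloor>) S"
    unfolding inj_on_def by (metis less_irrefl linorder_less_linear)
  show "(\<lambda>s. \<lfloor>s / l\<rfloor>) ` S \<subseteq> {\<lfloor>-B / l\<rfloor>..\<lfloor>B / l\<rfloor>}"
  proof (intro image_subsetI)
    fix s assume "s \<in> S"
    then have "- B \<le> s" "s \<le> B" using B[of s] by linarith+
    then have "- B / l \<le> s / l" "s / l \<le> B / l" using l by (intro divide_right_mono; simp)+
    then show "\<lfloor>s / l\<rfloor> \<in> {\<lfloor>-B / l\<rfloor>..\<lfloor>B / l\<rfloor>}" by (auto intro: floor_mono)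
  qed
qed simp

lemma finite_if_all_eq: "(\<And>a b. a \<in> S \<Longrightarrow> b \<in> S \<Longrightarrow> a = b) \<Longrightarrow> finite S"
proof (cases "S = {}")
  case False
  then obtain a where "a \<in> S" by blast
  then show "(\<And>a b. a \<in> S \<Longrightarrow> b \<in> S \<Longrightarrow> a = b) \<Longrightarrow> finite S"
    using finite_subset[of S "{a}"] by blast
qed simp

context rotation begin

lemma orbit_next: "x (m + 1) = phi (m + 1) (ext x m 0) (ext x m 1) + code x m"
  using ext_step[of x m "m + 1"] ext_phi[of x m "m + 1"] by simp

lemma orbit_prev: "x (m - 1) = phi (m - 1) (ext x (m + 1) 0) (ext x (m + 1) 1) + code x m"
  using ext_step[of x m "m - 1"] ext_phi[of x "m + 1" "m - 1"] U_minus[of 1] by simp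

lemma phi_strict_between:
  assumes "U i \<noteq> 0" "p < q" "q < r" "\<bar>phi i c p + k\<bar> \<le> 1/2" "\<bar>phi i c r + k\<bar> \<le> 1/2"
  shows "\<bar>phi i c q + k\<bar> < 1/2"
proof (cases "U i > 0")
  case True
  then have "U i * p < U i * q" "U i * q < U i * r" using assms by simp_all
  then show ?thesis using assms(4,5) unfolding phi_def abs_le_iff abs_less_iff by linarith
next
  case False
  then have "U i * p > U i * q" "U i * q > U i * r" using assms by simp_all
  then show ?thesis using assms(4,5) unfolding phi_def abs_le_iff abs_less_iff by linarith
qed

lemma U_mult_h [simp]: "int h dvd i \<Longrightarrow> U i = 0"
  by (simp add: U_eq_0_iff)

lemma abs_U_near_mult_h: "int h dvd i \<Longrightarrow> \<bar>U (i + 1)\<bar> = 1 \<and> \<bar>U (i - 1)\<bar> = 1"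
  using U_add_mult_h[of 1 "i div int h"] U_add_mult_h[of "-1" "i div int h"] U_minus[of 1]
  by (simp add: add.commute)

text \<open>\<open>no_triple_hit\<close> for the three times in any order; the two pairs that
  involve \<open>a\<close> cannot be the congruent ones.\<close>

lemma hits_cong:
  assumes x: "orbit x" and hit: "\<bar>x a\<bar> = 1/2" "\<bar>x m\<bar> = 1/2" "\<bar>x n\<bar> = 1/2"
    and "int h dvd a" "\<not> int h dvd m" "\<not> int h dvd n"
  shows "int h dvd m - n"
proof -
  have "int h dvd m - a \<longleftrightarrow> int h dvd m" "int h dvd n - a \<longleftrightarrow> int h dvd n"
    using dvd_add_left_iff[OF assms(5), of "m - a"] dvd_add_left_iff[OF assms(5), of "n - a"] by simp_all
  then have ne: "\<not> int h dvd m - a" "\<not> int h dvd a - m" "\<not> int h dvd n - a" "\<not> int h dvd a - n"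
    using assms by (simp_all add: dvd_diff_commute)
  have sym: "int h dvd n - m \<longleftrightarrow> int h dvd m - n" by (simp add: dvd_diff_commute)
  show ?thesis
  proof (cases "m = n")
    case False
    moreover have "a \<noteq> m" "a \<noteq> n" using assms by auto
    ultimately consider "a < m" "m < n" | "a < n" "n < m" | "m < a" "a < n" | "n < a" "a < m" | "m < n" "n < a" | "n < m" "m < a"
      by linarith
    then show ?thesis
      by cases (use no_triple_hit[OF x] hit ne sym in meson)+
  qed simp
qed

end

section \<open>Slices of the minimal set and the lengths of their gaps\<close>

context hitting begin

text \<open>When \<open>h\<close> divides \<open>m + 1\<close>, the code enters the new level with
  coefficient 1 or -1, so the two new levels are congruent modulo 1 and hence equal. At these times
  the boundary is parallel to the levels and the code depends on the level alone.\<close>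

lemma same_code_next:
  assumes "x \<in> M" "w \<in> M" "int h dvd m + 1" "ext x m 0 = ext w m 0"
  shows "code x m = code w m"
proof -
  have u: "\<bar>U (- m)\<bar> = 1" using abs_U_near_mult_h[OF assms(3)] U_minus[of m] by simp
  then have "U (- m) \<in> \<int>" by (metis Ints_1 Ints_minus abs_eq_iff' )
  then have "ext x (m + 1) 0 - ext w (m + 1) 0 \<in> \<int>"
    using assms orbit_code[OF M_orbit] ext_step[of x m 0] ext_step[of w m 0] by auto
  then have "ext x (m + 1) 0 = ext w (m + 1) 0" using level_eqI assms by blast
  then show ?thesis using ext_step[of x m 0] ext_step[of w m 0] assms(4) u by auto
qed

lemma same_code_prev:
  assumes "x \<in> M" "w \<in> M" "int h dvd m - 1" "ext x (m + 1) 0 = ext w (m + 1) 0"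
  shows "code x m = code w m"
proof -
  have u: "\<bar>U (- m)\<bar> = 1" using abs_U_near_mult_h[OF assms(3)] U_minus[of m] by simp
  then have "U (- m) \<in> \<int>" by (metis Ints_1 Ints_minus abs_eq_iff')
  moreover have e: "ext z m 0 = ext z (m - 1) 0" for z
    using ext_step[of z "m - 1" 0] U_mult_h[of "1 - m"] assms(3) by (simp add: dvd_diff_commute)
  ultimately have "ext x (m - 1) 0 - ext w (m - 1) 0 \<in> \<int>"
    using assms orbit_code[OF M_orbit] ext_step[of x m 0] ext_step[of w m 0]
    unfolding e[symmetric]
  proof -
    assume u: "U (- m) \<in> \<int>" and c: "\<And>z n. z \<in> M \<Longrightarrow> code z n \<in> \<int>"
      and x: "ext x (m + 1) 0 = ext x m 0 + code x m * U (0 - m)" and w: "ext w (m + 1) 0 = ext w m 0 + code w m * U (0 - m)"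
    have "ext x m 0 - ext w m 0 = code w m * U (- m) - code x m * U (- m)"
      using x w assms(4) by simp
    then show "ext x m 0 - ext w m 0 \<in> \<int>" using u c assms by simp
  qed
  then have "ext x m 0 = ext w m 0" using level_eqI assms e by metis
  then show ?thesis using ext_step[of x m 0] ext_step[of w m 0] assms(4) u by auto
qed

definition J :: "int \<Rightarrow> real \<Rightarrow> real set" where
  "J m c = {ext x m 1 |x. x \<in> M \<and> ext x m 0 = c}"

lemma J_I: "x \<in> M \<Longrightarrow> ext x m 1 \<in> J m (ext x m 0)"
  by (auto simp: J_def)

lemma J_cong: "int h * 2 dvd m - n \<Longrightarrow> J m c = J n c"
proof -
  have "J (n + 2 * int h * k) c \<subseteq> J n c" for n k
    unfolding J_def by (auto simp: ext_sh[symmetric] intro: M_sh)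
  from this[of n "(m - n) div (int h * 2)"] this[of m "- ((m - n) div (int h * 2))"]
  show "int h * 2 dvd m - n \<Longrightarrow> ?thesis" by (auto simp: mult.commute)
qed

lemma compact_J: "compact (J m c)"
proof -
  have "closed ((\<lambda>x. ext x m 0) -` {c})" by (intro closed_vimage continuous_ext) auto
  then have "compact (M \<inter> (\<lambda>x. ext x m 0) -` {c})" using M_compact by blast
  moreover have "J m c = (\<lambda>x. ext x m 1) ` (M \<inter> (\<lambda>x. ext x m 0) -` {c})" by (auto simp: J_def)
  ultimately show ?thesis
    by (metis compact_continuous_image continuous_ext continuous_on_subset subset_UNIV)
qed

lemma J_limit:
  assumes x: "\<And>k::nat. x k \<in> M" "\<And>k. ext (x k) m 0 = c" "\<And>k. code (x k) m = q" "(\<lambda>k. ext (x k) m 1) \<longlonglongrightarrow> p"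
  shows "\<exists>z\<in>M. ext z m 0 = c \<and> ext z m 1 = p \<and> code z m = q"
proof -
  obtain z r where z: "z \<in> M" "strict_mono (r :: nat \<Rightarrow> nat)" "(x \<circ> r) \<longlonglongrightarrow> z"
    using M_compact x(1) unfolding compact_def by blast
  have "(\<lambda>k. ext ((x \<circ> r) k) m 0) \<longlonglongrightarrow> ext z m 0" by (rule tendsto_ext[OF z(3)])
  then have "ext z m 0 = c" using x(2) by (simp add: LIMSEQ_const_iff)
  moreover have "(\<lambda>k. ext ((x \<circ> r) k) m 1) \<longlonglongrightarrow> ext z m 1" by (rule tendsto_ext[OF z(3)])
  then have "ext z m 1 = p" using LIMSEQ_subseq_LIMSEQ[OF x(4) z(2)] LIMSEQ_unique unfolding comp_def by blast
  moreover have "eventually (\<lambda>k. \<forall>n\<in>{m..m}. code ((x \<circ> r) k) n = code z n) sequentially"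
    by (rule eventually_code_eq[OF _ z(3)]) (use M_orbit x(1) in simp)
  then have "code z m = q" using x(3) by (auto simp: eventually_sequentially)
  ultimately show ?thesis using z(1) by blast
qed

definition gap :: "int \<Rightarrow> real \<Rightarrow> real \<Rightarrow> real \<Rightarrow> bool" where
  "gap m c u v \<longleftrightarrow> u \<in> J m c \<and> v \<in> J m c \<and> u < v \<and> (\<forall>w. u < w \<longrightarrow> w < v \<longrightarrow> w \<notin> J m c)"

text \<open>The positions where a boundary line met at time \<open>m + 1\<close> crosses the level.
  Times with \<open>h\<close> dividing \<open>m + 1\<close> are left out, since there the next value
  does not depend on the position.\<close>

definition disc :: "int \<Rightarrow> real \<Rightarrow> real \<Rightarrow> bool" where
  "disc m c e \<longleftrightarrow> \<not> int h dvd m + 1 \<and> phi (m + 1) c e + 1/2 \<in> \<int>"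

text \<open>Off the discontinuities the step is a translation along the level: by the intermediate
  value theorem both ends of the gap have the same code. A point of \<open>M\<close> inside the
  image would share it, because the inverse step is affine in the position and stays strictly inside
  the square between the two ends; so it would come from inside the original gap.\<close>

lemma gap_step:
  assumes x: "x \<in> M" and gap: "gap m (ext x m 0) (ext x m 1) (ext x m 1 + l)"
    and good: "\<And>e. ext x m 1 \<le> e \<Longrightarrow> e \<le> ext x m 1 + l \<Longrightarrow> \<not> disc m (ext x m 0) e"
  shows "gap (m + 1) (ext x (m + 1) 0) (ext x (m + 1) 1) (ext x (m + 1) 1 + l)"
proof -
  have l: "l > 0" using gap by (simp add: gap_def)
  from gap obtain z where z: "z \<in> M" "ext z m 0 = ext x m 0" "ext z m 1 = ext x m 1 + l"
    unfolding gap_def J_def by auto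
  have cxz: "code x m = code z m"
  proof (cases "int h dvd m + 1")
    case True
    then show ?thesis using same_code_next x z by metis
  next
    case False
    then have U0: "U (m + 1) \<noteq> 0" by (simp add: U_eq_0_iff)
    let ?c = "ext x m 0" let ?p = "ext x m 1"
    show ?thesis
    proof (rule ccontr)
      assume neq: "code x m \<noteq> code z m"
      let ?f = "\<lambda>e. phi (m + 1) ?c e + code x m"
      have cont: "continuous_on {?p..?p + l} ?f" unfolding phi_def by (intro continuous_intros)
      have fx: "\<bar>?f ?p\<bar> \<le> 1/2" using orbit_abs[OF M_orbit[OF x], of "m + 1"] orbit_next[of x m] by simp
      have fz: "\<bar>phi (m + 1) ?c (?p + l) + code z m\<bar> \<le> 1/2"
        using orbit_abs[OF M_orbit[OF z(1)], of "m + 1"] orbit_next[of z m] z by simp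
      have "\<not> \<bar>?f (?p + l)\<bar> < 1/2"
        using Ints_close_eq[OF orbit_code[OF M_orbit[OF x]] orbit_code[OF M_orbit[OF z(1)]] _ fz] neq by blast
      then consider "?f (?p + l) \<ge> 1/2" | "?f (?p + l) \<le> - (1/2)" by linarith
      then obtain e where e: "?p \<le> e" "e \<le> ?p + l" "?f e = 1/2 \<or> ?f e = - (1/2)"
      proof cases
        case 1
        have "?f ?p \<le> 1/2" "?p \<le> ?p + l" using fx l by linarith+
        from IVT'[OF this(1) 1 this(2) cont] show ?thesis using that by blast
      next
        case 2
        have "- (1/2) \<le> ?f ?p" "?p \<le> ?p + l" using fx l by linarith+
        from IVT2'[OF 2 this(1,2) cont] show ?thesis using that by blast
      qed
      have eq: "phi (m + 1) ?c e + 1/2 = ?f e + 1/2 - code x m" by simp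
      have "?f e + 1/2 \<in> \<int>" using e(3)
      proof
        assume h: "?f e = 1/2"
        have "?f e + 1/2 = 1" unfolding h by simp
        then show ?thesis by (simp only: Ints_1)
      next
        assume h: "?f e = - (1/2)"
        have "?f e + 1/2 = 0" unfolding h by simp
        then show ?thesis by (simp only: Ints_0)
      qed
      then have "phi (m + 1) ?c e + 1/2 \<in> \<int>"
        unfolding eq using orbit_code[OF M_orbit[OF x]] by (rule Ints_diff)
      then show False using good[OF e(1,2)] False by (simp add: disc_def)
    qed
  qed
  have st: "ext z (m + 1) 0 = ext x (m + 1) 0" "ext z (m + 1) 1 = ext x (m + 1) 1 + l"
    using ext_step[of x m 0] ext_step[of z m 0] ext_step[of x m 1] ext_step[of z m 1] cxz z by simp_all
  have "w \<notin> J (m + 1) (ext x (m + 1) 0)" if w: "ext x (m + 1) 1 < w" "w < ext x (m + 1) 1 + l" for w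
  proof
    assume "w \<in> J (m + 1) (ext x (m + 1) 0)"
    then obtain y where y: "y \<in> M" "ext y (m + 1) 0 = ext x (m + 1) 0" "ext y (m + 1) 1 = w" by (auto simp: J_def)
    have "code y m = code x m"
    proof (cases "int h dvd m - 1")
      case True
      then show ?thesis using same_code_prev y x by metis
    next
      case False
      then have U0: "U (m - 1) \<noteq> 0" by (simp add: U_eq_0_iff)
      have "\<bar>phi (m - 1) (ext x (m + 1) 0) (ext x (m + 1) 1) + code x m\<bar> \<le> 1/2"
        using orbit_abs[OF M_orbit[OF x], of "m - 1"] orbit_prev[of x m] by simp
      moreover have "\<bar>phi (m - 1) (ext x (m + 1) 0) (ext x (m + 1) 1 + l) + code x m\<bar> \<le> 1/2"
        using orbit_abs[OF M_orbit[OF z(1)], of "m - 1"] orbit_prev[of z m] st cxz by simp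
      ultimately have "\<bar>phi (m - 1) (ext x (m + 1) 0) w + code x m\<bar> < 1/2"
        using phi_strict_between[OF U0 w] by blast
      moreover have "\<bar>phi (m - 1) (ext x (m + 1) 0) w + code y m\<bar> \<le> 1/2"
        using orbit_abs[OF M_orbit[OF y(1)], of "m - 1"] orbit_prev[of y m] y by simp
      ultimately show ?thesis
        using Ints_close_eq[OF orbit_code[OF M_orbit[OF x]] orbit_code[OF M_orbit[OF y(1)]]] by metis
    qed
    then have "ext y m 0 = ext x m 0" "ext x m 1 < ext y m 1" "ext y m 1 < ext x m 1 + l"
      using ext_step[of x m 0] ext_step[of y m 0] ext_step[of x m 1] ext_step[of y m 1] y w by simp_all
    then show False using gap J_I[OF y(1), of m] unfolding gap_def by metis
  qed
  then show ?thesis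
    unfolding gap_def using J_I[OF x, of "m + 1"] J_I[OF z(1), of "m + 1"] st l by auto
qed

lemma gap_disjoint:
  assumes "gap m c u v" "gap m c u' v'" "u < u'"
  shows "v \<le> u'"
  using assms unfolding gap_def by (meson not_less)

lemma gap_unique: "gap m c u v \<Longrightarrow> gap m c u v' \<Longrightarrow> v = v'"
  unfolding gap_def by (metis linorder_cases)

lemma gap_unique': "gap m c u v \<Longrightarrow> gap m c u' v \<Longrightarrow> u = u'"
  unfolding gap_def by (metis linorder_cases)

lemma gap_shift: "gap (m + 2 * int h * k) c u v \<longleftrightarrow> gap m c u v"
  using J_cong[of "m + 2 * int h * k" m] by (simp add: gap_def)

text \<open>Otherwise the gap travels undisturbed forever. Its copies at times congruent modulo 2h
  have equal length, are pairwise distinct because no state recurs, and lie on finitely many bounded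
  levels, which have no room for infinitely many of them.\<close>

lemma ex_bad_gap:
  assumes x: "x \<in> M" and gap: "gap m (ext x m 0) (ext x m 1) (ext x m 1 + l)"
  shows "\<exists>n\<ge>m. gap n (ext x n 0) (ext x n 1) (ext x n 1 + l) \<and>
    (\<exists>e. ext x n 1 \<le> e \<and> e \<le> ext x n 1 + l \<and> disc n (ext x n 0) e)"
proof (rule ccontr)
  assume neg: "\<not> ?thesis"
  have l: "l > 0" using gap by (simp add: gap_def)
  have all: "gap (m + int k) (ext x (m + int k) 0) (ext x (m + int k) 1) (ext x (m + int k) 1 + l)" for k
  proof (induction k)
    case (Suc k)
    have "gap (m + int k + 1) (ext x (m + int k + 1) 0) (ext x (m + int k + 1) 1) (ext x (m + int k + 1) 1 + l)"
      using gap_step[OF x Suc] neg Suc by (metis le_add_same_cancel1 of_nat_0_le_iff)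
    then show ?case by (simp add: algebra_simps)
  qed (use gap in simp)
  define t where "t j = m + 2 * int h * int j" for j :: nat
  have g: "gap m (ext x (t j) 0) (ext x (t j) 1) (ext x (t j) 1 + l)" for j
  proof -
    have "t j = m + int (2 * h * j)" by (simp add: t_def)
    then have "gap (t j) (ext x (t j) 0) (ext x (t j) 1) (ext x (t j) 1 + l)" using all by metis
    then show ?thesis unfolding t_def gap_shift .
  qed
  obtain B where B: "\<And>x m i. orbit x \<Longrightarrow> \<bar>ext x m i\<bar> \<le> B" using ext_bound by blast
  define S where "S c = {ext x (t j) 1 |j. ext x (t j) 0 = c}" for c
  have fin: "finite (S c)" for c
  proof (rule finite_of_separated[OF _ l])
    show "l \<le> t' - s" if st: "s \<in> S c" "t' \<in> S c" "s < t'" for s t'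
    proof -
      have "gap m c s (s + l)" "gap m c t' (t' + l)" using st(1,2) g unfolding S_def by (smt (verit) mem_Collect_eq)+
      from gap_disjoint[OF this st(3)] show ?thesis by linarith
    qed
    show "\<bar>s\<bar> \<le> B" if "s \<in> S c" for s using that B[OF M_orbit[OF x]] by (auto simp: S_def)
  qed
  have "range (\<lambda>j. (ext x (t j) 0, ext x (t j) 1)) \<subseteq> (SIGMA c:levels. S c)"
    using level_mem[OF x] by (auto simp: S_def)
  moreover have "finite (SIGMA c:levels. S c)" using finite_levels fin by blast
  moreover have "inj (\<lambda>j. (ext x (t j) 0, ext x (t j) 1))"
  proof (rule linorder_injI)
    fix i j :: nat assume "i < j"
    then have "t i < t j" "2 * int h dvd t j - t i" using h_pos by (auto simp: t_def right_diff_distrib[symmetric])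
    then show "(ext x (t i) 0, ext x (t i) 1) \<noteq> (ext x (t j) 0, ext x (t j) 1)"
      using M_return_distinct[OF x] by blast
  qed
  ultimately show False using finite_subset range_inj_infinite by blast
qed

lemma finite_bounded_discs:
  "finite {e. \<bar>e\<bar> \<le> R \<and> disc m c e}"
proof (cases "int h dvd m + 1")
  case False
  then have U0: "U (m + 1) \<noteq> 0" by (simp add: U_eq_0_iff)
  define B where "B = \<bar>U (m + 1)\<bar> * R + \<bar>U m * c\<bar> + 1/2"
  have "{e. \<bar>e\<bar> \<le> R \<and> disc m c e} \<subseteq> (\<lambda>j::int. (of_int j - 1/2 + U m * c) / U (m + 1)) ` {\<lfloor>-B\<rfloor>..\<lceil>B\<rceil>}"
  proof
    fix e assume "e \<in> {e. \<bar>e\<bar> \<le> R \<and> disc m c e}"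
    then obtain j :: int where e: "\<bar>e\<bar> \<le> R" "U (m + 1) * e - U m * c + 1/2 = of_int j"
      by (auto simp: disc_def phi_def elim: Ints_cases)
    have "\<bar>U (m + 1) * e\<bar> \<le> \<bar>U (m + 1)\<bar> * R" unfolding abs_mult using e(1) by (intro mult_left_mono) auto
    then have "\<bar>of_int j\<bar> \<le> B" unfolding e(2)[symmetric] B_def by linarith
    then have "j \<in> {\<lfloor>-B\<rfloor>..\<lceil>B\<rceil>}" by (simp add: abs_le_iff) linarith
    moreover have "e = (of_int j - 1/2 + U m * c) / U (m + 1)" using e(2) U0 by (simp add: field_simps)
    ultimately show "e \<in> (\<lambda>j::int. (of_int j - 1/2 + U m * c) / U (m + 1)) ` {\<lfloor>-B\<rfloor>..\<lceil>B\<rceil>}" by blast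
  qed
  then show ?thesis using finite_subset by blast
qed (simp add: disc_def)

lemma J_bound: "\<exists>B>0. \<forall>m c. \<forall>p\<in>J m c. \<bar>p\<bar> \<le> B"
  using ext_bound M_orbit unfolding J_def by fastforce

text \<open>Only finitely many lengths occur. Each is also the length of a gap that touches a
  discontinuity; there are finitely many phases, levels and bounded discontinuities, and each of the
  latter touches at most three gaps.\<close>

lemma gap_length: "\<exists>l0>0. \<forall>m c u v. gap m c u v \<longrightarrow> v - u \<ge> l0"
proof -
  obtain B where B: "B > 0" "\<And>m c p. p \<in> J m c \<Longrightarrow> \<bar>p\<bar> \<le> B" using J_bound by blast
  define bad where "bad m c e = {v - u |u v. gap m c u v \<and> u \<le> e \<and> e \<le> v}" for m c e
  have fin: "finite (bad m c e)" for m c e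
  proof -
    have "bad m c e \<subseteq> {v - u |u v. gap m c u v \<and> u = e} \<union> {v - u |u v. gap m c u v \<and> v = e}
        \<union> {v - u |u v. gap m c u v \<and> u < e \<and> e < v}"
      unfolding bad_def by fastforce
    moreover have "finite {v - u |u v. gap m c u v \<and> u = e}"
      by (rule finite_if_all_eq) (use gap_unique in blast)
    moreover have "finite {v - u |u v. gap m c u v \<and> v = e}"
      by (rule finite_if_all_eq) (use gap_unique' in blast)
    moreover have "finite {v - u |u v. gap m c u v \<and> u < e \<and> e < v}"
    proof (rule finite_if_all_eq)
      fix a b assume "a \<in> {v - u |u v. gap m c u v \<and> u < e \<and> e < v}" "b \<in> {v - u |u v. gap m c u v \<and> u < e \<and> e < v}"
      then obtain u v u' v' where uv: "a = v - u" "gap m c u v" "u < e" "e < v" "b = v' - u'" "gap m c u' v'" "u' < e" "e < v'"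
        by blast
      have "u = u'" using gap_disjoint uv by (meson linorder_cases not_less order.strict_trans1 order.asym)
      then show "a = b" using gap_unique uv by blast
    qed
    ultimately show ?thesis using finite_subset by (meson finite_UnI)
  qed
  define S where "S = (\<Union>m\<in>{0..<int h * 2}. \<Union>c\<in>levels. \<Union>e\<in>{e. \<bar>e\<bar> \<le> B \<and> disc m c e}. bad m c e)"
  have "finite S" unfolding S_def using finite_levels finite_bounded_discs fin by (intro finite_UN_I) auto
  have inS: "v - u \<in> S" if gap0: "gap m c u v" for m c u v
  proof -
    obtain x where x: "x \<in> M" "ext x m 0 = c" "ext x m 1 = u" using gap0 by (auto simp: gap_def J_def)
    obtain n e where n: "gap n (ext x n 0) (ext x n 1) (ext x n 1 + (v - u))"
      "ext x n 1 \<le> e" "e \<le> ext x n 1 + (v - u)" "disc n (ext x n 0) e"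
      using ex_bad_gap[OF x(1), of m "v - u"] x gap0 by auto
    define d where "d = n div (2 * int h)"
    define k where "k = n mod (2 * int h)"
    have nk: "n = k + 2 * int h * d" by (simp add: k_def d_def)
    have "2 * int h > 0" using h_pos by simp
    then have k: "k \<in> {0..<int h * 2}" by (simp add: k_def mult.commute)
    have "gap k (ext x n 0) (ext x n 1) (ext x n 1 + (v - u))" using n(1) unfolding nk gap_shift .
    moreover have "disc k (ext x n 0) e"
    proof -
      have e1: "k + 2 * int h * d + 1 = (k + 1) + 2 * int h * d" by simp
      have "U (n + 1) = U (k + 1)" unfolding nk e1 by (rule U_add_mult_2h)
      moreover have "U n = U k" unfolding nk by (rule U_add_mult_2h)
      moreover have "int h dvd n + 1 \<longleftrightarrow> int h dvd k + 1"
        unfolding nk e1 by (subst dvd_add_left_iff) auto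
      ultimately show ?thesis using n(4) by (simp add: disc_def phi_def)
    qed
    moreover have "\<bar>ext x n 1\<bar> \<le> B" "\<bar>ext x n 1 + (v - u)\<bar> \<le> B" using n(1) B(2) by (auto simp: gap_def)
    then have "\<bar>e\<bar> \<le> B" using n(2,3) by (simp add: abs_le_iff)
    moreover have "v - u \<in> bad k (ext x n 0) e"
      using n(2,3) \<open>gap k _ _ _\<close> unfolding bad_def by (intro CollectI exI[of _ "ext x n 1"] exI[of _ "ext x n 1 + (v - u)"]) simp
    ultimately show ?thesis unfolding S_def using k level_mem[OF x(1), of n] by blast
  qed
  show ?thesis
  proof (cases "{s\<in>S. s > 0} = {}")
    case True
    have "\<not> gap m c u v" for m c u v
    proof
      assume g: "gap m c u v"
      then have "v - u \<in> S" "v - u > 0" using inS by (auto simp: gap_def)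
      then show False using True by blast
    qed
    then show ?thesis by (intro exI[of _ 1]) simp
  next
    case False
    define l0 where "l0 = Min {s\<in>S. s > 0}"
    have f: "finite {s\<in>S. s > 0}" using \<open>finite S\<close> by simp
    have "l0 > 0" using Min_in[OF f False] by (simp add: l0_def)
    moreover have "l0 \<le> v - u" if "gap m c u v" for m c u v
    proof -
      have "v - u \<in> S" "v - u > 0" using inS[OF that] that by (auto simp: gap_def)
      then show ?thesis unfolding l0_def using f by (intro Min_le) auto
    qed
    ultimately show ?thesis by blast
  qed
qed

subsection \<open>Components\<close>

text \<open>The right ends of the components of a slice: the left ends of gaps, and the maximum.
  Since gaps have length bounded below there are finitely many, so a slice is a finite union of
  closed segments, possibly points.\<close>

definition ER :: "int \<Rightarrow> real \<Rightarrow> real set" where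
  "ER m c = {u. (\<exists>v. gap m c u v) \<or> (u \<in> J m c \<and> (\<forall>w\<in>J m c. w \<le> u))}"

definition EL :: "int \<Rightarrow> real \<Rightarrow> real set" where
  "EL m c = {v. (\<exists>u. gap m c u v) \<or> (v \<in> J m c \<and> (\<forall>w\<in>J m c. v \<le> w))}"

lemma EL_J: "a \<in> EL m c \<Longrightarrow> a \<in> J m c" and ER_J: "a \<in> ER m c \<Longrightarrow> a \<in> J m c"
  by (auto simp: EL_def ER_def gap_def)

lemma finite_ER: "finite (ER m c)"
proof -
  obtain B where B: "B > 0" "\<And>m c p. p \<in> J m c \<Longrightarrow> \<bar>p\<bar> \<le> B" using J_bound by blast
  obtain l0 where l0: "l0 > 0" "\<And>m c u v. gap m c u v \<Longrightarrow> l0 \<le> v - u" using gap_length by blast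
  have "finite {u. \<exists>v. gap m c u v}"
  proof (rule finite_of_separated[OF _ l0(1)])
    fix s t assume "s \<in> {u. \<exists>v. gap m c u v}" "t \<in> {u. \<exists>v. gap m c u v}" "s < t"
    then obtain v v' where v: "gap m c s v" "gap m c t v'" by blast
    show "l0 \<le> t - s" using gap_disjoint[OF v \<open>s < t\<close>] l0(2)[OF v(1)] by linarith
  qed (use B in \<open>auto simp: gap_def\<close>)
  moreover have "finite {u. u \<in> J m c \<and> (\<forall>w\<in>J m c. w \<le> u)}" by (rule finite_if_all_eq) force
  ultimately show ?thesis by (simp add: ER_def Collect_disj_eq)
qed

lemma finite_EL: "finite (EL m c)"
proof -
  obtain B where B: "B > 0" "\<And>m c p. p \<in> J m c \<Longrightarrow> \<bar>p\<bar> \<le> B" using J_bound by blast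
  obtain l0 where l0: "l0 > 0" "\<And>m c u v. gap m c u v \<Longrightarrow> l0 \<le> v - u" using gap_length by blast
  have "finite {v. \<exists>u. gap m c u v}"
  proof (rule finite_of_separated[OF _ l0(1)])
    fix s t assume "s \<in> {v. \<exists>u. gap m c u v}" "t \<in> {v. \<exists>u. gap m c u v}" "s < t"
    then obtain v v' where v: "gap m c v s" "gap m c v' t" by blast
    have "v < v'"
    proof (rule ccontr)
      assume "\<not> v < v'"
      moreover have "v \<noteq> v'" using gap_unique v \<open>s < t\<close> by blast
      ultimately have "t \<le> v" using gap_disjoint[OF v(2,1)] by simp
      then show False using v(1) \<open>s < t\<close> by (simp add: gap_def)
    qed
    then show "l0 \<le> t - s" using gap_disjoint[OF v] l0(2)[OF v(2)] by linarith
  qed (use B in \<open>auto simp: gap_def\<close>)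
  moreover have "finite {u. u \<in> J m c \<and> (\<forall>w\<in>J m c. u \<le> w)}" by (rule finite_if_all_eq) force
  ultimately show ?thesis by (simp add: EL_def Collect_disj_eq)
qed

lemma ex_gap:
  assumes "s \<in> J m c" "t \<in> J m c" "s < w" "w < t" "w \<notin> J m c"
  shows "\<exists>u v. gap m c u v \<and> s \<le> u \<and> u < w \<and> w < v \<and> v \<le> t"
proof -
  have "compact (J m c \<inter> {s..w})" "J m c \<inter> {s..w} \<noteq> {}" using assms compact_J by (auto intro: compact_Int)
  then obtain u where u: "u \<in> J m c \<inter> {s..w}" "\<And>y. y \<in> J m c \<inter> {s..w} \<Longrightarrow> y \<le> u"
    using compact_attains_sup by metis
  have "compact (J m c \<inter> {w..t})" "J m c \<inter> {w..t} \<noteq> {}" using assms compact_J by (auto intro: compact_Int)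
  then obtain v where v: "v \<in> J m c \<inter> {w..t}" "\<And>y. y \<in> J m c \<inter> {w..t} \<Longrightarrow> v \<le> y"
    using compact_attains_inf by metis
  have uw: "u < w" "w < v" using u(1) v(1) assms(5) by (auto simp: less_le)
  moreover have "y \<notin> J m c" if y: "u < y" "y < v" for y
  proof
    assume "y \<in> J m c"
    then show False using u v uw y assms(5) by (cases y w rule: linorder_cases) fastforce+
  qed
  ultimately show ?thesis using u(1) v(1) unfolding gap_def by (intro exI[of _ u] exI[of _ v]) auto
qed

lemma ex_right_end:
  assumes t: "t \<in> J m c"
  obtains b where "b \<in> ER m c" "t \<le> b" "{t..b} \<subseteq> J m c"
proof -
  define S where "S = {u \<in> ER m c. t \<le> u}"
  have "finite S" using finite_ER by (simp add: S_def)
  obtain r where "r \<in> J m c" "\<And>w. w \<in> J m c \<Longrightarrow> w \<le> r" using compact_attains_sup[OF compact_J, of m c] t by blast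
  then have "r \<in> S" using t by (auto simp: S_def ER_def)
  then have b: "Min S \<in> S" using \<open>finite S\<close> by (intro Min_in) auto
  have "w \<in> J m c" if w: "w \<in> {t..Min S}" for w
  proof (rule ccontr)
    assume "w \<notin> J m c"
    moreover have "Min S \<in> J m c" using b ER_J by (auto simp: S_def)
    ultimately have "t < w" "w < Min S" using w t by (auto simp: less_le)
    from ex_gap[OF t \<open>Min S \<in> J m c\<close> this \<open>w \<notin> J m c\<close>]
    obtain u v where u: "gap m c u v" "t \<le> u" "u < w" by blast
    then have "u \<in> S" by (auto simp: S_def ER_def)
    then show False using u(3) \<open>w < Min S\<close> Min_le[OF \<open>finite S\<close>] by fastforce
  qed
  then show ?thesis using b by (intro that[of "Min S"]) (auto simp: S_def)
qed

lemma ex_left_end: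
  assumes t: "t \<in> J m c"
  obtains a where "a \<in> EL m c" "a \<le> t" "{a..t} \<subseteq> J m c"
proof -
  define S where "S = {u \<in> EL m c. u \<le> t}"
  have "finite S" using finite_EL by (simp add: S_def)
  obtain r where "r \<in> J m c" "\<And>w. w \<in> J m c \<Longrightarrow> r \<le> w" using compact_attains_inf[OF compact_J, of m c] t by blast
  then have "r \<in> S" using t by (auto simp: S_def EL_def)
  then have b: "Max S \<in> S" using \<open>finite S\<close> by (intro Max_in) auto
  have "w \<in> J m c" if w: "w \<in> {Max S..t}" for w
  proof (rule ccontr)
    assume "w \<notin> J m c"
    moreover have "Max S \<in> J m c" using b EL_J by (auto simp: S_def)
    ultimately have "Max S < w" "w < t" using w t by (auto simp: less_le)
    from ex_gap[OF \<open>Max S \<in> J m c\<close> t this \<open>w \<notin> J m c\<close>]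
    obtain u v where u: "gap m c u v" "w < v" "v \<le> t" by blast
    then have "v \<in> S" by (auto simp: S_def EL_def)
    then show False using u(2) \<open>Max S < w\<close> Max_ge[OF \<open>finite S\<close>] by fastforce
  qed
  then show ?thesis using b by (intro that[of "Max S"]) (auto simp: S_def)
qed

text \<open>If all components were points, every slice would be finite and a nonperiodic orbit would
  repeat a state at the same phase.\<close>

lemma ex_nondegenerate: "\<exists>c a b. a < b \<and> {a..b} \<subseteq> J m c"
proof (rule ccontr)
  assume neg: "\<not> ?thesis"
  have "J m c \<subseteq> ER m c" for c
  proof
    fix t assume "t \<in> J m c"
    then obtain b where "b \<in> ER m c" "t \<le> b" "{t..b} \<subseteq> J m c" by (rule ex_right_end)
    then show "t \<in> ER m c" using neg by (cases "t = b") (auto simp: less_le)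
  qed
  then have fin: "finite (SIGMA c:levels. J m c)" using finite_levels finite_ER finite_subset by blast
  obtain x where x: "x \<in> M" using M_ne by blast
  define t where "t j = m + 2 * int h * int j" for j :: nat
  have "(ext x (t j) 0, ext x (t j) 1) \<in> (SIGMA c:levels. J m c)" for j
    using level_mem[OF x] J_I[OF x, of "t j"] J_cong[of "t j" m] by (simp add: t_def)
  then have "range (\<lambda>j. (ext x (t j) 0, ext x (t j) 1)) \<subseteq> (SIGMA c:levels. J m c)" by blast
  moreover have "inj (\<lambda>j. (ext x (t j) 0, ext x (t j) 1))"
  proof (rule linorder_injI)
    fix i j :: nat assume "i < j"
    then have "t i < t j" "2 * int h dvd t j - t i" using h_pos by (auto simp: t_def right_diff_distrib[symmetric])
    then show "(ext x (t i) 0, ext x (t i) 1) \<noteq> (ext x (t j) 0, ext x (t j) 1)"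
      using M_return_distinct[OF x] by blast
  qed
  ultimately show False using fin finite_subset range_inj_infinite by blast
qed

end

subsection \<open>Confinement\<close>

lemma ex_pos_lower_bound:
  fixes S :: "real set"
  assumes "finite S"
  shows "\<exists>d>0. \<forall>s\<in>S. s \<noteq> 0 \<longrightarrow> d \<le> \<bar>s\<bar>"
proof (cases "S - {0} = {}")
  case True
  then show ?thesis by (intro exI[of _ 1]) auto
next
  case False
  have f: "finite (abs ` (S - {0}))" using assms by simp
  have "Min (abs ` (S - {0})) > 0" using False f by (subst Min_gr_iff) auto
  moreover have "Min (abs ` (S - {0})) \<le> \<bar>s\<bar>" if "s \<in> S" "s \<noteq> 0" for s using f that by (intro Min_le) auto
  ultimately show ?thesis by blast
qed

context rotation begin

lemma finite_range_mod:
  assumes "\<And>i. f (i mod (2 * int h)) = f i"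
  shows "finite (range f)"
proof -
  have "range f \<subseteq> f ` {0..<2 * int h}"
  proof
    fix x assume "x \<in> range f"
    then obtain i where "x = f i" by blast
    then have "x = f (i mod (2 * int h))" by (simp add: assms)
    then show "x \<in> f ` {0..<2 * int h}" using h_pos by (intro image_eqI) auto
  qed
  then show ?thesis using finite_subset by blast
qed

lemma U_cong: "2 * int h dvd i - j \<Longrightarrow> U i = U j"
  using U_add_mult_2h[of j "(i - j) div (2 * int h)"] by simp

lemma ex_ratio_bound: "\<exists>C\<ge>1. \<forall>i. \<bar>U (i - 1) / U i\<bar> \<le> C"
proof -
  have "finite (range (\<lambda>i. U (i - 1) / U i))"
  proof (rule finite_range_mod)
    fix i
    have "2 * int h dvd (i mod (2 * int h) - 1) - (i - 1)" by (simp add: mod_eq_dvd_iff[symmetric])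
    then show "U (i mod (2 * int h) - 1) / U (i mod (2 * int h)) = U (i - 1) / U i"
      using U_cong U_mod by simp
  qed
  from finite_imp_bounded[OF this] obtain A where "\<And>i. \<bar>U (i - 1) / U i\<bar> \<le> A"
    unfolding bounded_iff real_norm_def by blast
  then show ?thesis by (intro exI[of _ "max 1 A"]) (auto intro: max.coboundedI2)
qed

text \<open>A bound for the shear, in position per height, of the boundary lines against the levels.
  Where \<open>U i = 0\<close> the quotient is 0. The lower bound 1 is there to give \<bar>y\<bar>
  \<le> Cf * \<bar>y\<bar>.\<close>

definition Cf :: real where "Cf = (SOME C. C \<ge> 1 \<and> (\<forall>i. \<bar>U (i - 1) / U i\<bar> \<le> C))"

lemma Cf_ge_1: "Cf \<ge> 1" and ratio_le_Cf: "\<bar>U (i - 1) / U i\<bar> \<le> Cf"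
proof -
  have "Cf \<ge> 1 \<and> (\<forall>i. \<bar>U (i - 1) / U i\<bar> \<le> Cf)"
    unfolding Cf_def by (rule someI_ex[OF ex_ratio_bound])
  then show "Cf \<ge> 1" "\<bar>U (i - 1) / U i\<bar> \<le> Cf" by simp_all
qed

lemma ex_inverse_U_bound: "\<exists>W. \<forall>i. 1 / \<bar>U i\<bar> \<le> W"
proof -
  have "finite (range (\<lambda>i. 1 / \<bar>U i\<bar>))" by (rule finite_range_mod) (simp add: U_mod)
  from finite_imp_bounded[OF this] obtain W where "\<And>i. \<bar>1 / \<bar>U i\<bar>\<bar> \<le> W"
    unfolding bounded_iff real_norm_def by blast
  then show ?thesis by (intro exI[of _ W]) simp
qed

text \<open>A point at height \<open>y\<close> above a level and displacement \<open>s\<close> along it reaches the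
  boundary line through the reference point at time \<open>n\<close> iff its foot vanishes.\<close>

definition foot :: "int \<Rightarrow> real \<Rightarrow> real \<Rightarrow> real" where
  "foot n y s = s - U (n - 1) / U n * y"

lemma U_add_mult_h_sign: "\<exists>s\<in>{-1, 1}. \<forall>i. U (i + int h * j) = s * U i"
proof (induction j rule: int_induct[where k = 0])
  case (step1 j)
  then obtain s where s: "s \<in> {-1, 1}" "\<And>i. U (i + int h * j) = s * U i" by blast
  have "U (i + int h * (j + 1)) = - s * U i" for i
  proof -
    have e: "i + int h * (j + 1) = (i + int h * j) + int h" by (simp add: algebra_simps)
    show ?thesis unfolding e U_add_h s(2) by simp
  qed
  then show ?case using s(1) by (intro bexI[of _ "- s"]) auto
next
  case (step2 j)
  then obtain s where s: "s \<in> {-1, 1}" "\<And>i. U (i + int h * j) = s * U i" by blast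
  have "U (i + int h * (j - 1)) = - s * U i" for i
  proof -
    have e: "i + int h * j = (i + int h * (j - 1)) + int h" by (simp add: algebra_simps)
    show ?thesis using s(2)[of i] unfolding e U_add_h by simp
  qed
  then show ?case using s(1) by (intro bexI[of _ "- s"]) auto
qed auto

lemma foot_cong:
  assumes "int h dvd m - n"
  shows "foot m y s = foot n y s"
proof -
  obtain j where j: "m = n + int h * j" using assms by (metis dvdE diff_eq_eq add.commute)
  then have e: "m - 1 = n - 1 + int h * j" by simp
  obtain s where "s \<in> {-1, 1}" "\<And>i. U (i + int h * j) = s * U i" using U_add_mult_h_sign by blast
  then show ?thesis unfolding foot_def e unfolding j by auto
qed

lemma foot_close: "\<bar>foot n y s - s\<bar> \<le> Cf * \<bar>y\<bar>"
proof -
  have "\<bar>foot n y s - s\<bar> = \<bar>U (n - 1) / U n\<bar> * \<bar>y\<bar>" unfolding foot_def abs_mult[symmetric] by simp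
  then show ?thesis using mult_right_mono[OF ratio_le_Cf[of n], of "\<bar>y\<bar>"] by simp
qed

end

section \<open>Confinement of nearby strict orbits between the ends of a component\<close>

context hitting begin

text \<open>\<open>x\<close> is a barrier in \<open>M\<close> for \<eta>, which runs at height
  \<open>y\<close> above it: \<sigma> = 1 keeps \<eta> to the right of \<open>x\<close> and \<sigma>
  = -1 to the left. On positions this holds only up to the tolerance
  \<open>Cf * \<bar>y\<bar>\<close>, the possible shear; on the boundary lines through
  \<open>x\<close> that matter it is strict. The time of such a hit is unrestricted, past or future,
  so the condition is stable under time steps.\<close>

definition tie :: "real \<Rightarrow> (int \<Rightarrow> real) \<Rightarrow> real \<Rightarrow> int \<Rightarrow> (int \<Rightarrow> real) \<Rightarrow> bool" where
  "tie \<sigma> \<eta> y m x \<longleftrightarrow> x \<in> M \<and> ext \<eta> m 0 = ext x m 0 + y \<and>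
     \<sigma> * (ext \<eta> m 1 - ext x m 1) > - Cf * \<bar>y\<bar> \<and>
     (\<forall>n. \<not> int h dvd n \<longrightarrow> \<bar>x n\<bar> = 1/2 \<longrightarrow> \<sigma> * foot n y (ext \<eta> m 1 - ext x m 1) > 0)"

text \<open>The invariant of the confinement: \<eta> runs above one nondegenerate component of a
  slice, between its two ends in the sense of \<open>tie\<close>.\<close>

definition allowed :: "(int \<Rightarrow> real) \<Rightarrow> real \<Rightarrow> int \<Rightarrow> bool" where
  "allowed \<eta> y m \<longleftrightarrow> (\<exists>x z. tie 1 \<eta> y m x \<and> tie (-1) \<eta> y m z \<and> ext x m 1 < ext z m 1 \<and>
     {ext x m 1..ext z m 1} \<subseteq> J m (ext x m 0) \<and> ext x m 1 \<in> EL m (ext x m 0) \<and> ext z m 1 \<in> ER m (ext x m 0))"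

lemma tie_M: "tie \<sigma> \<eta> y m x \<Longrightarrow> x \<in> M" and tie_level: "tie \<sigma> \<eta> y m x \<Longrightarrow> ext \<eta> m 0 = ext x m 0 + y"
  by (auto simp: tie_def)

lemma tie_step:
  assumes "tie \<sigma> \<eta> y m x" "code x m = code \<eta> m"
  shows "tie \<sigma> \<eta> y (m + 1) x"
proof -
  have "ext \<eta> (m + 1) 1 - ext x (m + 1) 1 = ext \<eta> m 1 - ext x m 1"
    "ext \<eta> (m + 1) 0 - ext x (m + 1) 0 = ext \<eta> m 0 - ext x m 0"
    by (simp_all add: ext_step assms(2))
  then show ?thesis using assms(1) unfolding tie_def by auto
qed

text \<open>Beyond the largest shear \<open>Cf * \<bar>y\<bar>\<close> every foot has the sign of
  the displacement.\<close>

lemma tie_far: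
  assumes "x \<in> M" "ext \<eta> m 0 = ext x m 0 + y" "\<sigma> \<in> {-1, 1}" "\<sigma> * (ext \<eta> m 1 - ext x m 1) > Cf * \<bar>y\<bar>"
  shows "tie \<sigma> \<eta> y m x"
proof -
  have "Cf * \<bar>y\<bar> \<ge> 0" using Cf_ge_1 by simp
  moreover have "\<sigma> * foot n y (ext \<eta> m 1 - ext x m 1) > 0" for n
    using foot_close[of n y "ext \<eta> m 1 - ext x m 1"] assms(3,4) by (auto simp: abs_le_iff)
  ultimately show ?thesis using assms unfolding tie_def by auto
qed

text \<open>Here the arithmetic enters. All hits of \<open>x\<close> off phase 0 are congruent
  modulo \<open>h\<close>, so the boundary lines concerned share one direction and one foot, and the
  sign at a single hit settles all of them.\<close>

lemma tie_disc:
  assumes x: "x \<in> M" "ext \<eta> m 0 = ext x m 0 + y" and m: "\<not> int h dvd m + 1" "\<bar>x (m + 1)\<bar> = 1/2"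
    and f: "\<sigma> \<in> {-1, 1}" "\<sigma> * foot (m + 1) y (ext \<eta> m 1 - ext x m 1) > 0"
  shows "tie \<sigma> \<eta> y m x"
proof -
  obtain k where k: "\<bar>x (2 * int h * k)\<bar> = 1/2" using M_hit x(1) by blast
  have "\<sigma> * foot n y (ext \<eta> m 1 - ext x m 1) > 0" if "\<not> int h dvd n" "\<bar>x n\<bar> = 1/2" for n
  proof -
    have "int h dvd n - (m + 1)" by (rule hits_cong[OF M_orbit[OF x(1)] k that(2) m(2) _ that(1) m(1)]) simp
    then show ?thesis using f(2) foot_cong by metis
  qed
  moreover have "\<sigma> * (ext \<eta> m 1 - ext x m 1) > - Cf * \<bar>y\<bar>"
    using foot_close[of "m + 1" y "ext \<eta> m 1 - ext x m 1"] f by (auto simp: abs_le_iff)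
  ultimately show ?thesis using x unfolding tie_def by blast
qed

text \<open>If \<open>x\<close> or \<open>z\<close> is not an end of the component, the true end is
  farther away by more than twice the tolerance, and the tie to it is automatic by
  \<open>tie_far\<close>.\<close>

lemma allowed_extend:
  assumes x: "tie 1 \<eta> y m x" and z: "tie (-1) \<eta> y m z" and xz: "ext x m 1 < ext z m 1"
    and seg: "{ext x m 1..ext z m 1} \<subseteq> J m (ext x m 0)"
    and L: "\<And>a. a \<in> EL m (ext x m 0) \<Longrightarrow> a < ext x m 1 \<Longrightarrow> ext x m 1 - a > 2 * Cf * \<bar>y\<bar>"
    and R: "\<And>b. b \<in> ER m (ext x m 0) \<Longrightarrow> ext z m 1 < b \<Longrightarrow> b - ext z m 1 > 2 * Cf * \<bar>y\<bar>"
  shows "allowed \<eta> y m"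
proof -
  have lz: "ext z m 0 = ext x m 0" using tie_level[OF x] tie_level[OF z] by simp
  have ends: "ext x m 1 \<in> J m (ext x m 0)" "ext z m 1 \<in> J m (ext x m 0)" using seg xz by auto
  obtain a where a: "a \<in> EL m (ext x m 0)" "a \<le> ext x m 1" "{a..ext x m 1} \<subseteq> J m (ext x m 0)"
    by (rule ex_left_end[OF ends(1)])
  obtain b where b: "b \<in> ER m (ext x m 0)" "ext z m 1 \<le> b" "{ext z m 1..b} \<subseteq> J m (ext x m 0)"
    by (rule ex_right_end[OF ends(2)])
  have C: "Cf * \<bar>y\<bar> \<ge> 0" using Cf_ge_1 by simp
  have "\<exists>x'. tie 1 \<eta> y m x' \<and> ext x' m 0 = ext x m 0 \<and> ext x' m 1 = a"
  proof (cases "a = ext x m 1")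
    case False
    then have d: "ext x m 1 - a > 2 * Cf * \<bar>y\<bar>" using L a by simp
    obtain w where w: "w \<in> M" "ext w m 0 = ext x m 0" "ext w m 1 = a" using EL_J[OF a(1)] by (auto simp: J_def)
    have "tie 1 \<eta> y m w"
    proof (rule tie_far[OF w(1)])
      show "ext \<eta> m 0 = ext w m 0 + y" using tie_level[OF x] w(2) by simp
      have "ext \<eta> m 1 - ext x m 1 > - (Cf * \<bar>y\<bar>)" using x by (simp add: tie_def)
      then show "Cf * \<bar>y\<bar> < 1 * (ext \<eta> m 1 - ext w m 1)" using d C unfolding w(3) by simp
    qed simp
    then show ?thesis using w by blast
  qed (use x in blast)
  moreover have "\<exists>z'. tie (-1) \<eta> y m z' \<and> ext z' m 0 = ext x m 0 \<and> ext z' m 1 = b"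
  proof (cases "b = ext z m 1")
    case False
    then have d: "b - ext z m 1 > 2 * Cf * \<bar>y\<bar>" using R b by simp
    obtain w where w: "w \<in> M" "ext w m 0 = ext x m 0" "ext w m 1 = b" using ER_J[OF b(1)] by (auto simp: J_def)
    have "tie (-1) \<eta> y m w"
    proof (rule tie_far[OF w(1)])
      show "ext \<eta> m 0 = ext w m 0 + y" using tie_level[OF x] w(2) by simp
      have "- (ext \<eta> m 1 - ext z m 1) > - (Cf * \<bar>y\<bar>)" using z by (simp add: tie_def)
      then show "Cf * \<bar>y\<bar> < - 1 * (ext \<eta> m 1 - ext w m 1)" using d C unfolding w(3) by simp
    qed simp
    then show ?thesis using w by blast
  qed (use z lz in blast)
  moreover have "{a..b} \<subseteq> J m (ext x m 0)"
  proof
    fix s assume "s \<in> {a..b}"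
    then have "s \<in> {a..ext x m 1} \<or> s \<in> {ext x m 1..ext z m 1} \<or> s \<in> {ext z m 1..b}" by auto
    then show "s \<in> J m (ext x m 0)" using a(3) b(3) seg by blast
  qed
  ultimately show ?thesis unfolding allowed_def using a(1,2) b(1,2) xz by (smt (verit))
qed

text \<open>At a discontinuity a point of \<open>M\<close> may carry either of two codes.
  Approaching \<open>e\<close> from the side \<sigma>, where the code is forced to be
  \<open>K\<close>, and passing to a limit in the compact set \<open>M\<close> yields a point with
  the desired one.\<close>

lemma limit_at_disc:
  assumes \<sigma>: "\<sigma> \<in> {-1, 1::real}" and K: "K \<in> \<int>" and \<delta>: "\<delta> > 0"
    and near: "\<And>s. 0 < \<sigma> * (s - e) \<Longrightarrow> \<sigma> * (s - e) < \<delta> \<Longrightarrow> s \<in> J m c \<and> \<bar>phi (m + 1) c s + K\<bar> < 1/2"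
    and e: "\<bar>phi (m + 1) c e + K\<bar> = 1/2"
  shows "\<exists>x\<in>M. ext x m 0 = c \<and> ext x m 1 = e \<and> code x m = K \<and> \<bar>x (m + 1)\<bar> = 1/2"
proof -
  define s where "s k = e + \<sigma> * (\<delta> / real (k + 2))" for k
  have in01: "0 < \<delta> / real (k + 2)" "\<delta> / real (k + 2) < \<delta>" for k
    using \<delta> by (auto simp: field_simps add_pos_nonneg)
  have se: "\<sigma> * (s k - e) = \<delta> / real (k + 2)" for k using \<sigma> by (auto simp: s_def)
  have s: "s k \<in> J m c \<and> \<bar>phi (m + 1) c (s k) + K\<bar> < 1/2" for k
    by (rule near) (use se in01 in auto)
  have "\<exists>x. x \<in> M \<and> ext x m 0 = c \<and> ext x m 1 = s k" for k using s[of k] by (auto simp: J_def)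
  then obtain x where x: "\<And>k. x k \<in> M" "\<And>k. ext (x k) m 0 = c" "\<And>k. ext (x k) m 1 = s k" by metis
  have cx: "code (x k) m = K" for k
  proof -
    have "\<bar>phi (m + 1) c (s k) + code (x k) m\<bar> \<le> 1/2"
      using orbit_abs[OF M_orbit[OF x(1)], of k "m + 1"] orbit_next[of "x k" m] x by simp
    then show ?thesis using Ints_close_eq[OF K orbit_code[OF M_orbit[OF x(1)]]] s by metis
  qed
  have "(\<lambda>k. e + \<sigma> * (\<delta> / real (k + 2))) \<longlonglongrightarrow> e + \<sigma> * 0"
    by (intro tendsto_intros LIMSEQ_ignore_initial_segment[OF lim_const_over_n])
  then have "(\<lambda>k. ext (x k) m 1) \<longlonglongrightarrow> e" unfolding x(3) s_def by simp
  from J_limit[OF x(1) x(2) cx this] obtain z where "z \<in> M" "ext z m 0 = c" "ext z m 1 = e" "code z m = K" by blast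
  then show ?thesis using e orbit_next[of z m] by auto
qed

lemma ex_marked_set:
  "\<exists>F. finite F \<and> (\<forall>m. \<forall>c\<in>levels. EL m c \<subseteq> F \<and> ER m c \<subseteq> F \<and> {e. \<bar>e\<bar> \<le> R \<and> disc m c e} \<subseteq> F)"
proof -
  define F where "F = (\<Union>m\<in>{0..<int h * 2}. \<Union>c\<in>levels. EL m c \<union> ER m c \<union> {e. \<bar>e\<bar> \<le> R \<and> disc m c e})"
  have "finite F" unfolding F_def using finite_levels finite_EL finite_ER finite_bounded_discs by (intro finite_UN_I) auto
  moreover have "EL m c \<subseteq> F \<and> ER m c \<subseteq> F \<and> {e. \<bar>e\<bar> \<le> R \<and> disc m c e} \<subseteq> F" if c: "c \<in> levels" for m c
  proof -
    define k where "k = m mod (int h * 2)"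
    have k: "k \<in> {0..<int h * 2}" using h_pos by (simp add: k_def)
    have d2: "int h * 2 dvd k - m" by (simp add: k_def mod_eq_dvd_iff[symmetric])
    then have Jk: "J m c = J k c" by (metis J_cong dvd_diff_commute)
    have "EL m c = EL k c" "ER m c = ER k c" by (simp_all add: EL_def ER_def gap_def Jk)
    moreover have "disc m c e \<longleftrightarrow> disc k c e" for e
    proof -
      have "2 * int h dvd k + 1 - (m + 1)" "2 * int h dvd k - m" using d2 by (simp_all add: mult.commute)
      then have "U (k + 1) = U (m + 1)" "U k = U m" by (blast intro: U_cong)+
      moreover have "int h dvd k + 1 \<longleftrightarrow> int h dvd m + 1"
        using dvd_add_left_iff[of "int h" "k - m" "m + 1"] dvd_mult_left[OF d2] by (simp add: algebra_simps)
      ultimately show ?thesis by (simp add: disc_def phi_def)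
    qed
    ultimately show ?thesis using k c unfolding F_def by blast
  qed
  ultimately show ?thesis by blast
qed

end

context hitting begin

text \<open>At these times the code depends on the level alone. The sign of \<open>y\<close> moves a
  level \<open>side / 2\<close> into the open interval, and by smallness of \<open>y\<close> every
  other level stays in it.\<close>

lemma code_eq_near_level:
  assumes \<eta>: "strict \<eta>" and x: "x \<in> M" and m: "int h dvd m + 1" and l: "ext \<eta> m 0 = ext x m 0 + y"
    and y: "side * y < 0" "\<bar>y\<bar> < 1/2" "\<And>c. c \<in> levels \<Longrightarrow> \<bar>c\<bar> < 1/2 \<Longrightarrow> \<bar>c\<bar> + \<bar>y\<bar> < 1/2"
  shows "code x m = code \<eta> m"
proof -
  have u: "\<bar>U (- m)\<bar> = 1" using abs_U_near_mult_h[OF m] U_minus[of m] by simp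
  then have uZ: "U (- m) \<in> \<int>" by (metis Ints_1 Ints_minus abs_eq_iff')
  define c where "c = ext x (m + 1) 0"
  have c: "c = ext x m 0 + code x m * U (- m)" using ext_step[of x m 0] by (simp add: c_def)
  have cl: "c \<in> levels" using level_mem[OF x] by (simp add: c_def)
  have cb: "\<bar>c\<bar> \<le> 1/2" using ext_abs_0[OF m, of x] orbit_abs[OF M_orbit[OF x], of "m + 1"] by (simp add: c_def)
  have "\<bar>c + y\<bar> < 1/2"
  proof (cases "\<bar>c\<bar> = 1/2")
    case True
    moreover have "c \<noteq> - side / 2" using side_hit[OF x m] by (simp add: c_def)
    ultimately have "c = side / 2" using side_cases by auto
    then show ?thesis using y side_cases by auto
  next
    case False
    then show ?thesis using y(3)[OF cl] cb by linarith
  qed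
  then have "\<bar>(ext x m 0 + y) + code x m * U (- m)\<bar> < 1/2" unfolding c by (simp add: algebra_simps)
  moreover have "\<bar>(ext x m 0 + y) + code \<eta> m * U (- m)\<bar> \<le> 1/2"
    using ext_abs_0[OF m, of \<eta>] strict_abs[OF \<eta>, of "m + 1"] ext_step[of \<eta> m 0] l by simp
  ultimately have "code x m * U (- m) = code \<eta> m * U (- m)"
    using Ints_close_eq[of "code x m * U (- m)" "code \<eta> m * U (- m)"]
      orbit_code[OF M_orbit[OF x]] orbit_code[OF strict_orbit[OF \<eta>]] uZ by simp
  then show ?thesis using u by auto
qed

text \<open>Between the two discontinuities surrounding \<open>\<eta>\<close> the points of \<open>M\<close> have the code
  of \<open>\<eta>\<close>; a discontinuity that cuts off one end of the component becomes a new end.\<close>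

lemma allowed_cut:
  assumes \<eta>: "strict \<eta>" and al: "allowed \<eta> y m"
    and y: "side * y < 0" "\<bar>y\<bar> < 1/2" "\<And>c. c \<in> levels \<Longrightarrow> \<bar>c\<bar> < 1/2 \<Longrightarrow> \<bar>c\<bar> + \<bar>y\<bar> < 1/2"
    and B: "\<And>c p. p \<in> J m c \<Longrightarrow> \<bar>p\<bar> \<le> B" and W: "\<And>i. 1 / \<bar>U i\<bar> \<le> W"
    and F: "\<And>c. c \<in> levels \<Longrightarrow> EL m c \<subseteq> F" "\<And>c. c \<in> levels \<Longrightarrow> ER m c \<subseteq> F"
      "\<And>c e. c \<in> levels \<Longrightarrow> \<bar>e\<bar> \<le> B + 1 + W \<Longrightarrow> disc m c e \<Longrightarrow> e \<in> F"
    and d0: "\<And>s t. s \<in> F \<Longrightarrow> t \<in> F \<Longrightarrow> s < t \<Longrightarrow> d0 \<le> t - s" and sm: "2 * Cf * \<bar>y\<bar> < d0" "2 * Cf * \<bar>y\<bar> \<le> 1"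
  shows "\<exists>x z c. tie 1 \<eta> y m x \<and> tie (-1) \<eta> y m z \<and> code x m = code \<eta> m \<and> code z m = code \<eta> m \<and>
    ext x m 0 = c \<and> ext z m 0 = c \<and>
    ext x m 1 < ext z m 1 \<and> ext x m 1 \<in> F \<and> ext z m 1 \<in> F \<and> {ext x m 1..ext z m 1} \<subseteq> J m c \<and>
    (\<forall>w\<in>M. ext w m 0 = c \<longrightarrow> ext x m 1 < ext w m 1 \<longrightarrow> ext w m 1 < ext z m 1 \<longrightarrow> code w m = code \<eta> m)"
proof -
  obtain x z where x: "tie 1 \<eta> y m x" and z: "tie (-1) \<eta> y m z" and xz: "ext x m 1 < ext z m 1"
    and seg: "{ext x m 1..ext z m 1} \<subseteq> J m (ext x m 0)"
    and ends: "ext x m 1 \<in> EL m (ext x m 0)" "ext z m 1 \<in> ER m (ext x m 0)"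
    using al by (auto simp: allowed_def)
  define c where "c = ext x m 0"
  have lz: "ext z m 0 = c" using tie_level[OF x] tie_level[OF z] by (simp add: c_def)
  have cl: "c \<in> levels" unfolding c_def by (rule level_mem[OF tie_M[OF x]])
  have eF: "ext x m 1 \<in> F" "ext z m 1 \<in> F" using ends F(1,2)[OF cl] by (auto simp: c_def)
  define K where "K = code \<eta> m"
  have KZ: "K \<in> \<int>" using orbit_code[OF strict_orbit[OF \<eta>]] by (simp add: K_def)
  have le: "ext \<eta> m 0 = c + y" using tie_level[OF x] by (simp add: c_def)
  show ?thesis
  proof (cases "int h dvd m + 1")
    case True
    have "code w m = K" if "w \<in> M" "ext w m 0 = c" for w
      unfolding K_def by (rule code_eq_near_level[OF \<eta> that(1) True _ y]) (use le that in simp)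
    then show ?thesis using x z xz seg eF lz tie_M[OF x] tie_M[OF z] unfolding K_def c_def by blast
  next
    case False
    then have U0: "U (m + 1) \<noteq> 0" by (simp add: U_eq_0_iff)
    \<comment> \<open>With the code \<open>K\<close> of \<eta> the next value at position s is
      \<open>U (m + 1) * (s - q0)\<close>. So \<open>K\<close> keeps it strictly inside the square
      exactly for s between \<open>q0 - r\<close> and \<open>q0 + r\<close>.\<close>
    define r where "r = 1 / (2 * \<bar>U (m + 1)\<bar>)"
    define q0 where "q0 = (U m * c - K) / U (m + 1)"
    have r: "r > 0" using U0 by (simp add: r_def)
    have phi_q: "phi (m + 1) c s + K = U (m + 1) * (s - q0)" for s
      using U0 by (simp add: phi_def q0_def field_simps)
    have half: "\<bar>U (m + 1)\<bar> * r = 1/2" using U0 by (simp add: r_def)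
    have val_less: "\<bar>phi (m + 1) c s + K\<bar> < 1/2 \<longleftrightarrow> \<bar>s - q0\<bar> < r" for s
      unfolding phi_q abs_mult half[symmetric] using U0 by simp
    have val_eq: "\<bar>phi (m + 1) c s + K\<bar> = 1/2 \<longleftrightarrow> \<bar>s - q0\<bar> = r" for s
      unfolding phi_q abs_mult half[symmetric] using U0 by simp
    define p where "p = ext \<eta> m 1"
    \<comment> \<open>The projection of \<eta> to the level along the boundary direction of time
      \<open>m + 1\<close>. Since \<eta> is strict, \<open>P\<close> lies strictly inside that
      interval, and \<open>foot\<close> measures positions relative to it.\<close>
    define P where "P = p - U m / U (m + 1) * y"
    have ft: "foot (m + 1) y (p - s) = P - s" for s by (simp add: foot_def P_def)
    have Pp: "\<bar>P - p\<bar> \<le> Cf * \<bar>y\<bar>" using foot_close[of "m + 1" y p] by (simp add: foot_def P_def)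
    have Pq: "\<bar>P - q0\<bar> < r"
    proof -
      have "\<eta> (m + 1) = phi (m + 1) (c + y) p + K" using orbit_next[of \<eta> m] le by (simp add: p_def K_def)
      also have "\<dots> = U (m + 1) * (P - q0)" using U0 by (simp add: phi_def q0_def P_def field_simps)
      finally have "\<bar>U (m + 1)\<bar> * \<bar>P - q0\<bar> < \<bar>U (m + 1)\<bar> * r"
        using strict_abs[OF \<eta>, of "m + 1"] by (simp add: half abs_mult)
      then show ?thesis using U0 by simp
    qed
    define a b where "a = ext x m 1" and "b = ext z m 1"
    define e e' where "e = q0 - r" and "e' = q0 + r"
    have ee: "e < P" "P < e'" using Pq by (auto simp: e_def e'_def)
    have aP: "a < P + 2 * (Cf * \<bar>y\<bar>)" "P < b + 2 * (Cf * \<bar>y\<bar>)"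
    proof -
      have "a < p + Cf * \<bar>y\<bar>" using x by (simp add: tie_def a_def p_def)
      then show "a < P + 2 * (Cf * \<bar>y\<bar>)" using Pp by linarith
      have "p < b + Cf * \<bar>y\<bar>" using z by (simp add: tie_def b_def p_def)
      then show "P < b + 2 * (Cf * \<bar>y\<bar>)" using Pp by linarith
    qed
    have aB: "\<bar>a\<bar> \<le> B" "\<bar>b\<bar> \<le> B"
      using B ends EL_J ER_J unfolding a_def b_def by blast+
    have inner: "code w m = K" if w: "w \<in> M" "ext w m 0 = c" "e < ext w m 1" "ext w m 1 < e'" for w
    proof -
      have "\<bar>phi (m + 1) c (ext w m 1) + K\<bar> < 1/2" unfolding val_less using w by (auto simp: e_def e'_def)
      moreover have "\<bar>phi (m + 1) c (ext w m 1) + code w m\<bar> \<le> 1/2"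
        using orbit_abs[OF M_orbit[OF w(1)], of "m + 1"] orbit_next[of w m] w by simp
      ultimately show ?thesis using Ints_close_eq[OF KZ orbit_code[OF M_orbit[OF w(1)]]] by metis
    qed
    have hit_end: "\<bar>w (m + 1)\<bar> = 1/2" if w: "w \<in> M" "ext w m 0 = c" "ext w m 1 = e \<or> ext w m 1 = e'" for w
    proof -
      have "\<bar>phi (m + 1) c (ext w m 1) + K\<bar> = 1/2" unfolding val_eq using w r by (auto simp: e_def e'_def)
      then have "phi (m + 1) c (ext w m 1) + K + 1/2 = 1 \<or> phi (m + 1) c (ext w m 1) + K + 1/2 = 0" by linarith
      then have "phi (m + 1) c (ext w m 1) + K + 1/2 \<in> \<int>" by auto
      then have "phi (m + 1) c (ext w m 1) + K + 1/2 + (code w m - K) \<in> \<int>"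
        by (rule Ints_add[OF _ Ints_diff[OF orbit_code[OF M_orbit[OF w(1)]] KZ]])
      then have "w (m + 1) + 1/2 \<in> \<int>" using orbit_next[of w m] w(2) by (simp add: algebra_simps)
      then show ?thesis using Ints_half_abs orbit_abs[OF M_orbit[OF w(1)]] by blast
    qed
    have d_end: "disc m c t" if "t = e \<or> t = e'" for t
    proof -
      have "\<bar>phi (m + 1) c t + K\<bar> = 1/2" unfolding val_eq using that r by (auto simp: e_def e'_def)
      then have "phi (m + 1) c t + K = 1/2 \<or> phi (m + 1) c t + K = - 1/2" by (auto simp: abs_if split: if_splits)
      then have "phi (m + 1) c t + 1/2 = 1 - K \<or> phi (m + 1) c t + 1/2 = - K" by linarith
      then show ?thesis using False KZ by (auto simp: disc_def)
    qed
    have W2: "2 * r \<le> W" using W[of "m + 1"] by (simp add: r_def)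
    \<comment> \<open>If \<open>e\<close> were \<open>b\<close> itself, the tie of \<open>z\<close>
      would put \<open>P\<close> strictly to the left of \<open>e\<close>. If \<open>e\<close> were
      beyond \<open>b\<close>, it would be so by at least \<open>d0\<close>, as both are marked
      points, while \<open>P\<close> exceeds \<open>b\<close> by less than
      \<open>d0\<close>.\<close>
    have eb: "e < b"
    proof (rule ccontr)
      assume "\<not> e < b"
      then consider "e = b" | "b < e" by linarith
      then show False
      proof cases
        case 1
        then have "\<bar>z (m + 1)\<bar> = 1/2" using hit_end[OF tie_M[OF z] lz] by (simp add: b_def)
        then have "- 1 * foot (m + 1) y (p - b) > 0" using z False unfolding tie_def p_def b_def by blast
        then show False unfolding ft using ee 1 by simp
      next
        case 2
        have "\<bar>e\<bar> \<le> B + 1 + W" using 2 ee aP aB sm(2) W2 r by (simp add: abs_le_iff)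
        then have "e \<in> F" using F(3)[OF cl _ d_end] by blast
        then have "d0 \<le> e - b" using d0[of b e] eF 2 by (simp add: b_def)
        then show False using ee aP sm by linarith
      qed
    qed
    have ae: "a < e'"
    proof (rule ccontr)
      assume "\<not> a < e'"
      then consider "e' = a" | "e' < a" by linarith
      then show False
      proof cases
        case 1
        then have "\<bar>x (m + 1)\<bar> = 1/2" using hit_end[OF tie_M[OF x] c_def[symmetric]] by (simp add: a_def)
        then have "1 * foot (m + 1) y (p - a) > 0" using x False unfolding tie_def p_def a_def by blast
        then show False unfolding ft using ee 1 by simp
      next
        case 2
        have "\<bar>e'\<bar> \<le> B + 1 + W" using 2 ee aP aB sm(2) W2 r by (simp add: abs_le_iff)
        then have "e' \<in> F" using F(3)[OF cl _ d_end] by blast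
        then have "d0 \<le> a - e'" using d0[of e' a] eF 2 by (simp add: a_def)
        then show False using ee aP sm by linarith
      qed
    qed
    have segc: "s \<in> J m c" if "a \<le> s" "s \<le> b" for s using seg that by (auto simp: a_def b_def c_def)
    have lim: "s \<in> J m c \<and> \<bar>phi (m + 1) c s + K\<bar> < 1/2" if "max a e < s" "s < min b e'" for s
      using segc that unfolding val_less by (auto simp: e_def e'_def)
    have ab: "max a e < min b e'" using xz eb ae r by (simp add: a_def b_def e_def e'_def)
    \<comment> \<open>The left end either survives or is replaced by a point of \<open>M\<close> at
      the discontinuity \<open>e\<close>. That point hits the boundary at time \<open>m + 1\<close>,
      so \<open>e < P\<close> alone gives its tie.\<close>
    have X: "\<exists>x1. tie 1 \<eta> y m x1 \<and> code x1 m = K \<and> ext x1 m 0 = c \<and> ext x1 m 1 = max a e \<and> max a e \<in> F"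
    proof (cases "a > e")
      case True
      have "code x m = K" using inner[OF tie_M[OF x] c_def[symmetric]] True ae by (simp add: a_def)
      then show ?thesis using x True eF by (intro exI[of _ x]) (auto simp: a_def c_def)
    next
      case ea: False
      then have mx: "max a e = e" by simp
      have "\<exists>x1\<in>M. ext x1 m 0 = c \<and> ext x1 m 1 = e \<and> code x1 m = K \<and> \<bar>x1 (m + 1)\<bar> = 1/2"
      proof (rule limit_at_disc[where \<sigma> = 1, OF _ KZ])
        show "min b e' - e > 0" using ab mx by simp
        show "s \<in> J m c \<and> \<bar>phi (m + 1) c s + K\<bar> < 1 / 2" if "0 < 1 * (s - e)" "1 * (s - e) < min b e' - e" for s
          using lim[of s] that mx by simp
        show "\<bar>phi (m + 1) c e + K\<bar> = 1 / 2" unfolding val_eq using r by (simp add: e_def)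
      qed simp
      then obtain x1 where x1: "x1 \<in> M" "ext x1 m 0 = c" "ext x1 m 1 = e" "code x1 m = K" "\<bar>x1 (m + 1)\<bar> = 1/2" by blast
      have "tie 1 \<eta> y m x1"
        by (rule tie_disc[OF x1(1) _ False x1(5)]) (use le x1 ee ft[of e] in \<open>simp_all add: p_def\<close>)
      moreover have "e \<in> F"
      proof -
        have "\<bar>e\<bar> \<le> B + 1 + W" using ea eb W2 aB r by (simp add: abs_le_iff)
        then show ?thesis using F(3)[OF cl _ d_end] by blast
      qed
      ultimately show ?thesis using x1 mx by auto
    qed
    have Z: "\<exists>z1. tie (-1) \<eta> y m z1 \<and> code z1 m = K \<and> ext z1 m 0 = c \<and> ext z1 m 1 = min b e' \<and> min b e' \<in> F"
    proof (cases "b < e'")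
      case True
      have "code z m = K" using inner[OF tie_M[OF z] lz] True eb by (simp add: b_def)
      then show ?thesis using z True eF lz by (intro exI[of _ z]) (auto simp: b_def)
    next
      case ea: False
      then have mx: "min b e' = e'" by simp
      have "\<exists>x1\<in>M. ext x1 m 0 = c \<and> ext x1 m 1 = e' \<and> code x1 m = K \<and> \<bar>x1 (m + 1)\<bar> = 1/2"
      proof (rule limit_at_disc[where \<sigma> = "-1", OF _ KZ])
        show "e' - max a e > 0" using ab mx by simp
        show "s \<in> J m c \<and> \<bar>phi (m + 1) c s + K\<bar> < 1 / 2" if "0 < - 1 * (s - e')" "- 1 * (s - e') < e' - max a e" for s
          using lim[of s] that mx by simp
        show "\<bar>phi (m + 1) c e' + K\<bar> = 1 / 2" unfolding val_eq using r by (simp add: e'_def)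
      qed simp
      then obtain x1 where x1: "x1 \<in> M" "ext x1 m 0 = c" "ext x1 m 1 = e'" "code x1 m = K" "\<bar>x1 (m + 1)\<bar> = 1/2" by blast
      have "tie (-1) \<eta> y m x1"
        by (rule tie_disc[OF x1(1) _ False x1(5)]) (use le x1 ee ft[of e'] in \<open>simp_all add: p_def\<close>)
      moreover have "e' \<in> F"
      proof -
        have "\<bar>e'\<bar> \<le> B + 1 + W" using ea ae W2 aB r by (simp add: abs_le_iff)
        then show ?thesis using F(3)[OF cl _ d_end] by blast
      qed
      ultimately show ?thesis using x1 mx by auto
    qed
    obtain x1 where x1: "tie 1 \<eta> y m x1" "code x1 m = K" "ext x1 m 0 = c" "ext x1 m 1 = max a e" "max a e \<in> F"
      using X by blast
    obtain z1 where z1: "tie (-1) \<eta> y m z1" "code z1 m = K" "ext z1 m 0 = c" "ext z1 m 1 = min b e'" "min b e' \<in> F"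
      using Z by blast
    show ?thesis
    proof (rule exI[of _ x1], rule exI[of _ z1], rule exI[of _ c], intro conjI)
      show "{ext x1 m 1..ext z1 m 1} \<subseteq> J m c" using segc by (auto simp: x1 z1)
      show "\<forall>w\<in>M. ext w m 0 = c \<longrightarrow> ext x1 m 1 < ext w m 1 \<longrightarrow> ext w m 1 < ext z1 m 1 \<longrightarrow> code w m = code \<eta> m"
        using inner by (auto simp: x1 z1 K_def)
    qed (use x1 z1 ab in \<open>auto simp: K_def\<close>)
  qed
qed

text \<open>The part of the component left after cutting has the code of \<eta>, hence moves rigidly
  along with \<eta>. It is then enlarged to the full component that contains its image.\<close>

lemma allowed_step:
  "\<exists>h0>0. \<forall>\<eta> y m. strict \<eta> \<longrightarrow> y \<noteq> 0 \<longrightarrow> \<bar>y\<bar> < h0 \<longrightarrow> side * y < 0 \<longrightarrow> allowed \<eta> y m \<longrightarrow> allowed \<eta> y (m + 1)"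
proof -
  obtain B where B: "B > 0" "\<And>m c p. p \<in> J m c \<Longrightarrow> \<bar>p\<bar> \<le> B" using J_bound by blast
  obtain W where W: "\<And>i. 1 / \<bar>U i\<bar> \<le> W" using ex_inverse_U_bound by blast
  obtain F where F: "finite F" "\<And>m c. c \<in> levels \<Longrightarrow> EL m c \<subseteq> F" "\<And>m c. c \<in> levels \<Longrightarrow> ER m c \<subseteq> F"
    "\<And>m c e. c \<in> levels \<Longrightarrow> \<bar>e\<bar> \<le> B + 1 + W \<Longrightarrow> disc m c e \<Longrightarrow> e \<in> F"
    using ex_marked_set[of "B + 1 + W"] by blast
  \<comment> \<open>The ends are marked before the step, those of the image component after it; so
    marked points are compared up to the translations \<open>k * U i\<close> of a single
    step.\<close>
  have "finite ((\<lambda>(s, t, k, u). t - s - k * u) ` (F \<times> F \<times> {-1, 0, 1} \<times> range U))"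
    using F(1) finite_range_U by blast
  from ex_pos_lower_bound[OF this]
  obtain d0 where d': "d0 > 0" "\<forall>s\<in>(\<lambda>(s, t, k, u). t - s - k * u) ` (F \<times> F \<times> {-1, 0, 1} \<times> range U). s \<noteq> 0 \<longrightarrow> d0 \<le> \<bar>s\<bar>"
    by blast
  have d: "d0 > 0" "\<And>s t k i. s \<in> F \<Longrightarrow> t \<in> F \<Longrightarrow> k \<in> {-1, 0, 1} \<Longrightarrow> t - s - k * U i \<noteq> 0 \<Longrightarrow> d0 \<le> \<bar>t - s - k * U i\<bar>"
  proof -
    fix s t k :: real and i
    assume "s \<in> F" "t \<in> F" "k \<in> {-1, 0, 1}" and ne: "t - s - k * U i \<noteq> 0"
    then have "(s, t, k, U i) \<in> F \<times> F \<times> {-1, 0, 1} \<times> range U" by blast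
    from bspec[OF d'(2) imageI[OF this]] ne show "d0 \<le> \<bar>t - s - k * U i\<bar>" by simp
  qed (rule d'(1))
  have d0: "d0 \<le> t - s" if "s \<in> F" "t \<in> F" "s < t" for s t using d(2)[of s t 0] that by simp
  have "finite ((\<lambda>c. 1/2 - \<bar>c\<bar>) ` levels)" using finite_levels by simp
  from ex_pos_lower_bound[OF this]
  obtain d1 where d1: "d1 > 0" "\<And>c. c \<in> levels \<Longrightarrow> 1/2 - \<bar>c\<bar> \<noteq> 0 \<Longrightarrow> d1 \<le> \<bar>1/2 - \<bar>c\<bar>\<bar>" by auto
  \<comment> \<open>The three bounds give \<open>4 * Cf * \<bar>y\<bar> < d0\<close>, room for the
    levels in the open interval (-1/2, 1/2), and \<open>2 * Cf * \<bar>y\<bar> < 1\<close>.\<close>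
  define h0 where "h0 = min (min (d0 / (4 * Cf)) d1) (1 / (2 * Cf))"
  have C: "Cf \<ge> 1" by (rule Cf_ge_1)
  have "h0 > 0" using d(1) d1(1) C by (simp add: h0_def)
  moreover have "allowed \<eta> y (m + 1)" if \<eta>: "strict \<eta>" and y: "y \<noteq> 0" "\<bar>y\<bar> < h0" "side * y < 0" and al: "allowed \<eta> y m" for \<eta> y m
  proof -
    have sm0: "\<bar>y\<bar> < d0 / (4 * Cf)" "\<bar>y\<bar> < d1" "\<bar>y\<bar> < 1 / (2 * Cf)" using y(2) by (simp_all add: h0_def)
    have sm: "4 * Cf * \<bar>y\<bar> < d0" "2 * Cf * \<bar>y\<bar> < 1" using sm0 C by (simp_all add: field_simps)
    have "1 * \<bar>y\<bar> \<le> Cf * \<bar>y\<bar>" using C by (intro mult_right_mono) auto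
    then have y2: "\<bar>y\<bar> < 1/2" and sm': "2 * Cf * \<bar>y\<bar> < d0" "2 * Cf * \<bar>y\<bar> \<le> 1" using sm by linarith+
    have y3: "\<bar>c\<bar> + \<bar>y\<bar> < 1/2" if "c \<in> levels" "\<bar>c\<bar> < 1/2" for c using d1(2)[OF that(1)] that(2) sm0(2) by linarith
    obtain x z c where x: "tie 1 \<eta> y m x" "code x m = code \<eta> m" "ext x m 0 = c" "ext x m 1 \<in> F"
      and z: "tie (-1) \<eta> y m z" "code z m = code \<eta> m" "ext z m 0 = c" "ext z m 1 \<in> F"
      and xz: "ext x m 1 < ext z m 1" "{ext x m 1..ext z m 1} \<subseteq> J m c"
        "\<And>w. w \<in> M \<Longrightarrow> ext w m 0 = c \<Longrightarrow> ext x m 1 < ext w m 1 \<Longrightarrow> ext w m 1 < ext z m 1 \<Longrightarrow> code w m = code \<eta> m"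
    proof -
      have "\<exists>x z c. tie 1 \<eta> y m x \<and> tie (-1) \<eta> y m z \<and> code x m = code \<eta> m \<and> code z m = code \<eta> m \<and>
        ext x m 0 = c \<and> ext z m 0 = c \<and>
        ext x m 1 < ext z m 1 \<and> ext x m 1 \<in> F \<and> ext z m 1 \<in> F \<and> {ext x m 1..ext z m 1} \<subseteq> J m c \<and>
        (\<forall>w\<in>M. ext w m 0 = c \<longrightarrow> ext x m 1 < ext w m 1 \<longrightarrow> ext w m 1 < ext z m 1 \<longrightarrow> code w m = code \<eta> m)"
      proof (rule allowed_cut[OF \<eta> al y(3) y2 _ _ W _ _ _ _ sm'])
        show "\<bar>p\<bar> \<le> B" if "p \<in> J m c" for c p using B(2) that .
        show "EL m c \<subseteq> F" "ER m c \<subseteq> F" if "c \<in> levels" for c using F(2,3) that by blast+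
        show "e \<in> F" if "c \<in> levels" "\<bar>e\<bar> \<le> B + 1 + W" "disc m c e" for c e using F(4) that .
      qed (use y3 d0 in auto)
      then show thesis using that by blast
    qed
    define K where "K = code \<eta> m"
    have K: "K \<in> {-1, 0, 1}" using code_cases[OF strict_orbit[OF \<eta>]] by (simp add: K_def)
    have st: "ext w (m + 1) 0 = ext w m 0 + K * U (- m)" "ext w (m + 1) 1 = ext w m 1 + K * U (1 - m)"
      if "code w m = code \<eta> m" for w
      using ext_step[of w m 0] ext_step[of w m 1] that by (simp_all add: K_def)
    have cl: "ext x (m + 1) 0 \<in> levels" by (rule level_mem[OF tie_M[OF x(1)]])
    show ?thesis
    proof (rule allowed_extend[OF tie_step[OF x(1,2)] tie_step[OF z(1,2)]])
      show "ext x (m + 1) 1 < ext z (m + 1) 1" using st x z xz by simp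
      show "{ext x (m + 1) 1..ext z (m + 1) 1} \<subseteq> J (m + 1) (ext x (m + 1) 0)"
      proof
        fix s assume s: "s \<in> {ext x (m + 1) 1..ext z (m + 1) 1}"
        define s' where "s' = s - K * U (1 - m)"
        have s': "ext x m 1 \<le> s'" "s' \<le> ext z m 1" using s st[OF x(2)] st[OF z(2)] by (auto simp: s'_def)
        obtain w where w: "w \<in> M" "ext w m 0 = c" "ext w m 1 = s'" using xz(2) s' by (auto simp: J_def)
        consider "s' = ext x m 1" | "s' = ext z m 1" | "ext x m 1 < s'" "s' < ext z m 1" using s' by linarith
        then have "\<exists>w\<in>M. ext w m 0 = c \<and> ext w m 1 = s' \<and> code w m = code \<eta> m"
        proof cases
          case 3 then show ?thesis using xz(3) w by blast
        qed (use x z tie_M in blast)+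
        then obtain v where v: "v \<in> M" "ext v m 0 = c" "ext v m 1 = s'" "code v m = code \<eta> m" by blast
        then have "ext v (m + 1) 1 = s" "ext v (m + 1) 0 = ext x (m + 1) 0"
          using st[OF v(4)] st[OF x(2)] x(3) by (simp_all add: s'_def)
        then show "s \<in> J (m + 1) (ext x (m + 1) 0)" using J_I[OF v(1), of "m + 1"] by simp
      qed
      show "2 * Cf * \<bar>y\<bar> < ext x (m + 1) 1 - a" if a: "a \<in> EL (m + 1) (ext x (m + 1) 0)" "a < ext x (m + 1) 1" for a
      proof -
        have "a \<in> F" using F(2)[OF cl] a by blast
        moreover have "- K \<in> {-1, 0, 1}" using K by auto
        ultimately have "d0 \<le> \<bar>ext x m 1 - a - (- K) * U (1 - m)\<bar>" using d(2)[of a "ext x m 1" "- K" "1 - m"] x(4) a(2) st[OF x(2)] by simp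
        then show ?thesis using a(2) st[OF x(2)] sm' by simp
      qed
      show "2 * Cf * \<bar>y\<bar> < b - ext z (m + 1) 1" if b: "b \<in> ER (m + 1) (ext x (m + 1) 0)" "ext z (m + 1) 1 < b" for b
      proof -
        have "b \<in> F" using F(3)[OF cl] b by blast
        then have "d0 \<le> \<bar>b - ext z m 1 - K * U (1 - m)\<bar>" using d(2)[of "ext z m 1" b K "1 - m"] z(4) b(2) st[OF z(2)] K by simp
        then show ?thesis using b(2) st[OF z(2)] sm' by simp
      qed
    qed
  qed
  ultimately show ?thesis by blast
qed

end

section \<open>From confined strict orbits to their limits\<close>

context hitting begin

text \<open>\<open>x0\<close> is the midpoint of a nondegenerate segment, so strict orbits near it
  are far from both ends and the ties are automatic. At the next hit of \<open>x0\<close> of phase 0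
  these orbits are strictly inside the square, which determines the sign of \<open>y\<close> and
  rules out \<open>y = 0\<close>.\<close>

lemma allowed_start:
  "\<exists>x0\<in>M. \<forall>\<eta> h0. (\<forall>k. strict (\<eta> k)) \<longrightarrow> \<eta> \<longlonglongrightarrow> x0 \<longrightarrow> h0 > 0 \<longrightarrow>
     eventually (\<lambda>k. \<exists>y. y \<noteq> 0 \<and> \<bar>y\<bar> < h0 \<and> side * y < 0 \<and> allowed (\<eta> k) y 0) sequentially"
proof -
  obtain c a b where ab: "a < b" "{a..b} \<subseteq> J 0 c" using ex_nondegenerate by blast
  define q where "q = (a + b) / 2"
  have q: "a < q" "q < b" using ab by (auto simp: q_def)
  obtain x0 where x0: "x0 \<in> M" "ext x0 0 0 = c" "ext x0 0 1 = q"
  proof -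
    have "q \<in> J 0 c" using ab q by auto
    then show thesis using that by (auto simp: J_def)
  qed
  have "a \<in> J 0 c" "b \<in> J 0 c" using ab by auto
  obtain a' where a': "a' \<in> EL 0 c" "a' \<le> a" "{a'..a} \<subseteq> J 0 c" by (rule ex_left_end[OF \<open>a \<in> J 0 c\<close>])
  obtain b' where b': "b' \<in> ER 0 c" "b \<le> b'" "{b..b'} \<subseteq> J 0 c" by (rule ex_right_end[OF \<open>b \<in> J 0 c\<close>])
  obtain x where x: "x \<in> M" "ext x 0 0 = c" "ext x 0 1 = a'" using EL_J[OF a'(1)] by (auto simp: J_def)
  obtain z where z: "z \<in> M" "ext z 0 0 = c" "ext z 0 1 = b'" using ER_J[OF b'(1)] by (auto simp: J_def)
  have seg: "{a'..b'} \<subseteq> J 0 c"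
  proof
    fix s assume "s \<in> {a'..b'}"
    then have "s \<in> {a'..a} \<or> s \<in> {a..b} \<or> s \<in> {b..b'}" by auto
    then show "s \<in> J 0 c" using a' b' ab by blast
  qed
  obtain j where j: "j \<ge> 0" "\<bar>x0 (2 * int h * j)\<bar> = 1/2"
  proof -
    obtain L where "\<And>x j. x \<in> M \<Longrightarrow> \<exists>k\<in>{j..j + L}. \<bar>x (2 * int h * k)\<bar> = 1/2" using M_hit by blast
    from this[OF x0(1), of 0] show thesis using that by auto
  qed
  define n where "n = 2 * int h * j"
  have n: "n \<ge> 0" "int h dvd n" using j by (auto simp: n_def)
  have "\<bar>ext x0 n 0\<bar> = 1/2" using ext_abs_0[OF n(2)] j(2) by (simp add: n_def)
  moreover have "ext x0 n 0 \<noteq> - side / 2" using side_hit x0(1) n(2) by blast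
  ultimately have sn: "ext x0 n 0 = side / 2" using side_cases by auto
  show ?thesis
  proof (rule bexI[OF _ x0(1)], intro allI impI)
    fix \<eta> :: "nat \<Rightarrow> int \<Rightarrow> real" and h0 :: real
    assume \<eta>: "\<forall>k. strict (\<eta> k)" "\<eta> \<longlonglongrightarrow> x0" and h0: "h0 > 0"
    define Y where "Y k = ext (\<eta> k) 0 0 - c" for k
    have "(\<lambda>k. ext (\<eta> k) 0 0) \<longlonglongrightarrow> c" using tendsto_ext[OF \<eta>(2), of 0 0] x0(2) by simp
    then have Y0: "Y \<longlonglongrightarrow> 0" unfolding Y_def by (simp add: LIM_zero)
    then have CY0: "(\<lambda>k. Cf * \<bar>Y k\<bar>) \<longlonglongrightarrow> 0" by (intro tendsto_mult_right_zero tendsto_rabs_zero)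
    have P: "(\<lambda>k. ext (\<eta> k) 0 1) \<longlonglongrightarrow> q" using tendsto_ext[OF \<eta>(2), of 0 1] x0(3) by simp
    define d where "d = (b - a) / 4"
    have d: "d > 0" using ab by (simp add: d_def)
    have "eventually (\<lambda>k. dist (Y k) 0 < h0) sequentially" using Y0 h0 by (rule tendstoD)
    moreover have "eventually (\<lambda>k. dist (Cf * \<bar>Y k\<bar>) 0 < d) sequentially" using CY0 d by (rule tendstoD)
    moreover have "eventually (\<lambda>k. dist (ext (\<eta> k) 0 1) q < d) sequentially" using P d by (rule tendstoD)
    moreover have "eventually (\<lambda>k. \<forall>l\<in>{0..n}. code (\<eta> k) l = code x0 l) sequentially"
      by (rule eventually_code_eq[OF _ \<eta>(2)]) (use \<eta>(1) strict_orbit in blast)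
    ultimately show "eventually (\<lambda>k. \<exists>y. y \<noteq> 0 \<and> \<bar>y\<bar> < h0 \<and> side * y < 0 \<and> allowed (\<eta> k) y 0) sequentially"
    proof eventually_elim
      case (elim k)
      have "ext (\<eta> k) n 0 - ext (\<eta> k) 0 0 = ext x0 n 0 - ext x0 0 0"
        by (rule ext_diff_eq) (use n elim in auto)
      then have "ext (\<eta> k) n 0 = side / 2 + Y k" using sn x0(2) by (simp add: Y_def)
      moreover have "\<bar>ext (\<eta> k) n 0\<bar> < 1/2" using ext_abs_0[OF n(2)] \<eta>(1) strict_abs by simp
      ultimately have "side / 2 + Y k < 1/2" "- (1/2) < side / 2 + Y k" by linarith+
      then have s: "side * Y k < 0" using side_cases by auto
      have pd: "q - d < ext (\<eta> k) 0 1" "ext (\<eta> k) 0 1 < q + d" using elim(3) by (auto simp: dist_real_def)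
      have qd: "a + 2 * d = q" "b - 2 * d = q" by (auto simp: q_def d_def field_simps)
      have Cd: "Cf * \<bar>Y k\<bar> < d" using elim(2) by (simp add: dist_real_def)
      have "tie 1 (\<eta> k) (Y k) 0 x"
        by (rule tie_far[OF x(1)]) (use x pd qd Cd a' in \<open>simp_all add: Y_def\<close>)
      moreover have "tie (-1) (\<eta> k) (Y k) 0 z"
        by (rule tie_far[OF z(1)]) (use z pd qd Cd b' in \<open>simp_all add: Y_def\<close>)
      ultimately have "allowed (\<eta> k) (Y k) 0"
        unfolding allowed_def using x z a' b' ab seg by (intro exI[of _ x] exI[of _ z]) auto
      then show ?case using s elim(1) by (intro exI[of _ "Y k"]) auto
    qed
  qed
qed

lemma allowed_close:
  assumes "allowed \<eta> y m"
  shows "\<exists>w\<in>M. ext \<eta> m 0 = ext w m 0 + y \<and> \<bar>ext \<eta> m 1 - ext w m 1\<bar> \<le> Cf * \<bar>y\<bar>"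
proof -
  obtain x z where x: "tie 1 \<eta> y m x" and z: "tie (-1) \<eta> y m z" and xz: "ext x m 1 < ext z m 1"
    "{ext x m 1..ext z m 1} \<subseteq> J m (ext x m 0)"
    using assms by (auto simp: allowed_def)
  define s where "s = max (ext x m 1) (min (ext z m 1) (ext \<eta> m 1))"
  have "s \<in> J m (ext x m 0)" using xz by (auto simp: s_def)
  then obtain w where w: "w \<in> M" "ext w m 0 = ext x m 0" "ext w m 1 = s" by (auto simp: J_def)
  have b: "ext x m 1 < ext \<eta> m 1 + Cf * \<bar>y\<bar>" "ext \<eta> m 1 < ext z m 1 + Cf * \<bar>y\<bar>" using x z by (simp_all add: tie_def)
  have "Cf * \<bar>y\<bar> \<ge> 0" using Cf_ge_1 by simp
  then have "\<bar>ext \<eta> m 1 - s\<bar> \<le> Cf * \<bar>y\<bar>" using b xz(1) by (auto simp: s_def max_def min_def)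
  then show ?thesis using w tie_level[OF x] by (intro bexI[of _ w]) auto
qed

lemma confined_open:
  "\<exists>x0\<in>M. \<forall>\<delta>>0. \<exists>V. open V \<and> x0 \<in> V \<and> (\<forall>\<eta>\<in>V. strict \<eta> \<longrightarrow>
     (\<exists>y. \<bar>y\<bar> < \<delta> \<and> (\<forall>m. \<exists>w\<in>M. ext \<eta> m 0 = ext w m 0 + y \<and> \<bar>ext \<eta> m 1 - ext w m 1\<bar> \<le> \<delta>)))"
proof -
  obtain x0 where x0: "x0 \<in> M" "\<And>\<eta> h0. (\<And>k. strict (\<eta> k)) \<Longrightarrow> \<eta> \<longlonglongrightarrow> x0 \<Longrightarrow> h0 > 0 \<Longrightarrow>
     eventually (\<lambda>k. \<exists>y. y \<noteq> 0 \<and> \<bar>y\<bar> < h0 \<and> side * y < 0 \<and> allowed (\<eta> k) y 0) sequentially"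
    using allowed_start by blast
  obtain h1 where h1: "h1 > 0" "\<And>\<eta> y m. strict \<eta> \<Longrightarrow> y \<noteq> 0 \<Longrightarrow> \<bar>y\<bar> < h1 \<Longrightarrow> side * y < 0 \<Longrightarrow>
     allowed \<eta> y m \<Longrightarrow> allowed \<eta> y (m + 1)"
    using allowed_step by blast
  have "\<exists>V. open V \<and> x0 \<in> V \<and> (\<forall>\<eta>\<in>V. strict \<eta> \<longrightarrow>
     (\<exists>y. \<bar>y\<bar> < \<delta> \<and> (\<forall>m. \<exists>w\<in>M. ext \<eta> m 0 = ext w m 0 + y \<and> \<bar>ext \<eta> m 1 - ext w m 1\<bar> \<le> \<delta>)))" if \<delta>: "\<delta> > 0" for \<delta>
  proof (rule ccontr)
    assume neg: "\<not> ?thesis"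
    define Q where "Q \<eta> \<longleftrightarrow> (\<exists>y. \<bar>y\<bar> < \<delta> \<and> (\<forall>m. \<exists>w\<in>M. ext \<eta> m 0 = ext w m 0 + y \<and> \<bar>ext \<eta> m 1 - ext w m 1\<bar> \<le> \<delta>))" for \<eta>
    have "\<exists>\<eta>. \<eta> \<in> ball x0 (1 / real (Suc k)) \<and> strict \<eta> \<and> \<not> Q \<eta>" for k
    proof (rule ccontr)
      assume "\<not> ?thesis"
      then have "open (ball x0 (1 / real (Suc k))) \<and> x0 \<in> ball x0 (1 / real (Suc k)) \<and>
        (\<forall>\<eta>\<in>ball x0 (1 / real (Suc k)). strict \<eta> \<longrightarrow> Q \<eta>)" by auto
      then show False using neg unfolding Q_def by blast
    qed
    then obtain \<eta> where \<eta>: "\<And>k. \<eta> k \<in> ball x0 (1 / real (Suc k))" "\<And>k. strict (\<eta> k)" "\<And>k. \<not> Q (\<eta> k)" by metis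
    have "\<eta> \<longlonglongrightarrow> x0"
    proof (rule metric_LIMSEQ_I)
      fix r :: real assume "r > 0"
      then obtain N where N: "1 / real (Suc N) < r" using nat_approx_posE by blast
      have "dist (\<eta> n) x0 < r" if "n \<ge> N" for n
      proof -
        have "dist (\<eta> n) x0 < 1 / real (Suc n)" using \<eta>(1)[of n] by (simp add: dist_commute)
        also have "\<dots> \<le> 1 / real (Suc N)" using that by (intro divide_left_mono) auto
        finally show ?thesis using N by simp
      qed
      then show "\<exists>no. \<forall>n\<ge>no. dist (\<eta> n) x0 < r" by blast
    qed
    define h0 where "h0 = min (min h1 (\<delta> / Cf)) \<delta>"
    have "h0 > 0" using h1(1) \<delta> Cf_ge_1 by (simp add: h0_def)
    from x0(2)[OF \<eta>(2) \<open>\<eta> \<longlonglongrightarrow> x0\<close> this]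
    obtain k y where y: "y \<noteq> 0" "\<bar>y\<bar> < h0" "side * y < 0" "allowed (\<eta> k) y 0"
      unfolding eventually_sequentially by blast
    have yy: "\<bar>y\<bar> < h1" "Cf * \<bar>y\<bar> \<le> \<delta>" "\<bar>y\<bar> < \<delta>" using y(2) Cf_ge_1 by (auto simp: h0_def field_simps)
    have al: "allowed (\<eta> k) y (int m)" for m
    proof (induction m)
      case (Suc m)
      then have "allowed (\<eta> k) y (int m + 1)" using h1(2)[OF \<eta>(2) y(1) yy(1) y(3)] by blast
      then show ?case by (simp add: add.commute)
    qed (use y in simp)
    have "\<exists>w\<in>M. ext (\<eta> k) m 0 = ext w m 0 + y \<and> \<bar>ext (\<eta> k) m 1 - ext w m 1\<bar> \<le> \<delta>" for m
    proof -
      obtain p where p: "p > 0" "2 * int h dvd p" "\<And>n. \<eta> k (n + p) = \<eta> k n"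
        using periodicE[OF strict_periodic[OF \<eta>(2)]] by blast
      obtain q where q: "p = 2 * int h * q" using p(2) by (auto simp: dvd_def)
      \<comment> \<open>Only nonnegative times have been treated. A strict orbit is periodic, so an
        arbitrary time \<open>m\<close> is replaced by a nonnegative \<open>m'\<close> that differs
        from it by a multiple of the period.\<close>
      define m' where "m' = m + int (nat \<bar>m\<bar>) * p"
      have mq: "m' = m + 2 * int h * (int (nat \<bar>m\<bar>) * q)" by (simp add: m'_def q)
      have "\<bar>m\<bar> * 1 \<le> \<bar>m\<bar> * p" using p(1) by (intro mult_left_mono) auto
      then have "m' \<ge> 0" by (simp add: m'_def)
      then obtain w where w: "w \<in> M" "ext (\<eta> k) m' 0 = ext w m' 0 + y" "\<bar>ext (\<eta> k) m' 1 - ext w m' 1\<bar> \<le> Cf * \<bar>y\<bar>"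
        using allowed_close[OF al[of "nat m'"]] by auto
      have "sh (int (nat \<bar>m\<bar>) * q) (\<eta> k) = \<eta> k"
      proof
        fix n show "sh (int (nat \<bar>m\<bar>) * q) (\<eta> k) n = \<eta> k n"
          using periodic_mult[of "\<eta> k" p n "nat \<bar>m\<bar>"] p(3) by (simp add: sh_apply q algebra_simps)
      qed
      then have e: "ext (\<eta> k) m' i = ext (\<eta> k) m i" for i
        using ext_sh[of "int (nat \<bar>m\<bar>) * q" "\<eta> k" m i] by (simp add: mq)
      show ?thesis
      proof (rule bexI[OF _ M_sh[OF w(1)]], intro conjI)
        have e': "ext (sh (int (nat \<bar>m\<bar>) * q) w) m i = ext w m' i" for i unfolding ext_sh mq ..
        show "ext (\<eta> k) m 0 = ext (sh (int (nat \<bar>m\<bar>) * q) w) m 0 + y" unfolding e' using w(2) e by simp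
        show "\<bar>ext (\<eta> k) m 1 - ext (sh (int (nat \<bar>m\<bar>) * q) w) m 1\<bar> \<le> \<delta>" unfolding e' using w(3) yy(2) e by simp
      qed
    qed
    then have "Q (\<eta> k)" unfolding Q_def using yy(3) by blast
    then show False using \<eta>(3) by blast
  qed
  then show ?thesis using x0(1) by blast
qed

text \<open>A shift of \<omega> lies in the neighbourhood of \<open>x0\<close> given by
  \<open>confined_open\<close>. The same shift of the approximating strict orbits enters it too,
  which confines them at all times, earlier ones included.\<close>

lemma confined:
  assumes \<eta>: "\<And>k. strict (\<eta> k)" "\<eta> \<longlonglongrightarrow> \<omega>"
    and lim: "\<And>z V. z \<in> M \<Longrightarrow> open V \<Longrightarrow> z \<in> V \<Longrightarrow> \<exists>k. sh (int k) \<omega> \<in> V" and \<delta>: "\<delta> > 0"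
  shows "eventually (\<lambda>k. \<exists>y. \<bar>y\<bar> < \<delta> \<and>
    (\<forall>m. \<exists>w\<in>M. ext (\<eta> k) m 0 = ext w m 0 + y \<and> \<bar>ext (\<eta> k) m 1 - ext w m 1\<bar> \<le> \<delta>)) sequentially"
proof -
  obtain x0 V where V: "x0 \<in> M" "open V" "x0 \<in> V" "\<And>\<eta>. \<eta> \<in> V \<Longrightarrow> strict \<eta> \<Longrightarrow>
     (\<exists>y. \<bar>y\<bar> < \<delta> \<and> (\<forall>m. \<exists>w\<in>M. ext \<eta> m 0 = ext w m 0 + y \<and> \<bar>ext \<eta> m 1 - ext w m 1\<bar> \<le> \<delta>))"
  proof -
    from confined_open obtain x0 where x0: "x0 \<in> M" and c: "\<forall>\<delta>>0. \<exists>V. open V \<and> x0 \<in> V \<and> (\<forall>\<eta>\<in>V. strict \<eta> \<longrightarrow>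
     (\<exists>y. \<bar>y\<bar> < \<delta> \<and> (\<forall>m. \<exists>w\<in>M. ext \<eta> m 0 = ext w m 0 + y \<and> \<bar>ext \<eta> m 1 - ext w m 1\<bar> \<le> \<delta>)))"
      by (rule bexE)
    from c[rule_format, OF \<delta>] obtain V where "open V \<and> x0 \<in> V \<and> (\<forall>\<eta>\<in>V. strict \<eta> \<longrightarrow>
     (\<exists>y. \<bar>y\<bar> < \<delta> \<and> (\<forall>m. \<exists>w\<in>M. ext \<eta> m 0 = ext w m 0 + y \<and> \<bar>ext \<eta> m 1 - ext w m 1\<bar> \<le> \<delta>)))"
      by (rule exE)
    then have "open V" "x0 \<in> V" "\<And>\<eta>. \<eta> \<in> V \<Longrightarrow> strict \<eta> \<Longrightarrow>
     (\<exists>y. \<bar>y\<bar> < \<delta> \<and> (\<forall>m. \<exists>w\<in>M. ext \<eta> m 0 = ext w m 0 + y \<and> \<bar>ext \<eta> m 1 - ext w m 1\<bar> \<le> \<delta>))" by simp_all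
    with x0 show thesis by (rule that)
  qed
  obtain j :: nat where j: "sh (int j) \<omega> \<in> V" using lim[OF V(1,2,3)] by blast
  have "(\<lambda>k. sh (int j) (\<eta> k)) \<longlonglongrightarrow> sh (int j) \<omega>" unfolding sh_def by (rule tendsto_shift[OF \<eta>(2)])
  then have "eventually (\<lambda>k. sh (int j) (\<eta> k) \<in> V) sequentially" using V(2) j by (rule topological_tendstoD)
  then show ?thesis
  proof eventually_elim
    case (elim k)
    have "strict (sh (int j) (\<eta> k))" unfolding sh_def by (rule strict_shift[OF \<eta>(1)])
    from V(4)[OF elim this] obtain y where y: "\<bar>y\<bar> < \<delta>" "\<And>m. \<exists>w\<in>M. ext (sh (int j) (\<eta> k)) m 0 = ext w m 0 + y \<and>
      \<bar>ext (sh (int j) (\<eta> k)) m 1 - ext w m 1\<bar> \<le> \<delta>" by blast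
    have "\<exists>w\<in>M. ext (\<eta> k) m 0 = ext w m 0 + y \<and> \<bar>ext (\<eta> k) m 1 - ext w m 1\<bar> \<le> \<delta>" for m
    proof -
      obtain w where w: "w \<in> M" "ext (sh (int j) (\<eta> k)) (m - 2 * int h * int j) 0 = ext w (m - 2 * int h * int j) 0 + y"
        "\<bar>ext (sh (int j) (\<eta> k)) (m - 2 * int h * int j) 1 - ext w (m - 2 * int h * int j) 1\<bar> \<le> \<delta>" using y(2) by blast
      then show ?thesis using M_sh[OF w(1), of "- int j"] ext_sh[of "- int j" w m]
        by (intro bexI[of _ "sh (- int j) w"]) (auto simp: ext_sh)
    qed
    then show ?case using y(1) by blast
  qed
qed

text \<open>As \<delta> tends to 0, the state of \<omega> at time \<open>m\<close> falls into the
  closed set of states of \<open>M\<close>. The point of \<open>M\<close> obtained may depend on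
  \<open>m\<close>.\<close>

lemma confined_limit:
  assumes \<eta>: "\<And>k. strict (\<eta> k)" "\<eta> \<longlonglongrightarrow> \<omega>"
    and lim: "\<And>z V. z \<in> M \<Longrightarrow> open V \<Longrightarrow> z \<in> V \<Longrightarrow> \<exists>k. sh (int k) \<omega> \<in> V"
  shows "\<exists>w\<in>M. ext \<omega> m 0 = ext w m 0 \<and> ext \<omega> m 1 = ext w m 1"
proof -
  define S where "S = (\<lambda>w. (ext w m 0, ext w m 1)) ` M"
  have "compact S" unfolding S_def
    by (intro compact_continuous_image M_compact continuous_on_Pair)
      (metis continuous_ext continuous_on_subset subset_UNIV)+
  have "(ext \<omega> m 0, ext \<omega> m 1) \<in> closure S"
    unfolding closure_approachable
  proof (intro allI impI)
    fix e :: real assume e: "e > 0"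
    have "eventually (\<lambda>k. dist (ext (\<eta> k) m 0) (ext \<omega> m 0) < e/4) sequentially"
      "eventually (\<lambda>k. dist (ext (\<eta> k) m 1) (ext \<omega> m 1) < e/4) sequentially"
      using e by (intro tendstoD[OF tendsto_ext[OF \<eta>(2)]]; simp)+
    moreover have "eventually (\<lambda>k. \<exists>y. \<bar>y\<bar> < e/4 \<and>
      (\<forall>m. \<exists>w\<in>M. ext (\<eta> k) m 0 = ext w m 0 + y \<and> \<bar>ext (\<eta> k) m 1 - ext w m 1\<bar> \<le> e/4)) sequentially"
      using confined[OF \<eta> lim, where \<delta> = "e/4"] e by simp
    ultimately have "eventually (\<lambda>k. \<exists>y\<in>S. dist y (ext \<omega> m 0, ext \<omega> m 1) < e) sequentially"
    proof eventually_elim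
      case (elim k)
      then obtain y w where w: "\<bar>y\<bar> < e/4" "w \<in> M" "ext (\<eta> k) m 0 = ext w m 0 + y" "\<bar>ext (\<eta> k) m 1 - ext w m 1\<bar> \<le> e/4" by blast
      have "dist (ext w m 0, ext w m 1) (ext \<omega> m 0, ext \<omega> m 1)
          \<le> \<bar>dist (ext w m 0) (ext \<omega> m 0)\<bar> + \<bar>dist (ext w m 1) (ext \<omega> m 1)\<bar>"
        unfolding dist_Pair_Pair by (rule sqrt_sum_squares_le_sum_abs)
      also have "\<dots> < e" using w elim(1,2) unfolding dist_real_def abs_idempotent by linarith
      finally show ?case using w(2) by (auto simp: S_def)
    qed
    then show "\<exists>y\<in>S. dist y (ext \<omega> m 0, ext \<omega> m 1) < e" by (auto simp: eventually_sequentially)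
  qed
  then show ?thesis using compact_imp_closed[OF \<open>compact S\<close>] by (auto simp: S_def)
qed

end

section \<open>Countability of the arithmetic heights\<close>

lemma countable_ZP: "countable (ZP z)"
proof -
  define f where "f = foldr (\<lambda>(b, n) s. if b then s + z ^ n else s - z ^ n)"
  have "ZP z \<subseteq> range (\<lambda>l. f l 0)"
  proof
    fix x assume "x \<in> ZP z"
    then show "x \<in> range (\<lambda>l. f l 0)"
    proof induction
      case ZP_0
      have "f [] 0 = 0" by (simp add: f_def)
      then show ?case by (metis rangeI)
    next
      case (ZP_add_power x n)
      then obtain l where "x = f l 0" by blast
      then have "x + z ^ n = f ((True, n) # l) 0" by (simp add: f_def)
      then show ?case by (rule range_eqI)
    next
      case (ZP_diff_power x n)
      then obtain l where "x = f l 0" by blast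
      then have "x - z ^ n = f ((False, n) # l) 0" by (simp add: f_def)
      then show ?case by (rule range_eqI)
    qed
  qed
  then show ?thesis by (rule countable_subset) simp
qed

context rotation begin

text \<open>The real elements of Z[zeta]. They contain every change of an extrapolated value along
  an orbit and are countable, so avoiding them is a generic condition.\<close>

definition DZ :: "real set" where "DZ = {r. complex_of_real r \<in> ZP zeta}"

lemma countable_DZ: "countable DZ"
proof (rule countable_image_inj_on[of complex_of_real])
  show "countable (complex_of_real ` DZ)"
    by (rule countable_subset[OF _ countable_ZP[of zeta]]) (auto simp: DZ_def)
qed (simp add: inj_on_def)

lemma DZ_add: "r \<in> DZ \<Longrightarrow> s \<in> DZ \<Longrightarrow> r + s \<in> DZ"
  and DZ_diff: "r \<in> DZ \<Longrightarrow> s \<in> DZ \<Longrightarrow> r - s \<in> DZ"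
  and DZ_mult: "r \<in> DZ \<Longrightarrow> s \<in> DZ \<Longrightarrow> r * s \<in> DZ"
  and DZ_uminus: "r \<in> DZ \<Longrightarrow> - r \<in> DZ"
  by (simp_all add: DZ_def ZP_add ZP_diff ZP_mult ZP_minus)

lemma DZ_Ints: "r \<in> \<int> \<Longrightarrow> r \<in> DZ"
  by (auto simp: DZ_def ZP_of_int elim: Ints_cases)

lemma DZ_U: "U i \<in> DZ"
  by (simp add: DZ_def U_in_ZP)

lemma DZ_sum: "(\<And>i. i \<in> A \<Longrightarrow> f i \<in> DZ) \<Longrightarrow> sum f A \<in> DZ"
  by (simp add: DZ_def ZP_sum)

lemma ext_diff_DZ:
  assumes x: "orbit x"
  shows "ext x m i - ext x n i \<in> DZ"
proof -
  have "ext x (n + int k) i - ext x n i \<in> DZ" for n k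
    unfolding ext_sum using x by (simp add: DZ_sum DZ_mult DZ_U DZ_Ints orbit_code)
  from this[of n "nat (m - n)"] this[of m "nat (n - m)"] show ?thesis
    using DZ_uminus[of "ext x n i - ext x m i"] by (cases "n \<le> m") auto
qed

lemma ext_shift: "ext (\<lambda>n. x (n + a)) m i = ext x (m + a) (i + a)"
  by (simp add: ext_def algebra_simps)

lemma countable_half_DZ: "countable {c. c - 1/2 \<in> DZ}"
proof -
  have "{c. c - 1/2 \<in> DZ} \<subseteq> (\<lambda>d. d + 1/2) ` DZ"
  proof
    fix c assume "c \<in> {c. c - 1/2 \<in> DZ}"
    then show "c \<in> (\<lambda>d. d + 1/2) ` DZ" by (intro image_eqI[of _ _ "c - 1/2"]) auto
  qed
  then show ?thesis by (rule countable_subset) (simp add: countable_DZ)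
qed

end

context hitting begin

lemma levels_DZ: "c \<in> levels \<Longrightarrow> c - 1/2 \<in> DZ"
proof -
  assume "c \<in> levels"
  then obtain x m where x: "x \<in> M" "c = ext x m 0" by (auto simp: levels_def)
  obtain k where k: "\<bar>x (2 * int h * k)\<bar> = 1/2" using M_hit x(1) by blast
  define n where "n = 2 * int h * k"
  have "ext x n 0 = x n" using ext_add_mult_2h[of x n 0 k] by (simp add: n_def)
  then have "ext x n 0 - 1/2 = 0 \<or> ext x n 0 - 1/2 = - 1" using k by (auto simp: n_def abs_if split: if_splits)
  then have "ext x n 0 - 1/2 \<in> \<int>" by (metis Ints_0 Ints_1 Ints_minus)
  then have "ext x n 0 - 1/2 \<in> DZ" by (rule DZ_Ints)
  then have "(ext x m 0 - ext x n 0) + (ext x n 0 - 1/2) \<in> DZ"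
    using ext_diff_DZ[OF M_orbit[OF x(1)]] by (intro DZ_add)
  then show ?thesis by (simp add: x(2))
qed

end

section \<open>Nonperiodic limits and their return to a phase\<close>

context all_periodic begin

text \<open>A limit that hits the boundary at one phase must hit it there again: otherwise it either follows
  a point of the confining set, or hits the boundary only at a single other phase, and then returns.\<close>

lemma returns_to_phase:
  assumes "hit_set M" and \<omega>: "\<omega> \<in> Ybar" and a: "int h dvd a" and hit0: "\<bar>\<omega> 0\<bar> = 1/2"
    and conf: "\<And>m. \<exists>w\<in>M. ext (\<lambda>n. \<omega> (n + a)) m 0 = ext w m 0 \<and> ext (\<lambda>n. \<omega> (n + a)) m 1 = ext w m 1"
  shows "\<exists>n>0. int h dvd n \<and> \<bar>\<omega> n\<bar> = 1/2"
proof (rule ccontr)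
  interpret hitting h M by unfold_locales (rule assms(1))
  assume neg: "\<not> ?thesis"
  have X: "\<omega> \<in> Xbar" and np: "\<not> periodic \<omega>" using \<omega> by (auto simp: Ybar_def)
  have o: "orbit \<omega>" using X by (rule Xbar_orbit)
  define T where "T = {n. n > 0 \<and> \<bar>\<omega> n\<bar> = 1/2}"
  have Th: "\<not> int h dvd n" if "n \<in> T" for n using neg that by (auto simp: T_def)
  show False
  proof (cases "finite T")
    case True
    \<comment> \<open>After its last hit \<omega> is determined by its state, so it follows the
      point \<open>w\<close> of the confining set with the same state, and \<open>w\<close> hits the
      boundary again at phase 0.\<close>
    define N where "N = Max (insert 1 T)"
    have N: "N \<ge> 1" "\<And>n. n \<in> T \<Longrightarrow> n \<le> N" using True by (simp_all add: N_def)
    obtain w where w: "w \<in> M" "ext (\<lambda>n. \<omega> (n + a)) (N - a) 0 = ext w (N - a) 0"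
      "ext (\<lambda>n. \<omega> (n + a)) (N - a) 1 = ext w (N - a) 1" using conf by blast
    have e: "w (N - a) = \<omega> N" "w (N - a - 1) = \<omega> (N - 1)" using ext_eqI[OF w(2,3)] by simp_all
    have o': "orbit (\<lambda>n. \<omega> (n + a))" using o by (rule orbit_shift)
    obtain L where "\<And>x j. x \<in> M \<Longrightarrow> \<exists>k\<in>{j..j + L}. \<bar>x (2 * int h * k)\<bar> = 1/2" using M_hit by blast
    then obtain k where k: "k \<ge> \<bar>N - a\<bar>" "\<bar>w (2 * int h * k)\<bar> = 1/2" using w(1) by (meson atLeastAtMost_iff)
    define n where "n = 2 * int h * k"
    have "1 * k \<le> 2 * int h * k" using h_pos k(1) by (intro mult_right_mono) auto
    then have n: "N - a \<le> n" using k(1) by (simp add: n_def)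
    have "w n = \<omega> (n + a)"
    proof (rule forward_eq[OF o' M_orbit[OF w(1)], of "N - a" n])
      fix i assume "N - a < i"
      then have "i + a > N" by simp
      then have "i + a \<notin> T" using N(2) by force
      then have "\<bar>\<omega> (i + a)\<bar> \<noteq> 1/2" using \<open>i + a > N\<close> N(1) by (simp add: T_def)
      then show "\<bar>\<omega> (i + a)\<bar> < 1/2" using orbit_abs[OF o, of "i + a"] by simp
    qed (use e n in auto)
    then have "\<bar>\<omega> (n + a)\<bar> = 1/2" using k(2) by (simp add: n_def)
    moreover have "int h dvd n + a" using a by (simp add: n_def)
    moreover have "n + a > 0" using n N(1) by simp
    ultimately show False using neg by blast
  next
    case False
    \<comment> \<open>Residue, sign and level of a hit take finitely many values. If they agree at
      two hits n and n', the extrapolations from both times agree at \<open>a\<close> and at n,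
      which are incongruent modulo \<open>h\<close>; hence they agree everywhere and the state has
      returned.\<close>
    define f where "f n = (n mod (2 * int h), \<omega> n, ext \<omega> n a)" for n
    have lev: "ext \<omega> n a \<in> levels" for n
    proof -
      obtain w where "w \<in> M" "ext (\<lambda>n. \<omega> (n + a)) (n - a) 0 = ext w (n - a) 0" using conf by blast
      then show ?thesis using level_mem[of w "n - a"] by (simp add: ext_shift)
    qed
    have "f ` T \<subseteq> {0..<2 * int h} \<times> {1/2, -1/2} \<times> levels"
      using lev h_pos by (auto simp: f_def T_def abs_if split: if_splits)
    then have "finite (f ` T)" using finite_levels by (meson finite_SigmaI finite.emptyI finite.insertI finite_subset finite_atLeastLessThan_int)
    from pigeonhole_infinite[OF False this] obtain n1 where n1: "n1 \<in> T" "infinite {n \<in> T. f n = f n1}" by blast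
    have "infinite ({n \<in> T. f n = f n1} - {n1})" using n1(2) by simp
    then obtain n2 where n2: "n2 \<in> T" "f n2 = f n1" "n2 \<noteq> n1"
    proof -
      have "{n \<in> T. f n = f n1} - {n1} \<noteq> {}"
        by (rule infinite_imp_nonempty) fact
      then show thesis using that by blast
    qed
    have ret: False if n: "n \<in> T" "n < n'" "f n = f n'" for n n'
    proof -
      have d: "2 * int h dvd n' - n" using n(3) by (auto simp: f_def mod_eq_dvd_iff dvd_diff_commute)
      then obtain q where q: "n' = n + 2 * int h * q" by (metis dvdE diff_eq_eq add.commute)
      define v where "v i = ext \<omega> n' i - ext \<omega> n i" for i
      have hv: "v (i + 1) = lam * v i - v (i - 1)" for i
        unfolding v_def ext_homogeneous by (simp add: algebra_simps)
      have "v n = 0"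
        using n(3) ext_self[of \<omega> n'] ext_add_mult_2h[of \<omega> n' n q] by (simp add: v_def f_def q)
      moreover have va: "v a = 0" using n(3) by (simp add: v_def f_def)
      ultimately have "U (n - a) * v (a + 1) = 0" using homogeneous_via_U[of v n a, OF hv] by simp
      moreover have "\<not> int h dvd n - a" using Th[OF n(1)] a by (metis diff_add_cancel dvd_add)
      ultimately have "v (a + 1) = 0" by (simp add: U_eq_0_iff)
      then have v0: "v i = 0" for i using homogeneous_via_U[of v i a, OF hv] va by simp
      have "\<omega> n' = \<omega> n" using n(3) by (simp add: f_def)
      moreover have "\<omega> (n' - 1) = \<omega> (n - 1)"
      proof -
        have "\<omega> (n' - 1) = ext \<omega> n' (n - 1 + 2 * int h * q)" using ext_pred[of \<omega> n'] by (simp add: q algebra_simps)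
        also have "\<dots> = ext \<omega> n (n - 1)" using v0[of "n - 1"] by (simp add: ext_add_mult_2h v_def)
        finally show ?thesis by simp
      qed
      ultimately show False using periodic_of_return'[OF X n(2) d] np by blast
    qed
    show False using ret[of n1 n2] ret[of n2 n1] n1 n2 by (metis linorder_neqE)
  qed
qed

text \<open>This is all that is used later of minimal sets; \<open>a\<close> is the phase at which
  their levels are read. If \<open>h\<close> does not divide \<open>a\<close>, the finite set
  \<open>Lv\<close> will restrict the displacements along a line of constant \<open>x 0\<close>; if
  it does, the last clause supplies a return.\<close>

lemma limit_dichotomy:
  assumes \<omega>: "\<omega> \<in> Ybar" and \<eta>: "\<And>k. strict (\<eta> k)" "\<eta> \<longlonglongrightarrow> \<omega>"
  shows "\<exists>a Lv. finite Lv \<and> (\<forall>c\<in>Lv. c - 1/2 \<in> DZ) \<and> (\<forall>m. ext \<omega> m a \<in> Lv) \<and>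
    (\<forall>\<delta>>0. eventually (\<lambda>k. \<exists>y. \<bar>y\<bar> < \<delta> \<and> (\<forall>m. ext (\<eta> k) m a - y \<in> Lv)) sequentially) \<and>
    (int h dvd a \<longrightarrow> \<bar>\<omega> 0\<bar> = 1/2 \<longrightarrow> (\<exists>n>0. int h dvd n \<and> \<bar>\<omega> n\<bar> = 1/2))"
proof -
  from ex_hit_set[OF \<omega>] obtain a where "\<exists>M. hit_set M \<and>
    (\<forall>z\<in>M. \<forall>V. open V \<longrightarrow> z \<in> V \<longrightarrow> (\<forall>N. \<exists>k\<ge>N. sh (int k) (\<lambda>n. \<omega> (n + a)) \<in> V))" by (rule exE)
  then obtain M where M: "hit_set M \<and>
    (\<forall>z\<in>M. \<forall>V. open V \<longrightarrow> z \<in> V \<longrightarrow> (\<forall>N. \<exists>k\<ge>N. sh (int k) (\<lambda>n. \<omega> (n + a)) \<in> V))" by (rule exE)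
  then have hM: "hit_set M" by (rule conjunct1)
  have lim: "\<exists>k. sh (int k) (\<lambda>n. \<omega> (n + a)) \<in> V" if "z \<in> M" "open V" "z \<in> V" for z V
  proof -
    from conjunct2[OF M, rule_format, OF that] show "\<exists>k. sh (int k) (\<lambda>n. \<omega> (n + a)) \<in> V" by blast
  qed
  interpret hitting h M by unfold_locales (rule hM)
  define \<eta>' where "\<eta>' = (\<lambda>k n. \<eta> k (n + a))"
  have s': "strict (\<eta>' k)" for k unfolding \<eta>'_def by (rule strict_shift[OF \<eta>(1)])
  have t': "\<eta>' \<longlonglongrightarrow> (\<lambda>n. \<omega> (n + a))" unfolding \<eta>'_def by (rule tendsto_shift[OF \<eta>(2)])
  have cl: "\<exists>w\<in>M. ext (\<lambda>n. \<omega> (n + a)) m 0 = ext w m 0 \<and> ext (\<lambda>n. \<omega> (n + a)) m 1 = ext w m 1" for m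
    by (rule confined_limit[OF s' t' lim])
  have "ext \<omega> m a \<in> levels" for m
  proof -
    obtain w where "w \<in> M" "ext (\<lambda>n. \<omega> (n + a)) (m - a) 0 = ext w (m - a) 0" using cl by blast
    then show ?thesis using level_mem[of w "m - a"] by (simp add: ext_shift)
  qed
  moreover have "eventually (\<lambda>k. \<exists>y. \<bar>y\<bar> < \<delta> \<and> (\<forall>m. ext (\<eta> k) m a - y \<in> levels)) sequentially" if \<delta>: "\<delta> > 0" for \<delta>
  proof -
    have "eventually (\<lambda>k. \<exists>y. \<bar>y\<bar> < \<delta> \<and>
      (\<forall>m. \<exists>w\<in>M. ext (\<eta>' k) m 0 = ext w m 0 + y \<and> \<bar>ext (\<eta>' k) m 1 - ext w m 1\<bar> \<le> \<delta>)) sequentially"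
    proof (rule confined[OF s' t' _ \<delta>])
      fix z V assume "z \<in> M" "open V" "z \<in> V"
      then show "\<exists>k. sh (int k) (\<lambda>n. \<omega> (n + a)) \<in> V" by (rule lim)
    qed
    then show ?thesis
    proof eventually_elim
      case (elim k)
      then obtain y where y: "\<bar>y\<bar> < \<delta>" "\<And>m. \<exists>w\<in>M. ext (\<eta>' k) m 0 = ext w m 0 + y" by blast
      have "ext (\<eta> k) m a - y \<in> levels" for m
      proof -
        obtain w where "w \<in> M" "ext (\<eta>' k) (m - a) 0 = ext w (m - a) 0 + y" using y(2) by blast
        then show ?thesis using level_mem[of w "m - a"] by (simp add: \<eta>'_def ext_shift)
      qed
      then show ?case using y(1) by blast
    qed
  qed
  moreover have "int h dvd a \<longrightarrow> \<bar>\<omega> 0\<bar> = 1/2 \<longrightarrow> (\<exists>n>0. int h dvd n \<and> \<bar>\<omega> n\<bar> = 1/2)"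
    using returns_to_phase[OF hM \<omega> _ _ cl] by blast
  ultimately show ?thesis using finite_levels levels_DZ by blast
qed

end

section \<open>First return to a generic line\<close>

context rotation begin

definition centre :: "real \<Rightarrow> real" where
  "centre r = frac (r + 1/2) - 1/2"

lemma centre_abs: "\<bar>centre r\<bar> \<le> 1/2"
  unfolding centre_def using frac_ge_0[of "r + 1/2"] frac_lt_1[of "r + 1/2"] by linarith

lemma centre_diff: "centre r - r \<in> \<int>"
proof -
  have "centre r - r = - of_int \<lfloor>r + 1/2\<rfloor>" by (simp add: centre_def frac_def)
  then show ?thesis by simp
qed

text \<open>\<open>F\<close> and \<open>G\<close> are the torus map and its inverse with
  representatives in [-1/2, 1/2). On the boundary they need not be mutually inverse, but each
  half-orbit satisfies the recurrence, and the two share the values at times 0 and 1.\<close>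

lemma ex_orbit:
  assumes "\<bar>s\<bar> \<le> 1/2" "\<bar>t\<bar> \<le> 1/2"
  shows "\<exists>x. orbit x \<and> x 0 = s \<and> x 1 = t"
proof -
  define F where "F = (\<lambda>(u, v). (v, centre (lam * v - u)))"
  define G where "G = (\<lambda>(u, v). (centre (lam * u - v), u))"
  define x where "x n = (if n \<ge> 0 then fst ((F ^^ nat n) (s, t)) else fst ((G ^^ nat (- n)) (s, t)))" for n :: int
  have F: "fst (F p) = snd p" "snd (F p) = centre (lam * snd p - fst p)" for p by (simp_all add: F_def split_beta)
  have G: "snd (G p) = fst p" "fst (G p) = centre (lam * fst p - snd p)" for p by (simp_all add: G_def split_beta)
  have Fb: "\<bar>fst ((F ^^ n) (s, t))\<bar> \<le> 1/2 \<and> \<bar>snd ((F ^^ n) (s, t))\<bar> \<le> 1/2" for n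
    by (induction n) (use assms F centre_abs in auto)
  have Gb: "\<bar>fst ((G ^^ n) (s, t))\<bar> \<le> 1/2 \<and> \<bar>snd ((G ^^ n) (s, t))\<bar> \<le> 1/2" for n
    by (induction n) (use assms G centre_abs in auto)
  have pos: "x (int n) = fst ((F ^^ n) (s, t))" "x (int n + 1) = snd ((F ^^ n) (s, t))" for n
  proof -
    show "x (int n) = fst ((F ^^ n) (s, t))" by (simp add: x_def)
    have "nat (int n + 1) = Suc n" by simp
    then show "x (int n + 1) = snd ((F ^^ n) (s, t))" by (simp add: x_def F(1) del: nat_add_distrib)
  qed
  have neg: "x (- int n) = fst ((G ^^ n) (s, t)) \<and> x (- int n + 1) = snd ((G ^^ n) (s, t))" for n
  proof (induction n)
    case 0
    have "x 1 = snd (s, t)" using pos(2)[of 0] by simp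
    then show ?case by (simp add: x_def)
  next
    case (Suc n)
    have "x (- int (Suc n)) = fst ((G ^^ Suc n) (s, t))" by (simp add: x_def del: of_nat_Suc funpow.simps)
    moreover have "x (- int (Suc n) + 1) = x (- int n)" by (rule arg_cong[of _ _ x]) simp
    moreover have "snd ((G ^^ Suc n) (s, t)) = fst ((G ^^ n) (s, t))" by (simp add: G(1))
    ultimately show ?case using Suc by metis
  qed
  have "orbit x"
    unfolding orbit_def
  proof (intro allI conjI)
    fix n
    show "\<bar>x n\<bar> \<le> 1/2" using Fb Gb by (simp add: x_def)
    show "code x n \<in> \<int>"
    proof (cases "n \<ge> 1")
      case True
      define m where "m = nat (n - 1)"
      have n: "n - 1 = int m" "n = int m + 1" "n + 1 = int (Suc m) + 1" using True by (simp_all add: m_def)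
      have "x (n + 1) = centre (lam * x n - x (n - 1))" unfolding n(3) pos(2) unfolding n(1) pos(1) unfolding n(2) pos(2)
        by (simp add: F)
      then show ?thesis using centre_diff[of "lam * x n - x (n - 1)"] by (simp add: code_def algebra_simps)
    next
      case False
      define m where "m = nat (- n)"
      have n: "n = - int m" "n - 1 = - int (Suc m)" using False by (simp_all add: m_def)
      have "x (n - 1) = centre (lam * x n - x (n + 1))"
        using neg[of "Suc m"] neg[of m] unfolding n(2) by (simp add: n(1) G del: of_nat_Suc)
      then show ?thesis using centre_diff[of "lam * x n - x (n + 1)"] by (simp add: code_def algebra_simps)
    qed
  qed
  moreover have "x 0 = s" "x 1 = t" using pos[of 0] by simp_all
  ultimately show ?thesis by blast
qed

lemma ext_1: "ext x 1 n = U n * x 1 - U (n - 1) * x 0"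
  by (simp add: ext_def)

lemma orbit_value_DZ: "orbit x \<Longrightarrow> x n - (U n * x 1 - U (n - 1) * x 0) \<in> DZ"
  using ext_diff_DZ[of x n n 1] by (simp add: ext_1)

text \<open>Boundary hits are ruled out modulo \<open>DZ\<close> instead of along the actual orbit.
  This keeps the set countable and makes it invariant under the displacements of the return map
  (\<open>bad_add_DZ\<close>).\<close>

definition bad :: "real \<Rightarrow> real set" where
  "bad s = {t. \<exists>n. \<not> int h dvd n \<and> U n * t - U (n - 1) * s - 1/2 \<in> DZ}"

lemma countable_bad: "countable (bad s)"
proof -
  have "bad s \<subseteq> (\<Union>n. (\<lambda>d. (d + 1/2 + U (n - 1) * s) / U n) ` DZ)"
  proof
    fix t assume "t \<in> bad s"
    then obtain n where n: "\<not> int h dvd n" "U n * t - U (n - 1) * s - 1/2 \<in> DZ" by (auto simp: bad_def)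
    then have "U n \<noteq> 0" by (simp add: U_eq_0_iff)
    then have "t = (U n * t - U (n - 1) * s - 1/2 + 1/2 + U (n - 1) * s) / U n" by simp
    then show "t \<in> (\<Union>n. (\<lambda>d. (d + 1/2 + U (n - 1) * s) / U n) ` DZ)" using n(2) by blast
  qed
  moreover have "countable (\<Union>n::int. (\<lambda>d. (d + 1/2 + U (n - 1) * s) / U n) ` DZ)"
    using countable_DZ by (intro countable_UN countable_image) auto
  ultimately show ?thesis by (rule countable_subset)
qed

lemma half_abs_DZ: "\<bar>r\<bar> = 1/2 \<Longrightarrow> r - 1/2 \<in> DZ"
proof -
  assume "\<bar>r\<bar> = 1/2"
  then have "r - 1/2 = 0 \<or> r - 1/2 = - 1" by (auto simp: abs_if split: if_splits)
  then have "r - 1/2 \<in> \<int>" by (metis Ints_0 Ints_1 Ints_minus)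
  then show ?thesis by (rule DZ_Ints)
qed

lemma generic_no_hit:
  assumes x: "orbit x" and b: "x 1 \<notin> bad (x 0)" and n: "\<not> int h dvd n"
  shows "\<bar>x n\<bar> < 1/2"
proof (rule ccontr)
  assume "\<not> \<bar>x n\<bar> < 1/2"
  then have "\<bar>x n\<bar> = 1/2" using orbit_abs[OF x, of n] by simp
  then have "(x n - 1/2) - (x n - (U n * x 1 - U (n - 1) * x 0)) \<in> DZ"
    by (intro DZ_diff half_abs_DZ orbit_value_DZ x)
  then show False using b n by (auto simp: bad_def)
qed

text \<open>At multiples of \<open>h\<close> the value is \<open>x 0\<close> up to sign and
  \<open>DZ\<close>, so the genericity of the height excludes a hit; at other times that of the
  position does.\<close>

lemma generic_strict:
  assumes x: "orbit x" and b: "x 1 \<notin> bad (x 0)" and s: "x 0 - 1/2 \<notin> DZ"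
  shows "strict x"
  unfolding strict_def
proof (intro conjI allI x)
  fix n
  show "\<bar>x n\<bar> < 1/2"
  proof (cases "int h dvd n")
    case True
    show ?thesis
    proof (rule ccontr)
      assume "\<not> \<bar>x n\<bar> < 1/2"
      then have "\<bar>x n\<bar> = 1/2" using orbit_abs[OF x, of n] by simp
      then have "(x n - 1/2) - (x n - (U n * x 1 - U (n - 1) * x 0)) \<in> DZ"
        by (intro DZ_diff half_abs_DZ orbit_value_DZ x)
      moreover have "(x n - 1/2) - (x n - (U n * x 1 - U (n - 1) * x 0)) = - U (n - 1) * x 0 - 1/2"
        using U_mult_h[OF True] by (simp add: algebra_simps)
      ultimately have d: "- U (n - 1) * x 0 - 1/2 \<in> DZ" by (simp only:)
      have "U (n - 1) = 1 \<or> U (n - 1) = -1" using abs_U_near_mult_h[OF True] by auto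
      then show False
      proof
        assume "U (n - 1) = 1"
        then have "x 0 + 1/2 \<in> DZ" using DZ_uminus[OF d] by (simp add: add.commute)
        then have "x 0 + 1/2 - 1 \<in> DZ" by (rule DZ_diff) (simp add: DZ_Ints)
        then show False using s by simp
      qed (use d s in simp)
    qed
  qed (rule generic_no_hit[OF x b])
qed

lemma ext_sign:
  assumes "int h dvd n"
  shows "\<exists>\<sigma>\<in>{-1, 1}. \<forall>x m i. ext x m (i + n) = \<sigma> * ext x m i"
proof -
  obtain j where n: "n = int h * j" using assms by (auto simp: dvd_def)
  obtain \<sigma> where \<sigma>: "\<sigma> \<in> {-1, 1}" "\<And>i. U (i + int h * j) = \<sigma> * U i" using U_add_mult_h_sign by blast
  have "ext x m (i + n) = \<sigma> * ext x m i" for x m i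
  proof -
    have e: "i - m + int h * j + 1 = (i - m + 1) + int h * j" "i + n - m = (i - m) + int h * j" by (simp_all add: n)
    show ?thesis unfolding ext_def e \<sigma>(2) by (simp add: algebra_simps)
  qed
  then show ?thesis using \<sigma>(1) by blast
qed

lemma ext_next_abs: "int h dvd n \<Longrightarrow> \<bar>ext x (n + 1) 0\<bar> = \<bar>x n\<bar>"
  using ext_abs_mult_h[of x "n + 1" 0 "n div int h"] ext_pred[of x "n + 1"] by simp

lemma ext_1_0 [simp]: "ext x 1 0 = x 0" using ext_pred[of x 1] by simp

text \<open>\<open>ret x n\<close>: at time \<open>n\<close> the orbit is, up to sign, on the line \<open>\<xi>\<^sub>0 = x 0\<close> again.\<close>

definition ret :: "(int \<Rightarrow> real) \<Rightarrow> nat \<Rightarrow> bool" where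
  "ret x n \<longleftrightarrow> n > 0 \<and> int h dvd int n \<and> ext x (int n + 1) 0 = x 0"

definition rt :: "(int \<Rightarrow> real) \<Rightarrow> nat" where "rt x = (LEAST n. ret x n)"

text \<open>\<open>ext x m\<close> is built on the times m - 1 and m, so the initial state is that
  of \<open>ext x 1\<close>; this explains the index \<open>rt x + 1\<close>. Positions are read at
  time 1.\<close>

definition disp :: "(int \<Rightarrow> real) \<Rightarrow> real" where "disp x = ext x (int (rt x) + 1) 1 - x 1"

lemma disp_DZ: "orbit x \<Longrightarrow> disp x \<in> DZ"
  using ext_diff_DZ[of x "int (rt x) + 1" 1 1] by (simp add: disp_def)

definition Xo :: "real \<Rightarrow> real \<Rightarrow> int \<Rightarrow> real" where
  "Xo s t = (SOME x. orbit x \<and> x 0 = s \<and> x 1 = t)"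

lemma Xo:
  assumes "\<bar>s\<bar> \<le> 1/2" "\<bar>t\<bar> \<le> 1/2"
  shows "orbit (Xo s t)" "Xo s t 0 = s" "Xo s t 1 = t"
  using someI_ex[OF ex_orbit[OF assms]] unfolding Xo_def by blast+

lemma Xo_eq:
  assumes "strict x"
  shows "Xo (x 0) (x 1) = x"
proof -
  have "\<bar>x 0\<bar> \<le> 1/2" "\<bar>x 1\<bar> \<le> 1/2" using strict_abs[OF assms] less_imp_le by blast+
  from Xo[OF this] show ?thesis using strict_eqI[OF assms, of "Xo (x 0) (x 1)" 1] by simp
qed

definition gen :: "real \<Rightarrow> real set" where
  "gen s = {t. \<bar>t\<bar> < 1/2 \<and> t \<notin> bad s}"

definition T :: "real \<Rightarrow> real \<Rightarrow> real" where
  "T s t = t + disp (Xo s t)"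

lemma bad_add_DZ: "b \<in> DZ \<Longrightarrow> t + b \<in> bad s \<longleftrightarrow> t \<in> bad s"
proof -
  have imp: "t + b \<in> bad s" if b: "b \<in> DZ" and t: "t \<in> bad s" for t b
  proof -
    obtain n where n: "\<not> int h dvd n" "U n * t - U (n - 1) * s - 1/2 \<in> DZ" using t by (auto simp: bad_def)
    have "(U n * t - U (n - 1) * s - 1/2) + U n * b \<in> DZ" by (intro DZ_add DZ_mult n b DZ_U)
    then have "U n * (t + b) - U (n - 1) * s - 1/2 \<in> DZ" by (simp add: algebra_simps)
    then show ?thesis using n(1) unfolding bad_def by blast
  qed
  show "b \<in> DZ \<Longrightarrow> ?thesis" using imp[of b t] imp[of "- b" "t + b"] DZ_uminus[of b] by auto
qed

lemma Xo_strict: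
  assumes "t \<in> gen s" "\<bar>s\<bar> \<le> 1/2" "s - 1/2 \<notin> DZ"
  shows "strict (Xo s t)" "Xo s t 0 = s" "Xo s t 1 = t"
proof -
  have t: "\<bar>t\<bar> \<le> 1/2" "t \<notin> bad s" using assms(1) by (auto simp: gen_def)
  note x = Xo[OF assms(2) t(1)]
  show "strict (Xo s t)" by (rule generic_strict[OF x(1)]) (use x t assms in simp_all)
  show "Xo s t 0 = s" "Xo s t 1 = t" using x by simp_all
qed

text \<open>Only the initial pair is assumed to converge. While \<open>y\<close> stays off the
  boundary each next code is locally constant, and the convergence propagates one step
  further.\<close>

lemma forward_tendsto:
  fixes x :: "nat \<Rightarrow> int \<Rightarrow> real"
  assumes x: "\<And>k. orbit (x k)" and y: "orbit y" and t: "(\<lambda>k. x k 0) \<longlonglongrightarrow> y 0" "(\<lambda>k. x k 1) \<longlonglongrightarrow> y 1"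
    and str: "\<And>i. 1 < i \<Longrightarrow> i \<le> int N \<Longrightarrow> \<bar>y i\<bar> < 1/2"
  shows "\<lbrakk>1 \<le> l; l < int N\<rbrakk> \<Longrightarrow> eventually (\<lambda>k. code (x k) l = code y l) sequentially"
proof -
  have step: "eventually (\<lambda>k. code (x k) i = code y i) sequentially \<and> (\<lambda>k. x k (i + 1)) \<longlonglongrightarrow> y (i + 1)"
    if t: "(\<lambda>k. x k (i - 1)) \<longlonglongrightarrow> y (i - 1)" "(\<lambda>k. x k i) \<longlonglongrightarrow> y i" and i: "1 \<le> i" "i < int N" for i
  proof -
    define r where "r k = lam * x k i - x k (i - 1)" for k
    have r: "r \<longlonglongrightarrow> lam * y i - y (i - 1)" unfolding r_def by (intro tendsto_intros t)
    have yi: "y (i + 1) = (lam * y i - y (i - 1)) + code y i" by (simp add: code_def)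
    have xi: "x k (i + 1) = r k + code (x k) i" for k by (simp add: r_def code_def)
    have lim: "(\<lambda>k. \<bar>r k + code y i\<bar>) \<longlonglongrightarrow> \<bar>y (i + 1)\<bar>" unfolding yi by (intro tendsto_intros r)
    have "eventually (\<lambda>k. \<bar>r k + code y i\<bar> < 1/2) sequentially"
      by (rule order_tendstoD(2)[OF lim]) (use str i in simp)
    then have e: "eventually (\<lambda>k. code (x k) i = code y i) sequentially"
    proof eventually_elim
      case (elim k)
      have "\<bar>r k + code (x k) i\<bar> \<le> 1/2" using orbit_abs[OF x, of k "i + 1"] by (simp add: xi)
      then show ?case using Ints_close_eq[OF orbit_code[OF y] orbit_code[OF x] elim] by simp
    qed
    then have "eventually (\<lambda>k. r k + code y i = x k (i + 1)) sequentially" by eventually_elim (simp add: xi)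
    moreover have "(\<lambda>k. r k + code y i) \<longlonglongrightarrow> y (i + 1)" unfolding yi by (intro tendsto_intros r)
    ultimately have "(\<lambda>k. x k (i + 1)) \<longlonglongrightarrow> y (i + 1)" by (rule Lim_transform_eventually[rotated])
    then show ?thesis using e by blast
  qed
  have all: "int n \<le> int N \<Longrightarrow> n \<ge> 1 \<Longrightarrow> (\<lambda>k. x k (int n - 1)) \<longlonglongrightarrow> y (int n - 1) \<and> (\<lambda>k. x k (int n)) \<longlonglongrightarrow> y (int n)" for n
  proof (induction n)
    case (Suc n)
    show ?case
    proof (cases "n = 0")
      case False
      then show ?thesis using Suc step[of "int n"] by (simp add: add.commute)
    qed (use t in simp)
  qed simp
  show "\<lbrakk>1 \<le> l; l < int N\<rbrakk> \<Longrightarrow> eventually (\<lambda>k. code (x k) l = code y l) sequentially"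
    using all[of "nat l"] step[of l] by simp
qed

lemma ret_codes:
  assumes "\<And>l. 1 \<le> l \<Longrightarrow> l \<le> int n \<Longrightarrow> code x l = code y l"
  shows "ext x (int n + 1) i - ext x 1 i = ext y (int n + 1) i - ext y 1 i"
  by (rule ext_diff_eq) (use assms in auto)

end

section \<open>The first return map as a periodic piecewise translation\<close>

context all_periodic begin

lemma ret_ex:
  assumes "strict x"
  shows "\<exists>n. ret x n \<and> ext x (int n + 1) 1 = x 1"
proof -
  obtain p where p: "p > 0" "2 * int h dvd p" "\<And>n. x (n + p) = x n"
    using periodicE[OF strict_periodic[OF assms]] by blast
  obtain q where q: "p = 2 * int h * q" using p(2) by (auto simp: dvd_def)
  have "ext x (p + 1) i = ext x 1 i" for i
  proof -
    have "sh q x = x" using p(3) by (auto simp: sh_def q)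
    then show ?thesis using ext_sh[of q x 1 i] by (simp add: q add.commute)
  qed
  from this[of 0] this[of 1] have "ext x (p + 1) 0 = x 0" "ext x (p + 1) 1 = x 1" by simp_all
  then have "ret x (nat p) \<and> ext x (int (nat p) + 1) 1 = x 1" using p(1) by (simp add: ret_def q)
  then show ?thesis by blast
qed

lemma rt: "strict x \<Longrightarrow> ret x (rt x)" and rt_le: "ret x n \<Longrightarrow> rt x \<le> n"
  unfolding rt_def using ret_ex by (blast intro: LeastI_ex, auto intro: Least_le)

text \<open>At an odd multiple of \<open>h\<close> the line returns with the opposite sign. Since
  the negative of an orbit is an orbit, \<open>y\<close> is the shifted orbit up to that sign, and
  the later returns of \<open>x\<close> are the returns of \<open>y\<close>.\<close>

lemma first_return_orbit:
  assumes x: "strict x"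
  shows "\<exists>y. strict y \<and> y 0 = x 0 \<and> y 1 = x 1 + disp x \<and>
    (\<forall>n. ret x n \<longrightarrow> n \<noteq> rt x \<longrightarrow> ret y (n - rt x) \<and> ext y (int (n - rt x) + 1) 1 = ext x (int n + 1) 1)"
proof -
  define r where "r = int (rt x)"
  have R: "ret x (rt x)" by (rule rt[OF x])
  then have hr: "int h dvd r" by (simp add: ret_def r_def)
  obtain \<sigma> where \<sigma>: "\<sigma> \<in> {-1, 1}" "\<And>x m i. ext x m (i + r) = \<sigma> * ext x m i" using ext_sign[OF hr] by blast
  define y where "y n = \<sigma> * x (n + r)" for n
  have "y = (\<lambda>n. \<sigma> * x (n + r))" by (simp add: fun_eq_iff y_def)
  then have "strict y"
    using \<sigma>(1) strict_shift[OF x, of r] strict_uminus[OF strict_shift[OF x, of r]] by auto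
  moreover have ey: "ext y m i = ext x (m + r) i" for m i
  proof -
    have "ext y m i = \<sigma> * ext x (m + r) (i + r)" by (simp add: ext_def y_def algebra_simps)
    then show ?thesis using \<sigma> by auto
  qed
  moreover have "y 0 = x 0" using ey[of 1 0] R by (simp add: ret_def r_def add.commute)
  moreover have "y 1 = x 1 + disp x" using ey[of 1 1] by (simp add: disp_def r_def add.commute)
  moreover have "ret y (n - rt x) \<and> ext y (int (n - rt x) + 1) 1 = ext x (int n + 1) 1" if n: "ret x n" "n \<noteq> rt x" for n
  proof -
    have le: "rt x < n" using rt_le[OF n(1)] n(2) by simp
    then have e: "int (n - rt x) + 1 + r = int n + 1" by (simp add: r_def)
    have "int h dvd int (n - rt x)" using n(1) hr le by (simp add: ret_def r_def of_nat_diff)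
    then show ?thesis using n(1) le \<open>y 0 = x 0\<close> unfolding ret_def ey e by simp
  qed
  ultimately show ?thesis by blast
qed

lemma return_iterate:
  assumes "strict x" "ret x n"
  shows "\<exists>k>0. (T (x 0) ^^ k) (x 1) = ext x (int n + 1) 1"
  using assms
proof (induction n arbitrary: x rule: less_induct)
  case (less n)
  have Tx: "T (x 0) (x 1) = x 1 + disp x" using Xo_eq[OF less.prems(1)] by (simp add: T_def)
  show ?case
  proof (cases "n = rt x")
    case True
    then show ?thesis using Tx by (intro exI[of _ 1]) (simp add: disp_def)
  next
    case False
    obtain y where y: "strict y" "y 0 = x 0" "y 1 = x 1 + disp x" "ret y (n - rt x)" "ext y (int (n - rt x) + 1) 1 = ext x (int n + 1) 1"
      using first_return_orbit[OF less.prems(1)] less.prems(2) False by blast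
    have "n - rt x < n" using rt[OF less.prems(1)] less.prems(2) by (simp add: ret_def)
    from less.IH[OF this y(1,4)] obtain k where "k > 0" "(T (x 0) ^^ k) (T (x 0) (x 1)) = ext x (int n + 1) 1"
      using y Tx by auto
    then show ?thesis by (intro exI[of _ "Suc k"]) (simp add: funpow_swap1)
  qed
qed

lemma T_periodic:
  assumes "t \<in> gen s" "\<bar>s\<bar> \<le> 1/2" "s - 1/2 \<notin> DZ"
  shows "\<exists>k>0. (T s ^^ k) t = t"
proof -
  note x = Xo_strict[OF assms]
  obtain n where n: "ret (Xo s t) n" "ext (Xo s t) (int n + 1) 1 = Xo s t 1" using ret_ex[OF x(1)] by blast
  show ?thesis using return_iterate[OF x(1) n(1)] x n by simp
qed

lemma T_gen:
  assumes "t \<in> gen s" "\<bar>s\<bar> \<le> 1/2" "s - 1/2 \<notin> DZ"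
  shows "T s t \<in> gen s" "T s t - t \<in> DZ"
proof -
  note x = Xo_strict[OF assms]
  have d: "disp (Xo s t) \<in> DZ" by (rule disp_DZ[OF strict_orbit[OF x(1)]])
  then show "T s t - t \<in> DZ" by (simp add: T_def)
  obtain y where y: "strict y" "y 1 = T s t" using first_return_orbit[OF x(1)] x by (auto simp: T_def)
  have "T s t \<notin> bad s" using bad_add_DZ[OF d, of t s] assms(1) by (simp add: T_def gen_def)
  then show "T s t \<in> gen s" using strict_abs[OF y(1), of 1] y(2) by (simp add: gen_def)
qed

text \<open>Nearby generic points share the codes of \<open>t\<close> up to its first return, so
  their levels change by the same amounts: none returns earlier, and all are displaced
  equally.\<close>

lemma T_locally_translation:
  assumes t: "t \<in> gen s" and s: "\<bar>s\<bar> \<le> 1/2" "s - 1/2 \<notin> DZ"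
  shows "\<exists>e>0. \<forall>t'\<in>gen s. dist t' t < e \<longrightarrow> T s t' - t' = T s t - t"
proof (rule ccontr)
  assume neg: "\<not> ?thesis"
  have "\<exists>u. u \<in> gen s \<and> dist u t < 1 / real (Suc k) \<and> T s u - u \<noteq> T s t - t" for k
    using neg by (metis of_nat_0_less_iff zero_less_Suc zero_less_divide_1_iff)
  then obtain u where u: "\<And>k. u k \<in> gen s" "\<And>k. dist (u k) t < 1 / real (Suc k)" "\<And>k. T s (u k) - u k \<noteq> T s t - t" by metis
  have ut: "u \<longlonglongrightarrow> t"
  proof (rule metric_LIMSEQ_I)
    fix r :: real assume "r > 0"
    then obtain N where N: "1 / real (Suc N) < r" using nat_approx_posE by blast
    have "dist (u n) t < r" if "n \<ge> N" for n
    proof -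
      have "dist (u n) t < 1 / real (Suc n)" by (rule u(2))
      also have "\<dots> \<le> 1 / real (Suc N)" using that by (intro divide_left_mono) auto
      finally show ?thesis using N by simp
    qed
    then show "\<exists>no. \<forall>n\<ge>no. dist (u n) t < r" by blast
  qed
  note x = Xo_strict[OF t s] and y = Xo_strict[OF u(1) s]
  define r where "r = rt (Xo s t)"
  have "eventually (\<lambda>k. \<forall>l\<in>{1..int r}. code (Xo s (u k)) l = code (Xo s t) l) sequentially"
  proof (rule eventually_ball_finite, simp, rule ballI)
    fix l assume "l \<in> {1..int r}"
    then show "eventually (\<lambda>k. code (Xo s (u k)) l = code (Xo s t) l) sequentially"
      by (intro forward_tendsto[where N = "Suc r"] strict_orbit x y) (use x y ut strict_abs[OF x(1)] in auto)
  qed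
  then obtain k where k: "\<And>l. l \<in> {1..int r} \<Longrightarrow> code (Xo s (u k)) l = code (Xo s t) l"
    unfolding eventually_sequentially by blast
  have e: "ext (Xo s (u k)) (int n + 1) i - ext (Xo s (u k)) 1 i = ext (Xo s t) (int n + 1) i - ext (Xo s t) 1 i" if "n \<le> r" for n i
    by (rule ret_codes) (use k that in auto)
  have "ret (Xo s (u k)) n \<longleftrightarrow> ret (Xo s t) n" if "n \<le> r" for n
    using e[OF that, of 0] x y by (auto simp: ret_def)
  then have "rt (Xo s (u k)) = r"
    using rt[OF x(1)] rt_le rt[OF y(1)] unfolding r_def by (metis order.antisym order.refl)
  then have "disp (Xo s (u k)) = disp (Xo s t)"
    using e[of r 1] x y by (simp add: disp_def r_def)
  then show False using u(3)[of k] by (simp add: T_def)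
qed

end

section \<open>Displacements as the line approaches the boundary\<close>

context all_periodic begin

lemma ret_of_period:
  assumes p: "p > 0" "2 * int h dvd p" "\<And>n. x (n + p) = x n"
  shows "ret x (nat p)"
proof -
  obtain q where q: "p = 2 * int h * q" using p(2) by (auto simp: dvd_def)
  have "sh q x = x" using p(3) by (auto simp: sh_def q)
  then have "ext x (p + 1) 0 = x 0" using ext_sh[of q x 1 0] by (simp add: q add.commute)
  then show ?thesis using p(1) by (simp add: ret_def q)
qed

lemma disp_mem:
  assumes "orbit x" "rt x \<le> L"
  shows "disp x \<in> {ext x (m + int k) 1 - ext x m 1 |x m k. orbit x \<and> k \<le> L}"
proof -
  have "disp x = ext x (1 + int (rt x)) 1 - ext x 1 1" by (simp add: disp_def add.commute)
  then show ?thesis using assms by blast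
qed

lemma disp_level:
  assumes "strict x"
  shows "ext x (int (rt x) + 1) a - ext x 1 a = U a * disp x"
  using rt[OF assms] ext_phi[of x "int (rt x) + 1" a] ext_phi[of x 1 a]
  by (simp add: phi_def ret_def disp_def algebra_simps)

text \<open>Up to time \<open>n\<close> the strict orbits have the codes of \<omega>, so their
  levels change exactly as that of \<omega> does. If \<omega> came back to -1/2, the level of a
  strict orbit would fall by 1 from a value below 1/2, to less than -1/2. So it comes back to 1/2,
  which is a return for the strict orbits, and the first one if \<omega> has not hit before.\<close>

lemma return_limit:
  assumes x: "\<And>k. strict (x k)" "x \<longlonglongrightarrow> \<omega>" and w0: "\<omega> 0 = 1/2" and n: "n > 0" "int h dvd int n" "\<bar>\<omega> (int n)\<bar> = 1/2"
  shows "ext \<omega> (int n + 1) 0 = 1/2" and "eventually (\<lambda>k. ret (x k) n) sequentially"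
    and "(\<And>m. 0 < m \<Longrightarrow> m < n \<Longrightarrow> \<bar>\<omega> (int m)\<bar> < 1/2) \<Longrightarrow>
      eventually (\<lambda>k. disp (x k) = ext \<omega> (int n + 1) 1 - \<omega> 1) sequentially"
proof -
  have "eventually (\<lambda>k. \<forall>l\<in>{1..int n}. code (x k) l = code \<omega> l) sequentially"
    by (rule eventually_code_eq[OF strict_orbit[OF x(1)] x(2)])
  then have ev: "eventually (\<lambda>k. \<forall>m\<le>n. \<forall>i. ext (x k) (int m + 1) i - ext (x k) 1 i = ext \<omega> (int m + 1) i - ext \<omega> 1 i) sequentially"
  proof eventually_elim
    case (elim k)
    then show ?case by (auto intro!: ret_codes)
  qed
  then obtain K where K: "\<And>k. k \<ge> K \<Longrightarrow> \<forall>m\<le>n. \<forall>i. ext (x k) (int m + 1) i - ext (x k) 1 i = ext \<omega> (int m + 1) i - ext \<omega> 1 i"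
    unfolding eventually_sequentially by blast
  have e0: "ext (x k) (int m + 1) 0 - x k 0 = ext \<omega> (int m + 1) 0 - 1/2" if "k \<ge> K" "m \<le> n" for k m
    using K[OF that(1)] that(2) w0 by (metis ext_1_0)
  have "\<bar>ext \<omega> (int n + 1) 0\<bar> = 1/2" using ext_next_abs[OF n(2)] n(3) by simp
  moreover have "ext \<omega> (int n + 1) 0 \<noteq> - (1/2)"
  proof
    assume "ext \<omega> (int n + 1) 0 = - (1/2)"
    then have "ext (x K) (int n + 1) 0 = x K 0 - 1" using e0[of K n] by simp
    moreover have "\<bar>ext (x K) (int n + 1) 0\<bar> < 1/2" using ext_next_abs[OF n(2)] strict_abs[OF x(1)] by simp
    moreover have "\<bar>x K 0\<bar> < 1/2" by (rule strict_abs[OF x(1)])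
    ultimately show False by linarith
  qed
  ultimately show w: "ext \<omega> (int n + 1) 0 = 1/2" by linarith
  have r: "ret (x k) n" if "k \<ge> K" for k using e0[OF that order.refl] w n by (simp add: ret_def)
  then show "eventually (\<lambda>k. ret (x k) n) sequentially" unfolding eventually_sequentially by blast
  assume least: "\<And>m. 0 < m \<Longrightarrow> m < n \<Longrightarrow> \<bar>\<omega> (int m)\<bar> < 1/2"
  have "disp (x k) = ext \<omega> (int n + 1) 1 - \<omega> 1" if k: "k \<ge> K" for k
  proof -
    have "rt (x k) = n"
    proof (rule ccontr)
      assume "rt (x k) \<noteq> n"
      then have lt: "rt (x k) < n" using rt_le[OF r[OF k]] by simp
      have R: "ret (x k) (rt (x k))" by (rule rt[OF x(1)])
      then have "ext \<omega> (int (rt (x k)) + 1) 0 = 1/2" using e0[OF k, of "rt (x k)"] lt by (simp add: ret_def)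
      then have "\<bar>\<omega> (int (rt (x k)))\<bar> = 1/2" using ext_next_abs[of "int (rt (x k))" \<omega>] R by (simp add: ret_def)
      then show False using least[of "rt (x k)"] lt R by (simp add: ret_def)
    qed
    then show ?thesis using K[OF k] ext_self[of \<omega> 1] ext_self[of "x k" 1] unfolding disp_def by (metis order.refl)
  qed
  then show "eventually (\<lambda>k. disp (x k) = ext \<omega> (int n + 1) 1 - \<omega> 1) sequentially"
    unfolding eventually_sequentially by blast
qed

text \<open>In the nonperiodic case the level at \<open>a\<close> is 1/2 modulo \<open>DZ\<close>;
  if \<open>h\<close> did not divide \<open>a\<close>, this would say that the position is in
  \<open>bad (1/2)\<close>. So \<open>a\<close> is a multiple of \<open>h\<close> and the limit
  returns.\<close>

lemma phase_return:
  assumes x: "\<And>k. strict (x k)" "x \<longlonglongrightarrow> \<omega>" and w: "\<omega> 0 = 1/2" "\<omega> 1 \<notin> bad (1/2)"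
  shows "\<exists>n::nat. n > 0 \<and> int h dvd int n \<and> \<bar>\<omega> (int n)\<bar> = 1/2"
proof -
  have X: "\<omega> \<in> Xbar" by (rule Xbar_limit[OF strict_in_Xbar[OF x(1)] x(2)])
  have "\<exists>n>0. int h dvd n \<and> \<bar>\<omega> n\<bar> = 1/2"
  proof (cases "periodic \<omega>")
    case True
    then obtain p where p: "p > 0" "2 * int h dvd p" "\<And>n. \<omega> (n + p) = \<omega> n" using periodicE by blast
    have "\<bar>\<omega> p\<bar> = 1/2" using p(3)[of 0] w(1) by simp
    then show ?thesis using p(1,2) dvd_mult_right by blast
  next
    case False
    then have "\<omega> \<in> Ybar" using X by (simp add: Ybar_def)
    from limit_dichotomy[OF this x] obtain a Lv where a: "\<forall>c\<in>Lv. c - 1/2 \<in> DZ" "\<forall>m. ext \<omega> m a \<in> Lv"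
      "int h dvd a \<longrightarrow> \<bar>\<omega> 0\<bar> = 1/2 \<longrightarrow> (\<exists>n>0. int h dvd n \<and> \<bar>\<omega> n\<bar> = 1/2)" by blast
    have "ext \<omega> 1 a - 1/2 \<in> DZ" using a by blast
    then have "U a * \<omega> 1 - U (a - 1) * (1/2) - 1/2 \<in> DZ" unfolding ext_1 w(1) .
    then have "int h dvd a" using w(2) unfolding bad_def by blast
    then show ?thesis using a(3) w(1) by simp
  qed
  then obtain n where "n > 0" "int h dvd n" "\<bar>\<omega> n\<bar> = 1/2" by blast
  then show ?thesis by (intro exI[of _ "nat n"]) simp
qed

text \<open>Values tending to infinity would give a sequence of strict orbits with a limit \<omega>.
  In each case, \<omega> periodic or not and \<open>a\<close> divisible by \<open>h\<close> or not,
  the displacements along the sequence end up in a finite set, on which any function is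
  bounded.\<close>

lemma bounded_disp:
  fixes f :: "real \<Rightarrow> real"
  assumes s: "\<And>i. \<bar>s i\<bar> \<le> 1/2" "\<And>i. s i - 1/2 \<notin> DZ" "s \<longlonglongrightarrow> 1/2"
  shows "\<exists>A. \<forall>i. \<forall>t\<in>gen (s i). \<bar>f (disp (Xo (s i) t))\<bar> \<le> A"
proof (rule ccontr)
  assume neg: "\<not> ?thesis"
  have "\<exists>i t. t \<in> gen (s i) \<and> real k < \<bar>f (disp (Xo (s i) t))\<bar>" for k :: nat
  proof (rule ccontr)
    assume "\<not> ?thesis"
    then have "\<forall>i. \<forall>t\<in>gen (s i). \<bar>f (disp (Xo (s i) t))\<bar> \<le> real k" by (meson not_less)
    then show False using neg by blast
  qed
  then obtain j t where jt: "\<And>k. t k \<in> gen (s (j k))" "\<And>k. real k < \<bar>f (disp (Xo (s (j k)) (t k)))\<bar>" by metis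
  define x where "x k = Xo (s (j k)) (t k)" for k
  have x: "strict (x k)" "x k 0 = s (j k)" for k using Xo_strict[OF jt(1) s(1,2)] by (simp_all add: x_def)
  have "\<forall>k. x k \<in> Xbar" using x(1) strict_in_Xbar by blast
  then obtain \<omega> r where w: "\<omega> \<in> Xbar" "strict_mono (r :: nat \<Rightarrow> nat)" "(x \<circ> r) \<longlonglongrightarrow> \<omega>"
    using compact_Xbar unfolding compact_def by metis
  define \<eta> where "\<eta> k = x (r k)" for k
  have \<eta>: "strict (\<eta> k)" for k using x by (simp add: \<eta>_def)
  have lim: "\<eta> \<longlonglongrightarrow> \<omega>" using w(3) unfolding \<eta>_def comp_def .
  have by_rt: "\<exists>D. finite D \<and> eventually (\<lambda>k. disp (\<eta> k) \<in> D) sequentially" if ev: "eventually (\<lambda>k. ret (\<eta> k) n) sequentially" for n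
  proof (intro exI conjI)
    show "finite {ext x (m + int k) 1 - ext x m 1 |x m k. orbit x \<and> k \<le> n}" by (rule finite_ext_diff)
    show "eventually (\<lambda>k. disp (\<eta> k) \<in> {ext x (m + int k) 1 - ext x m 1 |x m k. orbit x \<and> k \<le> n}) sequentially"
      using ev by eventually_elim (rule disp_mem[OF strict_orbit[OF \<eta>] rt_le])
  qed
  have "\<exists>D. finite D \<and> eventually (\<lambda>k. disp (\<eta> k) \<in> D) sequentially"
  proof (cases "periodic \<omega>")
    case True
    then obtain p where p: "p > 0" "2 * int h dvd p" "\<And>n. \<omega> (n + p) = \<omega> n" using periodicE by blast
    have "eventually (\<lambda>k. \<forall>i. \<eta> k (i + p) = \<eta> k i) sequentially"
      by (rule eventually_period_eq[OF p(3,1,2) strict_in_Xbar[OF \<eta>] lim])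
    then have "eventually (\<lambda>k. ret (\<eta> k) (nat p)) sequentially"
      by eventually_elim (use p in \<open>auto intro: ret_of_period\<close>)
    then show ?thesis by (rule by_rt)
  next
    case False
    then have "\<omega> \<in> Ybar" using w(1) by (simp add: Ybar_def)
    from limit_dichotomy[OF this \<eta> lim] obtain a Lv where a: "finite Lv" "\<forall>c\<in>Lv. c - 1/2 \<in> DZ" "\<forall>m. ext \<omega> m a \<in> Lv"
      "\<forall>\<delta>>0. eventually (\<lambda>k. \<exists>y. \<bar>y\<bar> < \<delta> \<and> (\<forall>m. ext (\<eta> k) m a - y \<in> Lv)) sequentially"
      "int h dvd a \<longrightarrow> \<bar>\<omega> 0\<bar> = 1/2 \<longrightarrow> (\<exists>n>0. int h dvd n \<and> \<bar>\<omega> n\<bar> = 1/2)" by blast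
    show ?thesis
    proof (cases "int h dvd a")
      case False
      then have Ua: "U a \<noteq> 0" by (simp add: U_eq_0_iff)
      show ?thesis
      proof (intro exI conjI)
        \<comment> \<open>At a return the value of \<open>ext\<close> at 0 is unchanged, so its
          value at \<open>a\<close> changes by \<open>U a\<close> times the displacement. That
          change is a difference of two elements of \<open>Lv\<close>, as the common offset y
          cancels.\<close>
        show "finite ((\<lambda>(c, d). (c - d) / U a) ` (Lv \<times> Lv))" using a(1) by simp
        show "eventually (\<lambda>k. disp (\<eta> k) \<in> (\<lambda>(c, d). (c - d) / U a) ` (Lv \<times> Lv)) sequentially"
          using a(4)[rule_format, of 1, OF zero_less_one]
        proof eventually_elim
          case (elim k)
          then obtain y where y: "\<And>m. ext (\<eta> k) m a - y \<in> Lv" by blast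
          have "disp (\<eta> k) = ((ext (\<eta> k) (int (rt (\<eta> k)) + 1) a - y) - (ext (\<eta> k) 1 a - y)) / U a"
            using disp_level[OF \<eta>, of k a] Ua by (simp add: field_simps)
          then show ?case using y by (intro image_eqI[of _ _ "(ext (\<eta> k) (int (rt (\<eta> k)) + 1) a - y, ext (\<eta> k) 1 a - y)"]) auto
        qed
      qed
    next
      case True
      \<comment> \<open>For \<open>a\<close> divisible by \<open>h\<close> the level at
        \<open>a\<close> is \<omega> 0 up to sign and congruent to 1/2 modulo \<open>DZ\<close>. The
        heights \<open>s i\<close> are not, which leaves only their limit 1/2.\<close>
      have w0: "\<omega> 0 = 1/2"
      proof (rule ccontr)
        assume ne: "\<omega> 0 \<noteq> 1/2"
        have "(\<lambda>k. \<eta> k 0) \<longlonglongrightarrow> \<omega> 0" using lim by (simp add: seq_tendsto_iff)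
        then have "(\<lambda>k. s (j (r k))) \<longlonglongrightarrow> \<omega> 0" by (simp add: \<eta>_def x(2))
        moreover have "closed (insert (1/2) (range s))" by (rule compact_imp_closed[OF compact_sequence_with_limit[OF s(3)]])
        ultimately have "\<omega> 0 \<in> insert (1/2) (range s)" using closed_sequentially[of "insert (1/2) (range s)" "\<lambda>k. s (j (r k))"] by blast
        then obtain i where i: "\<omega> 0 = s i" using ne by blast
        obtain \<sigma> where \<sigma>: "\<sigma> \<in> {-1, 1}" "\<And>x m i. ext x m (i + a) = \<sigma> * ext x m i" using ext_sign[OF True] by blast
        have "ext \<omega> 1 a - 1/2 \<in> DZ" using a(2,3) by blast
        moreover have "ext \<omega> 1 a = \<sigma> * s i" using \<sigma>(2)[of \<omega> 1 0] i by simp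
        ultimately have "s i - 1/2 \<in> DZ \<or> - s i - 1/2 \<in> DZ" using \<sigma>(1) by auto
        moreover have "s i - 1/2 \<in> DZ" if d: "- s i - 1/2 \<in> DZ"
        proof -
          have "- (- s i - 1/2) - 1 \<in> DZ" by (rule DZ_diff[OF DZ_uminus[OF d]]) (simp add: DZ_Ints)
          then show ?thesis by simp
        qed
        ultimately show False using s(2) by blast
      qed
      then obtain n where n: "n > 0" "int h dvd n" "\<bar>\<omega> n\<bar> = 1/2" using a(5) True by auto
      have "eventually (\<lambda>k. ret (\<eta> k) (nat n)) sequentially"
        by (rule return_limit(2)[OF \<eta> lim w0]) (use n in auto)
      then show ?thesis by (rule by_rt)
    qed
  qed
  then obtain D where D: "finite D" "eventually (\<lambda>k. disp (\<eta> k) \<in> D) sequentially" by blast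
  obtain A where A: "\<And>d. d \<in> D \<Longrightarrow> \<bar>f d\<bar> \<le> A"
    using finite_imp_bounded[OF finite_imageI[OF D(1), of f]] by (auto simp: bounded_iff)
  obtain K where K: "\<And>k. k \<ge> K \<Longrightarrow> disp (\<eta> k) \<in> D" using D(2) unfolding eventually_sequentially by blast
  define k where "k = max K (nat \<lceil>A\<rceil>)"
  have "real (r k) < \<bar>f (disp (\<eta> k))\<bar>" using jt(2) by (simp add: \<eta>_def x_def)
  moreover have "\<bar>f (disp (\<eta> k))\<bar> \<le> A" using A K by (simp add: k_def)
  moreover have "k \<le> r k" using w(2) by (rule seq_suble)
  moreover have "A \<le> real k" by (simp add: k_def) linarith
  ultimately show False by linarith
qed

text \<open>The two sides of the boundary line carry the same dynamics until the first return; there the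
  jump of \<open>lam\<close> times the width of the torus separates them.\<close>

lemma disp_pair:
  assumes s: "\<And>i. \<bar>s i\<bar> \<le> 1/2" "\<And>i. s i - 1/2 \<notin> DZ" "s \<longlonglongrightarrow> 1/2"
    and t: "t \<notin> bad (1/2)" "- t \<notin> bad (1/2)" "\<And>i. t \<in> gen (s i)" "\<And>i. - t \<in> gen (s i)"
  shows "eventually (\<lambda>i. disp (Xo (s i) t) + disp (Xo (s i) (- t)) - lam \<in> \<int>) sequentially"
proof (rule ccontr)
  assume "\<not> ?thesis"
  from not_eventually_sequentiallyD[OF this]
  obtain r :: "nat \<Rightarrow> nat" where r: "strict_mono r" "\<And>k. \<not> disp (Xo (s (r k)) t) + disp (Xo (s (r k)) (- t)) - lam \<in> \<int>"
    by blast
  note X = Xo_strict[OF t(3) s(1,2)] and Z = Xo_strict[OF t(4) s(1,2)]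
  have "\<forall>k. Xo (s (r k)) t \<in> Xbar" using X(1) strict_in_Xbar by blast
  then obtain \<omega> r1 where w1: "strict_mono (r1 :: nat \<Rightarrow> nat)" "((\<lambda>k. Xo (s (r k)) t) \<circ> r1) \<longlonglongrightarrow> \<omega>"
    using compact_Xbar unfolding compact_def by (metis (mono_tags, lifting))
  have "\<forall>k. Xo (s (r (r1 k))) (- t) \<in> Xbar" using Z(1) strict_in_Xbar by blast
  then obtain \<omega>2 r2 where w2: "strict_mono (r2 :: nat \<Rightarrow> nat)" "((\<lambda>k. Xo (s (r (r1 k))) (- t)) \<circ> r2) \<longlonglongrightarrow> \<omega>2"
    using compact_Xbar unfolding compact_def by (metis (mono_tags, lifting))
  define q where "q k = r (r1 (r2 k))" for k
  define x z where "x k = Xo (s (q k)) t" and "z k = Xo (s (q k)) (- t)" for k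
  have x: "\<And>k. strict (x k)" "\<And>k. x k 0 = s (q k)" "\<And>k. x k 1 = t"
    and z: "\<And>k. strict (z k)" "\<And>k. z k 0 = s (q k)" "\<And>k. z k 1 = - t" using X Z by (simp_all add: x_def z_def)
  have xl: "x \<longlonglongrightarrow> \<omega>" using LIMSEQ_subseq_LIMSEQ[OF w1(2) w2(1)] unfolding x_def q_def comp_def .
  have zl: "z \<longlonglongrightarrow> \<omega>2" using w2(2) unfolding z_def q_def comp_def .
  have "strict_mono q" using r(1) w1(1) w2(1) by (auto simp: strict_mono_def q_def)
  then have sq: "(\<lambda>k. s (q k)) \<longlonglongrightarrow> 1/2" using LIMSEQ_subseq_LIMSEQ[OF s(3)] by (simp add: comp_def)
  have lx: "(\<lambda>k. x k i) \<longlonglongrightarrow> \<omega> i" and lz: "(\<lambda>k. z k i) \<longlonglongrightarrow> \<omega>2 i" for i using xl zl by (simp_all add: seq_tendsto_iff)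
  have w0: "\<omega> 0 = 1/2" "\<omega>2 0 = 1/2" using lx[of 0] lz[of 0] sq LIMSEQ_unique unfolding x z by blast+
  have w1: "\<omega> 1 = t" "\<omega>2 1 = - t" using lx[of 1] lz[of 1] unfolding x z by (simp_all add: LIMSEQ_const_iff)
  have o: "orbit \<omega>" "orbit \<omega>2" by (rule orbit_limit[OF strict_orbit[OF x(1)] xl], rule orbit_limit[OF strict_orbit[OF z(1)] zl])
  have "\<exists>n::nat. n > 0 \<and> int h dvd int n \<and> \<bar>\<omega> (int n)\<bar> = 1/2"
    by (rule phase_return[OF x(1) xl w0(1)]) (use w1 t in simp)
  then obtain n :: nat where n: "n > 0" "int h dvd int n" "\<bar>\<omega> (int n)\<bar> = 1/2"
    and least: "\<And>m::nat. m > 0 \<Longrightarrow> m < n \<Longrightarrow> int h dvd int m \<Longrightarrow> \<bar>\<omega> (int m)\<bar> \<noteq> 1/2"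
    using exists_least_iff[of "\<lambda>n::nat. n > 0 \<and> int h dvd int n \<and> \<bar>\<omega> (int n)\<bar> = 1/2"] by blast
  have n4: "n \<ge> 4" using n(1,2) h4 by (auto dest!: dvd_imp_le)
  have inner: "\<bar>\<omega> i\<bar> < 1/2" if "1 \<le> i" "i < int n" for i
  proof (cases "int h dvd i")
    case True
    then have "\<bar>\<omega> i\<bar> \<noteq> 1/2" using least[of "nat i"] that by simp
    then show ?thesis using orbit_abs[OF o(1), of i] by simp
  next
    case False
    show ?thesis by (rule generic_no_hit[OF o(1) _ False]) (unfold w0 w1, rule t)
  qed
  \<comment> \<open>By the symmetry x -> -x the limit starting at position -t becomes the orbit at
    position t on the other side of the boundary line, with height -1/2.\<close>
  define v where "v = (\<lambda>i. - \<omega>2 i)"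
  have ov: "orbit v" unfolding v_def by (rule orbit_uminus[OF o(2)])
  have v01: "v 0 = - (1/2)" "v 1 = t" using w0 w1 by (simp_all add: v_def)
  \<comment> \<open>The starting heights 1/2 and -1/2 differ by an integer, which the first code
    absorbs; from then on the two orbits agree until \<omega> hits the boundary.\<close>
  have v2: "v 2 = \<omega> 2"
  proof -
    have "\<omega> 2 = (lam * t - 1/2) + code \<omega> 1" "v 2 = (lam * t - 1/2) + (code v 1 + 1)"
      using w0 w1 v01 by (simp_all add: code_def)
    moreover have "\<bar>\<omega> 2\<bar> < 1/2" "\<bar>v 2\<bar> \<le> 1/2" using inner[of 2] n4 orbit_abs[OF ov] by auto
    moreover have "code v 1 + 1 \<in> \<int>" using orbit_code[OF ov] by simp
    ultimately show ?thesis using Ints_close_eq[OF orbit_code[OF o(1), of 1], where b = "code v 1 + 1" and r = "lam * t - 1/2"] by simp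
  qed
  have agree: "v i = \<omega> i" if "1 \<le> i" "i < int n" for i
  proof (cases "i = 1")
    case False
    show ?thesis
      by (rule forward_eq[OF o(1) ov, of 2 "int n - 1"]) (use v2 v01 w1 inner that False in auto)
  qed (use v01 w1 in simp)
  have "code v (int n - 1) - code \<omega> (int n - 1) = v (int n) - \<omega> (int n)"
    using agree[of "int n - 1"] agree[of "int n - 2"] n4 by (simp add: code_def)
  then have dZ: "v (int n) - \<omega> (int n) \<in> \<int>" using orbit_code[OF ov] orbit_code[OF o(1)] by (metis Ints_diff)
  have "\<omega> (int n) + 1/2 = 0 \<or> \<omega> (int n) + 1/2 = 1" using n(3) by (auto simp: abs_if split: if_splits)
  then have "\<omega> (int n) + 1/2 \<in> \<int>" by (metis Ints_0 Ints_1)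
  from Ints_add[OF dZ this] have "v (int n) + 1/2 \<in> \<int>" by simp
  then have "\<bar>v (int n)\<bar> = 1/2" using Ints_half_abs orbit_abs[OF ov] by blast
  then have n2: "\<bar>\<omega>2 (int n)\<bar> = 1/2" by (simp add: v_def)
  have inner2: "\<bar>\<omega>2 i\<bar> < 1/2" if "1 \<le> i" "i < int n" for i
    using agree[OF that] inner[OF that] by (simp add: v_def)
  have e0: "ext \<omega> (int n + 1) 0 = 1/2" "ext \<omega>2 (int n + 1) 0 = 1/2"
    by (rule return_limit(1)[OF x(1) xl w0(1) n], rule return_limit(1)[OF z(1) zl w0(2) n(1,2) n2])
  have "eventually (\<lambda>k. disp (x k) = ext \<omega> (int n + 1) 1 - \<omega> 1) sequentially"
    by (rule return_limit(3)[OF x(1) xl w0(1) n]) (use inner in simp)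
  moreover have "eventually (\<lambda>k. disp (z k) = ext \<omega>2 (int n + 1) 1 - \<omega>2 1) sequentially"
    by (rule return_limit(3)[OF z(1) zl w0(2) n(1,2) n2]) (use inner2 in simp)
  ultimately have "eventually (\<lambda>k. disp (x k) + disp (z k) = ext \<omega> (int n + 1) 1 + ext \<omega>2 (int n + 1) 1) sequentially"
    by eventually_elim (simp add: w1)
  then obtain k where k: "disp (x k) + disp (z k) = ext \<omega> (int n + 1) 1 + ext \<omega>2 (int n + 1) 1"
    unfolding eventually_sequentially by blast
  obtain \<sigma> where \<sigma>: "\<sigma> \<in> {-1, 1}" "\<And>x m i. ext x m (i + int n) = \<sigma> * ext x m i" using ext_sign[OF n(2)] by blast
  have sx: "ext y (int n + 1) 1 = \<sigma> * y (int n + 1)" "ext y (int n + 1) 0 = \<sigma> * y (int n)" for y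
    using \<sigma>(1) \<sigma>(2)[of y "int n + 1" 1] \<sigma>(2)[of y "int n + 1" 0] ext_self[of y "int n + 1"] ext_pred[of y "int n + 1"]
    by (auto simp: add.commute)
  define c where "c = code \<omega> (int n) + code \<omega>2 (int n)"
  \<comment> \<open>At the return both heights are 1/2 up to the common sign \<sigma>, so they add
    up to \<sigma> instead of cancelling. The recurrence multiplies this sum by \<open>lam\<close>:
    this is the jump.\<close>
  have "\<omega> (int n + 1) + \<omega>2 (int n + 1) = lam * (\<omega> (int n) + \<omega>2 (int n)) + c"
    using agree[of "int n - 1"] n4 by (simp add: c_def code_def v_def algebra_simps)
  then have "ext \<omega> (int n + 1) 1 + ext \<omega>2 (int n + 1) 1 = lam * (\<sigma> * \<omega> (int n) + \<sigma> * \<omega>2 (int n)) + \<sigma> * c"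
    unfolding sx(1) using \<sigma>(1) by (auto simp: algebra_simps)
  then have "disp (x k) + disp (z k) = lam + \<sigma> * c" using e0 k unfolding sx(2) by simp
  moreover have "\<sigma> * c \<in> \<int>" using \<sigma>(1) orbit_code[OF o(1)] orbit_code[OF o(2)] by (auto simp: c_def)
  ultimately have "disp (x k) + disp (z k) - lam \<in> \<int>" by simp
  then show False using r(2) unfolding x_def z_def q_def by blast
qed

end

section \<open>Existence of an aperiodic orbit\<close>

lemma periodic_funpow_mult: "(T ^^ k) t = t \<Longrightarrow> (T ^^ (k * l)) t = t"
  by (induction l) (simp_all add: funpow_add)

text \<open>Such a map preserves Lebesgue measure, and the sums of \<open>\<phi> (T t - t)\<close> along orbits are bounded.\<close>

lemma zero_mean_of_periodic_translations:
  fixes G C :: "real set" and T \<phi> :: "real \<Rightarrow> real"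
  assumes G: "G \<in> sets borel" "G \<subseteq> {-1/2<..<1/2}" and TG: "\<And>t. t \<in> G \<Longrightarrow> T t \<in> G"
    and C: "countable C" "\<And>t. t \<in> G \<Longrightarrow> T t - t \<in> C" and D: "\<And>b. {t \<in> G. T t - t = b} \<in> sets borel"
    and per: "\<And>t. t \<in> G \<Longrightarrow> \<exists>k>0. (T ^^ k) t = t" and \<phi>: "\<And>x y. \<phi> (x + y) = \<phi> x + \<phi> y"
    and A: "\<And>t. t \<in> G \<Longrightarrow> \<bar>\<phi> (T t - t)\<bar> \<le> A"
  shows "integrable lborel (\<lambda>t. indicator G t *\<^sub>R \<phi> (T t - t))" (is ?int)
    and "(\<integral>t. indicator G t *\<^sub>R \<phi> (T t - t) \<partial>lborel) = 0" (is ?zero)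
proof -
  \<comment> \<open>A common positive power of \<open>T\<close> fixes both points; likewise each
    point has a preimage on its own periodic orbit, so \<open>T\<close> permutes
    \<open>G\<close>.\<close>
  have inj: "u = v" if uv: "u \<in> G" "v \<in> G" "T u = T v" for u v
  proof -
    obtain k l where kl: "k > 0" "(T ^^ k) u = u" "l > 0" "(T ^^ l) v = v" using per uv by metis
    have e: "(T ^^ (k * l)) u = u" "(T ^^ (k * l)) v = v"
      using periodic_funpow_mult[OF kl(2), of l] periodic_funpow_mult[OF kl(4), of k] by (simp_all add: mult.commute)
    obtain m where m: "k * l = Suc m" using kl by (metis gr0_implies_Suc nat_0_less_mult_iff)
    have "(T ^^ Suc m) u = (T ^^ Suc m) v" unfolding funpow_Suc_right comp_def uv(3) ..
    then show ?thesis using e unfolding m by simp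
  qed
  have TnG: "(T ^^ n) t \<in> G" if "t \<in> G" for n t using that by (induction n) (auto intro: TG)
  have surj: "\<exists>v\<in>G. T v = u" if u: "u \<in> G" for u
  proof -
    obtain k where k: "k > 0" "(T ^^ k) u = u" using per[OF u] by blast
    then obtain m where "k = Suc m" by (metis gr0_implies_Suc)
    then show ?thesis using k TnG[OF u, of m] by (intro bexI[of _ "(T ^^ m) u"]) simp_all
  qed
  define \<mu> where "\<mu> = restrict_space lborel G"
  have sp: "space \<mu> = G" using G by (simp add: \<mu>_def space_restrict_space)
  have Gs: "G \<inter> space lborel \<in> sets lborel" using G by simp
  have sets_\<mu>: "A \<in> sets \<mu> \<longleftrightarrow> A \<in> sets borel \<and> A \<subseteq> G" for A
    using G by (auto simp: \<mu>_def sets_restrict_space_iff)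
  have em: "emeasure \<mu> A = emeasure lborel A" if "A \<in> sets \<mu>" for A
    unfolding \<mu>_def by (rule emeasure_restrict_space[OF Gs]) (use that sets_\<mu> in blast)
  define Db where "Db b = {t \<in> G. T t - t = b}" for b
  have Db: "Db b \<in> sets borel" for b using D by (simp add: Db_def)
  have shift_meas: "(\<lambda>t. t + b) -` B \<in> sets borel" if "B \<in> sets borel" for B and b :: real
    using measurable_sets[of "\<lambda>t. t + b" borel borel B] that by simp
  have TmG: "T -` B \<inter> G = (\<Union>b\<in>C. Db b \<inter> (\<lambda>t. t + b) -` B)" for B
  proof (intro subset_antisym subsetI)
    fix t assume t: "t \<in> T -` B \<inter> G"
    then have "t \<in> Db (T t - t) \<inter> (\<lambda>u. u + (T t - t)) -` B" by (simp add: Db_def)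
    then show "t \<in> (\<Union>b\<in>C. Db b \<inter> (\<lambda>t. t + b) -` B)" using C(2) t by blast
  next
    fix t assume "t \<in> (\<Union>b\<in>C. Db b \<inter> (\<lambda>t. t + b) -` B)"
    then obtain b where "t \<in> G" "T t - t = b" "t + b \<in> B" by (auto simp: Db_def)
    then show "t \<in> T -` B \<inter> G" by auto
  qed
  have Tm: "T \<in> measurable \<mu> \<mu>"
  proof (rule measurableI)
    show "T x \<in> space \<mu>" if "x \<in> space \<mu>" for x using that TG by (simp add: sp)
    fix B assume "B \<in> sets \<mu>"
    then have "B \<in> sets borel" by (simp add: sets_\<mu>)
    then have "T -` B \<inter> G \<in> sets borel" unfolding TmG
      using C(1) Db shift_meas by (intro sets.countable_UN') auto
    then show "T -` B \<inter> space \<mu> \<in> sets \<mu>" by (simp add: sp sets_\<mu>)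
  qed
  \<comment> \<open>On each of the countably many pieces \<open>Db b\<close> the map is translation
    by \<open>b\<close>. The images of the pieces are disjoint by injectivity and fill
    \<open>G\<close> by surjectivity, so measure is preserved piece by piece.\<close>
  have distr: "distr \<mu> \<mu> T = \<mu>"
  proof (rule measure_eqI)
    fix B assume "B \<in> sets (distr \<mu> \<mu> T)"
    then have B: "B \<in> sets \<mu>" by simp
    then have Bb: "B \<in> sets borel" "B \<subseteq> G" by (simp_all add: sets_\<mu>)
    define E where "E b = (\<lambda>t. t - b) -` Db b \<inter> B" for b
    have Eb: "E b \<in> sets borel" for b
      unfolding E_def using shift_meas[OF Db, of "- b" b] Bb by simp
    have pre: "(+) b -` E b = Db b \<inter> (\<lambda>t. t + b) -` B" for b by (auto simp: E_def add.commute)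
    have "emeasure lborel (E b) = emeasure lborel (Db b \<inter> (\<lambda>t. t + b) -` B)" for b
    proof -
      have "emeasure lborel (E b) = emeasure (distr lborel borel ((+) b)) (E b)" by (simp only: lborel_distr_plus)
      also have "\<dots> = emeasure lborel ((+) b -` E b)" using Eb by (simp add: emeasure_distr)
      finally show ?thesis unfolding pre .
    qed
    moreover have "emeasure lborel (\<Union>b\<in>C. Db b \<inter> (\<lambda>t. t + b) -` B)
        = (\<integral>\<^sup>+b. emeasure lborel (Db b \<inter> (\<lambda>t. t + b) -` B) \<partial>count_space C)"
      by (rule emeasure_UN_countable)
        (use C(1) Db shift_meas Bb in \<open>auto simp: disjoint_family_on_def Db_def\<close>)
    moreover have "emeasure lborel (\<Union>b\<in>C. E b) = (\<integral>\<^sup>+b. emeasure lborel (E b) \<partial>count_space C)"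
    proof (rule emeasure_UN_countable)
      show "disjoint_family_on E C"
        unfolding disjoint_family_on_def
      proof (intro ballI impI)
        fix b b' :: real assume "b \<noteq> b'"
        show "E b \<inter> E b' = {}"
        proof (rule ccontr)
          assume "E b \<inter> E b' \<noteq> {}"
          then obtain u where "u - b \<in> Db b" "u - b' \<in> Db b'" by (auto simp: E_def)
          then have "u - b \<in> G" "T (u - b) = u" "u - b' \<in> G" "T (u - b') = u" by (auto simp: Db_def)
          then show False using inj[of "u - b" "u - b'"] \<open>b \<noteq> b'\<close> by simp
        qed
      qed
    qed (use Eb C(1) in auto)
    moreover have "(\<Union>b\<in>C. E b) = B"
    proof (intro subset_antisym subsetI)
      fix u assume u: "u \<in> B"
      then obtain v where v: "v \<in> G" "T v = u" using surj Bb(2) by blast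
      have "u \<in> E (T v - v)" using v u by (simp add: E_def Db_def)
      then show "u \<in> (\<Union>b\<in>C. E b)" using C(2)[OF v(1)] by blast
    qed (auto simp: E_def)
    ultimately have "emeasure lborel (T -` B \<inter> G) = emeasure lborel B" unfolding TmG by simp
    moreover have "T -` B \<inter> G \<in> sets \<mu>" using measurable_sets[OF Tm B] by (simp add: sp)
    ultimately show "emeasure (distr \<mu> \<mu> T) B = emeasure \<mu> B"
      using em B by (simp add: emeasure_distr[OF Tm B] sp)
  qed simp
  interpret finite_measure \<mu>
  proof (rule finite_measureI)
    have "emeasure \<mu> G = emeasure lborel G" using em sets_\<mu> G by blast
    also have "\<dots> \<le> emeasure lborel {-1/2<..<1/2::real}" using G by (intro emeasure_mono) auto
    also have "\<dots> < \<infinity>" by simp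
    finally show "emeasure \<mu> (space \<mu>) \<noteq> \<infinity>" by (simp add: sp)
  qed
  define f0 where "f0 t = \<phi> (T t - t)" for t
  have f0m: "f0 \<in> borel_measurable \<mu>"
  proof (rule measurableI)
    fix B :: "real set" assume "B \<in> sets borel"
    have "f0 -` B \<inter> G = (\<Union>b\<in>{b\<in>C. \<phi> b \<in> B}. Db b)" using C(2) by (auto simp: Db_def f0_def)
    moreover have "\<dots> \<in> sets borel" using C(1) Db by (intro sets.countable_UN') (auto intro: countable_subset)
    ultimately show "f0 -` B \<inter> space \<mu> \<in> sets \<mu>" by (auto simp: sp sets_\<mu>)
  qed simp
  have int0: "integrable \<mu> f0"
    by (rule integrable_const_bound[of _ A]) (use A f0m in \<open>auto simp: sp f0_def intro!: AE_I2\<close>)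
  have Tnm: "(T ^^ n) \<in> measurable \<mu> \<mu>" for n by (rule measurable_compose_n[OF Tm])
  have fT: "integrable \<mu> (\<lambda>t. f0 ((T ^^ n) t)) \<and> (\<integral>t. f0 ((T ^^ n) t) \<partial>\<mu>) = (\<integral>t. f0 t \<partial>\<mu>)" for n
  proof (induction n)
    case (Suc n)
    have m: "(\<lambda>t. f0 ((T ^^ n) t)) \<in> borel_measurable \<mu>" using Tnm f0m by (rule measurable_compose)
    have "integrable (distr \<mu> \<mu> T) (\<lambda>t. f0 ((T ^^ n) t))" unfolding distr using Suc by blast
    then have "integrable \<mu> (\<lambda>t. f0 ((T ^^ n) (T t)))" using integrable_distr[OF Tm] by blast
    moreover have "(\<integral>t. f0 ((T ^^ n) (T t)) \<partial>\<mu>) = (\<integral>t. f0 ((T ^^ n) t) \<partial>\<mu>)"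
      using integral_distr[OF Tm m] unfolding distr by simp
    ultimately show ?case using Suc by (simp add: funpow_swap1)
  qed (use int0 in simp)
  have \<phi>0: "\<phi> 0 = 0" using \<phi>[of 0 0] by simp
  have tele: "(\<Sum>i<n. f0 ((T ^^ i) t)) = \<phi> ((T ^^ n) t - t)" for n t
  proof (induction n)
    case (Suc n)
    have "\<phi> ((T ^^ Suc n) t - t) = \<phi> ((T ((T ^^ n) t) - (T ^^ n) t) + ((T ^^ n) t - t))" by simp
    then show ?case using Suc unfolding \<phi> by (simp add: f0_def)
  qed (simp add: \<phi>0)
  \<comment> \<open>Birkhoff averages. By invariance they all have the integral of
    \<open>f0\<close>. Their sums telescope to \<phi> of a total displacement, which takes finitely
    many values along a periodic orbit, so the averages tend to 0 pointwise.\<close>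
  define u where "u n t = (\<Sum>i<Suc n. f0 ((T ^^ i) t)) / real (Suc n)" for n t
  have um: "u n \<in> borel_measurable \<mu>" for n
    unfolding u_def using measurable_compose[OF Tnm f0m] by (intro borel_measurable_divide borel_measurable_sum) auto
  have iu: "(\<integral>t. u n t \<partial>\<mu>) = (\<integral>t. f0 t \<partial>\<mu>)" for n
  proof -
    have "(\<integral>t. (\<Sum>i<Suc n. f0 ((T ^^ i) t)) \<partial>\<mu>) = (\<Sum>i<Suc n. \<integral>t. f0 ((T ^^ i) t) \<partial>\<mu>)"
      using fT by (intro Bochner_Integration.integral_sum) blast
    also have "\<dots> = real (Suc n) * (\<integral>t. f0 t \<partial>\<mu>)" using fT by (simp add: algebra_simps)
    finally show ?thesis unfolding u_def by (simp add: field_simps)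
  qed
  have lim: "(\<lambda>n. u n t) \<longlonglongrightarrow> 0" if t: "t \<in> G" for t
  proof -
    obtain k where k: "k > 0" "(T ^^ k) t = t" using per[OF t] by blast
    define Bt where "Bt = (\<Sum>j<k. \<bar>\<phi> ((T ^^ j) t - t)\<bar>)"
    have b: "\<bar>\<phi> ((T ^^ n) t - t)\<bar> \<le> Bt" for n
    proof -
      have "(T ^^ n) t = (T ^^ (n mod k)) t" using funpow_mod_eq[OF k(2)] by simp
      moreover have "\<bar>\<phi> ((T ^^ (n mod k)) t - t)\<bar> \<le> Bt"
        unfolding Bt_def by (rule member_le_sum[of "n mod k" "{..<k}" "\<lambda>j. \<bar>\<phi> ((T ^^ j) t - t)\<bar>"]) (use k in auto)
      ultimately show ?thesis by simp
    qed
    have B0: "(\<lambda>n. Bt / real (Suc n)) \<longlonglongrightarrow> 0" by (rule LIMSEQ_Suc[OF lim_const_over_n])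
    have "norm (u n t) \<le> Bt / real (Suc n)" for n
      unfolding u_def tele using b[of "Suc n"] by (simp add: divide_right_mono)
    then have "eventually (\<lambda>n. norm (u n t) \<le> Bt / real (Suc n)) sequentially" by (intro eventuallyI)
    then show ?thesis using B0 by (rule Lim_null_comparison)
  qed
  have ub: "\<bar>u n t\<bar> \<le> A" if t: "t \<in> G" for n t
  proof -
    have "\<bar>\<Sum>i<Suc n. f0 ((T ^^ i) t)\<bar> \<le> (\<Sum>i<Suc n. A)"
      by (rule order_trans[OF sum_abs sum_mono]) (use A[OF TnG[OF t]] in \<open>simp add: f0_def\<close>)
    then show ?thesis by (simp add: u_def field_simps)
  qed
  have "(\<lambda>n. \<integral>t. u n t \<partial>\<mu>) \<longlonglongrightarrow> (\<integral>t. 0 \<partial>\<mu>)"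
  proof (rule integral_dominated_convergence[where w = "\<lambda>_. A"])
    show "AE t in \<mu>. (\<lambda>n. u n t) \<longlonglongrightarrow> 0" using lim by (intro AE_I2) (simp add: sp)
    show "AE t in \<mu>. norm (u n t) \<le> A" for n using ub by (intro AE_I2) (simp add: sp)
  qed (use um in auto)
  then have "(\<integral>t. f0 t \<partial>\<mu>) = 0" unfolding iu by (simp add: LIMSEQ_const_iff)
  then show ?zero unfolding \<mu>_def f0_def integral_restrict_space[OF Gs] .
  show ?int using int0 unfolding \<mu>_def f0_def integrable_restrict_space[OF Gs] .
qed

text \<open>1 and \<open>lam\<close> are linearly independent over the rationals, so a functional
  may be prescribed as 0 on the first and 1 on the second.\<close>

lemma (in rotation) ex_additive:
  "\<exists>f :: real \<Rightarrow> real. (\<forall>x y. f (x + y) = f x + f y) \<and> (\<forall>r. r - lam \<in> \<int> \<longrightarrow> f r = 1)"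
proof -
  interpret V: vector_space "\<lambda>(q::rat) (x::complex). of_rat q * x"
    by unfold_locales (simp_all add: algebra_simps of_rat_add of_rat_mult)
  have "\<not> V.dependent {of_real lam, 1}"
  proof (rule V.independent_insertI)
    have "complex_of_real lam \<noteq> of_rat q" for q
    proof
      have q: "(of_rat q :: complex) = of_real (of_rat q)" by (cases q) (simp add: of_rat_rat)
      assume "complex_of_real lam = of_rat q"
      then have "complex_of_real lam = of_real (of_rat q)" unfolding q .
      then have "lam = of_rat q" by (simp only: of_real_eq_iff)
      then show False using lam_irrational by simp
    qed
    then show "complex_of_real lam \<notin> V.span {1}" by (auto simp: V.span_singleton)
    show "\<not> V.dependent {1}" by (simp add: V.dependent_single)
  qed
  from ex_rat_functional[OF this, of "\<lambda>x. if x = 1 then 0 else 1"]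
  obtain \<phi> :: "complex \<Rightarrow> rat" where \<phi>: "\<And>x y. \<phi> (x + y) = \<phi> x + \<phi> y" "\<And>q x. \<phi> (of_rat q * x) = q * \<phi> x"
    "\<forall>x\<in>{of_real lam, 1}. \<phi> x = (if x = 1 then 0 else 1)" by blast
  have "\<phi> 1 = 0" "\<phi> (of_real lam) = 1" using \<phi>(3) lam_bounds by auto
  define f :: "real \<Rightarrow> real" where "f r = of_rat (\<phi> (of_real r))" for r
  have "f (x + y) = f x + f y" for x y by (simp add: f_def \<phi>(1) of_rat_add)
  moreover have "f r = 1" if rl: "r - lam \<in> \<int>" for r
  proof -
    from rl obtain j :: int where j: "r - lam = of_int j" by (rule Ints_cases)
    have "complex_of_real r = of_real (lam + of_int j)" using j by (intro arg_cong[of _ _ complex_of_real]) simp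
    also have "\<dots> = of_real lam + of_rat (of_int j) * 1" by simp
    finally have "\<phi> (of_real r) = \<phi> (of_real lam) + of_int j * \<phi> 1" by (simp only: \<phi>(1,2))
    then show ?thesis using \<open>\<phi> 1 = 0\<close> \<open>\<phi> (of_real lam) = 1\<close> by (simp add: f_def)
  qed
  ultimately show ?thesis by blast
qed

lemma (in rotation) ex_generic_heights:
  "\<exists>s :: nat \<Rightarrow> real. (\<forall>i. \<bar>s i\<bar> \<le> 1/2) \<and> (\<forall>i. s i - 1/2 \<notin> DZ) \<and> s \<longlonglongrightarrow> 1/2"
proof -
  have "\<exists>s. s \<in> {1/2 - 1 / real (Suc i)<..<1/2} \<and> s - 1/2 \<notin> DZ" for i
  proof (rule ccontr)
    assume "\<not> ?thesis"
    then have "{1/2 - 1 / real (Suc i)<..<1/2} \<subseteq> {c. c - 1/2 \<in> DZ}" by blast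
    then have "countable {1/2 - 1 / real (Suc i)<..<1/2}" by (rule countable_subset[OF _ countable_half_DZ])
    moreover have "1/2 - 1 / real (Suc i) < 1/2" by simp
    ultimately show False using uncountable_open_interval by blast
  qed
  then obtain s where s: "\<And>i. s i \<in> {1/2 - 1 / real (Suc i)<..<1/2}" "\<And>i. s i - 1/2 \<notin> DZ" by metis
  have "\<bar>s i\<bar> \<le> 1/2" for i
  proof -
    have "1 / real (Suc i) \<le> 1" by simp
    then show ?thesis using s(1)[of i] unfolding greaterThanLessThan_iff by linarith
  qed
  moreover have "s \<longlonglongrightarrow> 1/2"
  proof (rule tendsto_sandwich[of "\<lambda>i. 1/2 - 1 / real (Suc i)" s _ "\<lambda>_. 1/2"])
    have "(\<lambda>i. 1/2 - 1 / real (Suc i)) \<longlonglongrightarrow> 1/2 - 0" by (intro tendsto_intros LIMSEQ_Suc[OF lim_const_over_n])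
    then show "(\<lambda>i. 1/2 - 1 / real (Suc i)) \<longlonglongrightarrow> 1/2" by simp
  qed (use s(1) in \<open>auto intro!: eventuallyI less_imp_le\<close>)
  ultimately show ?thesis using s(2) by blast
qed

context all_periodic begin

lemma gen_borel: "gen s \<in> sets borel"
proof -
  have "gen s = {-1/2<..<1/2} - bad s" by (auto simp: gen_def abs_less_iff)
  moreover have "bad s \<in> sets borel" by (rule sets.countable[OF _ countable_bad]) simp
  ultimately show ?thesis by simp
qed

lemma T_pieces_borel:
  assumes s: "\<bar>s\<bar> \<le> 1/2" "s - 1/2 \<notin> DZ"
  shows "{t \<in> gen s. T s t - t = b} \<in> sets borel"
proof -
  have "\<forall>t\<in>gen s. \<exists>e>0. \<forall>t'\<in>gen s. dist t' t < e \<longrightarrow> T s t' - t' = T s t - t"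
    using T_locally_translation s by blast
  then obtain e where e: "\<And>t. t \<in> gen s \<Longrightarrow> e t > 0"
    "\<And>t t'. t \<in> gen s \<Longrightarrow> t' \<in> gen s \<Longrightarrow> dist t' t < e t \<Longrightarrow> T s t' - t' = T s t - t" by metis
  define V where "V = (\<Union>t\<in>{t \<in> gen s. T s t - t = b}. ball t (e t))"
  have "{t \<in> gen s. T s t - t = b} = gen s \<inter> V"
  proof (intro subset_antisym subsetI)
    fix u assume u: "u \<in> gen s \<inter> V"
    then obtain t where t: "t \<in> gen s" "T s t - t = b" "u \<in> ball t (e t)" by (auto simp: V_def)
    then have "T s u - u = T s t - t" using u by (intro e(2)) (auto simp: dist_commute)
    then show "u \<in> {t \<in> gen s. T s t - t = b}" using u t by simp
  qed (use e(1) in \<open>auto simp: V_def\<close>)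
  moreover have "open V" by (auto simp: V_def)
  ultimately show ?thesis using gen_borel by (simp add: sets.Int)
qed

lemma all_periodic_absurd: False
proof -
  obtain s :: "nat \<Rightarrow> real" where s: "\<And>i. \<bar>s i\<bar> \<le> 1/2" "\<And>i. s i - 1/2 \<notin> DZ" "s \<longlonglongrightarrow> 1/2"
    using ex_generic_heights by blast
  obtain f :: "real \<Rightarrow> real" where f: "\<And>x y. f (x + y) = f x + f y" "\<And>r. r - lam \<in> \<int> \<Longrightarrow> f r = 1"
    using ex_additive by blast
  obtain A where A: "\<And>i t. t \<in> gen (s i) \<Longrightarrow> \<bar>f (disp (Xo (s i) t))\<bar> \<le> A"
    using bounded_disp[OF s, of f] by blast
  have dT: "T (s i) t - t = disp (Xo (s i) t)" for i t by (simp add: T_def)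
  define u where "u i t = indicator (gen (s i)) t *\<^sub>R f (T (s i) t - t)" for i t
  have ui: "integrable lborel (u i)" "(\<integral>t. u i t \<partial>lborel) = 0" for i
  proof -
    have G: "gen (s i) \<subseteq> {-1/2<..<1/2}" by (auto simp: gen_def abs_less_iff)
    note Z = zero_mean_of_periodic_translations[OF gen_borel G T_gen(1)[OF _ s(1,2)] countable_DZ T_gen(2)[OF _ s(1,2)]
        T_pieces_borel[OF s(1,2)] T_periodic[OF _ s(1,2)] f(1)]
    show "integrable lborel (u i)" unfolding u_def by (rule Z(1)) (use A dT in auto)
    show "(\<integral>t. u i t \<partial>lborel) = 0" unfolding u_def by (rule Z(2)) (use A dT in auto)
  qed
  have A0: "A \<ge> 0 \<or> gen (s i) = {}" for i using A abs_ge_zero order_trans by blast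
  have ub: "\<bar>u i t\<bar> \<le> A * indicator {-1/2<..<1/2} t" for i t
  proof (cases "t \<in> gen (s i)")
    case True
    then have "t \<in> {-1/2<..<1/2}" by (auto simp: gen_def abs_less_iff)
    then show ?thesis using A[OF True] True dT by (simp add: u_def)
  next
    case False
    have "A \<ge> 0"
    proof (rule ccontr)
      assume "\<not> A \<ge> 0"
      then have "gen (s i) = {}" using A0 by blast
      then have "{-1/2<..<1/2} \<subseteq> bad (s i)" by (auto simp: gen_def abs_less_iff)
      then show False using countable_subset[OF _ countable_bad] uncountable_open_interval[of "-1/2" "1/2::real"] by auto
    qed
    then show ?thesis using False by (simp add: u_def)
  qed
  \<comment> \<open>Reflection pairs the displacements at t and -t. Their sum is eventually
    \<open>lam\<close> up to an integer, where \<open>f\<close> equals 1; so the \<open>w i\<close>,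
    all of integral 0, converge to the indicator of an interval of length 1.\<close>
  define w where "w i t = u i t + u i (- t)" for i t
  have ur: "integrable lborel (\<lambda>t. u i (- t))" "(\<integral>t. u i (- t) \<partial>lborel) = 0" for i
    using lborel_integrable_real_affine[OF ui(1)[of i], of "-1" 0] lborel_integral_real_affine[of "-1" "u i" 0] ui(2)[of i]
    by simp_all
  have wi: "(\<integral>t. w i t \<partial>lborel) = 0" for i
    unfolding w_def using ui ur by (simp add: Bochner_Integration.integral_add)
  define I where "I = {-1/2<..<1/2::real}"
  \<comment> \<open>The positions that are exceptional for the limit line or for any of the lines
    \<open>s i\<close>, symmetrised so that outside this set t and -t are generic together.\<close>
  define N where "N = bad (1/2) \<union> uminus ` bad (1/2) \<union> (\<Union>i. bad (s i)) \<union> (\<Union>i. uminus ` bad (s i))"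
  have "countable N" unfolding N_def using countable_bad by (intro countable_Un countable_UN countable_image) auto
  then have N: "N \<in> null_sets lborel" by (rule countable_imp_null_set_lborel)
  have wl: "(\<lambda>i. w i t) \<longlonglongrightarrow> indicator I t" if t: "t \<notin> N" for t
  proof (cases "t \<in> I")
    case True
    have mem: "t \<notin> bad r" "- t \<notin> bad r" if "r = 1/2 \<or> r \<in> range s" for r
    proof -
      from that have "t \<in> bad r \<Longrightarrow> t \<in> N" unfolding N_def by blast
      moreover have "- t \<in> bad r \<Longrightarrow> t \<in> uminus ` bad r" by (rule image_eqI[of _ _ "- t"]) simp
      with that have "- t \<in> bad r \<Longrightarrow> t \<in> N" unfolding N_def by blast
      ultimately show "t \<notin> bad r" "- t \<notin> bad r" using t by blast+
    qed
    have "\<bar>t\<bar> < 1/2" using True by (auto simp: I_def abs_less_iff)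
    then have g: "t \<in> gen (s i)" "- t \<in> gen (s i)" for i using mem[of "s i"] by (auto simp: gen_def)
    have "eventually (\<lambda>i. disp (Xo (s i) t) + disp (Xo (s i) (- t)) - lam \<in> \<int>) sequentially"
      by (rule disp_pair[OF s _ _ g]) (use mem in auto)
    then have "eventually (\<lambda>i. w i t = 1) sequentially"
    proof eventually_elim
      case (elim i)
      have "w i t = f (T (s i) t - t) + f (T (s i) (- t) - - t)" using g by (simp add: w_def u_def)
      then have "w i t = f (disp (Xo (s i) t) + disp (Xo (s i) (- t)))" unfolding dT f(1) .
      then show ?case using f(2)[OF elim] by simp
    qed
    then show ?thesis using True by (simp add: tendsto_eventually)
  next
    case False
    then have "t \<notin> gen (s i)" "- t \<notin> gen (s i)" for i by (auto simp: I_def gen_def abs_less_iff)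
    then show ?thesis using False by (simp add: w_def u_def)
  qed
  have "(\<lambda>i. \<integral>t. w i t \<partial>lborel) \<longlonglongrightarrow> (\<integral>t. indicator I t \<partial>lborel)"
  proof (rule integral_dominated_convergence[where w = "\<lambda>t. 2 * A * indicator I t"])
    show "w i \<in> borel_measurable lborel" for i
      unfolding w_def by (rule borel_measurable_integrable[OF Bochner_Integration.integrable_add[OF ui(1) ur(1)]])
    show "integrable lborel (\<lambda>t. 2 * A * indicator I t)" by (simp add: I_def)
    show "AE t in lborel. (\<lambda>i. w i t) \<longlonglongrightarrow> indicator I t"
      by (rule AE_I'[OF N]) (use wl in auto)
    show "AE t in lborel. norm (w i t) \<le> 2 * A * indicator I t" for i
    proof (rule AE_I2)
      fix t :: real
      have "indicator I (- t) = (indicator I t :: real)" by (auto simp: I_def indicator_def)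
      then have "\<bar>u i t\<bar> \<le> A * indicator I t" "\<bar>u i (- t)\<bar> \<le> A * indicator I t"
        using ub[of i t] ub[of i "- t"] unfolding I_def[symmetric] by (simp_all only:)
      then show "norm (w i t) \<le> 2 * A * indicator I t"
        using abs_triangle_ineq[of "u i t" "u i (- t)"] unfolding w_def real_norm_def by linarith
    qed
  qed (simp add: I_def)
  then have "(\<integral>t. indicator I t \<partial>lborel) = (0::real)" unfolding wi by (simp add: LIMSEQ_const_iff)
  then show False by (simp add: I_def)
qed

end

lemma (in rotation) ex_strict_aperiodic: "\<exists>x. strict x \<and> \<not> periodic x"
proof (rule ccontr)
  assume "\<not> ?thesis"
  then interpret all_periodic h by unfold_locales blast
  show False by (rule all_periodic_absurd)
qed

section \<open>From sequences to the billiard\<close>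

context rotation begin

lemma U_subadditive:
  assumes "0 \<le> n" "n \<le> int h"
  shows "U (n + 1) \<le> U n + 1"
proof -
  have "0 \<le> sin (of_int n * th)"
  proof (rule sin_ge_zero)
    show "0 \<le> of_int n * th" using assms th_bounds by simp
    have "of_int n * th \<le> real h * th" using assms th_bounds by (intro mult_right_mono) auto
    then show "of_int n * th \<le> pi" by (simp add: h_th)
  qed
  then have "sin (of_int n * th) * cos th \<le> sin (of_int n * th) * 1" by (intro mult_left_mono) auto
  moreover have "cos (of_int n * th) * sin th \<le> 1 * sin th" using sin_th_pos by (intro mult_right_mono) auto
  ultimately have "sin (of_int (n + 1) * th) \<le> sin (of_int n * th) + sin th"
    by (simp add: distrib_right sin_add)
  then show ?thesis using sin_th_pos by (simp add: U_def divide_simps)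
qed

lemma U_pos: "0 < n \<Longrightarrow> n < int h \<Longrightarrow> U n > 0"
proof -
  assume n: "0 < n" "n < int h"
  have "0 < sin (of_int n * th)"
  proof (rule sin_gt_zero)
    show "0 < of_int n * th" using n th_bounds by simp
    have "of_int n * th < real h * th" using n th_bounds by (intro mult_strict_right_mono) auto
    then show "of_int n * th < pi" by (simp add: h_th)
  qed
  then show ?thesis using sin_th_pos by (simp add: U_def)
qed

text \<open>Two equal consecutive nonzero codes would let a homogeneous solution, which is a
  sinusoid, dip below \<open>-1/2\<close> twice while staying above in between.\<close>

lemma no_two_equal_codes_pos:
  assumes x: "strict x" and ml: "m < l" and c: "code x m = 1" "code x l = 1"
    and zero: "\<And>i. m < i \<Longrightarrow> i < l \<Longrightarrow> code x i = 0"
  shows False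
proof -
  define v where "v i = ext x (m + 1) i" for i
  have hv: "v (i + 1) = lam * v i - v (i - 1)" for i unfolding v_def by (rule ext_homogeneous)
  have vx: "v (m + int k) = x (m + int k) \<and> v (m + int k + 1) = x (m + int k + 1)" if "m + int k < l" for k
    using that
  proof (induction k)
    case 0
    then show ?case using ext_self[of x "m + 1"] ext_pred[of x "m + 1"] by (simp add: v_def)
  next
    case (Suc k)
    have "code x (m + int k + 1) = 0" using zero Suc.prems by simp
    then have "x (m + int k + 1 + 1) = lam * x (m + int k + 1) - x (m + int k + 1 - 1)" by (simp add: code_def)
    then have "v (m + int k + 1 + 1) = x (m + int k + 1 + 1)"
      using Suc hv[of "m + int k + 1"] by simp
    moreover have e: "m + int (Suc k) = m + int k + 1" by simp
    moreover have "v (m + int k + 1) = x (m + int k + 1)" using Suc by simp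
    ultimately show ?case unfolding e by blast
  qed
  have in_v: "v i = x i" if "m \<le> i" "i \<le> l" for i
  proof (cases "i = l")
    case True
    then show ?thesis using vx[of "nat (l - 1 - m)"] ml by simp
  next
    case False
    then show ?thesis using vx[of "nat (i - m)"] that by simp
  qed
  \<comment> \<open>The times just outside the run. Deprived of the codes at \<open>m\<close> and
    \<open>l\<close>, the sinusoid continues below -1/2 at both.\<close>
  define a b where "a = m - 1" and "b = l + 1"
  have va: "v a < - (1/2)"
  proof -
    have "v (m - 1) = lam * v m - v (m + 1)" using hv[of m] by simp
    then have "v a = x (m - 1) - code x m" using in_v[of m] in_v[of "m + 1"] ml by (simp add: a_def code_def)
    then show ?thesis using strict_abs[OF x, of "m - 1"] c by simp
  qed
  have vb: "v b < - (1/2)"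
  proof -
    have "v b = x (l + 1) - code x l" using in_v[of l] in_v[of "l - 1"] ml hv[of l] by (simp add: b_def code_def)
    then show ?thesis using strict_abs[OF x, of "l + 1"] c by simp
  qed
  define n where "n = b - a"
  have n: "n \<ge> 3" using ml by (simp add: n_def a_def b_def)
  \<comment> \<open>Less than half a period apart,
    \<open>v b = U n * v (a + 1) - U (n - 1) * v a\<close> exceeds (U (n - 1) - U n) / 2, which is
    at least -1/2. Otherwise antiperiodicity gives a value above 1/2 at time
    \<open>a + int h\<close>, which lies inside the run or is \<open>b\<close>.\<close>
  show False
  proof (cases "n < int h")
    case True
    have "v b = U n * v (a + 1) - U (n - 1) * v a" using homogeneous_via_U[of v b a, OF hv] by (simp add: n_def)
    moreover have "v (a + 1) > - (1/2)" using in_v[of "a + 1"] strict_abs[OF x, of "a + 1"] ml by (simp add: a_def abs_less_iff)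
    moreover have "U n > 0" "U (n - 1) > 0" using True n by (intro U_pos; simp)+
    moreover have "U n \<le> U (n - 1) + 1" using U_subadditive[of "n - 1"] n True by simp
    moreover have "U n * (- (1/2)) < U n * v (a + 1)" using calculation by (intro mult_strict_left_mono) auto
    moreover have "U (n - 1) * v a < U (n - 1) * (- (1/2))" using calculation va by (intro mult_strict_left_mono) auto
    ultimately show False using vb by linarith
  next
    case False
    have "v (a + int h) = - v a" unfolding v_def by (rule ext_add_h)
    then have big: "v (a + int h) > 1/2" using va by simp
    show False
    proof (cases "a + int h = b")
      case True then show False using big vb by simp
    next
      case neq: False
      then have "m \<le> a + int h" "a + int h \<le> l" using False h_pos by (auto simp: n_def a_def b_def)
      then have "v (a + int h) = x (a + int h)" by (rule in_v)
      then show False using big strict_abs[OF x, of "a + int h"] by (simp add: abs_less_iff)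
    qed
  qed
qed

lemma no_two_equal_codes:
  assumes x: "strict x" and ml: "m < l" and c: "code x m \<noteq> 0" "code x l \<noteq> 0"
    and zero: "\<And>i. m < i \<Longrightarrow> i < l \<Longrightarrow> code x i = 0"
  shows "code x l = - code x m"
proof (rule ccontr)
  assume "code x l \<noteq> - code x m"
  then consider "code x m = 1" "code x l = 1" | "code x m = -1" "code x l = -1"
    using code_cases[OF strict_orbit[OF x], of m] code_cases[OF strict_orbit[OF x], of l] c by auto
  then show False
  proof cases
    case 1
    then show False using no_two_equal_codes_pos[OF x ml _ _ zero] by blast
  next
    case 2
    have "code (\<lambda>n. - x n) i = - code x i" for i by (simp add: code_def)
    then show False using no_two_equal_codes_pos[OF strict_uminus[OF x] ml] 2 zero by simp
  qed
qed

text \<open>With zero codes from time n on, the motion is a rotation of order 2h, the state returns,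
  and a strict orbit with a returning state is periodic.\<close>

lemma ex_next_code:
  assumes x: "strict x" "\<not> periodic x"
  shows "\<exists>k::nat. code x (n + int k) \<noteq> 0"
proof (rule ccontr)
  assume "\<not> ?thesis"
  then have z: "code x (n + int k) = 0" for k by blast
  have e: "ext x (n + 2 * int h) i = ext x n i" for i
    using ext_sum[of x n "2 * h" i] z by simp
  have "x (n + 2 * int h) = x n" "x (n + 2 * int h - 1) = x (n - 1)"
    using e[of "n + 2 * int h"] e[of "n + 2 * int h - 1"] ext_add_mult_2h[of x n n 1] ext_add_mult_2h[of x n "n - 1" 1]
    by (simp_all add: algebra_simps)
  then have "x (i + (n + 2 * int h - n)) = x i" for i by (rule strict_return[OF x(1)])
  then have "periodic x" unfolding periodic_def using h_pos by (intro exI[of _ "2 * int h"]) simp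
  then show False using x by blast
qed

text \<open>Since the nonzero codes alternate, the sum of the codes is determined, up to a constant, by
  the sign of the next nonzero code.\<close>

lemma ex_code_potential:
  assumes x: "strict x" "\<not> periodic x"
  shows "\<exists>m :: int \<Rightarrow> nat. (\<forall>j. m j \<ge> 1) \<and> (\<forall>j. real (m (j + 1)) = real (m j) - code x j)"
proof -
  define nx where "nx n = (LEAST k. code x (n + int k) \<noteq> 0)" for n
  define \<phi> where "\<phi> n = code x (n + int (nx n))" for n
  have nz: "\<phi> n \<noteq> 0" and min: "k < nx n \<Longrightarrow> code x (n + int k) = 0" for n k
    using LeastI_ex[OF ex_next_code[OF x, of n]] not_less_Least[of k "\<lambda>k. code x (n + int k) \<noteq> 0"]
    by (auto simp: nx_def \<phi>_def)
  have \<phi>1: "\<phi> n = 1 \<or> \<phi> n = -1" for n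
    using nz[of n] code_cases[OF strict_orbit[OF x(1)], of "n + int (nx n)"] by (auto simp: \<phi>_def)
  have step: "\<phi> n - \<phi> (n + 1) = 2 * code x n" for n
  proof (cases "code x n = 0")
    case True
    have "nx n \<noteq> 0" using nz[of n] True by (auto simp: \<phi>_def intro: ccontr)
    then obtain k where k: "nx n = Suc k" by (metis not0_implies_Suc)
    have "nx (n + 1) = k"
      unfolding nx_def
    proof (rule Least_equality)
      show "code x (n + 1 + int k) \<noteq> 0" using nz[of n] by (simp add: \<phi>_def k algebra_simps)
      show "k \<le> y" if "code x (n + 1 + int y) \<noteq> 0" for y
      proof (rule ccontr)
        assume "\<not> k \<le> y"
        then have "code x (n + int (Suc y)) = 0" using min[of "Suc y" n] k by simp
        then show False using that by (simp add: algebra_simps)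
      qed
    qed
    then have "\<phi> (n + 1) = \<phi> n" by (simp add: \<phi>_def k algebra_simps)
    then show ?thesis using True by simp
  next
    case False
    then have "nx n = 0" by (simp add: nx_def)
    then have n: "\<phi> n = code x n" by (simp add: \<phi>_def)
    have "code x (n + 1 + int (nx (n + 1))) = - code x n"
    proof (rule no_two_equal_codes[OF x(1) _ False])
      show "code x (n + 1 + int (nx (n + 1))) \<noteq> 0" using nz[of "n + 1"] by (simp add: \<phi>_def)
      fix i assume "n < i" "i < n + 1 + int (nx (n + 1))"
      then show "code x i = 0" using min[of "nat (i - n - 1)" "n + 1"] by simp
    qed simp
    then show ?thesis using n by (simp add: \<phi>_def)
  qed
  \<comment> \<open>By \<open>step\<close>, half the sign of the next nonzero code decreases by
    exactly the current code. Adding 3/2 turns it into the positive integer 1 or 2.\<close>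
  define m where "m n = (if \<phi> n = 1 then 2 else 1 :: nat)" for n
  have m: "real (m n) = (3 + \<phi> n) / 2" for n using \<phi>1[of n] by (auto simp: m_def)
  have "real (m (j + 1)) = real (m j) - code x j" for j using step[of j] unfolding m by (simp add: field_simps)
  moreover have "m j \<ge> 1" for j by (simp add: m_def)
  ultimately show ?thesis by blast
qed

end

lemma ex_sign_sequence:
  fixes \<epsilon> :: "int \<Rightarrow> real"
  assumes \<epsilon>: "\<And>q. \<epsilon> q \<in> {-1, 1}"
  shows "\<exists>S. (\<forall>q. S q \<in> {-1, 1}) \<and> S 0 = 1 \<and> (\<forall>q. S (q + 1) = S q * \<epsilon> q)"
proof -
  define S where "S q = (if q \<ge> 0 then \<Prod>i<nat q. \<epsilon> (int i) else \<Prod>i<nat (- q). \<epsilon> (- int i - 1))" for q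
  have pm: "(\<Prod>i<k. g i) \<in> {-1, 1::real}" if "\<And>i. g i \<in> {-1, 1}" for g and k :: nat
  proof (induction k)
    case (Suc k)
    then show ?case using that[of k] by auto
  qed simp
  have "S q \<in> {-1, 1}" for q unfolding S_def by (cases "q \<ge> 0") (simp_all only: if_True if_False pm[OF \<epsilon>])
  moreover have "S (q + 1) = S q * \<epsilon> q" for q
  proof (cases "q \<ge> 0")
    case True
    then have "nat (q + 1) = Suc (nat q)" by simp
    then show ?thesis using True by (simp add: S_def)
  next
    case False
    define k where "k = nat (- q - 1)"
    have q: "q = - int k - 1" "nat (- q) = Suc k" "nat (- (q + 1)) = k" using False by (simp_all add: k_def)
    have "S q = (\<Prod>i<k. \<epsilon> (- int i - 1)) * \<epsilon> q" using False by (simp add: S_def q(2)) (simp add: q(1))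
    moreover have "S (q + 1) = (\<Prod>i<k. \<epsilon> (- int i - 1))"
    proof (cases "q + 1 \<ge> 0")
      case True
      then show ?thesis using False q by (simp add: S_def)
    next
      case False
      then show ?thesis unfolding S_def q(3) by simp
    qed
    ultimately show ?thesis using \<epsilon>[of q] by auto
  qed
  ultimately show ?thesis by (intro exI[of _ S]) (auto simp: S_def)
qed

subsection \<open>Orbits of injective partial maps\<close>

lemma partial_iterate_add:
  "partial_iterate f (m + n) z = Option.bind (partial_iterate f m z) (partial_iterate f n)"
proof (induction n)
  case (Suc n)
  then show ?case by (cases "partial_iterate f m z") simp_all
qed (cases "partial_iterate f m z"; simp)

lemma partial_iterate_prefix:
  assumes "partial_iterate f n z = Some w" "m \<le> n"
  shows "partial_iterate f m z \<noteq> None"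
proof -
  have "partial_iterate f n z = Option.bind (partial_iterate f m z) (partial_iterate f (n - m))"
    using partial_iterate_add[of f m "n - m" z] assms(2) by simp
  then show ?thesis using assms(1) by (cases "partial_iterate f m z") auto
qed

lemma partial_inverse_eq:
  assumes "\<And>a b w. f a = Some w \<Longrightarrow> f b = Some w \<Longrightarrow> a = b"
  shows "partial_inverse f w = Some a \<longleftrightarrow> f a = Some w"
proof
  assume h: "partial_inverse f w = Some a"
  then obtain z where z: "f z = Some w" by (auto simp: partial_inverse_def split: if_splits)
  then have "(THE z. f z = Some w) = z" using assms by blast
  then show "f a = Some w" using h z by (auto simp: partial_inverse_def split: if_splits)
next
  assume h: "f a = Some w"
  then have "(THE z. f z = Some w) = a" using assms by blast
  then show "partial_inverse f w = Some a" using h by (auto simp: partial_inverse_def)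
qed

lemma partial_iterate_inverse:
  assumes inj: "\<And>a b w. f a = Some w \<Longrightarrow> f b = Some w \<Longrightarrow> a = b"
  shows "partial_iterate f n z = Some w \<Longrightarrow> partial_iterate (partial_inverse f) n w = Some z"
proof (induction n arbitrary: w)
  case (Suc n)
  then obtain u where u: "partial_iterate f n z = Some u" "f u = Some w"
    by (cases "partial_iterate f n z") auto
  have "partial_iterate (partial_inverse f) (1 + n) w
      = Option.bind (partial_iterate (partial_inverse f) 1 w) (partial_iterate (partial_inverse f) n)"
    by (rule partial_iterate_add)
  moreover have "partial_inverse f w = Some u \<longleftrightarrow> f u = Some w" by (rule partial_inverse_eq) (erule (1) inj)
  then have "partial_iterate (partial_inverse f) 1 w = Some u" using u(2) by simp
  ultimately show ?case using Suc.IH[OF u(1)] by simp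
qed simp

text \<open>The points \<open>z q\<close> lie on one orbit with at least one iteration between
  neighbours, so all iterates in both directions exist. A coincidence among the iterates would make
  the forward orbit finite, yet it visits infinitely many \<open>z q\<close>.\<close>

lemma aperiodic_point_of_chain:
  fixes z :: "int \<Rightarrow> 'a"
  assumes inj: "\<And>a b w. f a = Some w \<Longrightarrow> f b = Some w \<Longrightarrow> a = b"
    and step: "\<And>q. n q \<ge> 1 \<and> partial_iterate f (n q) (z q) = Some (z (q + 1))"
    and inf: "infinite (z ` {0..})"
  shows "aperiodic_point f (z 0)"
proof -
  have chain: "\<exists>t\<ge>k. partial_iterate f t (z q) = Some (z (q + int k))" for q k
  proof (induction k)
    case (Suc k)
    then obtain t where t: "t \<ge> k" "partial_iterate f t (z q) = Some (z (q + int k))" by blast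
    have "partial_iterate f (t + n (q + int k)) (z q) = Some (z (q + int k + 1))"
      unfolding partial_iterate_add t(2) using step[of "q + int k"] by simp
    then show ?case using t(1) step[of "q + int k"]
      by (intro exI[of _ "t + n (q + int k)"]) (simp add: algebra_simps)
  qed (auto intro: exI[of _ 0])
  have fwd: "partial_iterate f k (z 0) \<noteq> None" for k
    using chain[of k 0] partial_iterate_prefix by metis
  have bwd: "partial_iterate (partial_inverse f) k (z 0) \<noteq> None" for k
  proof -
    obtain t where t: "t \<ge> k" "partial_iterate f t (z (- int k)) = Some (z 0)" using chain[of k "- int k"] by auto
    have "partial_iterate (partial_inverse f) t (z 0) = Some (z (- int k))"
      by (rule partial_iterate_inverse[OF _ t(2)]) (erule (1) inj)
    then show ?thesis using t(1) by (rule partial_iterate_prefix)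
  qed
  define g where "g i = the (int_iterate f i (z 0))" for i
  have g: "int_iterate f i (z 0) = Some (g i)" for i
    using fwd bwd by (auto simp: int_iterate_def g_def)
  have gstep: "f (g i) = Some (g (i + 1))" for i
  proof (cases "i \<ge> 0")
    case True
    have "partial_iterate f (nat i) (z 0) = Some (g i)" "partial_iterate f (nat (i + 1)) (z 0) = Some (g (i + 1))"
      using g[of i] g[of "i + 1"] True by (simp_all add: int_iterate_def)
    moreover have "nat (i + 1) = Suc (nat i)" using True by simp
    ultimately show ?thesis by simp
  next
    case False
    define k where "k = nat (- i - 1)"
    have k: "nat (- i) = Suc k" "i + 1 = - int k" using False by (simp_all add: k_def)
    have "partial_iterate (partial_inverse f) (Suc k) (z 0) = Some (g i)"
      using g[of i] False by (simp add: int_iterate_def k(1) del: partial_iterate.simps)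
    moreover have "partial_iterate (partial_inverse f) k (z 0) = Some (g (i + 1))"
      using g[of "i + 1"] by (cases "k = 0") (simp_all add: int_iterate_def k(2))
    ultimately have "partial_inverse f (g (i + 1)) = Some (g i)" by simp
    moreover have "partial_inverse f (g (i + 1)) = Some (g i) \<longleftrightarrow> f (g i) = Some (g (i + 1))"
      by (rule partial_inverse_eq) (erule (1) inj)
    ultimately show ?thesis by blast
  qed
  have "g a \<noteq> g b" if ab: "a < b" for a b
  proof
    assume eq: "g a = g b"
    have shift: "g (a + int k) = g (b + int k)" for k
    proof (induction k)
      case (Suc k)
      have "Some (g (a + int k + 1)) = Some (g (b + int k + 1))" using gstep Suc by metis
      then show ?case by (simp add: algebra_simps)
    qed (use eq in simp)
    have per: "g i \<in> g ` {a..<b}" if "i \<ge> a" for i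
    proof -
      have "\<And>i. nat (i - a) = k \<Longrightarrow> i \<ge> a \<Longrightarrow> g i \<in> g ` {a..<b}" for k
      proof (induction k rule: less_induct)
        case (less k)
        show ?case
        proof (cases "i < b")
          case False
          define i' where "i' = a + (i - b)"
          have "g i = g i'" using shift[of "nat (i - b)"] False by (simp add: i'_def)
          moreover have "g i' \<in> g ` {a..<b}"
            using less.IH[of "nat (i' - a)" i'] less.prems False ab by (simp add: i'_def)
          ultimately show ?thesis by simp
        qed (use less.prems in auto)
      qed
      then show ?thesis using that by blast
    qed
    have "z q \<in> g ` {a..<b} \<union> g ` {0..\<bar>a\<bar>}" if q: "q \<ge> 0" for q
    proof -
      obtain t where t: "partial_iterate f t (z 0) = Some (z q)" using chain[of "nat q" 0] q by auto
      then have "g (int t) = z q" by (simp add: g_def int_iterate_def)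
      moreover have "g (int t) \<in> g ` {a..<b} \<union> g ` {0..\<bar>a\<bar>}"
        using per[of "int t"] by (cases "int t \<ge> a") auto
      ultimately show ?thesis by simp
    qed
    then have "z ` {0..} \<subseteq> g ` {a..<b} \<union> g ` {0..\<bar>a\<bar>}" by auto
    then show False using inf finite_subset by blast
  qed
  then have "g a \<noteq> g b" if "a \<noteq> b" for a b using that by (metis linorder_neqE)
  then show ?thesis unfolding aperiodic_point_def using g by simp
qed

subsection \<open>Regular polygons\<close>

definition dir :: "real \<Rightarrow> real^2" where "dir \<alpha> = vector [cos \<alpha>, sin \<alpha>]"

definition along :: "real^2 \<Rightarrow> real \<Rightarrow> real" where "along u \<alpha> = u $ 1 * cos \<alpha> + u $ 2 * sin \<alpha>"

lemma dir_simps [simp]: "dir \<alpha> $ 1 = cos \<alpha>" "dir \<alpha> $ 2 = sin \<alpha>"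
  by (simp_all add: dir_def)

lemma vec2_eqI: "u $ 1 = v $ 1 \<Longrightarrow> u $ 2 = v $ 2 \<Longrightarrow> u = (v :: real^2)"
  by (simp add: vec_eq_iff forall_2)

lemma inner_dir: "u \<bullet> dir \<alpha> = along u \<alpha>"
  by (simp add: along_def inner_vec_def sum_2)

lemma along_dir: "along (dir \<beta>) \<alpha> = cos (\<beta> - \<alpha>)"
  by (simp add: along_def cos_diff)

lemma along_linear [simp]:
  "along (u + v) \<alpha> = along u \<alpha> + along v \<alpha>" "along (u - v) \<alpha> = along u \<alpha> - along v \<alpha>"
  "along (a *\<^sub>R u) \<alpha> = a * along u \<alpha>" "along (- u) \<alpha> = - along u \<alpha>"
  by (simp_all add: along_def algebra_simps)

lemma dir_add_pi: "dir (\<alpha> + pi) = - dir \<alpha>"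
  by (rule vec2_eqI) simp_all

lemma dir_add_2pi_int: "dir (\<alpha> + 2 * pi * of_int n) = dir \<alpha>"
proof (rule vec2_eqI)
  show "dir (\<alpha> + 2 * pi * of_int n) $ 1 = dir \<alpha> $ 1" "dir (\<alpha> + 2 * pi * of_int n) $ 2 = dir \<alpha> $ 2"
    by (simp_all only: dir_simps cos_add sin_add cos_int_2pin sin_int_2pin mult_1_right mult_zero_right add_0_right diff_zero)
qed

text \<open>The origin of \<open>lam\<close>: the projections of a fixed point to directions at
  equal angular steps satisfy the homogeneous recurrence.\<close>

lemma along_recurrence: "along u (\<alpha> - t) + along u (\<alpha> + t) = 2 * cos t * along u \<alpha>"
  by (simp add: along_def cos_add cos_diff sin_add sin_diff algebra_simps)

lemma ex_along:
  assumes "sin (\<beta> - \<alpha>) \<noteq> 0"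
  shows "\<exists>u. along u \<alpha> = A \<and> along u \<beta> = B"
proof -
  define d where "d = sin (\<beta> - \<alpha>)"
  define u :: "real^2" where "u = vector [(A * sin \<beta> - B * sin \<alpha>) / d, (B * cos \<alpha> - A * cos \<beta>) / d]"
  have d: "d = sin \<beta> * cos \<alpha> - cos \<beta> * sin \<alpha>" "d \<noteq> 0" using assms by (simp_all add: d_def sin_diff)
  have "along u \<alpha> = (A * (sin \<beta> * cos \<alpha> - cos \<beta> * sin \<alpha>)) / d" "along u \<beta> = (B * (sin \<beta> * cos \<alpha> - cos \<beta> * sin \<alpha>)) / d"
    by (simp_all add: along_def u_def add_divide_distrib[symmetric] algebra_simps)
  then show ?thesis using d by auto
qed

lemma along_eqI:
  assumes s: "sin (\<beta> - \<alpha>) \<noteq> 0" and "along u \<alpha> = along v \<alpha>" "along u \<beta> = along v \<beta>"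
  shows "u = v"
proof -
  define x y where "x = u $ 1 - v $ 1" and "y = u $ 2 - v $ 2"
  have e: "x * cos \<alpha> + y * sin \<alpha> = 0" "x * cos \<beta> + y * sin \<beta> = 0"
    using assms(2,3) by (simp_all add: along_def x_def y_def algebra_simps)
  have "x * sin (\<beta> - \<alpha>) = sin \<beta> * (x * cos \<alpha> + y * sin \<alpha>) - sin \<alpha> * (x * cos \<beta> + y * sin \<beta>)"
    "y * sin (\<beta> - \<alpha>) = cos \<alpha> * (x * cos \<beta> + y * sin \<beta>) - cos \<beta> * (x * cos \<alpha> + y * sin \<alpha>)"
    by (simp_all add: sin_diff algebra_simps)
  then have "x = 0" "y = 0" using s unfolding e by simp_all
  then show ?thesis by (intro vec2_eqI) (simp_all add: x_def y_def)
qed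

text \<open>The chord between the angles \<alpha> and \<alpha> + 2t has length 2 sin t, normal
  direction \<alpha> + t and distance cos t from the centre; the determinant is its length times the
  signed distance of \<open>u\<close> from it.\<close>

lemma det2_dir: "det2 (dir \<alpha> - u) (dir (\<alpha> + 2 * t) - u) = 2 * sin t * (cos t - along u (\<alpha> + t))"
proof -
  have e: "cos (\<alpha> + 2 * t) - cos \<alpha> = - 2 * sin t * sin (\<alpha> + t)" "sin (\<alpha> + 2 * t) - sin \<alpha> = 2 * sin t * cos (\<alpha> + t)"
    using cos_diff_cos[of "\<alpha> + 2 * t" \<alpha>] sin_diff_sin[of "\<alpha> + 2 * t" \<alpha>] by (simp_all add: add_divide_distrib algebra_simps)
  have "det2 (dir \<alpha> - u) (dir (\<alpha> + 2 * t) - u)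
      = (cos \<alpha> - u $ 1) * (sin (\<alpha> + 2 * t) - sin \<alpha>) - (sin \<alpha> - u $ 2) * (cos (\<alpha> + 2 * t) - cos \<alpha>)"
    by (simp add: det2_def algebra_simps)
  also have "\<dots> = 2 * sin t * ((cos \<alpha> * cos (\<alpha> + t) + sin \<alpha> * sin (\<alpha> + t)) - along u (\<alpha> + t))"
    unfolding e by (simp add: along_def algebra_simps)
  also have "cos \<alpha> * cos (\<alpha> + t) + sin \<alpha> * sin (\<alpha> + t) = cos t"
    using cos_diff[of "\<alpha> + t" \<alpha>] by (simp add: mult.commute)
  finally show ?thesis .
qed

text \<open>On an interval shorter than pi a sinusoid is a positive combination of its values at the
  two ends.\<close>

lemma sinusoid_pos:
  assumes "along u a > 0" "along u b > 0" "a \<le> t" "t \<le> b" "b - a < pi"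
  shows "along u t > 0"
proof (cases "t = a \<or> t = b")
  case False
  then have lt: "a < t" "t < b" using assms by auto
  have "along u t * sin (b - a) = along u a * sin (b - t) + along u b * sin (t - a)"
    by (simp add: along_def sin_diff algebra_simps)
  moreover have "along u a * sin (b - t) > 0" "along u b * sin (t - a) > 0" "sin (b - a) > 0"
    using assms lt by (auto intro!: mult_pos_pos sin_gt_zero)
  ultimately show ?thesis by (metis add_pos_pos zero_less_mult_pos2)
qed (use assms in auto)

section \<open>One step of the billiard about a regular polygon\<close>

locale polygon =
  fixes N :: nat and c :: "real^2" and r \<theta> :: real and P :: "(real^2) set"
  assumes N3: "N \<ge> 3" and r0: "r > 0"
    and P: "P = interior (convex hull ((\<lambda>k::nat. c + r *\<^sub>R vector [cos (\<theta> + 2 * pi * real k / real N),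
                                      sin (\<theta> + 2 * pi * real k / real N)]) ` {..<N}))"
begin

definition vtx :: "int \<Rightarrow> real^2" where "vtx k = c + r *\<^sub>R dir (\<theta> + 2 * pi * of_int k / N)"

definition V :: "(real^2) set" where "V = range vtx"

lemma vtx_mod: "vtx (k mod int N) = vtx k"
proof -
  have "(of_int k :: real) = of_int (int N * (k div int N) + k mod int N)" by (simp only: mult_div_mod_eq)
  then have "real_of_int k = real N * real_of_int (k div int N) + real_of_int (k mod int N)"
    by (simp only: of_int_add of_int_mult of_int_of_nat_eq)
  then have "2 * pi * of_int k / N = 2 * pi * of_int (k mod int N) / N + 2 * pi * of_int (k div int N)"
    using N3 by (simp add: field_simps)
  then have "\<theta> + 2 * pi * of_int k / N = (\<theta> + 2 * pi * of_int (k mod int N) / N) + 2 * pi * of_int (k div int N)" by simp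
  then have "dir (\<theta> + 2 * pi * of_int k / N) = dir (\<theta> + 2 * pi * of_int (k mod int N) / N)"
    by (simp only: dir_add_2pi_int)
  then show ?thesis by (simp add: vtx_def)
qed

lemma mod_bounds: "k mod int N \<noteq> 0 \<Longrightarrow> 1 \<le> k mod int N \<and> k mod int N \<le> int N - 1"
proof -
  have "int N > 0" using N3 by simp
  then have "0 \<le> k mod int N" "k mod int N < int N" by simp_all
  then show "k mod int N \<noteq> 0 \<Longrightarrow> ?thesis" by linarith
qed

lemma V_image: "V = (\<lambda>k. vtx (int k)) ` {..<N}"
proof -
  have "vtx k \<in> (\<lambda>k. vtx (int k)) ` {..<N}" for k
    using N3 by (intro image_eqI[of _ _ "nat (k mod int N)"]) (simp_all add: vtx_mod nat_less_iff)
  then show ?thesis by (auto simp: V_def)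
qed

lemma P_eq: "P = interior (convex hull V)"
  unfolding P V_image vtx_def dir_def by simp

lemma finite_V: "finite V" by (simp add: V_image)

lemma cos_vertex_le:
  assumes "k mod int N \<noteq> 0"
  shows "cos (2 * pi * of_int k / N) \<le> cos (2 * pi / N)"
proof -
  define j where "j = k mod int N"
  have j: "1 \<le> j" "j \<le> int N - 1" using mod_bounds[OF assms] by (simp_all add: j_def)
  have jr: "1 \<le> (of_int j :: real)" "of_int j \<le> real N - 1" using j by linarith+
  have "along (dir \<theta>) (\<theta> + 2 * pi * of_int k / N) = along (dir \<theta>) (\<theta> + 2 * pi * of_int j / N)"
    using vtx_mod[of k] r0 unfolding vtx_def j_def[symmetric] by (simp add: along_def) (metis dir_simps)
  then have e: "cos (2 * pi * of_int k / N) = cos (2 * pi * of_int j / N)" by (simp add: along_dir)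
  show ?thesis
  proof (cases "2 * j \<le> int N")
    case True
    then have "2 * (of_int j :: real) \<le> real N" by linarith
    then have "2 * pi * of_int j / N \<le> pi" using N3 by (simp add: field_simps)
    moreover have "2 * pi / N \<le> 2 * pi * of_int j / N" using jr by (intro divide_right_mono) auto
    ultimately show ?thesis unfolding e by (intro cos_monotone_0_pi_le) auto
  next
    case False
    then have "2 * (of_int j :: real) \<ge> real N" by linarith
    then have "2 * pi * (real N - of_int j) / N \<le> pi" using N3 by (simp add: field_simps)
    moreover have "2 * pi / N \<le> 2 * pi * (real N - of_int j) / N" using jr by (intro divide_right_mono) auto
    moreover have "2 * pi * (real N - of_int j) / N = 2 * pi - 2 * pi * of_int j / N" using N3 by (simp add: field_simps)
    then have "cos (2 * pi * (real N - of_int j) / N) = cos (2 * pi * of_int j / N)" by (simp add: cos_diff)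
    ultimately show ?thesis unfolding e using cos_monotone_0_pi_le[of "2 * pi / N" "2 * pi * (real N - of_int j) / N"] by auto
  qed
qed

text \<open>Odd multiples of pi/N are the angles between vertices and edge normals, and pi/N belongs
  to the two ends of the edge. So the line of an edge supports the polygon.\<close>

lemma cos_edge_le: "cos (pi * of_int (2 * k + 1) / N) \<le> cos (pi / N)"
proof -
  define j where "j = (2 * k + 1) mod (2 * int N)"
  have "j mod 2 = (2 * k + 1) mod 2" unfolding j_def by (rule mod_mod_cancel) simp
  then have "j \<noteq> 0" by auto
  moreover have "2 * int N > 0" using N3 by simp
  then have "0 \<le> j" "j < 2 * int N" unfolding j_def by (rule pos_mod_sign, rule pos_mod_bound)
  ultimately have j: "1 \<le> j" "j \<le> 2 * int N - 1" by auto
  have jr: "1 \<le> (of_int j :: real)" "of_int j \<le> 2 * real N - 1" using j by linarith+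
  define d where "d = (2 * k + 1) div (2 * int N)"
  have "2 * k + 1 = 2 * int N * d + j" by (simp only: j_def d_def mult_div_mod_eq)
  then have "of_int (2 * k + 1) = (of_int (2 * int N * d + j) :: real)" by (rule arg_cong)
  then have "of_int (2 * k + 1) = (2 * real N * of_int d + of_int j :: real)"
    by (simp only: of_int_add of_int_mult of_int_of_nat_eq of_int_numeral)
  then have "pi * of_int (2 * k + 1) / N = pi * of_int j / N + 2 * pi * of_int d"
    using N3 by (simp add: field_simps)
  then have e: "cos (pi * of_int (2 * k + 1) / N) = cos (pi * of_int j / N)"
    by (simp only: cos_add cos_int_2pin sin_int_2pin mult_1_right mult_zero_right diff_zero)
  show ?thesis
  proof (cases "j \<le> int N")
    case True
    then have "(of_int j :: real) \<le> real N" by linarith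
    then have "pi * of_int j / N \<le> pi" using N3 by (simp add: field_simps)
    moreover have "pi / N \<le> pi * of_int j / N" using jr by (intro divide_right_mono) auto
    ultimately show ?thesis unfolding e by (intro cos_monotone_0_pi_le) auto
  next
    case False
    then have "(of_int j :: real) \<ge> real N" by linarith
    then have "pi * (2 * real N - of_int j) / N \<le> pi" using N3 by (simp add: field_simps)
    moreover have "pi / N \<le> pi * (2 * real N - of_int j) / N" using jr by (intro divide_right_mono) auto
    moreover have "pi * (2 * real N - of_int j) / N = 2 * pi - pi * of_int j / N" using N3 by (simp add: field_simps)
    then have "cos (pi * (2 * real N - of_int j) / N) = cos (pi * of_int j / N)" by (simp add: cos_diff)
    ultimately show ?thesis unfolding e using cos_monotone_0_pi_le[of "pi / N" "pi * (2 * real N - of_int j) / N"] by auto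
  qed
qed

lemma vtx_along: "along (vtx k - c) \<alpha> = r * cos (\<theta> + 2 * pi * of_int k / N - \<alpha>)"
  by (simp add: vtx_def along_dir)

lemma hull_halfspace:
  assumes "\<And>v. v \<in> S \<Longrightarrow> along (v - c) \<alpha> \<le> b" "x \<in> convex hull S"
  shows "along (x - c) \<alpha> \<le> b"
proof -
  have "convex hull S \<subseteq> {x. dir \<alpha> \<bullet> x \<le> b + along c \<alpha>}"
  proof (intro hull_minimal convex_halfspace_le subsetI)
    fix x assume "x \<in> S"
    then show "x \<in> {x. dir \<alpha> \<bullet> x \<le> b + along c \<alpha>}"
      using assms(1)[of x] by (simp add: inner_commute[of "dir \<alpha>"] inner_dir)
  qed
  then show ?thesis using assms(2) by (auto simp: inner_commute[of "dir \<alpha>"] inner_dir)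
qed

text \<open>Vertices on a common line would have equal projections \<open>d\<close> to its normal.
  Three consecutive ones and the recurrence with 2 cos t < 2 force \<open>d = 0\<close>, and then
  the normal vector vanishes.\<close>

lemma interior_hull_V: "interior (convex hull V) \<noteq> {}"
proof
  assume "interior (convex hull V) = {}"
  then obtain a b where ab: "a \<noteq> 0" "convex hull V \<subseteq> {x. a \<bullet> x = b}"
    using empty_interior_subset_hyperplane[OF convex_convex_hull] by metis
  define t where "t = 2 * pi / N"
  have t: "0 < t" "t < pi" using N3 by (simp_all add: t_def field_simps)
  have v: "a \<bullet> vtx k = b" for k using ab(2) hull_subset[of V convex] by (auto simp: V_def)
  define d where "d = (b - a \<bullet> c) / r"
  have "along a (\<theta> + 2 * pi * of_int k / N) = d" for k
    using v[of k] r0 unfolding vtx_def d_def by (simp add: inner_dir[symmetric] inner_add_right field_simps)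
  from this[of "-1"] this[of 0] this[of 1]
  have d3: "along a (\<theta> - t) = d" "along a \<theta> = d" "along a (\<theta> + t) = d" by (simp_all add: t_def)
  then have "d + d = 2 * cos t * d" using along_recurrence[of a \<theta> t] by simp
  moreover have "cos t < 1" using cos_monotone_0_pi[of 0 t] t by simp
  moreover from calculation(1) have "(1 - cos t) * d = 0" by (simp add: algebra_simps)
  ultimately have "d = 0" by simp
  then have "a = 0" using along_eqI[of "\<theta> + t" \<theta> a 0] d3 sin_gt_zero[OF t] by (simp add: along_def)
  then show False using ab(1) by blast
qed

lemma closure_P: "closure P = convex hull V"
proof -
  have "closure P = closure (convex hull V)"
    unfolding P_eq by (rule convex_closure_interior[OF convex_convex_hull interior_hull_V])
  then show ?thesis
    by (simp add: closure_closed finite_V finite_imp_compact_convex_hull compact_imp_closed)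
qed

text \<open>By Krein-Milman the hull is spanned by its extreme points. Were a vertex not among them,
  all extreme points would project to its direction no farther than its neighbours do, strictly less
  than the vertex itself, which lies in their hull.\<close>

lemma polygon_vertices_P: "polygon_vertices P = V"
proof
  show "polygon_vertices P \<subseteq> V"
    unfolding polygon_vertices_def closure_P using extreme_point_of_convex_hull by blast
  show "V \<subseteq> polygon_vertices P"
  proof
    fix a assume "a \<in> V"
    then obtain k where k: "a = vtx k" by (auto simp: V_def)
    define E where "E = {x. x extreme_point_of (convex hull V)}"
    have KM: "convex hull V = convex hull E"
      unfolding E_def by (rule Krein_Milman_Minkowski[OF finite_imp_compact_convex_hull[OF finite_V] convex_convex_hull])
    have "a \<in> E"
    proof (rule ccontr)
      assume ne: "a \<notin> E"
      define \<alpha> where "\<alpha> = \<theta> + 2 * pi * of_int k / N"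
      have "along (v - c) \<alpha> \<le> r * cos (2 * pi / N)" if v: "v \<in> E" for v
      proof -
        have "v \<in> V" using v extreme_point_of_convex_hull unfolding E_def by blast
        then obtain l where l: "v = vtx l" by (auto simp: V_def)
        have "(l - k) mod int N \<noteq> 0"
        proof
          assume "(l - k) mod int N = 0"
          then have "l mod int N = k mod int N" by (simp add: mod_eq_dvd_iff dvd_eq_mod_eq_0)
          then have "v = a" unfolding l k by (metis vtx_mod)
          then show False using v ne by blast
        qed
        then have "cos (2 * pi * of_int (l - k) / N) \<le> cos (2 * pi / N)" by (rule cos_vertex_le)
        moreover have "\<theta> + 2 * pi * of_int l / N - \<alpha> = 2 * pi * of_int (l - k) / N"
          using N3 by (simp add: \<alpha>_def field_simps)
        ultimately show ?thesis unfolding l vtx_along using r0 by simp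
      qed
      moreover have "a \<in> convex hull E" using \<open>a \<in> V\<close> hull_subset[of V convex] KM by blast
      ultimately have "along (a - c) \<alpha> \<le> r * cos (2 * pi / N)" by (rule hull_halfspace)
      then have "1 \<le> cos (2 * pi / N)" unfolding k vtx_along using r0 by (simp add: \<alpha>_def)
      moreover have "cos (2 * pi / N) < cos 0"
        using N3 by (intro cos_monotone_0_pi) (auto simp: field_simps)
      ultimately show False by simp
    qed
    then show "a \<in> polygon_vertices P" by (simp add: E_def polygon_vertices_def closure_P)
  qed
qed

text \<open>In coordinates centred at \<open>c\<close>, scaled by \<open>\<sigma> r\<close>, the tangency condition at the vertex in
  direction \<open>\<alpha>\<close> involves only the normals of the two adjacent edges.\<close>

lemma billiard_step:
  assumes \<sigma>: "\<sigma> \<in> {-1, 1}" and vertex: "\<sigma> *\<^sub>R dir \<alpha> = dir (\<theta> + 2 * pi * of_int k / N)"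
    and hi: "along u (\<alpha> - pi / N) > cos (pi / N)" and lo: "along u (\<alpha> + pi / N) < cos (pi / N)"
  shows "outer_billiard P (c + (\<sigma> * r) *\<^sub>R u) = Some (c + (- \<sigma> * r) *\<^sub>R (u - 2 *\<^sub>R dir \<alpha>))"
proof -
  define z where "z = c + (\<sigma> * r) *\<^sub>R u"
  define \<beta> where "\<beta> = \<theta> + 2 * pi * of_int k / N"
  have ss: "\<sigma> * \<sigma> = 1" using \<sigma> by auto
  have bd: "dir \<beta> = \<sigma> *\<^sub>R dir \<alpha>" using vertex by (simp add: \<beta>_def)
  have rot: "dir (\<beta> + t) = \<sigma> *\<^sub>R dir (\<alpha> + t)" for t
  proof (rule vec2_eqI)
    have cs: "cos \<beta> = \<sigma> * cos \<alpha>" "sin \<beta> = \<sigma> * sin \<alpha>" using arg_cong[OF bd, of "\<lambda>v. v $ 1"] arg_cong[OF bd, of "\<lambda>v. v $ 2"] by simp_all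
    show "dir (\<beta> + t) $ 1 = (\<sigma> *\<^sub>R dir (\<alpha> + t)) $ 1" "dir (\<beta> + t) $ 2 = (\<sigma> *\<^sub>R dir (\<alpha> + t)) $ 2"
      by (simp_all add: cos_add sin_add cs algebra_simps)
  qed
  have va: "vtx k = c + (\<sigma> * r) *\<^sub>R dir \<alpha>" unfolding vtx_def \<beta>_def[symmetric] bd by (simp add: mult.commute)
  have other: "strictly_left_of_line z (vtx k) b" if b: "b \<in> V - {vtx k}" for b
  proof -
    obtain l where l: "b = vtx l" using b by (auto simp: V_def)
    define j where "j = (l - k) mod int N"
    have "j \<noteq> 0"
    proof
      assume "j = 0"
      then have "l mod int N = k mod int N" by (simp add: j_def mod_eq_dvd_iff dvd_eq_mod_eq_0)
      then have "b = vtx k" unfolding l by (metis vtx_mod)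
      then show False using b by blast
    qed
    then have j: "1 \<le> j" "j \<le> int N - 1" using mod_bounds[of "l - k"] by (simp_all add: j_def)
    have jr: "1 \<le> (of_int j :: real)" "of_int j \<le> real N - 1" using j by linarith+
    have "b = vtx (k + j)"
    proof -
      have "(k + j) mod int N = l mod int N" by (simp add: j_def mod_simps)
      then show ?thesis unfolding l by (metis vtx_mod)
    qed
    define t where "t = pi * of_int j / N"
    have "\<theta> + 2 * pi * of_int (k + j) / N = \<beta> + 2 * t" by (simp add: \<beta>_def t_def distrib_left add_divide_distrib)
    then have vb: "b = c + (\<sigma> * r) *\<^sub>R dir (\<alpha> + 2 * t)"
      unfolding \<open>b = vtx (k + j)\<close> vtx_def by (simp add: rot mult.commute)
    have "pi * 1 / N \<le> pi * of_int j / N" "pi * of_int j / N \<le> pi * (real N - 1) / N"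
      using jr by (intro divide_right_mono mult_left_mono; simp)+
    then have tb: "pi / N \<le> t" "t \<le> pi - pi / N" using N3 by (simp_all add: t_def field_simps)
    have pN: "0 < pi / N" "pi / N \<le> pi / 3" using N3 by (simp, intro divide_left_mono) auto
    \<comment> \<open>By \<open>det2_dir\<close> the vertex at angular offset 2t lies on the left
      iff this sinusoid is positive at \<alpha> + t. At the extreme values pi/N and pi - pi/N of t,
      the two neighbours, that is \<open>lo\<close> and \<open>hi\<close>; the vertices in between
      follow.\<close>
    define w where "w = dir \<alpha> - u"
    have wc: "along w (\<alpha> + t) = cos t - along u (\<alpha> + t)" for t by (simp add: w_def along_dir)
    have "along w (\<alpha> + t) > 0"
    proof (rule sinusoid_pos[of w "\<alpha> + pi / N" "\<alpha> + (pi - pi / N)"])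
      show "along w (\<alpha> + pi / N) > 0" unfolding wc using lo by simp
      have "along w (\<alpha> + (pi - pi / N)) = - along w (\<alpha> - pi / N)"
        by (simp add: along_def cos_add sin_add cos_diff sin_diff algebra_simps)
      moreover have "along w (\<alpha> - pi / N) = cos (pi / N) - along u (\<alpha> - pi / N)" using wc[of "- (pi / N)"] by simp
      ultimately show "along w (\<alpha> + (pi - pi / N)) > 0" using hi by simp
    qed (use tb pN in auto)
    moreover have "sin t > 0" using tb pN by (intro sin_gt_zero) linarith+
    ultimately have "det2 (dir \<alpha> - u) (dir (\<alpha> + 2 * t) - u) > 0" unfolding det2_dir wc by simp
    moreover have "det2 (vtx k - z) (b - z) = (\<sigma> * r) * (\<sigma> * r) * det2 (dir \<alpha> - u) (dir (\<alpha> + 2 * t) - u)"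
      unfolding va vb z_def det2_def by (simp add: algebra_simps)
    moreover have "(\<sigma> * r) * (\<sigma> * r) > 0" using \<sigma> r0 by auto
    ultimately show ?thesis unfolding strictly_left_of_line_def by simp
  qed
  have tangent: "tangent_vertex P z (vtx k)"
    unfolding tangent_vertex_def polygon_vertices_P using other by (auto simp: V_def)
  moreover have "z \<notin> closure P"
  proof
    assume "z \<in> closure P"
    then have hull: "z \<in> convex hull V" by (simp add: closure_P)
    \<comment> \<open>By \<open>hi\<close> the point lies strictly beyond the supporting line of the
      edge with normal \<beta> - pi/N, hence outside the closed polygon.\<close>
    have le: "along (v - c) (\<beta> - pi / N) \<le> r * cos (pi / N)" if v: "v \<in> V" for v
    proof -
      from v obtain l where l: "v = vtx l" by (auto simp: V_def)
      have "\<theta> + 2 * pi * of_int l / N - (\<beta> - pi / N) = pi * of_int (2 * (l - k) + 1) / N"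
        using N3 by (simp add: \<beta>_def field_simps)
      then show ?thesis unfolding l vtx_along using cos_edge_le[of "l - k"] r0 by simp
    qed
    have "along (z - c) (\<beta> - pi / N) \<le> r * cos (pi / N)" by (rule hull_halfspace[OF le hull])
    moreover have "along (z - c) (\<beta> - pi / N) = r * along u (\<alpha> - pi / N)"
    proof -
      have "along v (\<beta> - pi / N) = \<sigma> * along v (\<alpha> - pi / N)" for v
        using rot[of "- (pi / N)"] by (simp add: inner_dir[symmetric])
      then show ?thesis using ss by (simp add: z_def algebra_simps)
    qed
    ultimately show False using hi r0 by simp
  qed
  ultimately have "outer_billiard P z = Some (2 *\<^sub>R vtx k - z)" unfolding outer_billiard_eq_Some_iff by blast
  moreover have "2 *\<^sub>R vtx k - z = c + (- \<sigma> * r) *\<^sub>R (u - 2 *\<^sub>R dir \<alpha>)"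
    by (rule vec2_eqI) (simp_all add: va z_def algebra_simps)
  ultimately show ?thesis by (simp add: z_def)
qed

end

section \<open>Realisation of a nonperiodic orbit by the billiard\<close>

locale polygon_rotation = polygon + rotation
begin

text \<open>The projections of \<open>Z q\<close> give \<open>x (q - 1)\<close> exactly and
  \<open>x q\<close> up to an integer, which strictness removes. Two equal points with equal sign
  and equal q modulo 2h would therefore make \<open>x\<close> return. As signs and residues are
  finitely many, infinitely many distinct points arise.\<close>

lemma aperiodic_of_coordinates:
  assumes x: "strict x" "\<not> periodic x" and w: "w \<noteq> 0"
    and Z: "\<And>q. along (Z q) (\<psi> - of_int q * th) = a0 + w * x (q - 1)"
      "\<And>q. along (Z q) (\<psi> - of_int (q + 1) * th) = a1 + w * (x q + real (m q))"
    and S: "\<And>q. S q \<in> {-1, 1}"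
    and step: "\<And>q. n q \<ge> 1 \<and> partial_iterate (outer_billiard P) (n q) (c + (S q * r) *\<^sub>R Z q)
      = Some (c + (S (q + 1) * r) *\<^sub>R Z (q + 1))"
  shows "\<exists>z. aperiodic_point (outer_billiard P) z"
proof -
  define z where "z q = c + (S q * r) *\<^sub>R Z q" for q
  have eqI: False if eq: "z p = z q" "S p = S q" "p mod (2 * int h) = q mod (2 * int h)" "p \<noteq> q" for p q
  proof -
    have "S q * r \<noteq> 0" using S[of q] r0 by auto
    then have ZZ: "Z p = Z q" using eq(1) unfolding z_def eq(2) by simp
    have d: "2 * int h dvd p - q" using eq(3) by (simp add: mod_eq_dvd_iff)
    then obtain k where k: "p - q = 2 * int h * k" by (auto simp: dvd_def)
    have ang: "along u (\<psi> - of_int (p + j) * th) = along u (\<psi> - of_int (q + j) * th)" for u j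
    proof -
      have "p + j = (q + j) + 2 * int h * k" using k by simp
      then have "of_int (p + j) * th = of_int (q + j) * th + 2 * (real h * th) * of_int k"
        by (simp add: distrib_right)
      then have "\<psi> - of_int (q + j) * th = (\<psi> - of_int (p + j) * th) + 2 * pi * of_int k"
        unfolding h_th by simp
      then show ?thesis unfolding inner_dir[symmetric] by (simp only: dir_add_2pi_int)
    qed
    have x1: "x (p - 1) = x (q - 1)" using Z(1)[of p] Z(1)[of q] ang[of "Z q" 0] ZZ w by simp
    have "x p + real (m p) = x q + real (m q)" using Z(2)[of p] Z(2)[of q] ang[of "Z q" 1] ZZ w by simp
    then have "x p - x q = of_int (int (m q) - int (m p))" by simp
    then have "x p - x q \<in> \<int>" by (metis Ints_of_int)
    moreover have "\<bar>x p - x q\<bar> < 1" using strict_abs[OF x(1), of p] strict_abs[OF x(1), of q] by linarith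
    ultimately have x0: "x p = x q" using Ints_nonzero_abs_less1 by force
    have "x (i + (p - q)) = x i" "x (i + (q - p)) = x i" for i
      using strict_return[OF x(1), of p q] strict_return[OF x(1), of q p] x0 x1 by simp_all
    then have "\<forall>i. x (i + \<bar>p - q\<bar>) = x i" by (cases "p \<ge> q") auto
    then have "periodic x" unfolding periodic_def using eq(4) by (intro exI[of _ "\<bar>p - q\<bar>"]) simp
    then show False using x(2) by blast
  qed
  have "infinite (z ` {0..})"
  proof
    assume fin: "finite (z ` {0..})"
    define F where "F q = (z q, S q, q mod (2 * int h))" for q
    have "F ` {0..} \<subseteq> z ` {0..} \<times> {-1, 1} \<times> {0..<2 * int h}"
      using S h_pos unfolding F_def by auto
    then have "finite (F ` {0..})" using fin finite_subset by blast
    moreover have "infinite {0::int..}" by (rule infinite_Ici)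
    ultimately have "\<not> inj_on F {0..}" using finite_image_iff by blast
    then obtain p q where "F p = F q" "p \<noteq> q" unfolding inj_on_def by blast
    then show False using eqI[of p q] by (simp add: F_def)
  qed
  then have "aperiodic_point (outer_billiard P) (z 0)"
    using step outer_billiard_inj by (intro aperiodic_point_of_chain[where n = n]) (auto simp: z_def)
  then show ?thesis by blast
qed

lemma ex_coordinates:
  "\<exists>Z. \<forall>q. along (Z q) (\<psi> - of_int q * th) = A q \<and> along (Z q) (\<psi> - of_int (q + 1) * th) = B q"
proof -
  have "\<exists>u. along u (\<psi> - of_int q * th) = A q \<and> along u (\<psi> - of_int (q + 1) * th) = B q" for q
  proof (rule ex_along)
    have "(\<psi> - of_int (q + 1) * th) - (\<psi> - of_int q * th) = - th" by (simp add: algebra_simps)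
    then show "sin ((\<psi> - of_int (q + 1) * th) - (\<psi> - of_int q * th)) \<noteq> 0" using sin_th_pos by simp
  qed
  then show ?thesis by metis
qed

lemma along_rec: "along u (\<psi> - of_int (q + 1) * th) = lam * along u (\<psi> - of_int q * th) - along u (\<psi> - of_int (q - 1) * th)"
  using along_recurrence[of u "\<psi> - of_int q * th" th] by (simp add: lam_def algebra_simps)

lemma coordinates_eqI:
  assumes "along u (\<psi> - of_int q * th) = along v (\<psi> - of_int q * th)"
    "along u (\<psi> - of_int (q + 1) * th) = along v (\<psi> - of_int (q + 1) * th)"
  shows "u = v"
proof (rule along_eqI[OF _ assms])
  have "(\<psi> - of_int (q + 1) * th) - (\<psi> - of_int q * th) = - th" by (simp add: algebra_simps)
  then show "sin ((\<psi> - of_int (q + 1) * th) - (\<psi> - of_int q * th)) \<noteq> 0" using sin_th_pos by simp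
qed

text \<open>For even \<open>N\<close> the central symmetry lets the billiard use the same vertex, up to sign, \<open>m q\<close>
  times in a row.\<close>

lemma aperiodic_even:
  assumes N: "N = 2 * h"
  shows "\<exists>z. aperiodic_point (outer_billiard P) z"
proof -
  obtain x where x: "strict x" "\<not> periodic x" using ex_strict_aperiodic by blast
  obtain m where m: "\<And>j. m j \<ge> 1" "\<And>j. real (m (j + 1)) = real (m j) - code x j" using ex_code_potential[OF x] by blast
  have thN: "pi / N = th / 2" "2 * pi / N = th" by (simp_all add: N th_def)
  \<comment> \<open>The projection of a unit vertex vector to the normals of its two edges.
    Subtracting twice that vector lowers both projections by 2\<kappa>, which is the unit in which
    \<open>x\<close> is measured.\<close>
  define \<kappa> where "\<kappa> = cos (th / 2)"
  have \<kappa>: "\<kappa> > 0" unfolding \<kappa>_def using th_bounds pi_gt_zero by (intro cos_gt_zero_pi) linarith+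
  define \<psi> where "\<psi> = \<theta> + th / 2"
  obtain Z where Z: "\<And>q. along (Z q) (\<psi> - of_int q * th) = 0 + (2 * \<kappa>) * x (q - 1)"
    "\<And>q. along (Z q) (\<psi> - of_int (q + 1) * th) = 0 + (2 * \<kappa>) * (x q + real (m q))"
    using ex_coordinates[of \<psi> "\<lambda>q. 0 + (2 * \<kappa>) * x (q - 1)" "\<lambda>q. 0 + (2 * \<kappa>) * (x q + real (m q))"] by blast
  define a where "a q = dir (\<theta> - of_int q * th)" for q
  have a: "along (a q) (\<psi> - of_int q * th) = \<kappa>" "along (a q) (\<psi> - of_int (q + 1) * th) = \<kappa>" for q
  proof -
    have "\<theta> - of_int q * th - (\<psi> - of_int q * th) = - (th / 2)" "\<theta> - of_int q * th - (\<psi> - of_int (q + 1) * th) = th / 2"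
      by (simp_all add: \<psi>_def distrib_right)
    then show "along (a q) (\<psi> - of_int q * th) = \<kappa>" "along (a q) (\<psi> - of_int (q + 1) * th) = \<kappa>"
      unfolding a_def along_dir \<kappa>_def by (simp_all only: cos_minus)
  qed
  \<comment> \<open>On the normal shared by both blocks the shift removes the integer part
    \<open>m q\<close>. On the next normal the recurrence produces the code of \<open>x\<close>, and
    it matches because \<open>m (q + 1) = m q - code x q\<close>.\<close>
  have Zn: "Z (q + 1) = Z q - (2 * real (m q)) *\<^sub>R a q" for q
  proof (rule coordinates_eqI)
    show "along (Z (q + 1)) (\<psi> - of_int (q + 1) * th) = along (Z q - (2 * real (m q)) *\<^sub>R a q) (\<psi> - of_int (q + 1) * th)"
      using Z(1)[of "q + 1"] Z(2)[of q] a(2)[of q] by (simp add: algebra_simps)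
    have xq: "x (q + 1) = code x q + lam * x q - x (q - 1)" by (simp add: code_def)
    have rec: "along u (\<psi> - of_int (q + 1 + 1) * th) = lam * along u (\<psi> - of_int (q + 1) * th) - along u (\<psi> - of_int q * th)" for u
      using along_rec[of u \<psi> "q + 1"] by (simp only: add_diff_cancel_right')
    show "along (Z (q + 1)) (\<psi> - of_int (q + 1 + 1) * th) = along (Z q - (2 * real (m q)) *\<^sub>R a q) (\<psi> - of_int (q + 1 + 1) * th)"
      unfolding Z(2)[of "q + 1"] unfolding along_linear rec unfolding Z(1)[of q] Z(2)[of q] a m(2) xq by (simp add: algebra_simps)
  qed
  have vertex: "\<exists>k. \<sigma> *\<^sub>R dir (\<theta> - of_int q * th) = dir (\<theta> + 2 * pi * of_int k / N)" if "\<sigma> \<in> {-1, 1}" for \<sigma> q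
  proof -
    have e: "2 * pi * of_int k / N = of_int k * th" for k unfolding thN(2)[symmetric] by simp
    have "- dir (\<theta> - of_int q * th) = dir (\<theta> - of_int q * th + real h * th)"
      unfolding h_th by (simp only: dir_add_pi)
    moreover have "\<theta> - of_int q * th + real h * th = \<theta> + of_int (int h - q) * th" by (simp add: left_diff_distrib)
    moreover have "\<theta> - of_int q * th = \<theta> + of_int (- q) * th" by simp
    ultimately show ?thesis using that unfolding e by (metis insertE scaleR_minus1_left scaleR_one singletonD)
  qed
  have run: "i \<le> m q \<Longrightarrow> partial_iterate (outer_billiard P) i (c + (\<sigma> * r) *\<^sub>R Z q)
      = Some (c + (\<sigma> * (-1) ^ i * r) *\<^sub>R (Z q - (2 * real i) *\<^sub>R a q))" if \<sigma>: "\<sigma> \<in> {-1, 1}" for \<sigma> q i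
  proof (induction i)
    case (Suc i)
    define u where "u = Z q - (2 * real i) *\<^sub>R a q"
    have \<sigma>i: "\<sigma> * (-1) ^ i \<in> {-1, 1}" using \<sigma> by (cases "even i") auto
    obtain k where k: "(\<sigma> * (-1) ^ i) *\<^sub>R dir (\<theta> - of_int q * th) = dir (\<theta> + 2 * pi * of_int k / N)" using vertex[OF \<sigma>i] by blast
    have ang: "\<theta> - of_int q * th - pi / N = \<psi> - of_int (q + 1) * th" "\<theta> - of_int q * th + pi / N = \<psi> - of_int q * th"
      by (simp_all add: thN \<psi>_def distrib_right)
    have "outer_billiard P (c + ((\<sigma> * (-1) ^ i) * r) *\<^sub>R u)
        = Some (c + (- (\<sigma> * (-1) ^ i) * r) *\<^sub>R (u - 2 *\<^sub>R dir (\<theta> - of_int q * th)))"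
    proof (rule billiard_step[OF \<sigma>i k])
      \<comment> \<open>Tangency amounts to \<open>x q + m q - i > 1/2\<close> and
        \<open>x (q - 1) - i < 1/2\<close>. The first holds as long as \<open>i < m q\<close>, which
        is why the block has length \<open>m q\<close>.\<close>
      have b: "- (1/2) < x q" "x (q - 1) < 1/2" using strict_abs[OF x(1), of q] strict_abs[OF x(1), of "q - 1"] by linarith+
      have "1/2 < x q + real (m q) - real i" using b Suc.prems by linarith
      then have "\<kappa> * (1/2) < \<kappa> * (x q + real (m q) - real i)" using \<kappa> by (rule mult_strict_left_mono)
      then show "cos (pi / N) < along u (\<theta> - of_int q * th - pi / N)"
        unfolding ang u_def along_linear Z a unfolding thN \<kappa>_def[symmetric] by (simp add: algebra_simps)
      have "x (q - 1) - real i < 1/2" using b by linarith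
      then have "\<kappa> * (x (q - 1) - real i) < \<kappa> * (1/2)" using \<kappa> by (rule mult_strict_left_mono)
      then show "along u (\<theta> - of_int q * th + pi / N) < cos (pi / N)"
        unfolding ang u_def along_linear Z a unfolding thN \<kappa>_def[symmetric] by (simp add: algebra_simps)
    qed
    moreover have "u - 2 *\<^sub>R dir (\<theta> - of_int q * th) = Z q - (2 * real (Suc i)) *\<^sub>R a q"
      by (simp add: u_def a_def algebra_simps)
    ultimately show ?case using Suc by (simp add: u_def)
  qed simp
  have "(-1) ^ m q \<in> {-1, 1::real}" for q by (cases "even (m q)") auto
  from ex_sign_sequence[of "\<lambda>q. (-1) ^ m q", OF this]
  obtain S :: "int \<Rightarrow> real" where S: "\<And>q. S q \<in> {-1, 1}" "\<And>q. S (q + 1) = S q * (-1) ^ m q" by blast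
  show ?thesis
  proof (rule aperiodic_of_coordinates[where S = S and n = m, OF x _ Z S(1)])
    show "2 * \<kappa> \<noteq> 0" using \<kappa> by simp
    show "1 \<le> m q \<and> partial_iterate (outer_billiard P) (m q) (c + (S q * r) *\<^sub>R Z q) = Some (c + (S (q + 1) * r) *\<^sub>R Z (q + 1))" for q
      using run[OF S(1)[of q], of "m q" q] m(1)[of q] unfolding Zn S(2) by simp
  qed
qed

text \<open>For odd \<open>N\<close> the vertices of \<open>P\<close> and \<open>-P\<close> alternate: the billiard uses two neighbouring
  vertices of the resulting \<open>2N\<close>-gon in turns.\<close>

lemma aperiodic_odd:
  assumes N: "N = h" "odd N"
  shows "\<exists>z. aperiodic_point (outer_billiard P) z"
proof -
  obtain x where x: "strict x" "\<not> periodic x" using ex_strict_aperiodic by blast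
  obtain m where m: "\<And>j. m j \<ge> 1" "\<And>j. real (m (j + 1)) = real (m j) - code x j" using ex_code_potential[OF x] by blast
  have thN: "pi / N = th" by (simp add: N th_def)
  define \<kappa> where "\<kappa> = cos th"
  have lam: "lam = 2 * \<kappa>" by (simp add: lam_def \<kappa>_def)
  \<comment> \<open>A pair of reflections, in \<open>a\<close> and in \<open>b\<close>, shifts by
    twice their sum, whose projection to both normals is \<open>w\<close>. Since w/2 = 1 + \<kappa>,
    the offsets -1 and 1 in the coordinates turn two of the tangency conditions into comparisons
    with 1/2, as in the even case.\<close>
  define w where "w = 2 + 2 * \<kappa>"
  have l1: "lam > 1" using lam_bounds by simp
  have w: "w > 0" "w = lam + 2" using l1 by (simp_all add: w_def lam)
  define \<psi> where "\<psi> = \<theta> + th"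
  obtain Z where Z: "\<And>q. along (Z q) (\<psi> - of_int q * th) = -1 + w * x (q - 1)"
    "\<And>q. along (Z q) (\<psi> - of_int (q + 1) * th) = 1 + w * (x q + real (m q))"
    using ex_coordinates[of \<psi> "\<lambda>q. -1 + w * x (q - 1)" "\<lambda>q. 1 + w * (x q + real (m q))"] by blast
  define a b where "a q = dir (\<theta> - of_int q * th)" and "b q = dir (\<theta> - of_int (q - 1) * th)" for q
  have a: "along (a q) (\<psi> - of_int q * th) = \<kappa>" "along (a q) (\<psi> - of_int (q + 1) * th) = 1"
    and b: "along (b q) (\<psi> - of_int q * th) = 1" "along (b q) (\<psi> - of_int (q + 1) * th) = \<kappa>" for q
  proof -
    have "\<theta> - of_int q * th - (\<psi> - of_int q * th) = - th" "\<theta> - of_int q * th - (\<psi> - of_int (q + 1) * th) = 0"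
      "\<theta> - of_int (q - 1) * th - (\<psi> - of_int q * th) = 0" "\<theta> - of_int (q - 1) * th - (\<psi> - of_int (q + 1) * th) = th"
      by (simp_all add: \<psi>_def algebra_simps)
    then show "along (a q) (\<psi> - of_int q * th) = \<kappa>" "along (a q) (\<psi> - of_int (q + 1) * th) = 1"
      "along (b q) (\<psi> - of_int q * th) = 1" "along (b q) (\<psi> - of_int (q + 1) * th) = \<kappa>"
      unfolding a_def b_def along_dir \<kappa>_def by (simp_all only: cos_minus cos_zero)
  qed
  define Y where "Y q i = Z q - (2 * real i) *\<^sub>R a q - (2 * real i) *\<^sub>R b q" for q and i :: nat
  have Y0: "along (Y q i) (\<psi> - of_int q * th) = -1 + w * (x (q - 1) - real i)"
    and Y1: "along (Y q i) (\<psi> - of_int (q + 1) * th) = 1 + w * (x q + real (m q) - real i)" for q i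
    unfolding Y_def along_linear Z a b by (simp_all add: w_def algebra_simps)
  \<comment> \<open>The two remaining tangency conditions concern normals one step further out. The
    form is chosen so that they say that a bracket is positive, which follows from
    \<open>lam > 1\<close>, \<open>m q \<ge> 1\<close> and the bounds on \<open>x\<close> and its
    codes.\<close>
  have Y2: "along (Y q i) (\<psi> - of_int (q + 1 + 1) * th)
      = \<kappa> + w * (1/2 + x (q + 1) - code x q + lam * (real (m q) - real i) + real i)" for q i
  proof -
    have xq: "x (q + 1) = code x q + lam * x q - x (q - 1)" by (simp add: code_def)
    have "along (Y q i) (\<psi> - of_int (q + 1 + 1) * th) = lam * along (Y q i) (\<psi> - of_int (q + 1) * th) - along (Y q i) (\<psi> - of_int q * th)"
      using along_rec[of "Y q i" \<psi> "q + 1"] by (simp only: add_diff_cancel_right')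
    then show ?thesis unfolding Y0 Y1 xq lam w_def by (simp add: algebra_simps)
  qed
  have Ya0: "along (Y q i - 2 *\<^sub>R a q) (\<psi> - of_int (q - 1) * th)
      = \<kappa> - w * (1/2 - x (q - 2) + code x (q - 1) + (lam - 1) * (real i + 1) + real (m q))" for q i
  proof -
    have xq: "x (q - 2) = code x (q - 1) + lam * x (q - 1) - x q" by (simp add: code_def)
    have rec: "along u (\<psi> - of_int (q - 1) * th) = lam * along u (\<psi> - of_int q * th) - along u (\<psi> - of_int (q + 1) * th)" for u
      using along_rec[of u \<psi> q] by simp
    show ?thesis unfolding along_linear rec unfolding Y0 Y1 a xq lam w_def by (simp add: algebra_simps)
  qed
  have Zn: "Z (q + 1) = Y q (m q) - 2 *\<^sub>R a q" for q
  proof (rule coordinates_eqI)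
    show "along (Z (q + 1)) (\<psi> - of_int (q + 1) * th) = along (Y q (m q) - 2 *\<^sub>R a q) (\<psi> - of_int (q + 1) * th)"
      using Z(1)[of "q + 1"] Y1[of q "m q"] a(2)[of q] by simp
    have "along (a q) (\<psi> - of_int (q + 1 + 1) * th) = lam * along (a q) (\<psi> - of_int (q + 1) * th) - along (a q) (\<psi> - of_int q * th)"
      using along_rec[of "a q" \<psi> "q + 1"] by (simp only: add_diff_cancel_right')
    then have "along (a q) (\<psi> - of_int (q + 1 + 1) * th) = \<kappa>" unfolding a lam by simp
    then show "along (Z (q + 1)) (\<psi> - of_int (q + 1 + 1) * th) = along (Y q (m q) - 2 *\<^sub>R a q) (\<psi> - of_int (q + 1 + 1) * th)"
      unfolding Z(2)[of "q + 1"] m(2) along_linear Y2 by (simp add: w_def algebra_simps)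
  qed
  \<comment> \<open>A block consists of the odd number \<open>2 * m q + 1\<close> of reflections, so
    the sign changes from block to block. As N is odd, this sign also turns the q-th direction of
    the 2N-gon into a vertex direction of \<open>P\<close>.\<close>
  define S where "S q = (if even q then 1 else -1 :: real)" for q :: int
  have S: "S q \<in> {-1, 1}" "S (q + 1) = - S q" "S (q - 1) = - S q" for q by (simp_all add: S_def)
  have vertex: "\<exists>k. S q *\<^sub>R dir (\<theta> - of_int q * th) = dir (\<theta> + 2 * pi * of_int k / N)" for q
  proof -
    have e: "2 * pi * of_int k / N = of_int (2 * k) * th" for k unfolding thN[symmetric] by simp
    show ?thesis
    proof (cases "even q")
      case True
      then obtain k where "q = 2 * k" by blast
      then have "\<theta> - of_int q * th = \<theta> + of_int (2 * (- k)) * th" by simp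
      then show ?thesis unfolding e using True by (intro exI[of _ "- k"]) (simp only: S_def if_True scaleR_one)
    next
      case False
      then have "even (int h - q)" using N by simp
      then obtain k where k: "int h - q = 2 * k" by blast
      have "- dir (\<theta> - of_int q * th) = dir (\<theta> - of_int q * th + real h * th)"
        unfolding h_th by (simp only: dir_add_pi)
      also have "\<theta> - of_int q * th + real h * th = \<theta> + of_int (int h - q) * th" by (simp add: left_diff_distrib)
      finally show ?thesis unfolding e k using False by (intro exI[of _ k]) (simp add: S_def)
    qed
  qed
  have cb: "\<bar>code x j\<bar> \<le> 1" for j using code_cases[OF strict_orbit[OF x(1)], of j] by auto
  have xb: "- (1/2) < x j" "x j < 1/2" for j using strict_abs[OF x(1), of j] by linarith+
  have stepA: "outer_billiard P (c + (S q * r) *\<^sub>R Y q i) = Some (c + (- S q * r) *\<^sub>R (Y q i - 2 *\<^sub>R a q))" if i: "i \<le> m q" for q i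
  proof -
    obtain k where k: "S q *\<^sub>R dir (\<theta> - of_int q * th) = dir (\<theta> + 2 * pi * of_int k / N)" using vertex by blast
    have ang: "\<theta> - of_int q * th - pi / N = \<psi> - of_int (q + 1 + 1) * th" "\<theta> - of_int q * th + pi / N = \<psi> - of_int q * th"
      by (simp_all add: thN \<psi>_def algebra_simps)
    show ?thesis unfolding a_def
    proof (rule billiard_step[OF S(1) k])
      have "1 * (real (m q) - real i) \<le> lam * (real (m q) - real i)" using i l1 by (intro mult_right_mono) auto
      moreover have "real (m q) \<ge> 1" using m(1)[of q] by simp
      ultimately have "1/2 + x (q + 1) - code x q + lam * (real (m q) - real i) + real i > 0"
        using cb[of q] xb[of "q + 1"] by (simp add: abs_le_iff)
      then show "cos (pi / N) < along (Y q i) (\<theta> - of_int q * th - pi / N)"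
        unfolding ang Y2 unfolding thN \<kappa>_def[symmetric] using w by simp
      have "w * (x (q - 1) - real i) < w * (1/2)" using w xb[of "q - 1"] by (intro mult_strict_left_mono) auto
      then show "along (Y q i) (\<theta> - of_int q * th + pi / N) < cos (pi / N)"
        unfolding ang Y0 unfolding thN \<kappa>_def[symmetric] by (simp add: w_def)
    qed
  qed
  have stepB: "outer_billiard P (c + (- S q * r) *\<^sub>R (Y q i - 2 *\<^sub>R a q)) = Some (c + (S q * r) *\<^sub>R Y q (Suc i))" if i: "i < m q" for q i
  proof -
    obtain k where k: "- S q *\<^sub>R dir (\<theta> - of_int (q - 1) * th) = dir (\<theta> + 2 * pi * of_int k / N)"
      using vertex[of "q - 1"] S(3) by auto
    have ang: "\<theta> - of_int (q - 1) * th - pi / N = \<psi> - of_int (q + 1) * th" "\<theta> - of_int (q - 1) * th + pi / N = \<psi> - of_int (q - 1) * th"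
      by (simp_all add: thN \<psi>_def algebra_simps)
    have "outer_billiard P (c + (- S q * r) *\<^sub>R (Y q i - 2 *\<^sub>R a q))
        = Some (c + (- (- S q) * r) *\<^sub>R (Y q i - 2 *\<^sub>R a q - 2 *\<^sub>R dir (\<theta> - of_int (q - 1) * th)))"
    proof (rule billiard_step[OF _ k])
      show "- S q \<in> {-1, 1}" using S(1)[of q] by auto
      have "w * (1/2) < w * (x q + real (m q) - real i)" using w xb[of q] i by (intro mult_strict_left_mono) auto
      then show "cos (pi / N) < along (Y q i - 2 *\<^sub>R a q) (\<theta> - of_int (q - 1) * th - pi / N)"
        unfolding ang along_linear Y1 a unfolding thN \<kappa>_def[symmetric] by (simp add: w_def)
      have "(lam - 1) * (real i + 1) > 0" using l1 by simp
      moreover have "real (m q) \<ge> 1" using m(1)[of q] by simp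
      ultimately have "1/2 - x (q - 2) + code x (q - 1) + (lam - 1) * (real i + 1) + real (m q) > 0"
        using cb[of "q - 1"] xb[of "q - 2"] by (simp add: abs_le_iff)
      then show "along (Y q i - 2 *\<^sub>R a q) (\<theta> - of_int (q - 1) * th + pi / N) < cos (pi / N)"
        unfolding ang Ya0 unfolding thN \<kappa>_def[symmetric] using w by simp
    qed
    moreover have "Y q i - 2 *\<^sub>R a q - 2 *\<^sub>R dir (\<theta> - of_int (q - 1) * th) = Y q (Suc i)"
      by (simp add: Y_def b_def algebra_simps)
    ultimately show ?thesis by simp
  qed
  have run: "i \<le> m q \<Longrightarrow> partial_iterate (outer_billiard P) (2 * i) (c + (S q * r) *\<^sub>R Z q) = Some (c + (S q * r) *\<^sub>R Y q i)" for q i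
  proof (induction i)
    case (Suc i)
    have "2 * Suc i = Suc (Suc (2 * i))" by simp
    then show ?case using Suc stepA[of i q] stepB[of i q] by (simp only: partial_iterate.simps) simp
  qed (simp add: Y_def)
  show ?thesis
  proof (rule aperiodic_of_coordinates[where S = S and n = "\<lambda>q. 2 * m q + 1", OF x _ Z S(1)])
    show "w \<noteq> 0" using w by simp
    show "1 \<le> 2 * m q + 1 \<and> partial_iterate (outer_billiard P) (2 * m q + 1) (c + (S q * r) *\<^sub>R Z q)
        = Some (c + (S (q + 1) * r) *\<^sub>R Z (q + 1))" for q
      using run[of "m q" q] stepA[of "m q" q] unfolding Zn S(2) by simp
  qed
qed

end

theorem mainTheorem1:
  fixes N :: nat and P :: "(real^2) set"
  assumes "N > 4" and "N \<noteq> 6" and "regular_polygon N P"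
  shows "\<exists>z. aperiodic_point (outer_billiard P) z"
proof -
  obtain c r \<theta> where P: "polygon N c r \<theta> P"
    using assms(3) unfolding regular_polygon_def polygon_def by blast
  show ?thesis
  proof (cases "even N")
    case True
    then obtain h where h: "N = 2 * h" by blast
    then interpret polygon_rotation N c r \<theta> P h
      using P assms by (intro polygon_rotation.intro rotation.intro) auto
    show ?thesis using h by (rule aperiodic_even)
  next
    case False
    interpret polygon_rotation N c r \<theta> P N
      using P assms by (intro polygon_rotation.intro rotation.intro) auto
    show ?thesis using False by (intro aperiodic_odd) simp_all
  qed
qed

end
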